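(* Let $T\subset\mathbb{R}^2$ be a contractible polygon and let $k\ge 3$. Then the sequence $$\mathcal{RT}^1(T)\xrightarrow{\ \underline{I}_{V,T}^k\ }\underline{V}_T^k\xrightarrow{\ \underline{C}_{\mathrm{sym},T}^{k-1}\ }\underline{\Sigma}_T^{k-1}\xrightarrow{\ \mathsf{DD}_T^{k-2}\ }\mathcal{P}^{k-2}(T)\xrightarrow{\ 0\ }0$$ is an exact complex, i.e., $\underline{I}_{V,T}^k\big(\mathcal{RT}^1(T)\big)=\operatorname{Ker}\underline{C}_{\mathrm{sym},T}^{k-1}$, $\operatorname{Im}\underline{C}_{\mathrm{sym},T}^{k-1}=\operatorname{Ker}\mathsf{DD}_T^{k-2}$, and $\operatorname{Im}\mathsf{DD}_T^{k-2}=\mathcal{P}^{k-2}(T)$.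
   Context: **Geometry.** $T\subset\mathbb{R}^2$ is a contractible polygonal domain with set of edges $\mathcal{E}_T$ and set of vertices $\mathcal{V}_T$; $x_T$ is a fixed point of $T$ such that some disk centered at $x_T$ is contained in $T$. For $E\in\mathcal{E}_T$, $\mathcal{V}_E$ is the set of its two endpoints, $t_E$ a fixed unit tangent vector, and for $V\in\mathcal{V}_E$, $\omega_{EV}=+1$ if $t_E$ points towards $V$, $\omega_{EV}=-1$ otherwise. The unit normal $n_E$ to $E$ is such that $(t_E,n_E)$ is a right-handed system, and $\omega_{TE}\in\{-1,+1\}$ is such that $\omega_{TE}n_E$ points out of $T$. $x_V$ is the coordinate vector of the vertex $V$. $\partial_{t_E},\partial_{n_E}$ are derivatives in the directions $t_E,n_E$. **Operators.** $\mathbb{S}$ is the space of symmetric $2\times2$ real matrices, $A:B$ the Frobenius product. For $v=(v_1,v_2)$ and a $2\times2$ matrix field $\tau$: $(\mathbf{grad}\,v)_{ij}=\partial_jv_i$; $\mathbf{rot}\,\tau=(\partial_2\tau_{11}-\partial_1\tau_{12},\ \partial_2\tau_{21}-\partial_1\tau_{22})$; $\mathbf{hess}\,q$ is the Hessian matrix of $q$; $\mathrm{sym}\,\tau=\frac12(\tau+\tau^\top)$. For a matrix $\tau\in\mathbb{R}^{2\times2}$, $$\mathbb{C}\tau=\begin{pmatrix}\tau_{12}&\frac{-\tau_{11}+\tau_{22}}2\\ \frac{-\tau_{11}+\tau_{22}}2&-\tau_{21}\end{pmatrix}.$$ **Polynomial spaces.** For $Y\in\{T\}\cup\mathcal{E}_T$,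 $\mathcal{P}^m(Y)$ is the space of restrictions to $Y$ of bivariate polynomials of total degree $\le m$, with $\mathcal{P}^{-1}(Y)=\{0\}$; $\pi_{\mathcal{P},Y}^m$ is the $L^2(Y)$-orthogonal projector onto it (componentwise for vector fields); $\mathcal{P}^m(Y;\mathbb{R}^2)$, $\mathcal{P}^m(Y;\mathbb{S})$ are the vector and symmetric-matrix valued versions. $\mathcal{RT}^1(T)=\{x\mapsto \alpha+\beta x:\alpha\in\mathbb{R}^2,\beta\in\mathbb{R}\}$. With $y^\perp$ the rotation of $y\in\mathbb{R}^2$ by $\pi/2$, $$\mathcal{H}^m(T)=\mathbf{hess}\,\mathcal{P}^{m+2}(T),\qquad \mathcal{H}^{\mathrm c,m}(T)=\mathrm{sym}\big((x-x_T)^\perp\otimes\mathcal{P}^{m-1}(T;\mathbb{R}^2)\big),$$ with $L^2$-orthogonal projectors $\pi_{\mathcal{H},T}^m$, $\pi_{\mathcal{H},T}^{\mathrm c,m}$. (One has $\mathcal{P}^m(T;\mathbb{S})=\mathcal{H}^m(T)\oplus\mathcal{H}^{\mathrm c,m}(T)$.) **Discrete spaces** ($k\ge3$, $\ell\ge2$). $\underline{V}_T^k$ is the space of vectors $\underline{v}_T=(v_T,(v_E)_{E\in\mathcal{E}_T},(v_V,G_{v,V})_{V\in\mathcal{V}_T})$ with $v_T\in\mathcal{P}^{k-2}(T;\mathbb{R}^2)$, $v_E\in\mathcal{P}^{k-4}(E;\mathbb{R}^2)$, $v_V\in\mathbb{R}^2$, $G_{v,V}\in\mathbb{R}^{2\times2}$.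 $\underline{\Sigma}_T^\ell$ is the space of vectors $\underline{\tau}_T=(\tau_{\mathcal{H},T},\tau_{\mathcal{H},T}^{\mathrm c},(\tau_E,D_{\tau,E})_{E\in\mathcal{E}_T},(\tau_V)_{V\in\mathcal{V}_T})$ with $\tau_{\mathcal{H},T}\in\mathcal{H}^{\ell-3}(T)$, $\tau^{\mathrm c}_{\mathcal{H},T}\in\mathcal{H}^{\mathrm c,\ell}(T)$, $\tau_E\in\mathcal{P}^{\ell-2}(E)$, $D_{\tau,E}\in\mathcal{P}^{\ell-1}(E)$, $\tau_V\in\mathbb{S}$. In the sequence, $\ell=k-1$. **Interpolator.** For $v\in C^1(\overline T;\mathbb{R}^2)$, $\underline{I}_{V,T}^kv=\big(\pi_{\mathcal{P},T}^{k-2}v,(\pi_{\mathcal{P},E}^{k-4}v_{|E})_{E},(v(x_V),\mathbf{grad}\,v(x_V))_{V}\big)$. **Discrete symmetric curl.** For $\underline{v}_T\in\underline{V}_T^k$, $v_{\mathcal{E}_T}$ is the unique continuous function $\partial T\to\mathbb{R}^2$ whose restriction to each edge $E$ belongs to $\mathcal{P}^k(E;\mathbb{R}^2)$ and such that $\pi_{\mathcal{P},E}^{k-4}(v_{\mathcal{E}_T})_{|E}=v_E$ and $\partial_{t_E}(v_{\mathcal{E}_T})_{|E}(x_V)=G_{v,V}t_E$ for all $E\in\mathcal{E}_T$, $V\in\mathcal{V}_E$, and $v_{\mathcal{E}_T}(x_V)=v_V$ for all $V\in\mathcal{V}_T$. The full symmetric curl $\mathsf{C}_{\mathrm{sym},T}^{k-1}\underline{v}_T\in\mathcal{P}^{k-1}(T;\mathbb{S})$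 is defined by $$\int_T\mathsf{C}_{\mathrm{sym},T}^{k-1}\underline{v}_T:\tau=-\int_Tv_T\cdot\mathbf{rot}\,\tau+\sum_{E\in\mathcal{E}_T}\omega_{TE}\int_Ev_{\mathcal{E}_T}\cdot(\tau t_E)\qquad\forall\tau\in\mathcal{P}^{k-1}(T;\mathbb{S}).$$ The discrete symmetric curl $\underline{C}_{\mathrm{sym},T}^{k-1}:\underline{V}_T^k\to\underline{\Sigma}_T^{k-1}$ is $$\underline{C}_{\mathrm{sym},T}^{k-1}\underline{v}_T=\Big(\pi_{\mathcal{H},T}^{k-4}(\mathsf{C}_{\mathrm{sym},T}^{k-1}\underline{v}_T),\ \pi_{\mathcal{H},T}^{\mathrm c,k-1}(\mathsf{C}_{\mathrm{sym},T}^{k-1}\underline{v}_T),\ \big(-\pi_{\mathcal{P},E}^{k-3}(\partial_{t_E}v_{\mathcal{E}_T}\cdot n_E),\ -\partial_{t_E}^2v_{\mathcal{E}_T}\cdot t_E\big)_{E},\ (\mathbb{C}G_{v,V})_{V}\Big).$$ **Discrete div-div.** $\mathsf{DD}_T^{\ell-1}:\underline{\Sigma}_T^\ell\to\mathcal{P}^{\ell-1}(T)$ is defined by: for all $q\in\mathcal{P}^{\ell-1}(T)$, $$\int_T\mathsf{DD}_T^{\ell-1}\underline{\tau}_T\,q=\int_T\tau_{\mathcal{H},T}:\mathbf{hess}\,q-\sum_{E\in\mathcal{E}_T}\omega_{TE}\sum_{V\in\mathcal{V}_E}\omega_{EV}(\tau_Vn_E\cdot t_E)\,q(x_V)-\sum_{E\in\mathcal{E}_T}\omega_{TE}\Big(\int_E\tau_E\,\partial_{n_E}q-\int_ED_{\tau,E}\,q\Big).$$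 *)

theory Defs
  imports "HOL-Analysis.Analysis"
begin

section \<open>Polygonal domains\<close>

text \<open>
  An edge is stored as the ordered pair of its endpoints. The order carries the fixed choice of
  the unit tangent: it points from the first endpoint to the second one.
\<close>

type_synonym edge = "(real^2) \<times> (real^2)"

definition seg :: "edge \<Rightarrow> (real^2) set" where
  "seg E = closed_segment (fst E) (snd E)"

definition ends :: "edge \<Rightarrow> (real^2) set" where
  "ends E = {fst E, snd E}"

definition verts :: "edge set \<Rightarrow> (real^2) set" where
  "verts Es = (\<Union>E\<in>Es. ends E)"

text \<open>
  The domain is open. Flat vertices (two aligned consecutive edges) are allowed. The last two
  conditions say that the boundary is a one-dimensional manifold subdivided into edges, which
  excludes slits and domains touching themselves at a vertex. Holes are not excluded here.
\<close>

definition polygonal_domain :: "(real^2) set \<Rightarrow> edge set \<Rightarrow> bool" where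
  "polygonal_domain T Es \<longleftrightarrow>
     open T \<and> connected T \<and> bounded T \<and> T \<noteq> {} \<and> finite Es \<and>
     frontier T = (\<Union>E\<in>Es. seg E) \<and>
     (\<forall>E\<in>Es. fst E \<noteq> snd E) \<and>
     (\<forall>E\<in>Es. \<forall>E'\<in>Es. E \<noteq> E' \<longrightarrow> seg E \<inter> seg E' \<subseteq> ends E \<inter> ends E') \<and>
     (\<forall>V\<in>verts Es. card {E\<in>Es. V \<in> ends E} = 2)"

definition perp :: "real^2 \<Rightarrow> real^2" where
  "perp y = vector [- y$2, y$1]"

definition tangent :: "edge \<Rightarrow> real^2" where
  "tangent E = (snd E - fst E) /\<^sub>R norm (snd E - fst E)"

definition normal :: "edge \<Rightarrow> real^2" where
  "normal E = perp (tangent E)"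

definition omega_EV :: "edge \<Rightarrow> real^2 \<Rightarrow> real" where
  "omega_EV E V = (if V = snd E then 1 else - 1)"

definition points_out :: "(real^2) set \<Rightarrow> edge \<Rightarrow> real^2 \<Rightarrow> bool" where
  "points_out T E n \<longleftrightarrow>
     (\<forall>x\<in>open_segment (fst E) (snd E).
        eventually (\<lambda>s. x + s *\<^sub>R n \<notin> closure T \<and> x - s *\<^sub>R n \<in> T) (at_right 0))"

definition omega_TE :: "(real^2) set \<Rightarrow> edge \<Rightarrow> real" where
  "omega_TE T E = (if points_out T E (normal E) then 1 else - 1)"

definition int_T :: "(real^2) set \<Rightarrow> (real^2 \<Rightarrow> real) \<Rightarrow> real" where
  "int_T T f = (LINT x:T|lborel. f x)"

definition int_E :: "edge \<Rightarrow> (real^2 \<Rightarrow> real) \<Rightarrow> real" where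
  "int_E E f = norm (snd E - fst E) * (LBINT s:{0..1}. f (fst E + s *\<^sub>R (snd E - fst E)))"


section \<open>Differential operators\<close>

definition partial :: "2 \<Rightarrow> (real^2 \<Rightarrow> real) \<Rightarrow> real^2 \<Rightarrow> real" where
  "partial j f x = frechet_derivative f (at x) (axis j 1)"

definition grad :: "(real^2 \<Rightarrow> real^2) \<Rightarrow> real^2 \<Rightarrow> real^2^2" where
  "grad v x = (\<chi> i j. partial j (\<lambda>y. v y $ i) x)"

definition rot :: "(real^2 \<Rightarrow> real^2^2) \<Rightarrow> real^2 \<Rightarrow> real^2" where
  "rot \<tau> x = (\<chi> i. partial 2 (\<lambda>y. \<tau> y $ i $ 1) x - partial 1 (\<lambda>y. \<tau> y $ i $ 2) x)"

definition hess :: "(real^2 \<Rightarrow> real) \<Rightarrow> real^2 \<Rightarrow> real^2^2" where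
  "hess q x = (\<chi> i j. partial i (partial j q) x)"

definition deriv_n :: "edge \<Rightarrow> (real^2 \<Rightarrow> real) \<Rightarrow> real^2 \<Rightarrow> real" where
  "deriv_n E q x = frechet_derivative q (at x) (normal E)"

text \<open>
  The tangential derivative only sees the values on the edge (it is one-sided at the endpoints),
  so that it applies to functions that are meaningful on the boundary only.
\<close>

definition deriv_t :: "edge \<Rightarrow> (real^2 \<Rightarrow> real^2) \<Rightarrow> real^2 \<Rightarrow> real^2" where
  "deriv_t E f x =
     (if x \<in> seg E
      then vector_derivative (\<lambda>s. f (x + s *\<^sub>R tangent E))
             (at 0 within {s. x + s *\<^sub>R tangent E \<in> seg E})
      else 0)"

definition sym_part :: "real^2^2 \<Rightarrow> real^2^2" where
  "sym_part A = (1/2) *\<^sub>R (A + transpose A)"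

definition outer :: "real^2 \<Rightarrow> real^2 \<Rightarrow> real^2^2" where
  "outer a b = (\<chi> i j. a$i * b$j)"

definition sym_mats :: "(real^2^2) set" where
  "sym_mats = {A. transpose A = A}"

definition CC :: "real^2^2 \<Rightarrow> real^2^2" where
  "CC A = vector [vector [A$1$2, (- A$1$1 + A$2$2) / 2],
                  vector [(- A$1$1 + A$2$2) / 2, - A$2$1]]"


section \<open>Polynomial spaces and projectors\<close>

text \<open>
  Restrictions to a set \<open>Y\<close>, and families indexed by a set \<open>Y\<close>, are total functions extended by
  zero, so that equality of functions is equality on \<open>Y\<close> and the zero vector is the zero function.
  Taking \<open>Y = UNIV\<close> gives the polynomials themselves.
\<close>

definition zext :: "'a set \<Rightarrow> ('a \<Rightarrow> 'b::zero) \<Rightarrow> 'a \<Rightarrow> 'b" where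
  "zext Y f = (\<lambda>x. if x \<in> Y then f x else 0)"

definition bipoly :: "int \<Rightarrow> (real^2 \<Rightarrow> real) set" where
  "bipoly m = {p. \<exists>c :: nat \<Rightarrow> nat \<Rightarrow> real.
     \<forall>x. p x = (\<Sum>(i,j)\<in>{(i,j). int (i + j) \<le> m}. c i j * (x$1)^i * (x$2)^j)}"

definition P :: "int \<Rightarrow> (real^2) set \<Rightarrow> (real^2 \<Rightarrow> real) set" where
  "P m Y = zext Y ` bipoly m"

definition Pvec :: "int \<Rightarrow> (real^2) set \<Rightarrow> (real^2 \<Rightarrow> real^2) set" where
  "Pvec m Y = {v. \<forall>i. (\<lambda>x. v x $ i) \<in> P m Y}"

definition Psym :: "int \<Rightarrow> (real^2) set \<Rightarrow> (real^2 \<Rightarrow> real^2^2) set" where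
  "Psym m Y = {\<tau>. (\<forall>i j. (\<lambda>x. \<tau> x $ i $ j) \<in> P m Y) \<and> (\<forall>x. \<tau> x \<in> sym_mats)}"

text \<open>Not restricted to the domain: the interpolator needs point values and gradients at vertices.\<close>

definition RT1 :: "(real^2 \<Rightarrow> real^2) set" where
  "RT1 = {v. \<exists>\<alpha> \<beta>. v = (\<lambda>x. \<alpha> + \<beta> *\<^sub>R x)}"

definition Hsp :: "int \<Rightarrow> (real^2) set \<Rightarrow> (real^2 \<Rightarrow> real^2^2) set" where
  "Hsp m T = {zext T (hess q) | q. q \<in> P (m + 2) UNIV}"

definition Hcsp :: "int \<Rightarrow> (real^2) set \<Rightarrow> real^2 \<Rightarrow> (real^2 \<Rightarrow> real^2^2) set" where
  "Hcsp m T xT = {zext T (\<lambda>x. sym_part (outer (perp (x - xT)) (q x))) | q. q \<in> Pvec (m - 1) UNIV}"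

text \<open>
  \<open>I\<close> is the integral (\<open>int_T T\<close> or \<open>int_E E\<close>) defining the \<open>L\<^sup>2\<close> product. The inner product on
  \<open>real^2^2\<close> is the Frobenius product.
\<close>

definition L2_proj ::
  "((real^2 \<Rightarrow> real) \<Rightarrow> real) \<Rightarrow> (real^2 \<Rightarrow> 'b::real_inner) set \<Rightarrow> (real^2 \<Rightarrow> 'b) \<Rightarrow> real^2 \<Rightarrow> 'b" where
  "L2_proj I W f = (THE g. g \<in> W \<and> (\<forall>h\<in>W. I (\<lambda>x. g x \<bullet> h x) = I (\<lambda>x. f x \<bullet> h x)))"

definition proj_vec_T :: "int \<Rightarrow> (real^2) set \<Rightarrow> (real^2 \<Rightarrow> real^2) \<Rightarrow> real^2 \<Rightarrow> real^2" where
  "proj_vec_T m T v x = (\<chi> i. L2_proj (int_T T) (P m T) (\<lambda>y. v y $ i) x)"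

definition proj_E :: "int \<Rightarrow> edge \<Rightarrow> (real^2 \<Rightarrow> real) \<Rightarrow> real^2 \<Rightarrow> real" where
  "proj_E m E = L2_proj (int_E E) (P m (seg E))"

definition proj_vec_E :: "int \<Rightarrow> edge \<Rightarrow> (real^2 \<Rightarrow> real^2) \<Rightarrow> real^2 \<Rightarrow> real^2" where
  "proj_vec_E m E v x = (\<chi> i. proj_E m E (\<lambda>y. v y $ i) x)"


section \<open>Discrete spaces\<close>

record disc_V =
  v_T :: "real^2 \<Rightarrow> real^2"
  v_E :: "edge \<Rightarrow> real^2 \<Rightarrow> real^2"
  v_V :: "real^2 \<Rightarrow> real^2"
  G_V :: "real^2 \<Rightarrow> real^2^2"

record disc_Sigma =
  tau_H  :: "real^2 \<Rightarrow> real^2^2"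
  tau_Hc :: "real^2 \<Rightarrow> real^2^2"
  tau_E  :: "edge \<Rightarrow> real^2 \<Rightarrow> real"
  D_E    :: "edge \<Rightarrow> real^2 \<Rightarrow> real"
  tau_V  :: "real^2 \<Rightarrow> real^2^2"

definition V_space :: "(real^2) set \<Rightarrow> edge set \<Rightarrow> int \<Rightarrow> disc_V set" where
  "V_space T Es k = {v.
     v_T v \<in> Pvec (k - 2) T \<and>
     (\<forall>E\<in>Es. v_E v E \<in> Pvec (k - 4) (seg E)) \<and>
     (\<forall>E. E \<notin> Es \<longrightarrow> v_E v E = (\<lambda>_. 0)) \<and>
     (\<forall>V. V \<notin> verts Es \<longrightarrow> v_V v V = 0 \<and> G_V v V = 0)}"

definition Sigma_space :: "(real^2) set \<Rightarrow> edge set \<Rightarrow> real^2 \<Rightarrow> int \<Rightarrow> disc_Sigma set" where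
  "Sigma_space T Es xT l = {\<tau>.
     tau_H \<tau> \<in> Hsp (l - 3) T \<and>
     tau_Hc \<tau> \<in> Hcsp l T xT \<and>
     (\<forall>E\<in>Es. tau_E \<tau> E \<in> P (l - 2) (seg E) \<and> D_E \<tau> E \<in> P (l - 1) (seg E)) \<and>
     (\<forall>V\<in>verts Es. tau_V \<tau> V \<in> sym_mats) \<and>
     (\<forall>E. E \<notin> Es \<longrightarrow> tau_E \<tau> E = (\<lambda>_. 0) \<and> D_E \<tau> E = (\<lambda>_. 0)) \<and>
     (\<forall>V. V \<notin> verts Es \<longrightarrow> tau_V \<tau> V = 0)}"

definition zero_Sigma :: disc_Sigma where
  "zero_Sigma = \<lparr>tau_H = (\<lambda>_. 0), tau_Hc = (\<lambda>_. 0), tau_E = (\<lambda>_ _. 0), D_E = (\<lambda>_ _. 0),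
                 tau_V = (\<lambda>_. 0)\<rparr>"


section \<open>Discrete operators\<close>

definition interp_V :: "(real^2) set \<Rightarrow> edge set \<Rightarrow> int \<Rightarrow> (real^2 \<Rightarrow> real^2) \<Rightarrow> disc_V" where
  "interp_V T Es k v =
     \<lparr>v_T = proj_vec_T (k - 2) T v,
      v_E = (\<lambda>E. if E \<in> Es then proj_vec_E (k - 4) E v else (\<lambda>_. 0)),
      v_V = zext (verts Es) v,
      G_V = zext (verts Es) (grad v)\<rparr>"

definition v_bdry :: "(real^2) set \<Rightarrow> edge set \<Rightarrow> int \<Rightarrow> disc_V \<Rightarrow> real^2 \<Rightarrow> real^2" where
  "v_bdry T Es k v = (THE w.
     continuous_on (frontier T) w \<and> (\<forall>x. x \<notin> frontier T \<longrightarrow> w x = 0) \<and>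
     (\<forall>E\<in>Es. zext (seg E) w \<in> Pvec k (seg E) \<and>
             proj_vec_E (k - 4) E w = v_E v E \<and>
             (\<forall>V\<in>ends E. deriv_t E w V = G_V v V *v tangent E)) \<and>
     (\<forall>V\<in>verts Es. w V = v_V v V))"

text \<open>
  In the next and in the last definition the test functions range over the polynomials on the
  whole plane, which are in bijection with their restrictions to \<open>T\<close>; this gives a meaning to
  their values and normal derivatives on the boundary of the open set \<open>T\<close>.
\<close>

definition C_sym_full :: "(real^2) set \<Rightarrow> edge set \<Rightarrow> int \<Rightarrow> disc_V \<Rightarrow> real^2 \<Rightarrow> real^2^2" where
  "C_sym_full T Es k v = (THE \<sigma>. \<sigma> \<in> Psym (k - 1) T \<and>
     (\<forall>\<tau>\<in>Psym (k - 1) UNIV.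
        int_T T (\<lambda>x. \<sigma> x \<bullet> \<tau> x) =
          - int_T T (\<lambda>x. v_T v x \<bullet> rot \<tau> x)
          + (\<Sum>E\<in>Es. omega_TE T E * int_E E (\<lambda>x. v_bdry T Es k v x \<bullet> (\<tau> x *v tangent E)))))"

definition C_sym :: "(real^2) set \<Rightarrow> edge set \<Rightarrow> real^2 \<Rightarrow> int \<Rightarrow> disc_V \<Rightarrow> disc_Sigma" where
  "C_sym T Es xT k v = (let w = v_bdry T Es k v; \<sigma> = C_sym_full T Es k v in
     \<lparr>tau_H = L2_proj (int_T T) (Hsp (k - 4) T) \<sigma>,
      tau_Hc = L2_proj (int_T T) (Hcsp (k - 1) T xT) \<sigma>,
      tau_E = (\<lambda>E. if E \<in> Es
                 then (\<lambda>x. - proj_E (k - 3) E (\<lambda>y. deriv_t E w y \<bullet> normal E) x) else (\<lambda>_. 0)),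
      D_E = (\<lambda>E. if E \<in> Es
               then (\<lambda>x. - (deriv_t E (deriv_t E w) x \<bullet> tangent E)) else (\<lambda>_. 0)),
      tau_V = zext (verts Es) (\<lambda>V. CC (G_V v V))\<rparr>)"

definition DD :: "(real^2) set \<Rightarrow> edge set \<Rightarrow> int \<Rightarrow> disc_Sigma \<Rightarrow> real^2 \<Rightarrow> real" where
  "DD T Es l \<tau> = (THE g. g \<in> P (l - 1) T \<and>
     (\<forall>q\<in>P (l - 1) UNIV.
        int_T T (\<lambda>x. g x * q x) =
          int_T T (\<lambda>x. tau_H \<tau> x \<bullet> hess q x)
          - (\<Sum>E\<in>Es. omega_TE T E *
               (\<Sum>V\<in>ends E. omega_EV E V * ((tau_V \<tau> V *v normal E) \<bullet> tangent E) * q V))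
          - (\<Sum>E\<in>Es. omega_TE T E *
               (int_E E (\<lambda>x. tau_E \<tau> E x * deriv_n E q x) - int_E E (\<lambda>x. D_E \<tau> E x * q x)))))"

end

theory Submission
  imports Defs "HOL-Complex_Analysis.Riemann_Mapping" "HOL-Library.Function_Algebras"
begin

text \<open>
  The geometric input is the divergence theorem for polynomials on \<open>T\<close>, obtained from Fubini: on a
  coordinate line the indicator function of \<open>T\<close> is a step function that jumps at the edges. Applied
  to the curl of a gradient it says that the increments of any vertex function, summed along the
  oriented boundary, cancel. Since the boundary of the simply connected set \<open>T\<close> is connected and two
  edges meet at each vertex, this excludes slits, and conversely every edge function with vanishing
  oriented sum is the increment of a vertex function.

  Integration by parts along the edges turns the complex property into the observation that
  \<open>CC G n \<bullet> t + G t \<bullet> t\<close> is half the trace of \<open>G\<close>, hence does not depend on the edge.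
  In the kernel of the symmetric curl all vertex gradients are multiples \<open>\<beta>\<close> of the identity with
  the same \<open>\<beta>\<close>, so the boundary function is \<open>\<alpha> + \<beta> x\<close>; the interior component is then determined
  because \<open>q \<mapsto> rot (sym ((x - x\<^sub>T)\<^sup>\<bottom> \<otimes> q))\<close> is bijective on polynomial vector fields.
  For \<open>\<tau>\<close> in the kernel of the div-div operator, testing with \<open>q = 1\<close> and \<open>q = x\<^sub>i\<close> gives
  exactly the conditions under which first the traces of the vertex gradients and then the boundary
  function can be integrated along the boundary. The div-div operator is onto by the Riesz theorem
  for the form \<open>\<integral>\<^sub>T hess p : hess q + \<Sum>\<^sub>E \<integral>\<^sub>E p q\<close>, which is definite as an affine function vanishing
  on the boundary is zero.
\<close>


section \<open>Linear algebra in spaces of functions\<close>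

text \<open>The operators are definite descriptions over sets of functions, so nothing can be said
  about \<open>C_sym\<close> or \<open>DD\<close> before the described object is shown to exist and
  to be unique. One device serves throughout: a symmetric definite form on a finite-dimensional
  subspace represents every linear functional. It also produces preimages, so that no dimension of a
  polynomial space is ever computed; the only counting is that an injective endomorphism is onto.
  Preimages under the symmetric curl have two kinds of freedom on the boundary. The kernel of
  \<open>CC\<close> consists of the multiples of the identity, so a prescribed \<open>tau_V\<close>
  leaves one scalar per vertex; and a curve on an edge is known from its derivatives only up to a
  constant. Inside, \<open>v_T\<close> enters only through \<open>rot \<tau>\<close>, which vanishes
  on Hessians: it can adjust \<open>tau_Hc\<close>, while \<open>tau_H\<close> has to come out right
  by itself, from the div-div equation. The signs \<open>omega_TE\<close> cannot be used from the
  start, because their definition does not detect whether \<open>T\<close> lies on both sides of an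
  edge.\<close>

instantiation "fun" :: (type, real_vector) real_vector
begin

definition scaleR_fun_def: "r *\<^sub>R f = (\<lambda>x. r *\<^sub>R f x)"

instance
  by standard (simp_all add: scaleR_fun_def fun_eq_iff scaleR_add_right scaleR_add_left)

end

lemma scaleR_fun_apply [simp]: "(r *\<^sub>R f) x = r *\<^sub>R f x"
  by (simp add: scaleR_fun_def)

lemma sum_fun_apply: "(\<Sum>i\<in>I. f i) x = (\<Sum>i\<in>I. f i x :: 'b :: comm_monoid_add)"
  by (induction I rule: infinite_finite_induct) auto

text \<open>Linearity is asked only on a subset because operators built from
  \<open>frechet_derivative\<close>, such as \<open>hess\<close> and \<open>rot\<close>, are
  additive on differentiable functions but unspecified elsewhere.\<close>

definition lin_on :: "'v::real_vector set \<Rightarrow> ('v \<Rightarrow> 'w::real_vector) \<Rightarrow> bool" where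
  "lin_on W \<phi> \<longleftrightarrow> (\<forall>f\<in>W. \<forall>g\<in>W. \<phi> (f + g) = \<phi> f + \<phi> g) \<and> (\<forall>c. \<forall>f\<in>W. \<phi> (c *\<^sub>R f) = c *\<^sub>R \<phi> f)"

lemma lin_onI:
  assumes "\<And>f g. f \<in> W \<Longrightarrow> g \<in> W \<Longrightarrow> \<phi> (f + g) = \<phi> f + \<phi> g"
    and "\<And>c f. f \<in> W \<Longrightarrow> \<phi> (c *\<^sub>R f) = c *\<^sub>R \<phi> f"
  shows "lin_on W \<phi>"
  using assms by (auto simp: lin_on_def)

lemma lin_on_add: "lin_on W \<phi> \<Longrightarrow> f \<in> W \<Longrightarrow> g \<in> W \<Longrightarrow> \<phi> (f + g) = \<phi> f + \<phi> g"
  and lin_on_scale: "lin_on W \<phi> \<Longrightarrow> f \<in> W \<Longrightarrow> \<phi> (c *\<^sub>R f) = c *\<^sub>R \<phi> f"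
  by (auto simp: lin_on_def)

lemma lin_on_0: "lin_on W \<phi> \<Longrightarrow> subspace W \<Longrightarrow> \<phi> 0 = 0"
  using lin_on_scale[of W \<phi> 0 0] subspace_0[of W] by simp

lemma lin_on_uminus: "lin_on W \<phi> \<Longrightarrow> f \<in> W \<Longrightarrow> \<phi> (- f) = - \<phi> f"
  using lin_on_scale[of W \<phi> f "-1"] by simp

lemma lin_on_diff:
  assumes "lin_on W \<phi>" "subspace W" "f \<in> W" "g \<in> W"
  shows "\<phi> (f - g) = \<phi> f - \<phi> g"
proof -
  have "\<phi> (f + (- g)) = \<phi> f + \<phi> (- g)"
    using assms by (intro lin_on_add) (auto simp: subspace_neg)
  then show ?thesis
    using lin_on_uminus[OF assms(1,4)] by simp
qed

text \<open>Reduces the Riesz argument to finitely many generators.\<close>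

lemma lin_on_eq_span:
  assumes "lin_on W \<phi>" "lin_on W \<psi>" "subspace W" "S \<subseteq> W" "\<And>x. x \<in> S \<Longrightarrow> \<phi> x = \<psi> x" "h \<in> span S"
  shows "\<phi> h = \<psi> h"
proof -
  have sub: "span S \<subseteq> W"
    using assms by (simp add: span_minimal)
  have "h \<in> span S \<Longrightarrow> h \<in> span S \<and> \<phi> h = \<psi> h"
  proof (induction rule: span_induct_alt)
    case base
    then show ?case
      using lin_on_0 assms(1,2,3) span_0 by metis
  next
    case (step c x y)
    have "x \<in> W" "y \<in> W" "c *\<^sub>R x \<in> W"
      using step assms sub by (auto simp: subspace_scale)
    then show ?case
      using step assms lin_on_add[OF assms(1), of "c *\<^sub>R x" y] lin_on_add[OF assms(2), of "c *\<^sub>R x" y]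
        lin_on_scale[OF assms(1)] lin_on_scale[OF assms(2)]
      by (auto simp: span_add span_scale span_base)
  qed
  then show ?thesis
    using assms by blast
qed

text \<open>The space is a set, not a type, since it varies with the degree and the domain.
  Definiteness is an assumption on \<open>W\<close> only: the forms used later are degenerate on
  arbitrary functions.\<close>

locale inner_on =
  fixes W :: "'v::real_vector set" and B :: "'v \<Rightarrow> 'v \<Rightarrow> real"
  assumes W: "subspace W"
    and sym: "\<And>f g. f \<in> W \<Longrightarrow> g \<in> W \<Longrightarrow> B f g = B g f"
    and lin: "\<And>f. f \<in> W \<Longrightarrow> lin_on W (B f)"
    and definite: "\<And>f. f \<in> W \<Longrightarrow> B f f = 0 \<Longrightarrow> f = 0"
begin

lemma lin_left: "g \<in> W \<Longrightarrow> lin_on W (\<lambda>f. B f g)"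
  using lin[of g] W by (auto simp: lin_on_def sym subspace_add subspace_scale)

text \<open>Gram-Schmidt by induction on the generators. The functional is generalized because the
  induction hypothesis is used twice: for the given functional, and for \<open>B a\<close>, which
  yields the orthogonal projection of the new generator \<open>a\<close> onto the old span.\<close>

lemma riesz_aux:
  assumes "finite S"
  shows "S \<subseteq> W \<Longrightarrow> lin_on W \<phi> \<Longrightarrow> \<exists>g\<in>span S. \<forall>h\<in>S. B g h = \<phi> h"
  using assms
proof (induction S arbitrary: \<phi> rule: finite_induct)
  case empty
  then show ?case
    by (auto intro: span_0)
next
  case (insert a S)
  have SW: "span S \<subseteq> W"
    using insert W by (simp add: span_minimal)
  have aW: "a \<in> W"
    using insert by simp
  obtain p where p: "p \<in> span S" "\<forall>h\<in>S. B p h = B a h"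
    using insert.IH[of "B a"] insert.prems lin[OF aW] by auto
  obtain g where g: "g \<in> span S" "\<forall>h\<in>S. B g h = \<phi> h"
    using insert.IH[of \<phi>] insert.prems by auto
  define a' where "a' = a - p"
  have pW: "p \<in> W" and gW: "g \<in> W"
    using p g SW by auto
  have a'W: "a' \<in> W"
    using aW pW W by (simp add: a'_def subspace_diff)
  have orth: "B a' h = 0" if "h \<in> S" for h
    using that p lin_on_diff[OF lin_left[of h] W aW pW] insert.prems by (auto simp: a'_def)
  have orth': "B a' h = 0" if "h \<in> span S" for h
    using lin_on_eq_span[OF lin[OF a'W] _ W _ _ that, of "\<lambda>_. 0"] insert.prems orth
    by (auto simp: lin_on_def)
  show ?case
  \<comment> \<open>If \<open>a\<close> already lies in the span, agreement on \<open>S\<close>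
    extends to \<open>a\<close> by linearity. Otherwise the component \<open>a'\<close> orthogonal
    to \<open>S\<close> adjusts the value at \<open>a\<close> without spoiling the values on
    \<open>S\<close>.\<close>
  proof (cases "a' = 0")
    case True
    then have "a \<in> span S"
      using p by (simp add: a'_def)
    moreover have "B g a = \<phi> a"
      using lin_on_eq_span[OF lin[OF gW] insert.prems(2) W _ _ \<open>a \<in> span S\<close>] g insert.prems by auto
    ultimately show ?thesis
      using g span_mono[of S "insert a S"] by auto
  next
    case False
    then have nz: "B a' a' \<noteq> 0"
      using definite a'W by auto
    \<comment> \<open>Chosen so that \<open>B (g + c *\<^sub>R a') a' = \<phi> a'\<close>.\<close>
    define c where "c = \<phi> a' / B a' a' - B g a' / B a' a'"
    define g' where "g' = g + c *\<^sub>R a'"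
    have g'W: "g' \<in> W"
      using gW a'W W by (simp add: g'_def subspace_add subspace_scale)
    have B': "B g' h = B g h + c * B a' h" if "h \<in> W" for h
      using lin_on_add[OF lin_left[OF that] gW, of "c *\<^sub>R a'"] lin_on_scale[OF lin_left[OF that] a'W]
        a'W W by (simp add: g'_def subspace_scale)
    have "g' \<in> span (insert a S)"
      unfolding g'_def a'_def
      using p g span_mono[of S "insert a S"]
      by (intro span_add span_scale span_diff) (auto intro: span_base)
    moreover have on_S: "B g' h = \<phi> h" if "h \<in> S" for h
      using B'[of h] orth[OF that] g that insert.prems by auto
    moreover have "B g' a = \<phi> a"
    proof -
      have 1: "B g' a' = \<phi> a'"
        using B'[OF a'W] nz by (simp add: c_def field_simps)
      have 2: "B g' p = \<phi> p"
        using lin_on_eq_span[OF lin[OF g'W] insert.prems(2) W _ _ p(1)] on_S insert.prems by auto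
      have a: "a = a' + p"
        by (simp add: a'_def)
      show ?thesis
        using lin_on_add[OF lin[OF g'W] a'W pW] lin_on_add[OF insert.prems(2) a'W pW] 1 2 a by simp
    qed
    ultimately show ?thesis
      by auto
  qed
qed

lemma riesz_span:
  assumes "W = span S" "finite S" "lin_on W \<phi>"
  shows "\<exists>g\<in>W. \<forall>h\<in>W. B g h = \<phi> h"
proof -
  have "S \<subseteq> W"
    using assms span_superset by auto
  then obtain g where g: "g \<in> W" "\<forall>h\<in>S. B g h = \<phi> h"
    using riesz_aux assms by metis
  then have "B g h = \<phi> h" if "h \<in> W" for h
    using lin_on_eq_span[OF lin[OF g(1)] assms(3) W \<open>S \<subseteq> W\<close>] that assms by auto
  then show ?thesis
    using g by auto
qed

lemma riesz_unique:
  assumes "g \<in> W" "g' \<in> W" "\<And>h. h \<in> W \<Longrightarrow> B g h = B g' h"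
  shows "g = g'"
proof -
  have "g - g' \<in> W"
    using assms W by (simp add: subspace_diff)
  moreover have "B (g - g') (g - g') = 0"
    using lin_on_diff[OF lin_left W assms(1,2), of "g - g'"] assms(3) calculation by simp
  ultimately show ?thesis
    using definite by fastforce
qed

end

section \<open>Finite-dimensional subspaces\<close>

definition findim :: "'v::real_vector set \<Rightarrow> bool" where
  "findim W \<longleftrightarrow> (\<exists>S. finite S \<and> W = span S)"

lemma findim_span: "finite S \<Longrightarrow> findim (span S)"
  by (auto simp: findim_def)

lemma findim_subspace: "findim W \<Longrightarrow> subspace W"
  by (auto simp: findim_def)

text \<open>An independent subset of a span has at most as many elements as the generating set, so a
  maximal independent subset of \<open>V\<close> is finite.\<close>

lemma findim_subset:
  assumes "findim W" "subspace V" "V \<subseteq> W"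
  shows "findim V"
proof -
  obtain S where S: "finite S" "W = span S"
    using assms(1) by (auto simp: findim_def)
  obtain B where B: "B \<subseteq> V" "independent B" "V \<subseteq> span B"
    using maximal_independent_subset[of V] by blast
  have "finite B"
    using independent_span_bound[OF S(1) B(2)] B(1) assms(3) S(2) by auto
  moreover have "V = span B"
    using B assms(2) by (simp add: span_minimal subset_antisym)
  ultimately show ?thesis
    by (auto simp: findim_def)
qed

lemma findim_image:
  assumes "findim W" "lin_on W \<phi>"
  shows "findim (\<phi> ` W)"
proof -
  obtain S where S: "finite S" "W = span S"
    using assms(1) by (auto simp: findim_def)
  have W: "subspace W"
    using S by simp
  have 0: "\<phi> 0 = 0"
    using lin_on_0[OF assms(2) W] .
  have "subspace (\<phi> ` W)"
    unfolding subspace_def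
  proof (intro conjI ballI allI)
    show "0 \<in> \<phi> ` W"
      using 0 subspace_0[OF W] by (metis imageI)
  next
    fix x y assume "x \<in> \<phi> ` W" "y \<in> \<phi> ` W"
    then obtain f g where "f \<in> W" "g \<in> W" "x = \<phi> f" "y = \<phi> g"
      by auto
    then have "x + y = \<phi> (f + g)" "f + g \<in> W"
      using lin_on_add[OF assms(2)] subspace_add[OF W] by auto
    then show "x + y \<in> \<phi> ` W"
      by simp
  next
    fix x c assume "x \<in> \<phi> ` W"
    then obtain f where "f \<in> W" "x = \<phi> f"
      by auto
    then have "c *\<^sub>R x = \<phi> (c *\<^sub>R f)" "c *\<^sub>R f \<in> W"
      using lin_on_scale[OF assms(2)] subspace_scale[OF W] by auto
    then show "c *\<^sub>R x \<in> \<phi> ` W"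
      by simp
  qed
  moreover have "\<phi> ` W \<subseteq> span (\<phi> ` S)"
  proof (rule image_subsetI)
    fix f assume "f \<in> W"
    then have "f \<in> span S"
      using S by simp
    then have "f \<in> W \<and> \<phi> f \<in> span (\<phi> ` S)"
    proof (induction rule: span_induct_alt)
      case base
      then show ?case
        using 0 subspace_0[OF W] by (simp add: span_zero)
    next
      case (step c x y)
      then have "x \<in> W"
        using S by (simp add: span_base)
      then have "c *\<^sub>R x \<in> W"
        using W by (simp add: subspace_scale)
      have "\<phi> (c *\<^sub>R x + y) = c *\<^sub>R \<phi> x + \<phi> y"
        using lin_on_add[OF assms(2) \<open>c *\<^sub>R x \<in> W\<close>] step lin_on_scale[OF assms(2) \<open>x \<in> W\<close>] by auto
      then show ?case
        using step W \<open>c *\<^sub>R x \<in> W\<close> by (auto simp: subspace_add span_add span_scale span_base)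
    qed
    then show "\<phi> f \<in> span (\<phi> ` S)"
      by simp
  qed
  ultimately show ?thesis
    using findim_subset[of "span (\<phi> ` S)"] S findim_span by blast
qed

lemma (in inner_on) riesz:
  assumes "findim W" "lin_on W \<phi>"
  shows "\<exists>g\<in>W. \<forall>h\<in>W. B g h = \<phi> h"
  using assms riesz_span unfolding findim_def by blast

text \<open>\<open>R\<close> is linear on \<open>W\<close> only, so it is replaced by a globally
  linear \<open>g\<close> with the same values on a basis; the image of the basis is then an
  independent set of the same size.\<close>

lemma inj_endo_surj:
  assumes "findim W" "lin_on W R" "R ` W \<subseteq> W" "\<And>f. f \<in> W \<Longrightarrow> R f = 0 \<Longrightarrow> f = 0"
  shows "R ` W = W"
proof -
  obtain S where S: "finite S" "W = span S"
    using assms(1) by (auto simp: findim_def)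
  obtain B where B: "B \<subseteq> S" "independent B" "span B = W"
    using S(2) maximal_independent_subset[of S]
    by (metis span_mono span_span subset_antisym)
  have "finite B"
    using B(1) S(1) by (rule finite_subset)
  obtain g where g: "linear g" "\<forall>x\<in>B. g x = R x"
    using linear_independent_extend[OF B(2)] by blast
  have "lin_on W g"
    using g(1) by (auto simp: lin_on_def linear_add linear_scale)
  then have gR: "g x = R x" if "x \<in> W" for x
    using lin_on_eq_span[of W g R B x] assms(2) g B that span_superset[of B] by auto
  have sub: "subspace W"
    using S by simp
  have "inj_on g (span B)"
  proof (rule inj_onI)
    fix x y assume "x \<in> span B" "y \<in> span B" "g x = g y"
    then have "x - y \<in> W" "g (x - y) = 0"
      using B sub g by (auto simp: subspace_diff linear_diff)
    then show "x = y"
      using assms(4)[of "x - y"] gR by auto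
  qed
  then have ind: "independent (g ` B)"
    using g B by (intro linear_independent_injective_image) auto
  have card: "card (g ` B) = card B"
    by (rule card_image, rule inj_on_subset[OF \<open>inj_on g (span B)\<close> span_superset])
  have gW: "g ` W \<subseteq> W"
    using gR assms(3) by (auto simp: image_subset_iff)
  then have "g ` B \<subseteq> span B"
    using image_mono[OF span_superset[of B], of g] unfolding B(3) by (rule subset_trans[rotated])
  \<comment> \<open>Otherwise \<open>b\<close> and the image of the basis would form an independent
    set in \<open>span B\<close> with one element more than \<open>B\<close>.\<close>
  have "b \<in> span (g ` B)" if "b \<in> B" for b
  proof (rule ccontr)
    assume b: "b \<notin> span (g ` B)"
    then have "independent (insert b (g ` B))"
      using ind by (rule independent_insertI)
    moreover have "insert b (g ` B) \<subseteq> span B"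
      using \<open>g ` B \<subseteq> span B\<close> span_base[OF that] by simp
    ultimately have "card (insert b (g ` B)) \<le> card B"
      using independent_span_bound[OF \<open>finite B\<close>] by simp
    moreover have "b \<notin> g ` B"
      using b span_base by metis
    ultimately show False
      using \<open>finite B\<close> card by simp
  qed
  then have "W \<subseteq> span (g ` B)"
    unfolding B(3)[symmetric] by (simp add: span_minimal subsetI)
  also have "\<dots> = g ` W"
    unfolding B(3)[symmetric] using linear_span_image[OF g(1)] .
  also have "g ` W = R ` W"
    using gR by (rule image_cong[OF refl])
  finally have "W \<subseteq> R ` W" .
  then show ?thesis
    using assms(3) by (rule subset_antisym[rotated])
qed

section \<open>Polynomials in two variables\<close>

definition mon :: "nat \<Rightarrow> nat \<Rightarrow> real^2 \<Rightarrow> real" where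
  "mon i j = (\<lambda>x. (x$1)^i * (x$2)^j)"

definition mons :: "int \<Rightarrow> (real^2 \<Rightarrow> real) set" where
  "mons m = (\<lambda>(i,j). mon i j) ` {(i,j). int (i + j) \<le> m}"

lemma finite_exponents: "finite {(i,j). int (i + j) \<le> m}"
  by (rule finite_subset[of _ "{..nat m} \<times> {..nat m}"]) auto

lemma finite_mons: "finite (mons m)"
  unfolding mons_def by (rule finite_imageI[OF finite_exponents])

lemma subspace_bipoly: "subspace (bipoly m)"
  unfolding subspace_def
proof (intro conjI ballI allI)
  show "0 \<in> bipoly m"
    by (auto simp: bipoly_def intro!: exI[of _ "\<lambda>_ _. 0"])
next
  fix p q assume "p \<in> bipoly m" "q \<in> bipoly m"
  then obtain c d where "\<forall>x. p x = (\<Sum>(i,j)\<in>{(i,j). int (i + j) \<le> m}. c i j * (x$1)^i * (x$2)^j)"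
    "\<forall>x. q x = (\<Sum>(i,j)\<in>{(i,j). int (i + j) \<le> m}. d i j * (x$1)^i * (x$2)^j)"
    by (auto simp: bipoly_def)
  then have "(p + q) x = (\<Sum>(i,j)\<in>{(i,j). int (i + j) \<le> m}. (c i j + d i j) * (x$1)^i * (x$2)^j)" for x
    by (simp add: sum.distrib[symmetric] case_prod_unfold ring_distribs)
  then show "p + q \<in> bipoly m"
    unfolding bipoly_def by (intro CollectI exI[of _ "\<lambda>i j. c i j + d i j"] allI)
next
  fix p a assume "p \<in> bipoly m"
  then obtain c where "\<forall>x. p x = (\<Sum>(i,j)\<in>{(i,j). int (i + j) \<le> m}. c i j * (x$1)^i * (x$2)^j)"
    by (auto simp: bipoly_def)
  then have "(a *\<^sub>R p) x = (\<Sum>(i,j)\<in>{(i,j). int (i + j) \<le> m}. (a * c i j) * (x$1)^i * (x$2)^j)" for x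
    by (simp add: sum_distrib_left case_prod_unfold mult.assoc)
  then show "a *\<^sub>R p \<in> bipoly m"
    unfolding bipoly_def by (intro CollectI exI[of _ "\<lambda>i j. a * c i j"] allI)
qed

lemma mon_in_bipoly: "int (i + j) \<le> m \<Longrightarrow> mon i j \<in> bipoly m"
proof -
  assume ij: "int (i + j) \<le> m"
  define c where "c a b = (if (a,b) = (i,j) then 1 else 0 :: real)" for a b
  have "mon i j x = (\<Sum>(a,b)\<in>{(a,b). int (a + b) \<le> m}. c a b * (x$1)^a * (x$2)^b)" for x
  proof -
    have "(\<Sum>(a,b)\<in>{(a,b). int (a + b) \<le> m}. c a b * (x$1)^a * (x$2)^b)
       = (\<Sum>q\<in>{(a,b). int (a + b) \<le> m}. if q = (i,j) then mon i j x else 0)"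
      by (rule sum.cong) (auto simp: c_def mon_def split: if_splits)
    then show ?thesis
      using ij finite_exponents[of m] by (simp only: sum.delta mem_Collect_eq case_prod_conv if_True)
  qed
  then show ?thesis
    unfolding bipoly_def by blast
qed

lemma bipoly_eq_span: "bipoly m = span (mons m)"
proof (rule subset_antisym)
  show "bipoly m \<subseteq> span (mons m)"
  proof
    fix p assume "p \<in> bipoly m"
    then obtain c where c: "\<forall>x. p x = (\<Sum>(i,j)\<in>{(i,j). int (i + j) \<le> m}. c i j * (x$1)^i * (x$2)^j)"
      by (auto simp: bipoly_def)
    have "p = (\<Sum>q\<in>{(i,j). int (i + j) \<le> m}. c (fst q) (snd q) *\<^sub>R mon (fst q) (snd q))"
      using c by (auto simp: fun_eq_iff sum_fun_apply mon_def case_prod_unfold mult.assoc)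
    also have "\<dots> \<in> span (mons m)"
      by (intro span_sum span_scale span_base) (auto simp: mons_def)
    finally show "p \<in> span (mons m)" .
  qed
  show "span (mons m) \<subseteq> bipoly m"
    by (rule span_minimal[OF _ subspace_bipoly]) (auto simp: mons_def mon_in_bipoly)
qed

lemma findim_bipoly: "findim (bipoly m)"
  by (simp add: bipoly_eq_span findim_span finite_mons)

text \<open>Reduces linear statements to monomials. The remainder \<open>q\<close> is kept in
  \<open>bipoly m\<close> so that linearity on that space can be used in the step.\<close>

lemma bipoly_induct [consumes 1, case_names zero step]:
  assumes "p \<in> bipoly m" "Q 0"
    and "\<And>c i j q. int (i + j) \<le> m \<Longrightarrow> q \<in> bipoly m \<Longrightarrow> Q q \<Longrightarrow> Q (c *\<^sub>R mon i j + q)"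
  shows "Q p"
proof -
  have "p \<in> span (mons m)"
    using assms by (simp add: bipoly_eq_span)
  then have "p \<in> bipoly m \<and> Q p"
  proof (induction rule: span_induct_alt)
    case base
    then show ?case
      using assms(2) subspace_0[OF subspace_bipoly] by (simp add: zero_fun_def)
  next
    case (step c x y)
    then obtain i j where ij: "x = mon i j" "int (i + j) \<le> m"
      by (auto simp: mons_def)
    have "c *\<^sub>R x + y \<in> bipoly m"
      using step ij mon_in_bipoly[OF ij(2)] by (intro subspace_add[OF subspace_bipoly] subspace_scale[OF subspace_bipoly]) auto
    moreover have "Q (c *\<^sub>R x + y)"
      unfolding ij(1) using step by (intro assms(3)[OF ij(2)]) auto
    ultimately show ?case
      by (simp add: plus_fun_def scaleR_fun_def)
  qed
  then show ?thesis ..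
qed

lemma bipoly_add: "p \<in> bipoly m \<Longrightarrow> q \<in> bipoly m \<Longrightarrow> (\<lambda>x. p x + q x) \<in> bipoly m"
  using subspace_add[OF subspace_bipoly] by (simp add: plus_fun_def)

lemma bipoly_diff: "p \<in> bipoly m \<Longrightarrow> q \<in> bipoly m \<Longrightarrow> (\<lambda>x. p x - q x) \<in> bipoly m"
  using subspace_diff[OF subspace_bipoly] by (simp add: fun_diff_def)

lemma bipoly_uminus: "p \<in> bipoly m \<Longrightarrow> (\<lambda>x. - p x) \<in> bipoly m"
  using subspace_neg[OF subspace_bipoly] by (simp add: fun_Compl_def)

lemma bipoly_cmult: "p \<in> bipoly m \<Longrightarrow> (\<lambda>x. c * p x) \<in> bipoly m"
  using subspace_scale[OF subspace_bipoly, of p m c] by (simp add: scaleR_fun_def)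

lemma bipoly_zero: "(\<lambda>x. 0) \<in> bipoly m"
  using subspace_0[OF subspace_bipoly] by (simp add: zero_fun_def)

lemma bipoly_sum: "(\<And>i. i \<in> I \<Longrightarrow> p i \<in> bipoly m) \<Longrightarrow> (\<lambda>x. \<Sum>i\<in>I. p i x) \<in> bipoly m"
  by (induction I rule: infinite_finite_induct) (auto simp: bipoly_zero bipoly_add)

lemma bipoly_mono: "m \<le> n \<Longrightarrow> bipoly m \<subseteq> bipoly n"
  unfolding bipoly_eq_span by (rule span_mono) (auto simp: mons_def)

lemma bipoly_const: "0 \<le> m \<Longrightarrow> (\<lambda>x. c) \<in> bipoly m"
  using bipoly_cmult[OF mon_in_bipoly[of 0 0 m], of c] by (simp add: mon_def)

lemma bipoly_coord:
  assumes "1 \<le> m"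
  shows "(\<lambda>x. x$i) \<in> bipoly m"
proof -
  have "i = 1 \<or> i = 2"
    by (rule exhaust_2)
  then show ?thesis
    using mon_in_bipoly[of 1 0 m] mon_in_bipoly[of 0 1 m] assms by (auto simp: mon_def)
qed

lemma bipoly_mult:
  assumes "p \<in> bipoly m" "q \<in> bipoly n"
  shows "(\<lambda>x. p x * q x) \<in> bipoly (m + n)"
  using assms(1)
proof (induction rule: bipoly_induct)
  case zero
  then show ?case
    by (simp add: bipoly_zero)
next
  case (step c i j p)
  have "(\<lambda>x. mon i j x * q x) \<in> bipoly (m + n)"
    using assms(2)
  proof (induction rule: bipoly_induct)
    case zero
    then show ?case
      by (simp add: bipoly_zero)
  next
    case (step d a b q)
    have "(\<lambda>x. mon i j x * (d *\<^sub>R mon a b + q) x) = (\<lambda>x. d * mon (i+a) (j+b) x + mon i j x * q x)"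
      by (simp add: mon_def power_add algebra_simps)
    then show ?case
      using step \<open>int (i + j) \<le> m\<close> by (auto intro!: bipoly_add bipoly_cmult mon_in_bipoly)
  qed
  then have "(\<lambda>x. c * (mon i j x * q x) + p x * q x) \<in> bipoly (m + n)"
    using step by (intro bipoly_add bipoly_cmult)
  then show ?case
    by (simp add: algebra_simps)
qed

lemma bipoly_power: "p \<in> bipoly 1 \<Longrightarrow> (\<lambda>x. p x ^ n) \<in> bipoly (int n)"
proof (induction n)
  case 0
  then show ?case
    by (simp add: bipoly_const)
next
  case (Suc n)
  then show ?case
    using bipoly_mult[OF Suc(2) Suc(1)[OF Suc(2)]] by (simp add: add.commute)
qed

section \<open>Univariate polynomials and restrictions to lines\<close>

definition deg_le :: "int \<Rightarrow> real poly \<Rightarrow> bool" where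
  "deg_le m r \<longleftrightarrow> (\<forall>i. m < int i \<longrightarrow> coeff r i = 0)"

lemma deg_le_add: "deg_le m r \<Longrightarrow> deg_le m s \<Longrightarrow> deg_le m (r + s)"
  and deg_le_diff: "deg_le m r \<Longrightarrow> deg_le m s \<Longrightarrow> deg_le m (r - s)"
  and deg_le_uminus: "deg_le m r \<Longrightarrow> deg_le m (- r)"
  and deg_le_smult: "deg_le m r \<Longrightarrow> deg_le m (smult c r)"
  and deg_le_0: "deg_le m 0"
  and deg_le_mono: "deg_le m r \<Longrightarrow> m \<le> n \<Longrightarrow> deg_le n r"
  by (auto simp: deg_le_def)

text \<open>Negative bounds are included and force the zero polynomial, in agreement with
  \<open>P (-1)\<close>; for \<open>k = 3\<close> the bound \<open>k - 4\<close> does occur.\<close>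

lemma deg_le_iff: "deg_le m r \<longleftrightarrow> r = 0 \<or> int (degree r) \<le> m"
proof
  assume "deg_le m r"
  then show "r = 0 \<or> int (degree r) \<le> m"
    unfolding deg_le_def by (metis leading_coeff_0_iff not_le)
next
  assume "r = 0 \<or> int (degree r) \<le> m"
  then show "deg_le m r"
    unfolding deg_le_def by (auto intro: coeff_eq_0)
qed

lemma deg_le_const: "0 \<le> m \<Longrightarrow> deg_le m [:c:]"
  by (auto simp: deg_le_iff)

lemma deg_le_linear: "1 \<le> m \<Longrightarrow> deg_le m [:a, b:]"
  by (auto simp: deg_le_iff)

lemma deg_le_mult: "deg_le m r \<Longrightarrow> deg_le n s \<Longrightarrow> deg_le (m + n) (r * s)"
  by (cases "r = 0 \<or> s = 0") (auto simp: deg_le_iff degree_mult_eq)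

lemma deg_le_power: "deg_le 1 r \<Longrightarrow> deg_le (int n) (r ^ n)"
proof (induction n)
  case 0
  then show ?case
    by (simp add: deg_le_iff)
next
  case (Suc n)
  then show ?case
    using deg_le_mult[of 1 r "int n" "r ^ n"] by (simp add: add.commute)
qed

lemma deg_le_pderiv: "deg_le m r \<Longrightarrow> deg_le (m - 1) (pderiv r)"
  by (auto simp: deg_le_def coeff_pderiv)

lemma deg_le_antideriv:
  assumes "deg_le m r"
  shows "\<exists>s. deg_le (m + 1) s \<and> pderiv s = r"
proof -
  define s where "s = (\<Sum>i\<le>degree r. monom (coeff r i / real (Suc i)) (Suc i))"
  have c: "coeff s n = (case n of 0 \<Rightarrow> 0 | Suc i \<Rightarrow> coeff r i / real (Suc i))" for n
  proof (cases n)
    case (Suc i)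
    have "coeff s n = (\<Sum>j\<le>degree r. if j = i then coeff r j / real (Suc j) else 0)"
      unfolding s_def coeff_sum Suc by (rule sum.cong) auto
    also have "\<dots> = coeff r i / real (Suc i)"
      by (auto simp: coeff_eq_0)
    finally show ?thesis
      using Suc by simp
  qed (simp add: s_def coeff_sum)
  have "deg_le (m + 1) s"
    using assms by (auto simp: deg_le_def c split: nat.splits)
  moreover have "pderiv s = r"
    by (auto simp: poly_eq_iff coeff_pderiv c)
  ultimately show ?thesis
    by blast
qed

text \<open>Substituting affine functions of one variable does not raise the total degree, so degree
  bounds survive on every edge.\<close>

lemma bipoly_on_line:
  assumes "p \<in> bipoly m"
  shows "\<exists>r. deg_le m r \<and> (\<forall>s. p (a + s *\<^sub>R b) = poly r s)"
  using assms
proof (induction rule: bipoly_induct)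
  case zero
  then show ?case
    by (auto intro!: exI[of _ 0] simp: deg_le_0)
next
  case (step c i j q)
  then obtain r where r: "deg_le m r" "\<forall>s. q (a + s *\<^sub>R b) = poly r s"
    by blast
  define l where "l = smult c ([:a$1, b$1:] ^ i * [:a$2, b$2:] ^ j)"
  have "deg_le (int i + int j) l"
    unfolding l_def by (intro deg_le_smult deg_le_mult deg_le_power deg_le_linear) auto
  then have "deg_le m (l + r)"
    using r step by (auto intro!: deg_le_add elim!: deg_le_mono)
  moreover have "(c *\<^sub>R mon i j + q) (a + s *\<^sub>R b) = poly (l + r) s" for s
    using r by (simp add: l_def mon_def algebra_simps)
  ultimately show ?case
    by blast
qed

text \<open>Used with the affine coordinate along an edge, it extends a univariate polynomial from
  the edge to the plane without raising the degree.\<close>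

lemma poly_affine_bipoly:
  assumes "deg_le m r" "l \<in> bipoly 1"
  shows "(\<lambda>x. poly r (l x)) \<in> bipoly m"
proof (cases "r = 0")
  case True
  then show ?thesis
    by (simp add: bipoly_zero)
next
  case False
  have "(\<lambda>x. coeff r i * l x ^ i) \<in> bipoly m" if "i \<le> degree r" for i
  proof -
    have "int i \<le> m"
      using that False assms(1) by (auto simp: deg_le_iff)
    then show ?thesis
      using bipoly_power[OF assms(2), of i] bipoly_mono[of "int i" m] by (auto intro!: bipoly_cmult)
  qed
  then show ?thesis
    unfolding poly_altdef by (auto intro!: bipoly_sum)
qed

section \<open>Partial derivatives and potentials of polynomials\<close>

lemma has_derivative_mon:
  "(mon i j has_derivative
     (\<lambda>h. real i * (x$1)^(i-1) * (x$2)^j * h$1 + real j * (x$1)^i * (x$2)^(j-1) * h$2)) (at x)"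
  unfolding mon_def
  by (rule has_derivative_eq_rhs, (rule derivative_intros bounded_linear_vec_nth[THEN bounded_linear.has_derivative])+)
     (auto simp: algebra_simps)

lemma bipoly_differentiable: "p \<in> bipoly m \<Longrightarrow> p differentiable at x"
proof (induction rule: bipoly_induct)
  case zero
  then show ?case
    by (simp add: zero_fun_def)
next
  case (step c i j q)
  then show ?case
    using has_derivative_mon[of i j x]
    by (auto simp: plus_fun_def scaleR_fun_def intro!: differentiable_add differentiable_mult differentiable_const intro: differentiableI)
qed

lemma partial_eq: "(f has_derivative f') (at x) \<Longrightarrow> partial j f x = f' (axis j 1)"
  unfolding partial_def by (simp add: frechet_derivative_at[symmetric])

lemma vec2_eq: "(h :: real^2) = h$1 *\<^sub>R axis 1 1 + h$2 *\<^sub>R axis 2 1"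
  by (simp add: vec_eq_iff forall_2 axis_def)

lemma frechet_partial:
  assumes "f differentiable at x"
  shows "frechet_derivative f (at x) h = h$1 * partial 1 f x + h$2 * partial 2 f x"
proof -
  have l: "linear (frechet_derivative f (at x))"
    using assms by (rule linear_frechet_derivative)
  have "frechet_derivative f (at x) h
      = frechet_derivative f (at x) (h$1 *\<^sub>R axis 1 1 + h$2 *\<^sub>R axis 2 1)"
    by (subst vec2_eq) (rule refl)
  also have "\<dots> = h$1 * partial 1 f x + h$2 * partial 2 f x"
    by (simp add: linear_add[OF l] linear_scale[OF l] partial_def)
  finally show ?thesis .
qed

lemma has_derivative_partial:
  assumes "f differentiable at x"
  shows "(f has_derivative (\<lambda>h. h$1 * partial 1 f x + h$2 * partial 2 f x)) (at x)"
proof -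
  have "frechet_derivative f (at x) = (\<lambda>h. h$1 * partial 1 f x + h$2 * partial 2 f x)"
    using frechet_partial[OF assms] by (rule ext)
  then show ?thesis
    using frechet_derivative_works[THEN iffD1, OF assms] by simp
qed

lemma partial_add:
  assumes "f differentiable at x" "g differentiable at x"
  shows "partial j (\<lambda>x. f x + g x) x = partial j f x + partial j g x"
  using partial_eq[OF has_derivative_add[OF frechet_derivative_works[THEN iffD1, OF assms(1)]
        frechet_derivative_works[THEN iffD1, OF assms(2)]]]
  by (simp add: partial_def)

lemma partial_cmult:
  assumes "f differentiable at x"
  shows "partial j (\<lambda>x. c * f x) x = c * partial j f x"
  using partial_eq[OF has_derivative_mult_right[OF frechet_derivative_works[THEN iffD1, OF assms(1)]]]
  by (simp add: partial_def)

lemma partial_mult: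
  assumes "f differentiable at x" "g differentiable at x"
  shows "partial j (\<lambda>x. f x * g x) x = f x * partial j g x + partial j f x * g x"
  using partial_eq[OF has_derivative_mult[OF frechet_derivative_works[THEN iffD1, OF assms(1)]
        frechet_derivative_works[THEN iffD1, OF assms(2)]]]
  by (simp add: partial_def)

lemma partial_const [simp]: "partial j (\<lambda>x. c) = (\<lambda>x. 0)"
  by (rule ext) (simp add: partial_eq[OF has_derivative_const])

lemma partial_coord: "partial j (\<lambda>x. x$i) = (\<lambda>x. if i = j then 1 else 0)"
  by (rule ext) (simp add: partial_eq[OF bounded_linear_vec_nth[THEN bounded_linear.has_derivative, OF has_derivative_ident]] axis_def)

lemma partial_mon:
  "partial 1 (mon i j) = real i *\<^sub>R mon (i - 1) j" "partial 2 (mon i j) = real j *\<^sub>R mon i (j - 1)"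
  by (simp_all add: fun_eq_iff partial_eq[OF has_derivative_mon]) (simp_all add: mon_def axis_def)

lemma lin_on_partial: "lin_on (bipoly m) (partial j)"
  by (rule lin_onI)
     (auto simp: fun_eq_iff plus_fun_def scaleR_fun_def partial_add partial_cmult bipoly_differentiable)

lemma partial_step:
  assumes "q \<in> bipoly m"
  shows "partial l (c *\<^sub>R mon i j + q) = c *\<^sub>R partial l (mon i j) + partial l q"
proof (rule ext)
  fix x
  have m: "mon i j differentiable at x"
    using has_derivative_mon differentiableI by blast
  then have "(\<lambda>x. c * mon i j x) differentiable at x"
    by (auto intro!: differentiable_mult)
  then show "partial l (c *\<^sub>R mon i j + q) x = (c *\<^sub>R partial l (mon i j) + partial l q) x"
    using m bipoly_differentiable[OF assms]
    by (simp add: plus_fun_def scaleR_fun_def partial_add partial_cmult)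
qed

lemma partial_zero [simp]: "partial j 0 = 0"
  by (simp add: zero_fun_def)

lemma partial_bipoly: "p \<in> bipoly m \<Longrightarrow> partial l p \<in> bipoly (m - 1)"
proof (induction rule: bipoly_induct)
  case zero
  then show ?case
    using subspace_0[OF subspace_bipoly] by (simp add: zero_fun_def)
next
  case (step c i j q)
  have "partial l (mon i j) \<in> bipoly (m - 1)"
  proof -
    have "real i *\<^sub>R mon (i - 1) j \<in> bipoly (m - 1)"
      using step(1) by (cases i) (auto simp: subspace_0 subspace_bipoly intro!: subspace_scale[OF subspace_bipoly] mon_in_bipoly)
    moreover have "real j *\<^sub>R mon i (j - 1) \<in> bipoly (m - 1)"
      using step(1) by (cases j) (auto simp: subspace_0 subspace_bipoly intro!: subspace_scale[OF subspace_bipoly] mon_in_bipoly)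
    ultimately show ?thesis
      using exhaust_2[of l] partial_mon by auto
  qed
  then show ?case
    unfolding partial_step[OF step(2)]
    using step by (intro subspace_add[OF subspace_bipoly] subspace_scale[OF subspace_bipoly]) auto
qed

lemma partial_commute_12: "p \<in> bipoly m \<Longrightarrow> partial 1 (partial 2 p) = partial 2 (partial 1 p)"
proof (induction rule: bipoly_induct)
  case zero
  then show ?case
    by (simp add: zero_fun_def)
next
  case (step c i j q)
  have *: "partial 1 (partial 2 (mon i j)) = partial 2 (partial 1 (mon i j))"
    using lin_on_scale[OF lin_on_partial mon_in_bipoly[OF order_refl]] by (simp add: partial_mon)
  have b: "partial 1 q \<in> bipoly (m - 1)" "partial 2 q \<in> bipoly (m - 1)"
    "partial 1 (mon i j) \<in> bipoly (m - 1)" "partial 2 (mon i j) \<in> bipoly (m - 1)"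
    using partial_bipoly step mon_in_bipoly by blast+
  have sc: "c *\<^sub>R partial 1 (mon i j) \<in> bipoly (m - 1)" "c *\<^sub>R partial 2 (mon i j) \<in> bipoly (m - 1)"
    using b subspace_scale[OF subspace_bipoly] by auto
  have "partial 1 (partial 2 (c *\<^sub>R mon i j + q)) = c *\<^sub>R partial 1 (partial 2 (mon i j)) + partial 1 (partial 2 q)"
    by (simp only: partial_step[OF step(2)] lin_on_add[OF lin_on_partial sc(2) b(2)] lin_on_scale[OF lin_on_partial b(4)])
  moreover have "partial 2 (partial 1 (c *\<^sub>R mon i j + q)) = c *\<^sub>R partial 2 (partial 1 (mon i j)) + partial 2 (partial 1 q)"
    by (simp only: partial_step[OF step(2)] lin_on_add[OF lin_on_partial sc(1) b(1)] lin_on_scale[OF lin_on_partial b(3)])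
  ultimately show ?case
    by (simp only: * step(3))
qed

lemma partial_commute: "p \<in> bipoly m \<Longrightarrow> partial i (partial j p) = partial j (partial i p)"
  using exhaust_2[of i] exhaust_2[of j] partial_commute_12[of p m] by auto

lemma bipoly_antiderivative: "p \<in> bipoly m \<Longrightarrow> \<exists>q\<in>bipoly (m + 1). partial l q = p"
proof (induction rule: bipoly_induct)
  case zero
  then show ?case
    by (rule bexI[of _ 0]) (simp_all add: subspace_0 subspace_bipoly)
next
  case (step c i j p)
  then obtain q where q: "q \<in> bipoly (m + 1)" "partial l q = p"
    by blast
  have "\<exists>u\<in>bipoly (m + 1). partial l u = mon i j"
  proof -
    have "(1 / real (Suc i)) *\<^sub>R mon (Suc i) j \<in> bipoly (m + 1)"
      "(1 / real (Suc j)) *\<^sub>R mon i (Suc j) \<in> bipoly (m + 1)"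
      using step(1) by (auto intro!: subspace_scale[OF subspace_bipoly] mon_in_bipoly)
    moreover have "partial 1 ((1 / real (Suc i)) *\<^sub>R mon (Suc i) j) = mon i j"
      "partial 2 ((1 / real (Suc j)) *\<^sub>R mon i (Suc j)) = mon i j"
      using lin_on_scale[OF lin_on_partial mon_in_bipoly[OF order_refl]] partial_mon
      by (simp_all add: fun_eq_iff)
    ultimately show ?thesis
      using exhaust_2[of l] by auto
  qed
  then obtain u where u: "u \<in> bipoly (m + 1)" "partial l u = mon i j"
    by blast
  have cu: "c *\<^sub>R u \<in> bipoly (m + 1)"
    using u subspace_scale[OF subspace_bipoly] by blast
  show ?case
  proof (rule bexI)
    show "c *\<^sub>R u + q \<in> bipoly (m + 1)"
      using cu q subspace_add[OF subspace_bipoly] by blast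
    show "partial l (c *\<^sub>R u + q) = c *\<^sub>R mon i j + p"
      using lin_on_add[OF lin_on_partial cu q(1)] lin_on_scale[OF lin_on_partial u(1)] u q by simp
  qed
qed

lemma bipoly_const_along:
  assumes "h \<in> bipoly m" "partial 1 h = (\<lambda>_. 0)"
  shows "h x = h (axis 2 (x$2))"
proof -
  define g where "g s = h (axis 2 (x$2) + s *\<^sub>R axis 1 1)" for s
  have "(g has_field_derivative 0) (at s)" for s
  proof -
    have "((\<lambda>s. axis 2 (x$2) + s *\<^sub>R axis 1 (1::real)) has_derivative (\<lambda>d. d *\<^sub>R axis 1 1)) (at s)"
      by (auto intro!: derivative_eq_intros)
    from has_derivative_compose[OF this has_derivative_partial[OF bipoly_differentiable[OF assms(1)]]]
    show ?thesis
      using assms(2) unfolding g_def[abs_def] has_field_derivative_def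
      by (simp add: axis_def lambda_zero[symmetric])
  qed
  then have "g (x$1) = g 0"
    using DERIV_isconst_all by blast
  moreover have "axis 2 (x$2) + (x$1) *\<^sub>R axis 1 1 = x"
    by (simp add: vec_eq_iff forall_2 axis_def)
  ultimately show ?thesis
    by (simp add: g_def)
qed

text \<open>A general antiderivative in the second variable might depend on the first one. Here
  \<open>h\<close> is rewritten by its values on the line where the first coordinate is 0, so that
  its monomials involve the second variable only.\<close>

lemma bipoly_antiderivative_2:
  assumes "h \<in> bipoly m" "partial 1 h = (\<lambda>_. 0)"
  shows "\<exists>q\<in>bipoly (m + 1). partial 1 q = (\<lambda>_. 0) \<and> partial 2 q = h"
proof -
  have "\<exists>q\<in>bipoly (m + 1). partial 1 q = 0 \<and> partial 2 q = (\<lambda>x. h (axis 2 (x$2)))"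
    using assms(1)
  proof (induction rule: bipoly_induct)
    case zero
    then show ?case
      by (rule bexI[of _ "\<lambda>_. 0"]) (simp_all add: bipoly_zero zero_fun_def)
  next
    case (step c i j p)
    then obtain q where q: "q \<in> bipoly (m + 1)" "partial 1 q = 0" "partial 2 q = (\<lambda>x. p (axis 2 (x$2)))"
      by blast
    \<comment> \<open>On the line \<open>x$1 = 0\<close> the monomial \<open>mon i j\<close> is
      \<open>0 ^ i\<close> times a power of \<open>x$2\<close>, hence the factor, which is 1 for
      \<open>i = 0\<close> and 0 otherwise.\<close>
    define u where "u = (c * 0 ^ i / real (Suc j)) *\<^sub>R mon 0 (Suc j)"
    have u: "u \<in> bipoly (m + 1)" "partial 1 u = 0" "partial 2 u = (\<lambda>x. c * mon i j (axis 2 (x$2)))"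
    proof -
      show "u \<in> bipoly (m + 1)"
        using step(1) unfolding u_def by (intro subspace_scale[OF subspace_bipoly] mon_in_bipoly) auto
      show "partial 1 u = 0" "partial 2 u = (\<lambda>x. c * mon i j (axis 2 (x$2)))"
        unfolding u_def lin_on_scale[OF lin_on_partial mon_in_bipoly[OF order_refl]] partial_mon
        by (simp_all add: fun_eq_iff) (simp add: mon_def axis_def)
    qed
    show ?case
    proof (rule bexI)
      show "u + q \<in> bipoly (m + 1)"
        using u q subspace_add[OF subspace_bipoly] by blast
      show "partial 1 (u + q) = 0 \<and> partial 2 (u + q) = (\<lambda>x. (c *\<^sub>R mon i j + p) (axis 2 (x$2)))"
        using lin_on_add[OF lin_on_partial u(1) q(1)] u q by (simp add: fun_eq_iff)
    qed
  qed
  moreover have "(\<lambda>x. h (axis 2 (x$2))) = h"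
    using bipoly_const_along[OF assms] by (simp add: fun_eq_iff)
  ultimately show ?thesis
    by (simp add: zero_fun_def)
qed

text \<open>Poincare lemma for polynomials. An antiderivative \<open>a\<close> of \<open>f\<close>
  in the first variable leaves the defect \<open>g - partial 2 a\<close>; by the compatibility
  condition it does not depend on the first variable and can be removed by a function of the second
  one.\<close>

lemma bipoly_potential:
  assumes "f \<in> bipoly m" "g \<in> bipoly m" "partial 2 f = partial 1 g"
  shows "\<exists>q\<in>bipoly (m + 1). partial 1 q = f \<and> partial 2 q = g"
proof -
  obtain a where a: "a \<in> bipoly (m + 1)" "partial 1 a = f"
    using bipoly_antiderivative[OF assms(1)] by blast
  have b2: "partial 2 a \<in> bipoly m"
    using partial_bipoly[OF a(1), of 2] by simp
  have h: "g - partial 2 a \<in> bipoly m"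
    using assms(2) b2 by (simp add: subspace_diff[OF subspace_bipoly])
  moreover have "partial 1 (g - partial 2 a) = (\<lambda>_. 0)"
    using lin_on_diff[OF lin_on_partial subspace_bipoly assms(2) b2, of 1] partial_commute_12[OF a(1)] a assms
    by (simp add: fun_eq_iff)
  ultimately obtain b where b: "b \<in> bipoly (m + 1)" "partial 1 b = (\<lambda>_. 0)" "partial 2 b = g - partial 2 a"
    using bipoly_antiderivative_2 by blast
  show ?thesis
  proof (rule bexI)
    show "a + b \<in> bipoly (m + 1)"
      using a b subspace_add[OF subspace_bipoly] by blast
    show "partial 1 (a + b) = f \<and> partial 2 (a + b) = g"
      using lin_on_add[OF lin_on_partial a(1) b(1)] a b by (simp add: fun_eq_iff)
  qed
qed

lemma poly_zero_on_interval:
  fixes r :: "real poly"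
  assumes "a < b" "\<And>s. s \<in> {a<..<b} \<Longrightarrow> poly r s = 0"
  shows "r = 0"
proof (rule ccontr)
  assume "r \<noteq> 0"
  then have "finite {s. poly r s = 0}"
    by (rule poly_roots_finite)
  moreover have "{a<..<b} \<subseteq> {s. poly r s = 0}"
    using assms(2) by auto
  ultimately have "finite {a<..<b}"
    using finite_subset by blast
  then show False
    using assms(1) by (simp add: infinite_Ioo)
qed

text \<open>On the line from \<open>x0\<close> through \<open>x\<close> the restriction is a
  univariate polynomial that vanishes for small positive parameters, hence everywhere, in particular
  at parameter 1, which is \<open>x\<close>.\<close>

lemma bipoly_zero_on_open:
  assumes "p \<in> bipoly m" "open S" "x0 \<in> S" "\<And>x. x \<in> S \<Longrightarrow> p x = 0"
  shows "p = (\<lambda>_. 0)"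
proof
  fix x
  obtain r where r: "\<And>s. p (x0 + s *\<^sub>R (x - x0)) = poly r s"
    using bipoly_on_line[OF assms(1)] by blast
  have "((\<lambda>s. x0 + s *\<^sub>R (x - x0)) \<longlongrightarrow> x0 + 0 *\<^sub>R (x - x0)) (at_right 0)"
    by (intro tendsto_intros)
  then have "eventually (\<lambda>s. x0 + s *\<^sub>R (x - x0) \<in> S) (at_right 0)"
    using assms(2,3) topological_tendstoD by fastforce
  then obtain b where b: "b > 0" "\<And>s. 0 < s \<Longrightarrow> s < b \<Longrightarrow> x0 + s *\<^sub>R (x - x0) \<in> S"
    unfolding eventually_at_right_field by auto
  have "r = 0"
    by (rule poly_zero_on_interval[OF b(1)]) (use b assms(4) r in \<open>auto simp flip: r\<close>)
  then show "p x = 0"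
    using r[of 1] by simp
qed

lemma bipoly_continuous: "p \<in> bipoly m \<Longrightarrow> continuous_on S p"
  by (meson bipoly_differentiable differentiable_at_withinI differentiable_imp_continuous_within
      continuous_on_eq_continuous_within)

section \<open>Edges\<close>

text \<open>The parameter runs over the unit interval rather than over the arc length, so that the
  polynomial lemmas on \<open>{0..1}\<close> apply to all edges; the price is a factor
  \<open>len E\<close> in integrals and derivatives.\<close>

definition gam :: "edge \<Rightarrow> real \<Rightarrow> real^2" where
  "gam E s = fst E + s *\<^sub>R (snd E - fst E)"

definition len :: "edge \<Rightarrow> real" where
  "len E = norm (snd E - fst E)"

lemma gam_0 [simp]: "gam E 0 = fst E" and gam_1 [simp]: "gam E 1 = snd E"
  by (simp_all add: gam_def)

lemma seg_gam: "seg E = gam E ` {0..1}"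
  by (auto simp: seg_def gam_def closed_segment_def algebra_simps image_def)

lemma open_seg_gam: "fst E \<noteq> snd E \<Longrightarrow> open_segment (fst E) (snd E) = gam E ` {0<..<1}"
  by (force simp: gam_def in_segment algebra_simps image_def)

lemma gam_diff: "gam E s - gam E s' = (s - s') *\<^sub>R (snd E - fst E)"
  by (simp add: gam_def algebra_simps)

lemma gam_inj: "fst E \<noteq> snd E \<Longrightarrow> gam E s = gam E s' \<longleftrightarrow> s = s'"
  using gam_diff[of E s s'] by auto

lemma len_pos: "fst E \<noteq> snd E \<Longrightarrow> len E > 0"
  by (simp add: len_def)

lemma tangent_len: "len E *\<^sub>R tangent E = snd E - fst E"
  by (cases "fst E = snd E") (simp_all add: len_def tangent_def)

lemma perp_nth [simp]: "perp y $ 1 = - y$2" "perp y $ 2 = y$1"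
  by (simp_all add: perp_def)

lemma inner_2: "(x::real^2) \<bullet> y = x$1 * y$1 + x$2 * y$2"
  by (simp add: inner_vec_def sum_2)

lemma perp_orth: "y \<bullet> perp y = 0" "perp y \<bullet> y = 0"
  by (simp_all add: inner_2)

lemma normal_nth: "normal E $ 1 = - tangent E $ 2" "normal E $ 2 = tangent E $ 1"
  by (simp_all add: normal_def)

lemma tangent_normal: "tangent E \<bullet> normal E = 0" "normal E \<bullet> tangent E = 0"
  by (simp_all add: normal_def perp_orth)

lemma tangent_norm: "fst E \<noteq> snd E \<Longrightarrow> (tangent E $ 1)^2 + (tangent E $ 2)^2 = 1"
proof -
  assume E: "fst E \<noteq> snd E"
  have "norm (tangent E) = 1"
    using E by (simp add: tangent_def)
  then have "tangent E \<bullet> tangent E = 1"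
    by (simp add: norm_eq_1)
  then show ?thesis
    by (simp add: inner_2 power2_eq_square)
qed

lemma normal_nz: "fst E \<noteq> snd E \<Longrightarrow> normal E \<bullet> normal E = 1"
  using tangent_norm[of E] by (simp add: inner_2 normal_nth power2_eq_square add.commute)

lemma gam_normal: "(gam E s - gam E s') \<bullet> normal E = 0"
  by (simp add: gam_diff tangent_len[symmetric] tangent_normal)

section \<open>The two sides of an edge\<close>

locale polygon =
  fixes T :: "(real^2) set" and Es :: "edge set"
  assumes polygonal: "polygonal_domain T Es"
begin

lemma open_T: "open T" and connected_T: "connected T" and bounded_T: "bounded T" and T_ne: "T \<noteq> {}"
  and finite_Es: "finite Es" and frontier_T: "frontier T = (\<Union>E\<in>Es. seg E)"
  and edge_ne: "E \<in> Es \<Longrightarrow> fst E \<noteq> snd E"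
  and seg_Int: "E \<in> Es \<Longrightarrow> E' \<in> Es \<Longrightarrow> E \<noteq> E' \<Longrightarrow> seg E \<inter> seg E' \<subseteq> ends E \<inter> ends E'"
  and card_vert: "V \<in> verts Es \<Longrightarrow> card {E\<in>Es. V \<in> ends E} = 2"
  using polygonal by (auto simp: polygonal_domain_def)

lemma finite_verts: "finite (verts Es)"
  using finite_Es by (simp add: verts_def ends_def)

text \<open>A half disk is used, not a ray along \<open>m\<close>, so that one statement covers all
  directions crossing the edge, as needed on coordinate lines.\<close>

definition inner_at :: "real^2 \<Rightarrow> real^2 \<Rightarrow> bool" where
  "inner_at m x \<longleftrightarrow> (\<exists>r>0. \<forall>y\<in>ball x r. (y - x) \<bullet> m > 0 \<longrightarrow> y \<in> T)"

definition outer_at :: "real^2 \<Rightarrow> real^2 \<Rightarrow> bool" where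
  "outer_at m x \<longleftrightarrow> (\<exists>r>0. \<forall>y\<in>ball x r. (y - x) \<bullet> m > 0 \<longrightarrow> y \<notin> closure T)"

text \<open>The other edges form a closed set that does not contain \<open>x\<close>, because
  distinct edges meet only in endpoints; so near \<open>x\<close> the frontier lies on the line of
  \<open>E\<close>.\<close>

lemma frontier_near_edge:
  assumes "E \<in> Es" "x \<in> open_segment (fst E) (snd E)"
  obtains r where "r > 0" "\<And>y. y \<in> ball x r \<Longrightarrow> y \<in> frontier T \<Longrightarrow> (y - x) \<bullet> normal E = 0"
    "\<And>y E'. y \<in> ball x r \<Longrightarrow> E' \<in> Es \<Longrightarrow> E' \<noteq> E \<Longrightarrow> y \<notin> seg E'"
proof -
  let ?C = "\<Union>E'\<in>Es - {E}. seg E'"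
  have "closed ?C"
    using finite_Es by (auto simp: seg_def)
  moreover have "x \<notin> ?C"
  proof
    assume "x \<in> ?C"
    then obtain E' where "E' \<in> Es" "E' \<noteq> E" "x \<in> seg E'"
      by auto
    moreover have "x \<in> seg E"
      using assms(2) by (auto simp: seg_def open_segment_def)
    ultimately have "x \<in> ends E"
      using seg_Int assms(1) by blast
    then show False
      using assms(2) by (auto simp: ends_def open_segment_def)
  qed
  ultimately obtain r where r: "r > 0" "ball x r \<subseteq> - ?C"
    by (meson ComplI open_Compl open_contains_ball_eq)
  show thesis
  proof
    show "r > 0"
      by fact
    show "y \<notin> seg E'" if "y \<in> ball x r" "E' \<in> Es" "E' \<noteq> E" for y E'
      using r that by auto
    then have "y \<in> seg E" if "y \<in> ball x r" "y \<in> frontier T" for y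
      using frontier_T that by blast
    moreover obtain s' where "x = gam E s'"
      using assms edge_ne by (auto simp: open_seg_gam)
    ultimately show "(y - x) \<bullet> normal E = 0" if "y \<in> ball x r" "y \<in> frontier T" for y
      using that gam_normal[of E] by (force simp: seg_gam)
  qed
qed

lemma half_ball_ne:
  assumes "r > 0" "m \<bullet> m = 1"
  shows "x + (r/2) *\<^sub>R m \<in> ball x r" "(x + (r/2) *\<^sub>R m - x) \<bullet> m > 0"
proof -
  have "norm m = 1"
    using assms by (simp add: norm_eq_1)
  then show "x + (r/2) *\<^sub>R m \<in> ball x r" "(x + (r/2) *\<^sub>R m - x) \<bullet> m > 0"
    using assms by (auto simp: dist_norm)
qed

lemma inner_outer_disj:
  assumes "m \<bullet> m = 1"
  shows "\<not> (inner_at m x \<and> outer_at m x)"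
proof
  assume "inner_at m x \<and> outer_at m x"
  then obtain r r' where r: "r > 0" "\<forall>y\<in>ball x r. (y - x) \<bullet> m > 0 \<longrightarrow> y \<in> T"
    "r' > 0" "\<forall>y\<in>ball x r'. (y - x) \<bullet> m > 0 \<longrightarrow> y \<notin> closure T"
    unfolding inner_at_def outer_at_def by blast
  let ?y = "x + (min r r' / 2) *\<^sub>R m"
  have "?y \<in> ball x (min r r')" "(?y - x) \<bullet> m > 0"
    using half_ball_ne[of "min r r'" m x] r assms by auto
  then have "?y \<in> T" "?y \<notin> closure T"
    using r by auto
  then show False
    using closure_subset by blast
qed

text \<open>The open half disk is convex and, being off the line of the edge, misses the frontier of
  \<open>T\<close>; a connected set missing the frontier lies in \<open>T\<close> or avoids its
  closure.\<close>

lemma inner_or_outer: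
  assumes "E \<in> Es" "x \<in> open_segment (fst E) (snd E)" "m = normal E \<or> m = - normal E"
  shows "inner_at m x \<or> outer_at m x"
proof -
  obtain r where r: "r > 0" "\<And>y. y \<in> ball x r \<Longrightarrow> y \<in> frontier T \<Longrightarrow> (y - x) \<bullet> normal E = 0"
    using frontier_near_edge[OF assms(1,2)] by metis
  define H where "H = ball x r \<inter> {y. m \<bullet> y > m \<bullet> x}"
  have H: "y \<in> H \<longleftrightarrow> y \<in> ball x r \<and> (y - x) \<bullet> m > 0" for y
    by (auto simp: H_def inner_diff_left inner_diff_right inner_commute)
  have "convex H"
    unfolding H_def by (intro convex_Int convex_ball convex_halfspace_gt)
  then have "connected H"
    by (rule convex_connected)
  moreover have Hf: "H \<inter> frontier T = {}"
    using r(2) assms(3) by (force simp: H)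
  ultimately have "H \<inter> T = {} \<or> H - T = {}"
    using connected_Int_frontier by blast
  then have "H \<subseteq> T \<or> H \<inter> closure T = {}"
    using Hf open_T by (auto simp: frontier_def interior_open)
  then show ?thesis
    unfolding inner_at_def outer_at_def using r(1) H by blast
qed

lemma near_shift:
  assumes "r > 0" "(x' - x) \<bullet> m = 0" "x' \<in> ball x r" "\<forall>y\<in>ball x r. (y - x) \<bullet> m > 0 \<longrightarrow> Q y"
  shows "\<exists>r>0. \<forall>y\<in>ball x' r. (y - x') \<bullet> m > 0 \<longrightarrow> Q y"
proof (intro exI conjI ballI impI)
  show "r - dist x x' > 0"
    using assms by simp
  fix y assume y: "y \<in> ball x' (r - dist x x')" "(y - x') \<bullet> m > 0"
  have "y \<in> ball x r"
    using y(1) dist_triangle[of x y x'] by auto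
  moreover have "(y - x) \<bullet> m > 0"
    using y(2) assms(2) by (simp add: inner_diff_left)
  ultimately show "Q y"
    using assms by blast
qed

text \<open>The half disk at \<open>x\<close> contains smaller half disks at all nearby points of
  the edge, so the property is locally constant on the connected open edge.\<close>

lemma side_const:
  assumes "E \<in> Es" "m = normal E \<or> m = - normal E"
    "x \<in> open_segment (fst E) (snd E)" "x' \<in> open_segment (fst E) (snd E)"
  shows "inner_at m x \<longleftrightarrow> inner_at m x'"
proof -
  have mm: "m \<bullet> m = 1"
    using assms(2) normal_nz[OF edge_ne[OF assms(1)]] by auto
  let ?S = "open_segment (fst E) (snd E)"
  have loc: "eventually (\<lambda>x'. inner_at m x = inner_at m x') (at x within ?S)" if x: "x \<in> ?S" for x
  proof -
    have orth: "(x' - x) \<bullet> m = 0" if "x' \<in> ?S" for x'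
      using x that assms(1,2) gam_normal[of E] by (auto simp: open_seg_gam edge_ne)
    consider "inner_at m x" | "outer_at m x"
      using inner_or_outer[OF assms(1) x assms(2)] by blast
    then show ?thesis
    proof cases
      case 1
      then obtain r where r: "r > 0" "\<forall>y\<in>ball x r. (y - x) \<bullet> m > 0 \<longrightarrow> y \<in> T"
        unfolding inner_at_def by blast
      have "inner_at m x'" if "x' \<in> ?S" "x' \<in> ball x r" for x'
        using near_shift[OF r(1) orth[OF that(1)] that(2) r(2)] unfolding inner_at_def .
      then show ?thesis
        using 1 r(1) unfolding eventually_at by (intro exI[of _ r]) (auto simp: dist_commute)
    next
      case 2
      then obtain r where r: "r > 0" "\<forall>y\<in>ball x r. (y - x) \<bullet> m > 0 \<longrightarrow> y \<notin> closure T"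
        unfolding outer_at_def by blast
      have "\<not> inner_at m x'" if "x' \<in> ?S" "x' \<in> ball x r" for x'
        using near_shift[OF r(1) orth[OF that(1)] that(2) r(2)] inner_outer_disj[OF mm]
        unfolding outer_at_def by blast
      then show ?thesis
        using inner_outer_disj[OF mm] 2 r(1) unfolding eventually_at
        by (intro exI[of _ r]) (auto simp: dist_commute)
    qed
  qed
  show ?thesis
    using connected_local_const[of ?S x x' "inner_at m"] loc assms(3,4)
      convex_connected[OF convex_open_segment] by blast
qed

definition side :: "edge \<Rightarrow> real^2 \<Rightarrow> bool" where
  "side E m \<longleftrightarrow> (\<forall>x\<in>open_segment (fst E) (snd E). inner_at m x)"

lemma not_side:
  assumes "E \<in> Es" "m = normal E \<or> m = - normal E" "\<not> side E m" "x \<in> open_segment (fst E) (snd E)"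
  shows "outer_at m x"
  using assms side_const[OF assms(1,2)] inner_or_outer[OF assms(1) assms(4,2)] unfolding side_def by blast

text \<open>If both sides were exterior, \<open>T\<close> near the midpoint would be contained in
  the line of the edge; but it is nonempty there and open. That \<open>T\<close> lies on both sides
  is not excluded at this stage.\<close>

lemma some_side:
  assumes "E \<in> Es"
  shows "side E (normal E) \<or> side E (- normal E)"
proof (rule ccontr)
  assume "\<not> ?thesis"
  then have ns: "\<not> side E (normal E)" "\<not> side E (- normal E)"
    by auto
  define x where "x = gam E (1/2)"
  have x: "x \<in> open_segment (fst E) (snd E)"
    using open_seg_gam[OF edge_ne[OF assms]] by (auto simp: x_def)
  obtain r where r: "r > 0" "\<forall>y\<in>ball x r. (y - x) \<bullet> normal E > 0 \<longrightarrow> y \<notin> closure T"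
    using not_side[OF assms _ ns(1) x] unfolding outer_at_def by blast
  obtain r' where r': "r' > 0" "\<forall>y\<in>ball x r'. (y - x) \<bullet> - normal E > 0 \<longrightarrow> y \<notin> closure T"
    using not_side[OF assms _ ns(2) x] unfolding outer_at_def by blast
  define B where "B = ball x (min r r') \<inter> T"
  have "x \<in> frontier T"
    using assms x unfolding frontier_T by (auto simp: seg_def open_segment_def)
  then have "x \<in> closure T"
    by (simp add: frontier_def)
  then have "B \<noteq> {}"
    unfolding B_def using r(1) r'(1) closure_approachable[of x T]
    by (auto simp: disjoint_iff dist_commute dest!: spec[of _ "min r r'"])
  then obtain y where y: "y \<in> B"
    by blast
  have "open B"
    unfolding B_def using open_T by blast
  then obtain e where e: "e > 0" "ball y e \<subseteq> B"
    using y open_contains_ball by blast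
  have line: "(z - x) \<bullet> normal E = 0" if "z \<in> B" for z
  proof -
    have "z \<in> closure T"
      using that closure_subset by (auto simp: B_def)
    then have "\<not> (z - x) \<bullet> normal E > 0" "\<not> (z - x) \<bullet> - normal E > 0"
      using that r r' unfolding B_def by auto
    then show ?thesis
      by simp
  qed
  have nn: "normal E \<bullet> normal E = 1"
    using normal_nz[OF edge_ne[OF assms]] .
  have z: "y + (e/2) *\<^sub>R normal E \<in> ball y e"
    using half_ball_ne(1)[OF e(1) nn] .
  have "(y + (e/2) *\<^sub>R normal E - x) \<bullet> normal E = (y - x) \<bullet> normal E + e/2"
    using nn by (simp add: inner_diff_left inner_add_left)
  then show False
    using line[OF y] line[of "y + (e/2) *\<^sub>R normal E"] z e by auto
qed

text \<open>The value \<open>0\<close> stands for a slit, which will turn out to be impossible.\<close>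

definition orient :: "edge \<Rightarrow> real" where
  "orient E = of_bool (side E (- normal E)) - of_bool (side E (normal E))"

text \<open>Moving along \<open>d\<close>, one passes from the side of \<open>- normal E\<close> to
  that of \<open>normal E\<close> or conversely, according to the sign of
  \<open>d \<bullet> normal E\<close>. At a slit both limits are 1 and the jump is 0, in accordance
  with \<open>orient\<close>.\<close>

lemma side_limits:
  assumes "E \<in> Es" "x \<in> open_segment (fst E) (snd E)" "d \<bullet> normal E \<noteq> 0"
  shows "\<exists>l r. eventually (\<lambda>s. indicator T (x + s *\<^sub>R d) = l) (at_left 0) \<and>
               eventually (\<lambda>s. indicator T (x + s *\<^sub>R d) = r) (at_right 0) \<and>
               l - r = sgn (d \<bullet> normal E) * orient E"
proof -
  have dir: "eventually (\<lambda>s. indicator T (x + s *\<^sub>R d) = (of_bool (side E m) :: real)) (at_right 0)"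
    if m: "m = normal E \<or> m = - normal E" and pos: "d \<bullet> m > 0" for m d
  proof -
    have "\<exists>r>0. \<forall>y\<in>ball x r. (y - x) \<bullet> m > 0 \<longrightarrow> indicator T y = (of_bool (side E m) :: real)"
    proof (cases "side E m")
      case True
      then have "inner_at m x"
        using assms(2) by (auto simp: side_def)
      then show ?thesis
        using True by (auto simp: inner_at_def)
    next
      case False
      then have "outer_at m x"
        using not_side assms(1,2) m by blast
      then obtain r where "r > 0" "\<forall>y\<in>ball x r. (y - x) \<bullet> m > 0 \<longrightarrow> y \<notin> closure T"
        unfolding outer_at_def by blast
      then have "\<forall>y\<in>ball x r. (y - x) \<bullet> m > 0 \<longrightarrow> indicator T y = (of_bool (side E m) :: real)"
        using False closure_subset[of T] by (simp add: indicator_def) blast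
      then show ?thesis
        using \<open>r > 0\<close> by blast
    qed
    then obtain r where r: "r > 0" "\<forall>y\<in>ball x r. (y - x) \<bullet> m > 0 \<longrightarrow> indicator T y = (of_bool (side E m) :: real)"
      by blast
    have "((\<lambda>s. x + s *\<^sub>R d) \<longlongrightarrow> x + 0 *\<^sub>R d) (at_right 0)"
      by (intro tendsto_intros)
    then have "eventually (\<lambda>s. x + s *\<^sub>R d \<in> ball x r) (at_right 0)"
      using r(1) topological_tendstoD[of _ "x + 0 *\<^sub>R d" _ "ball x r"] by auto
    then show ?thesis
      using eventually_at_right_less
      by eventually_elim (use r(2) pos in \<open>auto simp: zero_less_mult_iff\<close>)
  qed
  have left: "eventually (\<lambda>s. indicator T (x + s *\<^sub>R d) = (of_bool (side E m) :: real)) (at_left 0)"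
    if m: "m = normal E \<or> m = - normal E" and pos: "(-d) \<bullet> m > 0" for m
    using dir[OF that] unfolding at_left_minus[of "0::real"] eventually_filtermap by simp
  consider "d \<bullet> normal E > 0" | "d \<bullet> normal E < 0"
    using assms(3) by linarith
  then show ?thesis
  proof cases
    case 1
    then show ?thesis
      using dir[of "normal E" d] left[of "- normal E"]
      by (intro exI[of _ "of_bool (side E (- normal E))"] exI[of _ "of_bool (side E (normal E))"])
        (auto simp: orient_def)
  next
    case 2
    then show ?thesis
      using dir[of "- normal E" d] left[of "normal E"]
      by (intro exI[of _ "of_bool (side E (normal E))"] exI[of _ "of_bool (side E (- normal E))"])
        (auto simp: orient_def)
  qed
qed

end

section \<open>The divergence theorem on polygons\<close>

text \<open>Exact values on the two punctured sides instead of limits: the functions concerned are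
  step functions near every point considered, and the value at \<open>b\<close> itself is ignored
  because it carries no information at a jump.\<close>

definition lims :: "(real \<Rightarrow> real) \<Rightarrow> real \<Rightarrow> real \<Rightarrow> real \<Rightarrow> bool" where
  "lims f b l r \<longleftrightarrow> (\<exists>e>0. \<forall>s\<in>{0<..<e}. f (b - s) = l \<and> f (b + s) = r)"

lemma lims_add:
  assumes "lims f b l r" "lims g b l' r'"
  shows "lims (\<lambda>x. f x + g x) b (l + l') (r + r')"
proof -
  obtain e e' where "e > 0" "e' > 0" "\<forall>s\<in>{0<..<e}. f (b - s) = l \<and> f (b + s) = r"
    "\<forall>s\<in>{0<..<e'}. g (b - s) = l' \<and> g (b + s) = r'"
    using assms by (auto simp: lims_def)
  then show ?thesis
    unfolding lims_def by (intro exI[of _ "min e e'"]) auto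
qed

lemma lims_cmult: "lims f b l r \<Longrightarrow> lims (\<lambda>x. c * f x) b (c * l) (c * r)"
  by (auto simp: lims_def)

lemma lims_const: "lims (\<lambda>x. c) b c c"
  by (auto simp: lims_def intro!: exI[of _ 1])

lemma lims_sum:
  assumes "\<And>i. i \<in> I \<Longrightarrow> lims (f i) b (l i) (r i)"
  shows "lims (\<lambda>x. \<Sum>i\<in>I. f i x) b (\<Sum>i\<in>I. l i) (\<Sum>i\<in>I. r i)"
  using assms by (induction I rule: infinite_finite_induct) (auto simp: lims_const lims_add)

lemma lims_unique: "lims f b l r \<Longrightarrow> lims f b l' r' \<Longrightarrow> l = l' \<and> r = r'"
proof -
  assume "lims f b l r" "lims f b l' r'"
  then obtain e e' where "e > 0" "e' > 0" "\<forall>s\<in>{0<..<e}. f (b - s) = l \<and> f (b + s) = r"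
    "\<forall>s\<in>{0<..<e'}. f (b - s) = l' \<and> f (b + s) = r'"
    by (auto simp: lims_def)
  moreover obtain s where "0 < s" "s < e" "s < e'"
    using field_lbound_gt_zero[of e e'] \<open>e > 0\<close> \<open>e' > 0\<close> by auto
  ultimately show ?thesis
    by (metis greaterThanLessThan_iff)
qed

lemma lims_step: "lims (\<lambda>x. of_bool (x < c)) b (of_bool (b \<le> c)) (of_bool (b < c))"
proof -
  have "lims (\<lambda>x. of_bool (x < c)) b (of_bool (b \<le> c)) (of_bool (b < c))" if "e = (if b = c then 1 else \<bar>b - c\<bar>)" for e
    unfolding lims_def by (rule exI[of _ e]) (auto simp: that)
  then show ?thesis
    by blast
qed

lemma lims_of_open:
  fixes x d :: "'a::real_normed_vector"
  assumes "open U" "x + b *\<^sub>R d \<in> U" "\<And>y. y \<in> U \<Longrightarrow> f y = c"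
  shows "lims (\<lambda>b. f (x + b *\<^sub>R d)) b c c"
proof -
  have "((\<lambda>s. x + s *\<^sub>R d) \<longlongrightarrow> x + b *\<^sub>R d) (at b)"
    by (intro tendsto_intros)
  then have "eventually (\<lambda>s. x + s *\<^sub>R d \<in> U) (at b)"
    using assms topological_tendstoD by blast
  then obtain e where "e > 0" "\<And>s. s \<noteq> b \<Longrightarrow> dist s b < e \<Longrightarrow> x + s *\<^sub>R d \<in> U"
    unfolding eventually_at by auto
  then show ?thesis
    unfolding lims_def using assms(3) by (intro exI[of _ e]) (auto simp: dist_norm)
qed

text \<open>Where left and right values agree everywhere, the common value is locally constant in
  the point, hence constant on the connected real line; far to the right it is 0. The function
  itself may still differ from it at isolated points.\<close>

lemma zero_of_lims:
  assumes l: "\<And>b. \<exists>c. lims d b c c" and M: "\<And>b. b > M \<Longrightarrow> d b = 0" and x: "lims d x c c"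
  shows "c = 0"
proof -
  define D where "D b = (SOME c. lims d b c c)" for b
  have D: "lims d b (D b) (D b)" for b
    unfolding D_def using someI_ex[OF l] .
  have "\<forall>b\<in>UNIV. eventually (\<lambda>x. D b = D x) (at b within UNIV)"
  proof
    fix b
    obtain e where e: "e > 0" "\<forall>s\<in>{0<..<e}. d (b - s) = D b \<and> d (b + s) = D b"
      using D[of b] by (auto simp: lims_def)
    have dD: "d y = D b" if "y \<noteq> b" "\<bar>y - b\<bar> < e" for y
      using e(2)[rule_format, of "\<bar>y - b\<bar>"] that by (auto simp: abs_if split: if_splits)
    have "D x = D b" if "x \<noteq> b" "\<bar>x - b\<bar> < e" for x
    proof -
      have "lims d x (D b) (D b)"
        unfolding lims_def
      proof (intro exI conjI ballI)
        show "min \<bar>x - b\<bar> (e - \<bar>x - b\<bar>) > 0"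
          using that by auto
        fix s assume "s \<in> {0<..<min \<bar>x - b\<bar> (e - \<bar>x - b\<bar>)}"
        then show "d (x - s) = D b" "d (x + s) = D b"
          by (intro dD; auto simp: abs_if split: if_splits)+
      qed
      then show ?thesis
        using lims_unique D by blast
    qed
    then show "eventually (\<lambda>x. D b = D x) (at b within UNIV)"
      using e(1) unfolding eventually_at by (intro exI[of _ e]) (auto simp: dist_real_def)
  qed
  then have "D x = D (M + 1)"
    using connected_local_const[of UNIV x "M + 1" D] by auto
  moreover have "lims d (M + 1) 0 0"
    unfolding lims_def by (intro exI[of _ 1]) (auto simp: M)
  ultimately show ?thesis
    using lims_unique x D by metis
qed

section \<open>The domain on a line\<close>

context polygon
begin

text \<open>A line that meets an edge and is parallel to it contains the endpoints of the edge.
  Avoiding vertices therefore makes every intersection transversal, interior to the edge and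
  unique.\<close>

lemma edge_line:
  assumes "E \<in> Es" "\<And>b. p + b *\<^sub>R e \<notin> verts Es" "p + b *\<^sub>R e \<in> seg E" "e \<noteq> 0"
  shows "p + b *\<^sub>R e \<in> open_segment (fst E) (snd E)" "e \<bullet> normal E \<noteq> 0"
    "p + b' *\<^sub>R e \<in> seg E \<Longrightarrow> b' = b"
proof -
  have V: "fst E \<in> verts Es" "snd E \<in> verts Es"
    using assms(1) by (auto simp: verts_def ends_def)
  show o: "p + b *\<^sub>R e \<in> open_segment (fst E) (snd E)"
    using assms(2)[of b] assms(3) V by (auto simp: seg_def open_segment_def)
  then obtain s where s: "p + b *\<^sub>R e = gam E s" "0 < s" "s < 1"
    using open_seg_gam[OF edge_ne[OF assms(1)]] by auto
  show n: "e \<bullet> normal E \<noteq> 0"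
  proof
    assume 0: "e \<bullet> normal E = 0"
    let ?t = "tangent E"
    have "e = (e \<bullet> ?t) *\<^sub>R ?t"
    proof -
      have "e$1 * ?t$2 = e$2 * ?t$1"
        using 0 by (simp add: inner_2 normal_nth)
      then show ?thesis
        using tangent_norm[OF edge_ne[OF assms(1)]]
        by (simp add: vec_eq_iff forall_2 inner_2 power2_eq_square) algebra
    qed
    then have "e = ((e \<bullet> ?t) / len E) *\<^sub>R (snd E - fst E)"
      using len_pos[OF edge_ne[OF assms(1)]] by (simp flip: tangent_len)
    then obtain c where c: "e = c *\<^sub>R (snd E - fst E)"
      by blast
    then have "c \<noteq> 0"
      using assms(4) by auto
    then have "s *\<^sub>R (snd E - fst E) = (s / c) *\<^sub>R e"
      by (simp add: c)
    then have "fst E = p + (b - s / c) *\<^sub>R e"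
      using s(1) by (simp add: gam_def algebra_simps)
    then show False
      using assms(2) V by metis
  qed
  assume "p + b' *\<^sub>R e \<in> seg E"
  then obtain s' where "p + b' *\<^sub>R e = gam E s'"
    by (auto simp: seg_gam)
  then have "((p + b' *\<^sub>R e) - (p + b *\<^sub>R e)) \<bullet> normal E = 0"
    using s gam_normal[of E s' s] by simp
  then have "(b' - b) * (e \<bullet> normal E) = 0"
    by (simp add: algebra_simps)
  then show "b' = b"
    using n by simp
qed

text \<open>Both sides have the same jump at each crossing and are locally constant elsewhere, so
  their difference has no jumps; it vanishes beyond all crossings because \<open>T\<close> is
  bounded.\<close>

lemma indicator_on_line:
  assumes nv: "\<And>b. p + b *\<^sub>R e \<notin> verts Es" and e: "e \<noteq> 0"
    and X: "X = {E \<in> Es. \<exists>b. p + b *\<^sub>R e \<in> seg E}" and bE: "\<And>E. E \<in> X \<Longrightarrow> p + bE E *\<^sub>R e \<in> seg E"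
    and b: "p + b *\<^sub>R e \<notin> frontier T"
  shows "indicator T (p + b *\<^sub>R e) = (\<Sum>E\<in>X. sgn (e \<bullet> normal E) * orient E * of_bool (b < bE E))"
proof -
  have finX: "finite X"
    using finite_Es X by simp
  define d where "d b = indicator T (p + b *\<^sub>R e) + (\<Sum>E\<in>X. - (sgn (e \<bullet> normal E) * orient E) * of_bool (b < bE E))" for b
  have off: "lims d b (d b) (d b)" if "p + b *\<^sub>R e \<notin> frontier T" for b
  proof -
    have "lims (\<lambda>b. indicator T (p + b *\<^sub>R e)) b (indicator T (p + b *\<^sub>R e)) (indicator T (p + b *\<^sub>R e))"
    proof (cases "p + b *\<^sub>R e \<in> T")
      case True
      show ?thesis
        by (rule lims_of_open[OF open_T True]) (use True in auto)
    next
      case False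
      then have 1: "p + b *\<^sub>R e \<in> - closure T"
        using that open_T by (auto simp: frontier_def interior_open)
      show ?thesis
        by (rule lims_of_open[OF _ 1]) (use False closure_subset[of T] in \<open>auto simp: indicator_def\<close>)
    qed
    moreover have "lims (\<lambda>x. of_bool (x < bE E)) b (of_bool (b < bE E)) (of_bool (b < bE E))" if "E \<in> X" for E
    proof -
      have "b \<noteq> bE E"
        using bE[OF that] \<open>p + b *\<^sub>R e \<notin> frontier T\<close> that X unfolding frontier_T by auto
      then show ?thesis
        using lims_step[of "bE E" b] by (auto simp: order_le_less)
    qed
    ultimately show ?thesis
      unfolding d_def by (intro lims_add lims_sum lims_cmult) auto
  qed
  have all: "\<exists>c. lims d b c c" for b
  proof (cases "p + b *\<^sub>R e \<in> frontier T")
    case False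
    then show ?thesis
      using off by blast
  next
    case True
    then obtain E where E: "E \<in> Es" "p + b *\<^sub>R e \<in> seg E"
      unfolding frontier_T by auto
    then have EX: "E \<in> X"
      using X by auto
    have bb: "b = bE E'" if "E' \<in> X" "E' = E" for E'
      using edge_line(3)[OF E(1) nv bE e E(2)] EX that by blast
    \<comment> \<open>Two edges through the same point share it as a vertex, but the line avoids
      vertices: exactly one summand jumps at \<open>b\<close>.\<close>
    have nb: "b \<noteq> bE E'" if "E' \<in> X" "E' \<noteq> E" for E'
    proof
      assume "b = bE E'"
      then have "p + b *\<^sub>R e \<in> seg E'"
        using bE that by simp
      then have "p + b *\<^sub>R e \<in> ends E"
        using seg_Int[of E E'] E that X by auto
      then show False
        using nv E(1) by (auto simp: verts_def)
    qed
    obtain l r where lr: "eventually (\<lambda>s. indicator T ((p + b *\<^sub>R e) + s *\<^sub>R e) = l) (at_left 0)"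
       "eventually (\<lambda>s. indicator T ((p + b *\<^sub>R e) + s *\<^sub>R e) = r) (at_right 0)"
       "l - r = sgn (e \<bullet> normal E) * orient E"
      using side_limits[OF E(1) edge_line(1,2)[OF E(1) nv E(2) e]] by blast
    obtain u where u: "u < 0" "\<And>s. u < s \<Longrightarrow> s < 0 \<Longrightarrow> indicator T ((p + b *\<^sub>R e) + s *\<^sub>R e) = l"
      using lr(1) unfolding eventually_at_left_field by auto
    obtain v where v: "v > 0" "\<And>s. 0 < s \<Longrightarrow> s < v \<Longrightarrow> indicator T ((p + b *\<^sub>R e) + s *\<^sub>R e) = r"
      using lr(2) unfolding eventually_at_right_field by auto
    have "lims (\<lambda>b. indicator T (p + b *\<^sub>R e)) b l r"
      unfolding lims_def
    proof (intro exI conjI ballI)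
      show "min (- u) v > 0"
        using u v by simp
      fix s assume s: "s \<in> {0<..<min (- u) v}"
      have "p + (b - s) *\<^sub>R e = (p + b *\<^sub>R e) + (- s) *\<^sub>R e" "p + (b + s) *\<^sub>R e = (p + b *\<^sub>R e) + s *\<^sub>R e"
        by (simp_all add: algebra_simps)
      then show "indicator T (p + (b - s) *\<^sub>R e) = l" "indicator T (p + (b + s) *\<^sub>R e) = r"
        using u(2)[of "- s"] v(2)[of s] s by (auto simp: algebra_simps)
    qed
    then have *: "lims d b (l + (\<Sum>E\<in>X. - (sgn (e \<bullet> normal E) * orient E) * of_bool (b \<le> bE E)))
        (r + (\<Sum>E\<in>X. - (sgn (e \<bullet> normal E) * orient E) * of_bool (b < bE E)))"
      unfolding d_def by (intro lims_add lims_sum lims_cmult lims_step)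
    have "(\<Sum>E\<in>X. - (sgn (e \<bullet> normal E) * orient E) * of_bool (b \<le> bE E))
        = (\<Sum>E'\<in>X. - (sgn (e \<bullet> normal E') * orient E') * of_bool (b < bE E') + (if E' = E then - (l - r) else 0))"
      using lr(3) by (intro sum.cong refl) (auto simp: nb bb order_le_less dest: nb)
    also have "\<dots> = (\<Sum>E\<in>X. - (sgn (e \<bullet> normal E) * orient E) * of_bool (b < bE E)) - (l - r)"
      using EX finX by (simp add: sum.distrib sum_subtractf sum_negf)
    finally show ?thesis
      using * by (metis (no_types, lifting) add_diff_cancel_left' add_diff_eq diff_add_cancel)
  qed
  obtain M where M: "\<And>x. x \<in> T \<Longrightarrow> norm x \<le> M"
    using bounded_T bounded_iff by blast
  define M' where "M' = Max (insert ((M + norm p) / norm e) (bE ` X))"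
  have "d b = 0" if "b > M'" for b
  proof -
    have bb: "b > (M + norm p) / norm e" "\<And>E. E \<in> X \<Longrightarrow> b > bE E"
      using that finX by (auto simp: M'_def)
    have "norm (b *\<^sub>R e) > M + norm p"
    proof -
      have "M + norm p < b * norm e"
        using bb(1) e by (simp add: pos_divide_less_eq)
      also have "\<dots> \<le> \<bar>b\<bar> * norm e"
        by (intro mult_right_mono) auto
      finally show ?thesis
        by simp
    qed
    then have "norm (p + b *\<^sub>R e) > M"
      using norm_triangle_ineq4[of "p + b *\<^sub>R e" p] by simp
    then have "p + b *\<^sub>R e \<notin> T"
      using M[of "p + b *\<^sub>R e"] by auto
    moreover have "\<not> b < bE E" if "E \<in> X" for E
      using bb(2)[OF that] by simp
    ultimately show ?thesis
      by (simp add: d_def)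
  qed
  then have "d b = 0"
    using zero_of_lims[of d M', OF all] off[OF b] by blast
  then show ?thesis
    by (simp add: d_def sum_negf)
qed

text \<open>The indicator is a signed sum of half-line indicators. Cutting them off at a point
  \<open>m\<close> before \<open>T\<close> and applying the fundamental theorem gives the values of
  \<open>F\<close> at the crossings, while the terms with \<open>F m\<close> cancel since the jumps
  add up to 0.\<close>

lemma line_integral:
  assumes nv: "\<And>b. p + b *\<^sub>R e \<notin> verts Es" and e: "e \<noteq> 0"
    and X: "X = {E \<in> Es. \<exists>b. p + b *\<^sub>R e \<in> seg E}" and bE: "\<And>E. E \<in> X \<Longrightarrow> p + bE E *\<^sub>R e \<in> seg E"
    and F: "\<And>b. (F has_field_derivative f b) (at b)" and f: "continuous_on UNIV f"
  shows "(LINT b|lborel. indicator T (p + b *\<^sub>R e) * f b) = (\<Sum>E\<in>X. sgn (e \<bullet> normal E) * orient E * F (bE E))"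
proof -
  have finX: "finite X"
    using finite_Es X by simp
  have "bounded (closure T)"
    using bounded_T by (rule bounded_closure)
  then obtain M where M: "\<And>x. x \<in> closure T \<Longrightarrow> norm x \<le> M"
    using bounded_iff by blast
  define m where "m = - (\<bar>M\<bar> + norm p + 1) / norm e"
  have far: "p + b *\<^sub>R e \<notin> closure T" if "b \<le> m" for b
  proof
    assume "p + b *\<^sub>R e \<in> closure T"
    then have "norm (p + b *\<^sub>R e) \<le> M"
      by (rule M)
    then have "norm (b *\<^sub>R e) \<le> M + norm p"
      using norm_triangle_ineq4[of "p + b *\<^sub>R e" p] by simp
    moreover have "norm (b *\<^sub>R e) \<ge> \<bar>M\<bar> + norm p + 1"
    proof -
      have "\<bar>M\<bar> + norm p + 1 \<le> - b * norm e"
        using that e by (simp add: m_def field_simps)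
      also have "\<dots> \<le> \<bar>b\<bar> * norm e"
        by (intro mult_right_mono) auto
      finally show ?thesis
        by simp
    qed
    ultimately show False
      by simp
  qed
  have mb: "m < bE E" if "E \<in> X" for E
  proof (rule ccontr)
    assume "\<not> m < bE E"
    then have "p + bE E *\<^sub>R e \<notin> closure T"
      using far by simp
    moreover have "p + bE E *\<^sub>R e \<in> frontier T"
      using bE[OF that] that X unfolding frontier_T by auto
    ultimately show False
      by (simp add: frontier_def)
  qed
  let ?\<sigma> = "\<lambda>E. sgn (e \<bullet> normal E) * orient E"
  have line: "indicator T (p + b *\<^sub>R e) = (\<Sum>E\<in>X. sgn (e \<bullet> normal E) * orient E * of_bool (b < bE E))"
    if "p + b *\<^sub>R e \<notin> frontier T" for b
    using indicator_on_line[OF nv e X _ that, of bE] bE by blast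
  \<comment> \<open>The jump formula evaluated at \<open>m\<close>, before the line has reached
    \<open>T\<close>: all crossings lie ahead.\<close>
  have "0 = (\<Sum>E\<in>X. ?\<sigma> E * of_bool (m < bE E))"
  proof -
    have "p + m *\<^sub>R e \<notin> T" "p + m *\<^sub>R e \<notin> frontier T"
      using far[of m] closure_subset[of T] by (auto simp: frontier_def)
    then show ?thesis
      using line[of m] by simp
  qed
  also have "\<dots> = (\<Sum>E\<in>X. ?\<sigma> E)"
    using mb by (intro sum.cong) auto
  finally have \<sigma>0: "(\<Sum>E\<in>X. ?\<sigma> E) = 0" ..
  have FTC: "has_bochner_integral lborel (\<lambda>x. indicator {m..bE E} x *\<^sub>R f x) (F (bE E) - F m)" if "E \<in> X" for E
    using mb[OF that] F f
    by (intro has_bochner_integral_FTC_Icc)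
       (auto intro: has_field_derivative_at_within continuous_on_subset simp flip: has_real_derivative_iff_has_vector_derivative)
  have "has_bochner_integral lborel (\<lambda>b. \<Sum>E\<in>X. ?\<sigma> E * (indicator {m..bE E} b *\<^sub>R f b)) (\<Sum>E\<in>X. ?\<sigma> E * (F (bE E) - F m))"
    by (intro has_bochner_integral_sum has_bochner_integral_mult_right FTC)
  then have "(LINT b|lborel. (\<Sum>E\<in>X. ?\<sigma> E * (indicator {m..bE E} b *\<^sub>R f b))) = (\<Sum>E\<in>X. ?\<sigma> E * (F (bE E) - F m))"
    by (rule has_bochner_integral_integral_eq)
  also have "\<dots> = (\<Sum>E\<in>X. ?\<sigma> E * F (bE E)) - (\<Sum>E\<in>X. ?\<sigma> E) * F m"
    by (simp add: right_diff_distrib sum_subtractf sum_distrib_right)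
  finally have 1: "(LINT b|lborel. (\<Sum>E\<in>X. ?\<sigma> E * (indicator {m..bE E} b *\<^sub>R f b))) = (\<Sum>E\<in>X. ?\<sigma> E * F (bE E))"
    using \<sigma>0 by simp
  have "(LINT b|lborel. indicator T (p + b *\<^sub>R e) * f b) = (LINT b|lborel. (\<Sum>E\<in>X. ?\<sigma> E * (indicator {m..bE E} b *\<^sub>R f b)))"
  proof (rule integral_cong_AE)
    have fb: "f \<in> borel_measurable lborel"
      using f by (simp add: borel_measurable_continuous_onI)
    have "open ((\<lambda>b. p + b *\<^sub>R e) -` T)"
      using open_T by (intro open_vimage) (auto intro!: continuous_intros)
    then have "(\<lambda>b. indicator ((\<lambda>b. p + b *\<^sub>R e) -` T) b :: real) \<in> borel_measurable borel"
      by (intro borel_measurable_indicator) simp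
    then have "(\<lambda>b. indicator T (p + b *\<^sub>R e) :: real) \<in> borel_measurable borel"
      by (simp add: indicator_def)
    then show "(\<lambda>b. indicator T (p + b *\<^sub>R e) * f b) \<in> borel_measurable lborel"
      using fb by simp
    show "(\<lambda>b. \<Sum>E\<in>X. ?\<sigma> E * (indicator {m..bE E} b *\<^sub>R f b)) \<in> borel_measurable lborel"
      using fb by measurable
    \<comment> \<open>The jump formula is available off the frontier, that is, away from finitely
      many crossings.\<close>
    have "AE b in lborel. b \<notin> bE ` X"
      using finX by (intro AE_not_in finite_imp_null_set_lborel) auto
    then show "AE b in lborel. indicator T (p + b *\<^sub>R e) * f b = (\<Sum>E\<in>X. ?\<sigma> E * (indicator {m..bE E} b *\<^sub>R f b))"
    proof (rule AE_mp, intro AE_I2 impI)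
      fix b assume b: "b \<notin> bE ` X"
      have "p + b *\<^sub>R e \<notin> frontier T"
      proof
        assume "p + b *\<^sub>R e \<in> frontier T"
        then obtain E where "E \<in> Es" "p + b *\<^sub>R e \<in> seg E"
          unfolding frontier_T by auto
        moreover then have "E \<in> X"
          using X by auto
        ultimately have "bE E = b"
          using edge_line(3)[OF _ nv _ e bE] by blast
        then show False
          using b \<open>E \<in> X\<close> by auto
      qed
      note l = line[OF this]
      show "indicator T (p + b *\<^sub>R e) * f b = (\<Sum>E\<in>X. ?\<sigma> E * (indicator {m..bE E} b *\<^sub>R f b))"
      proof (cases "b < m")
        case True
        then show ?thesis
          using far[of b] closure_subset[of T] by (auto simp: indicator_def intro!: sum.neutral[symmetric])
      next
        case False
        have "(\<Sum>E\<in>X. ?\<sigma> E * of_bool (b < bE E)) * f b = (\<Sum>E\<in>X. ?\<sigma> E * (indicator {m..bE E} b *\<^sub>R f b))"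
          unfolding sum_distrib_right
          using False b by (intro sum.cong) (auto simp: indicator_def)
        then show ?thesis
          using l by simp
      qed
    qed
  qed
  then show ?thesis
    using 1 by simp
qed

end

section \<open>Fubini in the plane and derivatives along lines\<close>

lemma lborel_axes:
  assumes "i \<noteq> (j::2)"
  shows "(lborel :: (real^2) measure) = distr (lborel :: (real \<times> real) measure) borel (\<lambda>(a,b). a *\<^sub>R axis i 1 + b *\<^sub>R axis j 1)"
proof (rule lborel_eqI)
  let ?\<phi> = "\<lambda>(a,b). a *\<^sub>R axis i 1 + b *\<^sub>R axis j 1 :: real^2"
  have comp: "?\<phi> (a,b) $ i = a" "?\<phi> (a,b) $ j = b" for a b
    using assms by (auto simp: axis_def)
  have "x \<in> {i, j}" for x
    using assms exhaust_2[of i] exhaust_2[of j] exhaust_2[of x] by auto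
  then have ij: "UNIV = {i,j}"
    by auto
  have m: "?\<phi> \<in> borel_measurable borel"
    by (intro borel_measurable_continuous_onI) (auto simp: case_prod_unfold intro!: continuous_intros)
  have Basis: "(Basis :: (real^2) set) = {axis i 1, axis j 1}"
    unfolding Basis_vec_def using ij by auto
  have ne: "axis i 1 \<noteq> (axis j 1 :: real^2)"
    using assms by (simp add: axis_eq_axis)
  fix l u :: "real^2" assume lu: "\<And>b. b \<in> Basis \<Longrightarrow> l \<bullet> b \<le> u \<bullet> b"
  have le: "l$i \<le> u$i" "l$j \<le> u$j"
    using lu[of "axis i 1"] lu[of "axis j 1"] Basis by (auto simp: inner_axis)
  have "?\<phi> -` box l u = box (l$i, l$j) (u$i, u$j)"
  proof (intro set_eqI)
    fix z :: "real \<times> real"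
    obtain a b where z: "z = (a,b)"
      by force
    have "z \<in> ?\<phi> -` box l u \<longleftrightarrow> (\<forall>k\<in>{i,j}. l $ k < ?\<phi> (a,b) $ k \<and> ?\<phi> (a,b) $ k < u $ k)"
      unfolding z vimage_eq mem_box_cart ij[symmetric] by simp
    also have "\<dots> \<longleftrightarrow> z \<in> box (l$i, l$j) (u$i, u$j)"
      using comp[of a b] by (auto simp: z box_def Basis_prod_def)
    finally show "z \<in> ?\<phi> -` box l u \<longleftrightarrow> z \<in> box (l$i, l$j) (u$i, u$j)" .
  qed
  then have "emeasure (distr lborel borel ?\<phi>) (box l u) = emeasure lborel (box (l$i, l$j) (u$i, u$j))"
    using m by (subst emeasure_distr) auto
  also have "\<dots> = (\<Prod>b\<in>Basis. ((u$i, u$j) - (l$i, l$j)) \<bullet> b)"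
    using le by (intro emeasure_lborel_box) (auto simp: Basis_prod_def)
  also have "\<dots> = (\<Prod>b\<in>Basis. (u - l) \<bullet> b)"
    unfolding Basis using ne by (simp add: Basis_prod_def inner_axis image_Un prod.union_disjoint mult.commute)
  finally show "emeasure (distr lborel borel ?\<phi>) (box l u) = (\<Prod>b\<in>Basis. (u - l) \<bullet> b)" .
qed simp

text \<open>The order of the axes is a parameter, since the divergence theorem for
  \<open>partial j\<close> integrates in direction \<open>j\<close> first. The second part supplies
  the measurability of the inner integral, which is then changed on a null set.\<close>

lemma integral_axes:
  fixes g :: "real^2 \<Rightarrow> real"
  assumes "i \<noteq> (j::2)" "integrable lborel g"
  shows "(LINT x|lborel. g x) = (LINT a|lborel. LINT b|lborel. g (a *\<^sub>R axis i 1 + b *\<^sub>R axis j 1))"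
    and "integrable lborel (\<lambda>a. LINT b|lborel. g (a *\<^sub>R axis i 1 + b *\<^sub>R axis j 1))"
proof -
  let ?\<phi> = "\<lambda>(a,b). a *\<^sub>R axis i 1 + b *\<^sub>R axis j 1 :: real^2"
  have m: "?\<phi> \<in> borel_measurable borel"
    by (intro borel_measurable_continuous_onI) (auto simp: case_prod_unfold intro!: continuous_intros)
  then have m': "?\<phi> \<in> measurable (lborel :: (real \<times> real) measure) borel"
    by simp
  have gm: "g \<in> borel_measurable borel"
    using borel_measurable_integrable[OF assms(2)] by simp
  have "integrable (lborel :: (real \<times> real) measure) (\<lambda>z. g (?\<phi> z))"
    using assms(2) integrable_distr_eq[OF m' gm] lborel_axes[OF assms(1)] by simp
  then have int: "integrable (lborel \<Otimes>\<^sub>M lborel) (\<lambda>z. g (?\<phi> z))"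
    by (simp add: lborel_prod)
  have "(LINT x|lborel. g x) = (LINT z|lborel. g (?\<phi> z))"
    by (subst lborel_axes[OF assms(1)]) (rule integral_distr[OF m' gm])
  also have "\<dots> = (LINT z|(lborel \<Otimes>\<^sub>M lborel). g (?\<phi> z))"
    by (simp add: lborel_prod)
  also have "\<dots> = (LINT a|lborel. LINT b|lborel. g (?\<phi> (a, b)))"
    using lborel_pair.integral_fst'[OF int] by simp
  finally show "(LINT x|lborel. g x) = (LINT a|lborel. LINT b|lborel. g (a *\<^sub>R axis i 1 + b *\<^sub>R axis j 1))"
    by simp
  show "integrable lborel (\<lambda>a. LINT b|lborel. g (a *\<^sub>R axis i 1 + b *\<^sub>R axis j 1))"
    using lborel_pair.integrable_fst'[OF int] by simp
qed

lemma bipoly_deriv_line: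
  assumes "F \<in> bipoly m"
  shows "((\<lambda>s. F (p + s *\<^sub>R d)) has_field_derivative
    (d$1 * partial 1 F (p + s *\<^sub>R d) + d$2 * partial 2 F (p + s *\<^sub>R d))) (at s)"
proof -
  have "((\<lambda>s. p + s *\<^sub>R d) has_derivative (\<lambda>h. h *\<^sub>R d)) (at s)"
    by (auto intro!: derivative_eq_intros)
  from has_derivative_compose[OF this has_derivative_partial[OF bipoly_differentiable[OF assms]]]
  show ?thesis
    unfolding has_field_derivative_def
    by (rule has_derivative_eq_rhs) (simp add: fun_eq_iff algebra_simps)
qed

lemma bipoly_deriv_axis:
  assumes "F \<in> bipoly m"
  shows "((\<lambda>s. F (p + s *\<^sub>R axis j 1)) has_field_derivative partial j F (p + s *\<^sub>R axis j 1)) (at s)"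
  using bipoly_deriv_line[OF assms, of p "axis j 1" s] exhaust_2[of j] by (auto simp: axis_def)

context polygon
begin

lemma integrable_T:
  assumes "continuous_on UNIV (f :: real^2 \<Rightarrow> real)"
  shows "set_integrable lborel T f"
proof (rule set_integrable_subset)
  have "compact (closure T)"
    using bounded_T by (simp add: compact_closure)
  then show "set_integrable lborel (closure T) f"
    unfolding set_integrable_def
    by (rule borel_integrable_compact) (rule continuous_on_subset[OF assms], simp)
  show "T \<in> sets lborel"
    using open_T by simp
qed (rule closure_subset)

text \<open>On almost every line in direction \<open>j\<close> the inner integral is a signed sum of
  values of \<open>F\<close> on the edges. The substitution from the coordinate \<open>a\<close> to
  the edge parameter has Jacobian \<open>len E * \<bar>normal E $ j\<bar>\<close>; together with the
  sign of the crossing it yields the factor \<open>normal E $ j\<close> and the length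
  element.\<close>

lemma divergence:
  assumes F: "F \<in> bipoly m"
  shows "int_T T (partial j F) = (\<Sum>E\<in>Es. orient E * normal E $ j * int_E E F)"
proof -
  have "(if j = 1 then 2 else 1) \<noteq> j"
    by simp
  then obtain i :: 2 where ij: "i \<noteq> j"
    by blast
  let ?f = "partial j F"
  let ?\<sigma> = "\<lambda>E. sgn (axis j 1 \<bullet> normal E) * orient E"
  let ?c = "\<lambda>E. snd E $ i - fst E $ i"
  \<comment> \<open>If the edge is parallel to direction \<open>j\<close>, this quotient is 0 by the
    convention on division; its term then vanishes because \<open>normal E $ j = 0\<close>.\<close>
  let ?s = "\<lambda>E a. (a - fst E $ i) / ?c E"
  let ?h = "\<lambda>E a. indicator {0..1} (?s E a) * F (gam E (?s E a))"
  let ?L = "\<lambda>a b. a *\<^sub>R axis i 1 + b *\<^sub>R axis j 1 :: real^2"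
  have f: "continuous_on S ?f" for S
    using bipoly_continuous[OF partial_bipoly[OF F]] .
  have int: "integrable lborel (\<lambda>x. indicator T x * ?f x)"
    using integrable_T[OF f] by (simp add: set_integrable_def)
  have Lij: "?L a b $ i = a" "?L a b $ j = b" for a b
    using ij by (auto simp: axis_def)
  have vec_ij: "x = y \<longleftrightarrow> x$i = y$i \<and> x$j = y$j" for x y :: "real^2"
    using ij exhaust_2[of i] exhaust_2[of j] by (auto simp: vec_eq_iff forall_2)
  \<comment> \<open>Lines through vertices are excluded; their coordinates form a finite, hence null
    set.\<close>
  define A where "A = (\<lambda>V. V$i) ` verts Es"
  have finA: "finite A"
    using finite_verts by (simp add: A_def)
  have inner: "(LINT b|lborel. indicator T (?L a b) * ?f (?L a b)) = (\<Sum>E\<in>Es. ?\<sigma> E * ?h E a)" if a: "a \<notin> A" for a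
  proof -
    define X where "X = {E \<in> Es. \<exists>b. ?L a b \<in> seg E}"
    define bE where "bE E = gam E (?s E a) $ j" for E
    have nv: "?L a b \<notin> verts Es" for b
      using a Lij(1)[of a b] unfolding A_def by (metis image_eqI)
    have ends: "a \<noteq> fst E $ i" "a \<noteq> snd E $ i" if "E \<in> Es" for E
      using that a by (auto simp: A_def verts_def ends_def)
    have X1: "?c E \<noteq> 0 \<and> ?s E a \<in> {0..1}" if E: "E \<in> X" for E
    proof -
      obtain b s where s: "?L a b = gam E s" "s \<in> {0..1}"
        using E by (auto simp: X_def seg_gam)
      then have "gam E s $ i = a"
        using Lij(1)[of a b] by simp
      then have "a = fst E $ i + s * ?c E"
        by (simp add: gam_def)
      then show ?thesis
        using ends[of E] E s(2) by (auto simp: X_def)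
    qed
    have gamL: "gam E (?s E a) = ?L a (bE E)" if "?c E \<noteq> 0" for E
      unfolding vec_ij Lij using that by (simp add: bE_def gam_def)
    have X2: "E \<in> X" if "E \<in> Es" "?c E \<noteq> 0" "?s E a \<in> {0..1}" for E
      using gamL[OF that(2)] that(1,3) unfolding X_def seg_gam by (metis (mono_tags, lifting) image_eqI mem_Collect_eq)
    have bE: "?L a (bE E) \<in> seg E" if "E \<in> X" for E
      using X1[OF that] gamL[of E] unfolding seg_gam by (metis image_eqI)
    have axis_ne: "axis j 1 \<noteq> (0 :: real^2)"
      by (simp add: axis_eq_0_iff)
    have "continuous_on UNIV (\<lambda>b. ?f (?L a b))"
      by (rule continuous_on_compose2[OF f[of UNIV]]) (auto intro!: continuous_intros)
    then have "(LINT b|lborel. indicator T (?L a b) * ?f (?L a b)) = (\<Sum>E\<in>X. ?\<sigma> E * F (?L a (bE E)))"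
      using nv axis_ne X_def bE bipoly_deriv_axis[OF F]
      by (intro line_integral[where F = "\<lambda>b. F (?L a b)"]) auto
    also have "\<dots> = (\<Sum>E\<in>X. ?\<sigma> E * ?h E a)"
      using X1 gamL by (intro sum.cong) auto
    also have "\<dots> = (\<Sum>E\<in>Es. ?\<sigma> E * ?h E a)"
    proof (rule sum.mono_neutral_left)
      show "\<forall>E\<in>Es - X. ?\<sigma> E * ?h E a = 0"
      proof
        fix E assume E: "E \<in> Es - X"
        show "?\<sigma> E * ?h E a = 0"
        proof (cases "?c E = 0")
          case True
          have "tangent E $ i = 0"
            using True by (simp add: tangent_def)
          then have "normal E $ j = 0"
            using ij exhaust_2[of i] exhaust_2[of j] by (auto simp: normal_nth)
          then show ?thesis
            by (simp add: inner_axis inner_commute)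
        next
          case False
          then have "?s E a \<notin> {0..1}"
            using X2 E by blast
          then show ?thesis
            by simp
        qed
      qed
    qed (auto simp: finite_Es X_def)
    finally show ?thesis .
  qed
  have edge: "has_bochner_integral lborel (\<lambda>a. ?\<sigma> E * ?h E a) (orient E * normal E $ j * int_E E F)" if E: "E \<in> Es" for E
  proof -
    have t: "?c E = len E * tangent E $ i"
      using tangent_len[of E] by (metis vector_minus_component vector_scaleR_component real_scaleR_def)
    have n: "\<bar>tangent E $ i\<bar> = \<bar>normal E $ j\<bar>"
      using ij exhaust_2[of i] exhaust_2[of j] by (auto simp: normal_nth)
    have ax: "axis j 1 \<bullet> normal E = normal E $ j"
      by (simp add: inner_axis inner_commute)
    show ?thesis
    proof (cases "?c E = 0")
      case True
      then have "normal E $ j = 0"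
        using t n len_pos[OF edge_ne[OF E]] by simp
      then show ?thesis
        using ax by (simp add: has_bochner_integral_zero)
    next
      case False
      let ?g = "\<lambda>s. indicator {0..1} s *\<^sub>R F (gam E s)"
      have "continuous_on {0..1} (\<lambda>s. F (gam E s))"
        by (rule continuous_on_compose2[OF bipoly_continuous[OF F, of UNIV]])
           (auto simp: gam_def intro!: continuous_intros)
      then have g: "integrable lborel ?g"
        by (intro borel_integrable_compact) auto
      have i1: "(LINT a|lborel. ?h E a) = \<bar>?c E\<bar> * (LINT s|lborel. ?g s)"
        using lborel_integral_real_affine[OF False, of "?h E" "fst E $ i"] False by simp
      have "integrable lborel (\<lambda>x. ?h E (fst E $ i + ?c E * x))"
        using g False by simp
      then have "integrable lborel (?h E)"
        using lborel_integrable_real_affine_iff[OF False, of "?h E" "fst E $ i"] by blast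
      then have hb: "has_bochner_integral lborel (\<lambda>a. ?\<sigma> E * ?h E a) (?\<sigma> E * (\<bar>?c E\<bar> * (LINT s|lborel. ?g s)))"
        unfolding has_bochner_integral_iff
        by (intro conjI integrable_mult_right) (simp_all only: integral_mult_right_zero i1)
      have "int_E E F = len E * (LINT s|lborel. ?g s)"
        by (simp add: int_E_def len_def set_lebesgue_integral_def gam_def)
      moreover have "sgn (normal E $ j) * \<bar>?c E\<bar> = normal E $ j * len E"
        using t n len_pos[OF edge_ne[OF E]] by (simp add: abs_mult sgn_mult_abs mult.left_commute mult.commute[of _ "len E"])
      moreover have "?\<sigma> E * (\<bar>?c E\<bar> * (LINT s|lborel. ?g s))
          = orient E * (sgn (normal E $ j) * \<bar>?c E\<bar>) * (LINT s|lborel. ?g s)"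
        by (simp only: ax mult_ac)
      ultimately have "?\<sigma> E * (\<bar>?c E\<bar> * (LINT s|lborel. ?g s)) = orient E * normal E $ j * int_E E F"
        by (simp only: mult.assoc)
      then show ?thesis
        using hb by (simp only:)
    qed
  qed
  have "int_T T ?f = (LINT a|lborel. LINT b|lborel. indicator T (?L a b) * ?f (?L a b))"
    unfolding int_T_def set_lebesgue_integral_def using integral_axes(1)[OF ij int] by simp
  also have "\<dots> = (LINT a|lborel. (\<Sum>E\<in>Es. ?\<sigma> E * ?h E a))"
  proof (rule integral_cong_AE)
    show "(\<lambda>a. LINT b|lborel. indicator T (?L a b) * ?f (?L a b)) \<in> borel_measurable lborel"
      using integral_axes(2)[OF ij int] by (rule borel_measurable_integrable)
    show "(\<lambda>a. \<Sum>E\<in>Es. ?\<sigma> E * ?h E a) \<in> borel_measurable lborel"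
      by (intro borel_measurable_sum borel_measurable_has_bochner_integral[OF edge])
    have "AE a in lborel. a \<notin> A"
      using finA by (intro AE_not_in finite_imp_null_set_lborel)
    then show "AE a in lborel. (LINT b|lborel. indicator T (?L a b) * ?f (?L a b)) = (\<Sum>E\<in>Es. ?\<sigma> E * ?h E a)"
      by (rule AE_mp) (intro AE_I2 impI inner)
  qed
  also have "\<dots> = (\<Sum>E\<in>Es. orient E * normal E $ j * int_E E F)"
    by (intro has_bochner_integral_integral_eq has_bochner_integral_sum edge)
  finally show ?thesis .
qed

end

section \<open>Orientation of the boundary\<close>

context polygon
begin

text \<open>A positive value would persist on a ball inside \<open>T\<close>, which has positive
  measure.\<close>

lemma int_T_pos:
  assumes f: "continuous_on UNIV (f :: real^2 \<Rightarrow> real)" and nn: "\<And>x. f x \<ge> 0" and 0: "int_T T f = 0" and x: "x \<in> T"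
  shows "f x = 0"
proof (rule ccontr)
  assume "f x \<noteq> 0"
  then have fx: "f x > 0"
    using nn[of x] by simp
  have int: "integrable lborel (\<lambda>x. indicator T x *\<^sub>R f x)"
    using integrable_T[OF f] by (simp add: set_integrable_def)
  have ae: "AE x in lborel. indicator T x *\<^sub>R f x = 0"
    using 0 nn unfolding int_T_def set_lebesgue_integral_def
    by (subst (asm) integral_nonneg_eq_0_iff_AE[OF int]) auto
  have "open (T \<inter> {x. f x > 0})"
    using open_T f by (intro open_Int open_Collect_less) auto
  then obtain r where r: "r > 0" "ball x r \<subseteq> T \<inter> {x. f x > 0}"
    using x fx open_contains_ball by blast
  from ae have "AE y in lborel. y \<notin> ball x r"
  proof (rule AE_mp, intro AE_I2 impI notI)
    fix y assume "indicator T y *\<^sub>R f y = 0" "y \<in> ball x r"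
    then show False
      using r by (auto simp: subset_iff)
  qed
  then have "ball x r \<in> null_sets lborel"
    by (subst AE_iff_null_sets) auto
  then have "measure lborel (ball x r) = 0"
    by (simp add: null_sets_def measure_def)
  then show False
    using content_ball_pos[OF r(1), of x] by simp
qed

lemma int_T_add: "continuous_on UNIV f \<Longrightarrow> continuous_on UNIV g \<Longrightarrow> int_T T (\<lambda>x. f x + g x) = int_T T f + int_T T g"
  and int_T_diff: "continuous_on UNIV f \<Longrightarrow> continuous_on UNIV g \<Longrightarrow> int_T T (\<lambda>x. f x - g x) = int_T T f - int_T T g"
  unfolding int_T_def by (simp_all add: set_integral_add set_integral_diff integrable_T)

end

lemma int_T_cmult: "int_T T (\<lambda>x. c * f x) = c * int_T T f"
  and int_T_0: "int_T T (\<lambda>x. 0) = 0"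
  unfolding int_T_def set_lebesgue_integral_def by (simp_all add: mult.left_commute)

lemma int_T_cong: "(\<And>x. x \<in> T \<Longrightarrow> f x = g x) \<Longrightarrow> int_T T f = int_T T g"
  unfolding int_T_def set_lebesgue_integral_def
  by (intro Bochner_Integration.integral_cong) (auto simp: indicator_def)

section \<open>Integrals over edges, and vertex functions\<close>

definition I01 :: "(real \<Rightarrow> real) \<Rightarrow> real" where
  "I01 f = (LBINT s:{0..1}. f s)"

lemma int_E_I01: "int_E E f = len E * I01 (\<lambda>s. f (gam E s))"
  by (simp add: int_E_def len_def I01_def gam_def)

lemma integrable_01: "continuous_on {0..1} (f :: real \<Rightarrow> real) \<Longrightarrow> set_integrable lborel {0..1} f"
  unfolding set_integrable_def by (intro borel_integrable_compact) auto

lemma I01_add: "continuous_on {0..1} f \<Longrightarrow> continuous_on {0..1} g \<Longrightarrow> I01 (\<lambda>x. f x + g x) = I01 f + I01 g"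
  and I01_diff: "continuous_on {0..1} f \<Longrightarrow> continuous_on {0..1} g \<Longrightarrow> I01 (\<lambda>x. f x - g x) = I01 f - I01 g"
  unfolding I01_def by (simp_all add: set_integral_add set_integral_diff integrable_01)

lemma I01_cmult: "I01 (\<lambda>x. c * f x) = c * I01 f"
  and I01_uminus: "I01 (\<lambda>x. - f x) = - I01 f"
  and I01_0: "I01 (\<lambda>x. 0) = 0"
  unfolding I01_def set_lebesgue_integral_def by (simp_all add: mult.left_commute)

lemma I01_cong: "(\<And>x. x \<in> {0..1} \<Longrightarrow> f x = g x) \<Longrightarrow> I01 f = I01 g"
  unfolding I01_def set_lebesgue_integral_def
  by (intro Bochner_Integration.integral_cong) (auto simp: indicator_def)

lemma I01_FTC:
  assumes "\<And>s. (F has_field_derivative f s) (at s)" "continuous_on {0..1} f"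
  shows "I01 f = F 1 - F 0"
proof -
  have "has_bochner_integral lborel (\<lambda>x. indicator {0..1} x *\<^sub>R f x) (F 1 - F 0)"
    using assms
    by (intro has_bochner_integral_FTC_Icc)
       (auto intro: has_field_derivative_at_within simp flip: has_real_derivative_iff_has_vector_derivative)
  then show ?thesis
    by (simp add: I01_def set_lebesgue_integral_def has_bochner_integral_iff)
qed

lemma I01_pos:
  assumes f: "continuous_on {0..1} f" and nn: "\<And>s. s \<in> {0..1} \<Longrightarrow> f s \<ge> 0" and 0: "I01 f = 0" and s: "s \<in> {0..1}"
  shows "f s = 0"
proof -
  have "I01 f = integral {0..1} f"
    unfolding I01_def by (rule set_borel_integral_eq_integral(2)[OF integrable_01[OF f]])
  then have "integral {0..1} f = 0"
    using 0 by simp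
  moreover have "f integrable_on {0..1}"
    using f by (rule integrable_continuous_interval)
  ultimately have "(f has_integral 0) (cbox 0 1)"
    by (metis cbox_interval has_integral_integral)
  then show ?thesis
    using has_integral_0_cbox_imp_0[of 0 1 f s] f nn s by (auto simp: box_real)
qed

lemma continuous_gam: "continuous_on UNIV f \<Longrightarrow> continuous_on S (\<lambda>s. f (gam E s))"
  by (rule continuous_on_compose2[of UNIV]) (auto simp: gam_def intro!: continuous_intros)

lemma int_E_add: "continuous_on UNIV f \<Longrightarrow> continuous_on UNIV g \<Longrightarrow> int_E E (\<lambda>x. f x + g x) = int_E E f + int_E E g"
  unfolding int_E_I01 by (simp_all add: I01_add I01_diff continuous_gam algebra_simps)

lemma int_E_cmult: "int_E E (\<lambda>x. c * f x) = c * int_E E f"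
  and int_E_uminus: "int_E E (\<lambda>x. - f x) = - int_E E f"
  and int_E_0: "int_E E (\<lambda>x. 0) = 0"
  unfolding int_E_I01 by (simp_all add: I01_cmult I01_uminus I01_0)

lemma int_E_cong: "(\<And>x. x \<in> seg E \<Longrightarrow> f x = g x) \<Longrightarrow> int_E E f = int_E E g"
  unfolding int_E_I01 seg_gam by (auto intro!: I01_cong arg_cong[where f = "\<lambda>x. len E * x"])

lemma deriv_gam:
  assumes "f \<in> bipoly m"
  shows "((\<lambda>s. f (gam E s)) has_field_derivative
    len E * (tangent E $ 1 * partial 1 f (gam E s) + tangent E $ 2 * partial 2 f (gam E s))) (at s)"
proof -
  have c: "(snd E - fst E) $ i = len E * tangent E $ i" for i
    using tangent_len[of E] by (metis vector_scaleR_component real_scaleR_def)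
  show ?thesis
    using bipoly_deriv_line[OF assms, of "fst E" "snd E - fst E" s] unfolding c gam_def
    by (simp add: algebra_simps)
qed

lemma int_E_tangential:
  assumes "f \<in> bipoly m"
  shows "tangent E $ 1 * int_E E (partial 1 f) + tangent E $ 2 * int_E E (partial 2 f) = f (snd E) - f (fst E)"
proof -
  have c: "continuous_on UNIV (partial i f)" for i
    using bipoly_continuous[OF partial_bipoly[OF assms]] .
  have "I01 (\<lambda>s. len E * (tangent E $ 1 * partial 1 f (gam E s) + tangent E $ 2 * partial 2 f (gam E s))) = f (gam E 1) - f (gam E 0)"
    using deriv_gam[OF assms] by (rule I01_FTC) (intro continuous_intros continuous_gam c)
  then show ?thesis
    by (simp add: int_E_I01 I01_cmult I01_add continuous_gam c continuous_intros algebra_simps)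
qed

text \<open>Lagrange interpolation with products of squared distances to the other points as basis
  functions. It makes an arbitrary vertex function accessible to the divergence theorem for
  polynomials.\<close>

lemma vertex_polynomial:
  assumes "finite S"
  shows "\<exists>f m. f \<in> bipoly m \<and> (\<forall>V\<in>S. f V = \<phi> V)"
proof -
  define w where "w V = (\<lambda>x::real^2. \<Prod>V'\<in>S-{V}. (x - V') \<bullet> (x - V'))" for V
  have q: "(\<lambda>x. (x - V) \<bullet> (x - V)) \<in> bipoly 2" for V :: "real^2"
  proof -
    have c: "(\<lambda>x. x$i - V$i) \<in> bipoly 1" for i
      by (intro bipoly_diff bipoly_coord bipoly_const) auto
    show ?thesis
      using bipoly_add[OF bipoly_mult[OF c[of 1] c[of 1]] bipoly_mult[OF c[of 2] c[of 2]]]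
      by (simp add: inner_2)
  qed
  have prod: "finite A \<Longrightarrow> (\<lambda>x. \<Prod>V'\<in>A. (x - V') \<bullet> (x - V')) \<in> bipoly (2 * int (card A))" for A :: "(real^2) set"
  proof (induction A rule: finite_induct)
    case empty
    then show ?case
      by (simp add: bipoly_const)
  next
    case (insert V A)
    then show ?case
      using bipoly_mult[OF q[of V] insert(3)] by (simp add: algebra_simps)
  qed
  have w: "w V \<in> bipoly (2 * int (card S))" for V
    using prod[of "S - {V}"] bipoly_mono[of "2 * int (card (S - {V}))" "2 * int (card S)"] assms
    unfolding w_def by (auto simp: card_mono)
  define f where "f = (\<lambda>x. \<Sum>V\<in>S. (\<phi> V / w V V) * w V x)"
  have "f \<in> bipoly (2 * int (card S))"
    unfolding f_def by (intro bipoly_sum bipoly_cmult w)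
  moreover have "f V = \<phi> V" if "V \<in> S" for V
  proof -
    have "w V V \<noteq> 0"
      unfolding w_def using assms by (auto simp: prod_zero_iff)
    moreover have "w V' V = 0" if "V' \<in> S" "V' \<noteq> V" for V'
      unfolding w_def using assms \<open>V \<in> S\<close> that by (auto simp: prod_zero_iff)
    ultimately have "f V = (\<Sum>V'\<in>S. if V' = V then \<phi> V else 0)"
      unfolding f_def by (intro sum.cong) auto
    then show ?thesis
      using assms that by simp
  qed
  ultimately show ?thesis
    by blast
qed

lemma findim_finite_support:
  assumes "finite S"
  shows "findim {g :: 'a \<Rightarrow> real. \<forall>x. x \<notin> S \<longrightarrow> g x = 0}" (is "findim ?U")
proof -
  define \<delta> where "\<delta> y = (\<lambda>x. of_bool (x = y) :: real)" for y :: 'a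
  have "?U = span (\<delta> ` S)"
  proof (rule subset_antisym)
    show "?U \<subseteq> span (\<delta> ` S)"
    proof
      fix g assume g: "g \<in> ?U"
      have "g = (\<Sum>y\<in>S. g y *\<^sub>R \<delta> y)"
      proof
        fix x
        have "(\<Sum>y\<in>S. g y *\<^sub>R \<delta> y) x = (\<Sum>y\<in>S. if y = x then g x else 0)"
          unfolding sum_fun_apply by (intro sum.cong) (auto simp: \<delta>_def)
        then show "g x = (\<Sum>y\<in>S. g y *\<^sub>R \<delta> y) x"
          using g assms by simp
      qed
      also have "\<dots> \<in> span (\<delta> ` S)"
        by (intro span_sum span_scale span_base) auto
      finally show "g \<in> span (\<delta> ` S)" .
    qed
    show "span (\<delta> ` S) \<subseteq> ?U"
      by (rule span_minimal) (auto simp: \<delta>_def subspace_def)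
  qed
  then show ?thesis
    using assms by (simp add: findim_span)
qed

context polygon
begin

text \<open>Since the normal is the rotated tangent, the boundary terms of the two mixed derivatives
  combine into the tangential derivative of \<open>f\<close>, whose edge integral is an
  increment.\<close>

lemma orient_telescope: "(\<Sum>E\<in>Es. orient E * (\<phi> (snd E) - \<phi> (fst E))) = 0"
proof -
  obtain f m where f: "f \<in> bipoly m" "\<forall>V\<in>verts Es. f V = \<phi> V"
    using vertex_polynomial[OF finite_verts] by metis
  have d: "partial i f \<in> bipoly (m - 1)" for i
    using partial_bipoly[OF f(1)] .
  have "0 = int_T T (partial 2 (partial 1 f)) - int_T T (partial 1 (partial 2 f))"
    using partial_commute[OF f(1), of 1 2] by simp
  also have "\<dots> = (\<Sum>E\<in>Es. orient E * normal E $ 2 * int_E E (partial 1 f) - orient E * normal E $ 1 * int_E E (partial 2 f))"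
    unfolding divergence[OF d] by (simp add: sum_subtractf)
  also have "\<dots> = (\<Sum>E\<in>Es. orient E * (f (snd E) - f (fst E)))"
    unfolding int_E_tangential[OF f(1), symmetric] by (intro sum.cong) (auto simp: normal_nth algebra_simps)
  also have "\<dots> = (\<Sum>E\<in>Es. orient E * (\<phi> (snd E) - \<phi> (fst E)))"
    using f(2) by (intro sum.cong) (auto simp: verts_def ends_def)
  finally show ?thesis ..
qed

lemma two_edges:
  assumes "E \<in> Es" "E' \<in> Es" "E \<noteq> E'" "V \<in> ends E" "V \<in> ends E'"
  shows "{E \<in> Es. V \<in> ends E} = {E, E'}"
proof -
  have "V \<in> verts Es"
    using assms by (auto simp: verts_def)
  then have "card {E \<in> Es. V \<in> ends E} = 2"
    by (rule card_vert)
  then show ?thesis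
    using assms finite_Es by (intro card_subset_eq[symmetric]) auto
qed

text \<open>The bracket is the increment of the indicator of \<open>V\<close> along an edge, so only
  the two edges at \<open>V\<close> survive: a global orthogonality relation becomes a relation at
  one vertex.\<close>

lemma sum_at_vertex:
  assumes "E \<in> Es" "E' \<in> Es" "E \<noteq> E'" "V \<in> ends E" "V \<in> ends E'"
  shows "(\<Sum>E\<in>Es. r E * (of_bool (snd E = V) - of_bool (fst E = V))) = r E * omega_EV E V + r E' * omega_EV E' V"
proof -
  have "(\<Sum>E\<in>Es. r E * (of_bool (snd E = V) - of_bool (fst E = V))) = (\<Sum>E\<in>{E\<in>Es. V \<in> ends E}. r E * (of_bool (snd E = V) - of_bool (fst E = V)))"
    using finite_Es by (intro sum.mono_neutral_right) (auto simp: ends_def)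
  also have "\<dots> = (\<Sum>E\<in>{E\<in>Es. V \<in> ends E}. r E * omega_EV E V)"
    by (intro sum.cong) (auto simp: ends_def omega_EV_def dest: edge_ne)
  also have "\<dots> = r E * omega_EV E V + r E' * omega_EV E' V"
    unfolding two_edges[OF assms] using assms(3) by simp
  finally show ?thesis .
qed

lemma omega_EV_square: "omega_EV E V * omega_EV E V = 1"
  by (simp add: omega_EV_def)

lemma orient_cancel:
  assumes "E \<in> Es" "E' \<in> Es" "E \<noteq> E'" "V \<in> ends E" "V \<in> ends E'"
  shows "orient E * omega_EV E V + orient E' * omega_EV E' V = 0"
  using sum_at_vertex[OF assms, of orient] orient_telescope[of "\<lambda>x. of_bool (x = V)"] by simp

end

section \<open>Consequences of the connectedness of the boundary\<close>

locale contractible_polygon = polygon +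
  assumes contractible: "contractible T"
begin

text \<open>A contractible set is simply connected, and a bounded simply connected open subset of
  the complex plane has connected frontier. The linear homeomorphism \<open>h\<close> transports
  this to \<open>real^2\<close>.\<close>

lemma connected_frontier: "connected (frontier T)"
proof -
  define h where "h x = Complex (x$1) (x$2)" for x :: "real^2"
  define g where "g z = (vector [Re z, Im z] :: real^2)" for z
  have gh: "g (h x) = x" for x
    by (simp add: g_def h_def vec_eq_iff forall_2)
  have hg: "h (g z) = z" for z
    by (simp add: g_def h_def)
  have lh: "linear h"
    by (rule linearI) (simp_all add: h_def complex_eq_iff)
  have lg: "linear g"
    by (rule linearI) (simp_all add: g_def vec_eq_iff forall_2)
  have ch: "continuous_on S h" and cg: "continuous_on U g" for S U
    using lh lg by (simp_all add: linear_continuous_on linear_conv_bounded_linear)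
  have inj: "inj h"
    using gh by (metis injI)
  have img: "h ` S = g -` S" for S
    by (auto simp: gh) (metis hg image_eqI)
  have "homeomorphism T (h ` T) h g"
    using ch cg gh hg by (auto simp: homeomorphism_def image_image)
  then have "T homeomorphic h ` T"
    by (auto simp: homeomorphic_def)
  then have "simply_connected (h ` T)"
    using homeomorphic_simply_connected_eq contractible_imp_simply_connected[OF contractible] by blast
  moreover have op: "open (h ` T)"
    unfolding img using open_T cg by (intro open_vimage)
  moreover have "bounded (h ` T)"
    using bounded_linear_image bounded_T lh linear_conv_bounded_linear by blast
  ultimately have con: "connected (frontier (h ` T))"
    using simply_connected_eq_frontier_properties[OF op] by simp
  have "closure (h ` T) = h ` closure T"
    using closure_injective_linear_image[OF lh inj] by simp
  then have "frontier (h ` T) = h ` frontier T"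
    using op open_T inj by (simp add: frontier_def interior_open image_set_diff)
  then have "frontier T = g ` frontier (h ` T)"
    by (simp add: image_image gh)
  then show ?thesis
    using connected_continuous_image[OF cg con] by simp
qed

text \<open>The edges with the value \<open>h E\<close> and the remaining ones form two closed sets
  covering the frontier; a common point would be a vertex shared by edges with different values.
  Connectedness leaves only one of them.\<close>

lemma edge_constant:
  assumes h: "\<And>E E' V. E \<in> Es \<Longrightarrow> E' \<in> Es \<Longrightarrow> E \<noteq> E' \<Longrightarrow> V \<in> ends E \<Longrightarrow> V \<in> ends E' \<Longrightarrow> h E = h E'"
    and E: "E \<in> Es" "E' \<in> Es"
  shows "h E = h E'"
proof (rule ccontr)
  assume ne: "h E \<noteq> h E'"
  define A where "A = (\<Union>E''\<in>{E''\<in>Es. h E'' = h E}. seg E'')"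
  define B where "B = (\<Union>E''\<in>{E''\<in>Es. h E'' \<noteq> h E}. seg E'')"
  have "closed A" "closed B"
    using finite_Es by (auto simp: A_def B_def seg_def)
  moreover have "frontier T \<subseteq> A \<union> B"
    unfolding frontier_T A_def B_def by auto
  moreover have "A \<inter> B \<inter> frontier T = {}"
  proof -
    have False if "x \<in> seg E1" "x \<in> seg E2" "E1 \<in> Es" "E2 \<in> Es" "h E1 = h E" "h E2 \<noteq> h E" for x E1 E2
    proof -
      have "E1 \<noteq> E2"
        using that by auto
      then have "x \<in> ends E1" "x \<in> ends E2"
        using seg_Int[of E1 E2] that by auto
      then show False
        using h[OF that(3,4) \<open>E1 \<noteq> E2\<close>] that by auto
    qed
    then show ?thesis
      unfolding A_def B_def by blast
  qed
  moreover have "fst E \<in> A"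
    unfolding A_def by (rule UN_I[of E]) (use E in \<open>simp_all add: seg_def\<close>)
  moreover have "fst E' \<in> B"
    unfolding B_def by (rule UN_I[of E']) (use E ne in \<open>simp_all add: seg_def\<close>)
  moreover have "fst E \<in> frontier T"
    unfolding frontier_T by (rule UN_I[of E]) (use E in \<open>simp_all add: seg_def\<close>)
  moreover have "fst E' \<in> frontier T"
    unfolding frontier_T by (rule UN_I[of E']) (use E in \<open>simp_all add: seg_def\<close>)
  ultimately show False
    using connected_closedD[OF connected_frontier, of A B] by blast
qed

lemma vertex_constant:
  assumes h: "\<And>E. E \<in> Es \<Longrightarrow> h (fst E) = h (snd E)" and V: "V \<in> verts Es" "V' \<in> verts Es"
  shows "h V = h V'"
proof -
  obtain E E' where E: "E \<in> Es" "V \<in> ends E" "E' \<in> Es" "V' \<in> ends E'"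
    using V by (auto simp: verts_def)
  have hE: "h V = h (fst E)" if "E \<in> Es" "V \<in> ends E" for V E
    using that h by (auto simp: ends_def)
  have "h (fst E) = h (fst E')"
  proof (rule edge_constant[where h = "\<lambda>E. h (fst E)", OF _ E(1,3)])
    fix E E' V assume "E \<in> Es" "E' \<in> Es" "V \<in> ends E" "V \<in> ends E'"
    then show "h (fst E) = h (fst E')"
      using hE[of E V] hE[of E' V] by simp
  qed
  then show ?thesis
    using hE[OF E(1,2)] hE[OF E(3,4)] by simp
qed

text \<open>A zero propagates across vertices by \<open>orient_cancel\<close>, hence to all edges;
  the divergence theorem for the first coordinate function would then give \<open>T\<close> area
  0.\<close>

lemma orient_ne: "E \<in> Es \<Longrightarrow> orient E \<noteq> 0"
proof
  assume E: "E \<in> Es" "orient E = 0"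
  have "(orient E1 = 0) = (orient E2 = 0)" if "E1 \<in> Es" "E2 \<in> Es" "E1 \<noteq> E2" "V \<in> ends E1" "V \<in> ends E2" for E1 E2 V
    using orient_cancel[OF that] omega_EV_square[of E1 V] omega_EV_square[of E2 V] by auto
  then have "orient E' = 0" if "E' \<in> Es" for E'
    using edge_constant[of "\<lambda>E. orient E = 0" E E'] E that by blast
  then have "int_T T (partial 1 (\<lambda>x. x$1)) = 0"
    using divergence[OF bipoly_coord[OF order_refl]] by simp
  then have "int_T T (\<lambda>x. 1) = 0"
    by (simp add: partial_coord)
  moreover obtain x where "x \<in> T"
    using T_ne by blast
  ultimately show False
    using int_T_pos[of "\<lambda>x. 1" x] by auto
qed

text \<open>At a slit \<open>orient\<close> is 0 while \<open>omega_TE\<close> is -1, so the two can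
  be identified only after slits are excluded.\<close>

lemma orient_omega:
  assumes E: "E \<in> Es"
  shows "orient E = omega_TE T E"
proof -
  have n1: "normal E \<bullet> normal E = 1"
    using normal_nz[OF edge_ne[OF E]] .
  have ev: "eventually (\<lambda>s. x + s *\<^sub>R m \<in> S) (at_right 0)"
    if "r > 0" "\<forall>y\<in>ball x r. (y - x) \<bullet> m > 0 \<longrightarrow> y \<in> S" "m \<bullet> m = 1" for x m :: "real^2" and r S
  proof -
    have "norm m = 1"
      using that by (simp add: norm_eq_1)
    then have "x + s *\<^sub>R m \<in> S" if "0 < s" "s < r" for s
      using that \<open>\<forall>y\<in>ball x r. (y - x) \<bullet> m > 0 \<longrightarrow> y \<in> S\<close> \<open>m \<bullet> m = 1\<close> by (auto simp: dist_norm)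
    then show ?thesis
      using that(1) unfolding eventually_at_right_field by blast
  qed
  have evi: "eventually (\<lambda>s. x + s *\<^sub>R m \<in> T) (at_right 0)" if "inner_at m x" "m \<bullet> m = 1" for x m
    using that ev[of _ x m T] unfolding inner_at_def by blast
  have evo: "eventually (\<lambda>s. x + s *\<^sub>R m \<notin> closure T) (at_right 0)" if "outer_at m x" "m \<bullet> m = 1" for x m
    using that ev[of _ x m "- closure T"] unfolding outer_at_def by auto
  have nm: "- normal E \<bullet> - normal E = 1"
    using n1 by simp
  show ?thesis
  proof (cases "side E (- normal E)")
    case True
    then have ns: "\<not> side E (normal E)"
      using orient_ne[OF E] by (auto simp: orient_def)
    have "points_out T E (normal E)"
      unfolding points_out_def
    proof
      fix x assume x: "x \<in> open_segment (fst E) (snd E)"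
      have "inner_at (- normal E) x" "outer_at (normal E) x"
        using True not_side[OF E _ ns x] x by (auto simp: side_def)
      from eventually_conj[OF evo[OF this(2) n1] evi[OF this(1) nm]]
      show "eventually (\<lambda>s. x + s *\<^sub>R normal E \<notin> closure T \<and> x - s *\<^sub>R normal E \<in> T) (at_right 0)"
        by simp
    qed
    then show ?thesis
      using True ns by (simp add: orient_def omega_TE_def)
  next
    case False
    then have s: "side E (normal E)"
      using some_side[OF E] by auto
    have "\<not> points_out T E (normal E)"
    proof
      assume p: "points_out T E (normal E)"
      define x where "x = gam E (1/2)"
      have x: "x \<in> open_segment (fst E) (snd E)"
        using open_seg_gam[OF edge_ne[OF E]] by (auto simp: x_def)
      have "eventually (\<lambda>s. x + s *\<^sub>R normal E \<notin> closure T) (at_right 0)"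
        using p x unfolding points_out_def by (auto elim: eventually_mono)
      moreover have "eventually (\<lambda>s. x + s *\<^sub>R normal E \<in> T) (at_right 0)"
        using s x evi n1 by (auto simp: side_def)
      ultimately have "eventually (\<lambda>s. False) (at_right (0::real))"
        by eventually_elim (use closure_subset in blast)
      then show False
        by simp
    qed
    then show ?thesis
      using s False by (simp add: orient_def omega_TE_def)
  qed
qed

abbreviation om :: "edge \<Rightarrow> real" where "om \<equiv> omega_TE T"

lemma om_square: "om E * om E = 1"
  by (simp add: omega_TE_def)

lemma divergence_om:
  "F \<in> bipoly m \<Longrightarrow> int_T T (partial j F) = (\<Sum>E\<in>Es. om E * normal E $ j * int_E E F)"
  using divergence[of F m j] by (simp add: orient_omega)

lemma om_telescope: "(\<Sum>E\<in>Es. om E * (\<phi> (snd E) - \<phi> (fst E))) = 0"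
  using orient_telescope[of \<phi>] by (simp add: orient_omega)

text \<open>Least squares instead of walking along the boundary: \<open>d \<phi>\<close> is the best
  approximation of \<open>f\<close> by increments. The residual \<open>r\<close> is orthogonal to
  all increments, so it balances at each vertex just as \<open>om\<close> does; hence
  \<open>r E * om E\<close> is the same for all edges, and the hypothesis on \<open>f\<close> makes
  it 0.\<close>

lemma vertex_potential:
  assumes f: "(\<Sum>E\<in>Es. om E * f E) = 0"
  shows "\<exists>\<phi>. \<forall>E\<in>Es. \<phi> (snd E) - \<phi> (fst E) = f E"
proof -
  define d where "d \<phi> = (\<lambda>E. if E \<in> Es then \<phi> (snd E) - \<phi> (fst E) else (0::real))" for \<phi> :: "real^2 \<Rightarrow> real"
  define B where "B g h = (\<Sum>E\<in>Es. g E * h E)" for g h :: "edge \<Rightarrow> real"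
  have ld: "linear d"
    by (rule linearI) (auto simp: d_def fun_eq_iff algebra_simps)
  have sub: "subspace (range d)"
    using linear_subspace_image[OF ld subspace_UNIV] .
  have fin: "findim (range d)"
    by (rule findim_subset[OF findim_finite_support[OF finite_Es] sub]) (auto simp: d_def)
  have lB: "lin_on W (B g)" for W g
    by (rule lin_onI) (simp_all add: B_def sum.distrib sum_distrib_left algebra_simps)
  interpret inner_on "range d" B
  proof
    show "B g h = B h g" for g h
      by (simp add: B_def mult.commute)
    fix g assume g: "g \<in> range d" "B g g = 0"
    then have "\<forall>E\<in>Es. g E * g E = 0"
      unfolding B_def by (subst (asm) sum_nonneg_eq_0_iff) (auto simp: finite_Es)
    then show "g = 0"
      using g(1) by (auto simp: d_def fun_eq_iff split: if_splits)
  qed (use sub lB in auto)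
  obtain \<phi> where \<phi>: "\<And>\<psi>. B (d \<phi>) (d \<psi>) = B f (d \<psi>)"
    using riesz[OF fin lB[of _ f]] by auto
  define r where "r E = f E - d \<phi> E" for E
  have r0: "(\<Sum>E\<in>Es. r E * (\<psi> (snd E) - \<psi> (fst E))) = 0" for \<psi>
  proof -
    have "(\<Sum>E\<in>Es. r E * (\<psi> (snd E) - \<psi> (fst E))) = B f (d \<psi>) - B (d \<phi>) (d \<psi>)"
      unfolding B_def sum_subtractf[symmetric] by (intro sum.cong) (auto simp: r_def d_def algebra_simps)
    then show ?thesis
      using \<phi> by simp
  qed
  have rc: "r E * om E = r E' * om E'" if "E \<in> Es" "E' \<in> Es" for E E'
  proof (rule edge_constant[where h = "\<lambda>E. r E * om E", OF _ that])
    fix E E' V assume EV: "E \<in> Es" "E' \<in> Es" "E \<noteq> E'" "V \<in> ends E" "V \<in> ends E'"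
    \<comment> \<open>Both \<open>om\<close> and \<open>r\<close> satisfy the balance at
      \<open>V\<close>; multiplying the two relations removes the signs
      \<open>omega_EV\<close>.\<close>
    have 1: "om E * omega_EV E V = - (om E' * omega_EV E' V)"
      using orient_cancel[OF EV] EV orient_omega by simp
    have 2: "r E * omega_EV E V = - (r E' * omega_EV E' V)"
      using sum_at_vertex[OF EV, of r] r0[of "\<lambda>x. of_bool (x = V)"] by simp
    have "(r E * omega_EV E V) * (om E * omega_EV E V) = (r E' * omega_EV E' V) * (om E' * omega_EV E' V)"
      unfolding 1 2 by simp
    then show "r E * om E = r E' * om E'"
      using omega_EV_square[of E V] omega_EV_square[of E' V] by (metis (no_types, opaque_lifting) mult.assoc mult.commute mult.right_neutral)
  qed
  have "r E = 0" if "E \<in> Es" for E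
  proof -
    \<comment> \<open>The constant is summed over all edges: the oriented sum of the residual is
      that of \<open>f\<close> minus that of an increment, and both vanish.\<close>
    have "real (card Es) * (r E * om E) = (\<Sum>E'\<in>Es. r E * om E)"
      by simp
    also have "\<dots> = (\<Sum>E'\<in>Es. r E' * om E')"
      using rc[OF that] by (rule sum.cong[OF refl])
    also have "\<dots> = (\<Sum>E\<in>Es. om E * f E) - (\<Sum>E\<in>Es. om E * (\<phi> (snd E) - \<phi> (fst E)))"
      unfolding sum_subtractf[symmetric] by (intro sum.cong) (auto simp: r_def d_def algebra_simps)
    also have "\<dots> = 0"
      using f om_telescope[of \<phi>] by simp
    finally show ?thesis
      using that finite_Es om_square[of E] by auto
  qed
  then show ?thesis
    unfolding r_def d_def by (intro exI[of _ \<phi>]) auto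
qed

end

section \<open>Vector and matrix valued polynomials\<close>

lemma zext_UNIV [simp]: "zext UNIV f = f"
  by (simp add: zext_def)

lemma P_UNIV: "P m UNIV = bipoly m"
  by (simp add: P_def)

lemma Pvec_UNIV: "v \<in> Pvec m UNIV \<longleftrightarrow> (\<forall>i. (\<lambda>x. v x $ i) \<in> bipoly m)"
  by (simp add: Pvec_def P_UNIV)

lemma Psym_UNIV: "\<tau> \<in> Psym m UNIV \<longleftrightarrow> (\<forall>i j. (\<lambda>x. \<tau> x $ i $ j) \<in> bipoly m) \<and> (\<forall>x i j. \<tau> x $ i $ j = \<tau> x $ j $ i)"
  by (auto simp: Psym_def P_UNIV sym_mats_def transpose_def vec_eq_iff)

lemma linear_zext: "linear (zext Y :: ('a \<Rightarrow> 'b::real_vector) \<Rightarrow> _)"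
  by (rule linearI) (auto simp: zext_def fun_eq_iff)

lemma lin_on_linear: "linear \<phi> \<Longrightarrow> lin_on W \<phi>"
  by (auto simp: lin_on_def linear_add linear_scale)

lemma findim_P: "findim (P m Y)"
  unfolding P_def by (intro findim_image findim_bipoly lin_on_linear linear_zext)

lemma findim_components:
  fixes W :: "('a \<Rightarrow> 'b::real_vector) set"
  assumes "findim W"
  shows "findim {v :: 'a \<Rightarrow> 'b ^ 'n. \<forall>i. (\<lambda>x. v x $ i) \<in> W}" (is "findim ?V")
proof -
  obtain S where S: "finite S" "W = span S"
    using assms by (auto simp: findim_def)
  define a where "a i f = (\<lambda>x. axis i (f x) :: 'b ^ 'n)" for i and f :: "'a \<Rightarrow> 'b"
  have la: "linear (a i)" for i
    by (rule linearI) (auto simp: a_def fun_eq_iff axis_def vec_eq_iff)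
  let ?U = "\<Union>i. a i ` S"
  have sub: "subspace W"
    using S by simp
  have "subspace ?V"
    unfolding subspace_def
  proof (intro conjI ballI allI)
    show "0 \<in> ?V"
      using subspace_0[OF sub] by (simp add: zero_fun_def)
    show "u + v \<in> ?V" if "u \<in> ?V" "v \<in> ?V" for u v
      using that subspace_add[OF sub] by (fastforce simp: plus_fun_def)
    show "c *\<^sub>R u \<in> ?V" if "u \<in> ?V" for c u
      using that subspace_scale[OF sub] by (fastforce simp: scaleR_fun_def)
  qed
  moreover have "?V \<subseteq> span ?U"
  proof
    fix v assume v: "v \<in> ?V"
    have "v = (\<Sum>i\<in>UNIV. a i (\<lambda>x. v x $ i))"
    proof
      fix x
      have "v x $ j = (\<Sum>i\<in>UNIV. axis i (v x $ i)) $ j" for j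
      proof -
        have "(\<Sum>i\<in>UNIV. axis i (v x $ i)) $ j = (\<Sum>i\<in>UNIV. if i = j then v x $ i else 0)"
          unfolding sum_component by (intro sum.cong) (auto simp: axis_def)
        then show ?thesis
          by simp
      qed
      then show "v x = (\<Sum>i\<in>UNIV. a i (\<lambda>x. v x $ i)) x"
        unfolding sum_fun_apply a_def vec_eq_iff by (rule allI)
    qed
    moreover have "a i (\<lambda>x. v x $ i) \<in> span ?U" for i
    proof -
      have "a i (\<lambda>x. v x $ i) \<in> a i ` span S"
        using v S by auto
      also have "\<dots> = span (a i ` S)"
        using linear_span_image[OF la] by simp
      also have "\<dots> \<subseteq> span ?U"
        by (intro span_mono) auto
      finally show ?thesis .
    qed
    ultimately show "v \<in> span ?U"
      by (metis (no_types, lifting) span_sum)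
  qed
  moreover have "finite ?U"
    using S(1) by simp
  ultimately show ?thesis
    using findim_subset findim_span by blast
qed

lemma findim_Pvec: "findim (Pvec m Y)"
  unfolding Pvec_def by (rule findim_components[OF findim_P])

lemma subspace_sym: "subspace {\<tau> :: 'a \<Rightarrow> real^2^2. \<forall>x. \<tau> x \<in> sym_mats}"
  by (auto simp: subspace_def sym_mats_def transpose_def vec_eq_iff)

lemma findim_Psym: "findim (Psym m Y)"
proof -
  have 1: "findim {\<tau> :: real^2 \<Rightarrow> real^2^2. \<forall>i. (\<lambda>x. \<tau> x $ i) \<in> {v. \<forall>j. (\<lambda>x. v x $ j) \<in> P m Y}}" (is "findim ?M")
    by (intro findim_components findim_P)
  have "Psym m Y = ?M \<inter> {\<tau>. \<forall>x. \<tau> x \<in> sym_mats}"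
    by (auto simp: Psym_def)
  moreover have "subspace (?M \<inter> {\<tau>. \<forall>x. \<tau> x \<in> sym_mats})"
    using findim_subspace[OF 1] subspace_sym by (rule subspace_inter)
  ultimately show ?thesis
    using findim_subset[OF 1] by simp
qed

lemmas subspace_P = findim_subspace[OF findim_P]
  and subspace_Pvec = findim_subspace[OF findim_Pvec]
  and subspace_Psym = findim_subspace[OF findim_Psym]

lemma zext_eq: "x \<in> Y \<Longrightarrow> zext Y f x = f x" and zext_out: "x \<notin> Y \<Longrightarrow> zext Y f x = 0"
  by (simp_all add: zext_def)

lemma zext_component: "(\<lambda>x. zext Y v x $ i) = zext Y (\<lambda>x. v x $ i)"
  by (auto simp: zext_def fun_eq_iff)

lemma Pvec_image: "Pvec m Y = zext Y ` Pvec m UNIV"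
proof (intro subset_antisym subsetI)
  fix v assume "v \<in> Pvec m Y"
  then have "\<forall>i. \<exists>p\<in>bipoly m. (\<lambda>x. v x $ i) = zext Y p"
    by (auto simp: Pvec_def P_def)
  then obtain p where p: "\<And>i. p i \<in> bipoly m" "\<And>i. (\<lambda>x. v x $ i) = zext Y (p i)"
    by metis
  have "v = zext Y (\<lambda>x. \<chi> i. p i x)"
  proof
    fix x
    have "v x $ i = zext Y (p i) x" for i
      using fun_cong[OF p(2)[of i], of x] by simp
    then show "v x = zext Y (\<lambda>x. \<chi> i. p i x) x"
      by (simp add: zext_def vec_eq_iff)
  qed
  moreover have "(\<lambda>x. \<chi> i. p i x) \<in> Pvec m UNIV"
    using p(1) by (simp add: Pvec_UNIV)
  ultimately show "v \<in> zext Y ` Pvec m UNIV"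
    by blast
next
  fix v assume "v \<in> zext Y ` Pvec m UNIV"
  then show "v \<in> Pvec m Y"
    by (auto simp: Pvec_def P_UNIV P_def zext_component)
qed

lemma sym_part_nth: "sym_part A $ i $ j = (A$i$j + A$j$i) / 2"
  by (simp add: sym_part_def transpose_def field_simps)

lemma Psym_image: "Psym m Y = zext Y ` Psym m UNIV"
proof (intro subset_antisym subsetI)
  fix \<tau> assume t: "\<tau> \<in> Psym m Y"
  have "\<exists>p\<in>bipoly m. (\<lambda>x. \<tau> x $ i $ j) = zext Y p" for i j
    using t unfolding Psym_def P_def by blast
  then obtain p where p: "\<And>i j. p i j \<in> bipoly m" "\<And>i j. (\<lambda>x. \<tau> x $ i $ j) = zext Y (p i j)"
    by metis
  have s: "\<tau> x $ i $ j = \<tau> x $ j $ i" for x i j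
    using t by (auto simp: Psym_def sym_mats_def transpose_def vec_eq_iff)
  \<comment> \<open>Representatives of the entries are chosen independently and may differ outside
    \<open>Y\<close>; symmetrizing them keeps the values on \<open>Y\<close>.\<close>
  define q where "q = (\<lambda>x. \<chi> i j. (1/2) * (p i j x + p j i x))"
  have "\<tau> x = zext Y q x" for x
  proof -
    have "\<tau> x $ i $ j = zext Y (p i j) x" for i j
      using fun_cong[OF p(2)[of i j], of x] by simp
    then have "\<tau> x $ i $ j = (1/2) * (zext Y (p i j) x + zext Y (p j i) x)" for i j
      using s[of x i j] by simp
    then show ?thesis
      by (cases "x \<in> Y") (simp_all add: zext_def vec_eq_iff q_def)
  qed
  then have "\<tau> = zext Y q"
    by (rule ext)
  moreover have "q \<in> Psym m UNIV"
  proof -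
    have "(\<lambda>x. (1/2) * (p i j x + p j i x)) \<in> bipoly m" for i j
      by (intro bipoly_cmult bipoly_add p(1))
    then show ?thesis
      by (simp add: Psym_UNIV q_def add.commute)
  qed
  ultimately show "\<tau> \<in> zext Y ` Psym m UNIV"
    by blast
next
  fix \<tau> assume "\<tau> \<in> zext Y ` Psym m UNIV"
  then obtain q where q: "q \<in> Psym m UNIV" "\<tau> = zext Y q"
    by auto
  have "(\<lambda>x. \<tau> x $ i $ j) = zext Y (\<lambda>x. q x $ i $ j)" for i j
    by (auto simp: q(2) zext_def fun_eq_iff)
  moreover have "\<tau> x \<in> sym_mats" for x
    using q by (auto simp: Psym_def zext_def sym_mats_def transpose_def vec_eq_iff)
  ultimately show "\<tau> \<in> Psym m Y"
    using q(1) by (auto simp: Psym_def P_def)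
qed

lemma continuous_vec: "(\<And>i. continuous_on S (\<lambda>x. v x $ i)) \<Longrightarrow> continuous_on S v"
  using continuous_on_vec_lambda[of S "\<lambda>i x. v x $ i"] by simp

lemma Pvec_continuous: "v \<in> Pvec m UNIV \<Longrightarrow> continuous_on S v"
  by (rule continuous_vec) (auto simp: Pvec_UNIV intro: bipoly_continuous)

lemma Psym_continuous: "\<tau> \<in> Psym m UNIV \<Longrightarrow> continuous_on S \<tau>"
  by (intro continuous_vec) (auto simp: Psym_UNIV intro: bipoly_continuous)

section \<open>The complex of polynomial Hessians\<close>

lemma hess_Psym:
  assumes "q \<in> bipoly (m + 2)"
  shows "hess q \<in> Psym m UNIV"
proof -
  have "partial i (partial j q) \<in> bipoly m" for i j
    using partial_bipoly[OF partial_bipoly[OF assms], of i j] by simp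
  then show ?thesis
    unfolding Psym_UNIV hess_def using partial_commute[OF assms] by simp
qed

lemma lin_on_hess: "lin_on (bipoly m) hess"
proof (rule lin_onI)
  fix f g assume fg: "f \<in> bipoly m" "g \<in> bipoly m"
  have "partial i (partial j (f + g)) = partial i (partial j f) + partial i (partial j g)" for i j
    by (simp only: lin_on_add[OF lin_on_partial fg] lin_on_add[OF lin_on_partial partial_bipoly[OF fg(1)] partial_bipoly[OF fg(2)]])
  then show "hess (f + g) = hess f + hess g"
    by (simp add: hess_def fun_eq_iff vec_eq_iff)
next
  fix c f assume f: "f \<in> bipoly m"
  have "partial i (partial j (c *\<^sub>R f)) = c *\<^sub>R partial i (partial j f)" for i j
    by (simp only: lin_on_scale[OF lin_on_partial f] lin_on_scale[OF lin_on_partial partial_bipoly[OF f]])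
  then show "hess (c *\<^sub>R f) = c *\<^sub>R hess f"
    by (simp add: hess_def fun_eq_iff vec_eq_iff)
qed

lemma Psym_differentiable: "\<tau> \<in> Psym m UNIV \<Longrightarrow> (\<lambda>x. \<tau> x $ i $ j) differentiable at x"
  unfolding Psym_UNIV using bipoly_differentiable by blast

lemma rot_nth: "rot \<tau> x $ i = partial 2 (\<lambda>y. \<tau> y $ i $ 1) x - partial 1 (\<lambda>y. \<tau> y $ i $ 2) x"
  by (simp add: rot_def)

lemma rot_hess:
  assumes "q \<in> bipoly m"
  shows "rot (hess q) = (\<lambda>_. 0)"
proof -
  have "partial 2 (partial i (partial 1 q)) = partial 1 (partial i (partial 2 q))" for i
    using exhaust_2[of i] partial_commute[OF assms, of 1 2] partial_commute[OF partial_bipoly[OF assms], of 1 2]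
    by auto
  then show ?thesis
    by (simp add: fun_eq_iff vec_eq_iff rot_nth) (simp add: hess_def)
qed

lemma rot_Pvec:
  assumes "\<tau> \<in> Psym m UNIV"
  shows "rot \<tau> \<in> Pvec (m - 1) UNIV"
  unfolding Pvec_UNIV rot_nth using assms
  by (auto simp: Psym_UNIV intro!: bipoly_diff partial_bipoly)

lemma lin_on_rot: "lin_on (Psym m UNIV) rot"
proof (rule lin_onI)
  fix \<sigma> \<tau> assume *: "\<sigma> \<in> Psym m UNIV" "\<tau> \<in> Psym m UNIV"
  then have "partial l (\<lambda>y. \<sigma> y $ i $ j + \<tau> y $ i $ j) x = partial l (\<lambda>y. \<sigma> y $ i $ j) x + partial l (\<lambda>y. \<tau> y $ i $ j) x" for l i j x
    by (intro partial_add Psym_differentiable)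
  then show "rot (\<sigma> + \<tau>) = rot \<sigma> + rot \<tau>"
    by (simp add: fun_eq_iff vec_eq_iff rot_nth)
next
  fix c \<tau> assume "\<tau> \<in> Psym m UNIV"
  then have "partial l (\<lambda>y. c * \<tau> y $ i $ j) x = c * partial l (\<lambda>y. \<tau> y $ i $ j) x" for l i j x
    by (intro partial_cmult Psym_differentiable)
  then show "rot (c *\<^sub>R \<tau>) = c *\<^sub>R rot \<tau>"
    by (simp add: fun_eq_iff vec_eq_iff rot_nth algebra_simps)
qed

text \<open>Two uses of the polynomial Poincare lemma: vanishing \<open>rot\<close> makes each row
  of \<tau> a gradient, of \<open>a\<close> and of \<open>c\<close>, and the symmetry of \<tau> is
  the compatibility condition for the pair \<open>a\<close>, \<open>c\<close>.\<close>

lemma rot_free_hess: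
  assumes "\<tau> \<in> Psym m UNIV" "rot \<tau> = (\<lambda>_. 0)"
  shows "\<exists>q\<in>bipoly (m + 2). hess q = \<tau>"
proof -
  have b: "(\<lambda>x. \<tau> x $ i $ j) \<in> bipoly m" for i j
    using assms(1) by (auto simp: Psym_UNIV)
  have s: "(\<lambda>x. \<tau> x $ 1 $ 2) = (\<lambda>x. \<tau> x $ 2 $ 1)"
    using assms(1) by (auto simp: Psym_UNIV)
  have r: "partial 2 (\<lambda>y. \<tau> y $ i $ 1) = partial 1 (\<lambda>y. \<tau> y $ i $ 2)" for i
  proof
    fix x
    show "partial 2 (\<lambda>y. \<tau> y $ i $ 1) x = partial 1 (\<lambda>y. \<tau> y $ i $ 2) x"
      using rot_nth[of \<tau> x i] assms(2) by simp
  qed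
  obtain a where a: "a \<in> bipoly (m + 1)" "partial 1 a = (\<lambda>x. \<tau> x $ 1 $ 1)" "partial 2 a = (\<lambda>x. \<tau> x $ 1 $ 2)"
    using bipoly_potential[OF b b r[of 1]] by blast
  obtain c where c: "c \<in> bipoly (m + 1)" "partial 1 c = (\<lambda>x. \<tau> x $ 2 $ 1)" "partial 2 c = (\<lambda>x. \<tau> x $ 2 $ 2)"
    using bipoly_potential[OF b b r[of 2]] by blast
  have "partial 2 a = partial 1 c"
    using a c s by simp
  then obtain q where q: "q \<in> bipoly (m + 1 + 1)" "partial 1 q = a" "partial 2 q = c"
    using bipoly_potential[OF a(1) c(1)] by blast
  have "hess q x = \<tau> x" for x
    unfolding hess_def by (simp only: vec_eq_iff forall_2 vec_lambda_beta q a c) (simp add: fun_cong[OF s])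
  then have "hess q = \<tau>"
    by (rule ext)
  moreover have "m + 1 + 1 = m + 2"
    by simp
  ultimately show ?thesis
    using q(1) by metis
qed

text \<open>The general element of the complement space \<open>Hcsp\<close> before restriction to
  \<open>T\<close>, with \<open>z\<close> in the role of \<open>x\<^sub>T\<close>.\<close>

definition Rfield :: "real^2 \<Rightarrow> (real^2 \<Rightarrow> real^2) \<Rightarrow> real^2 \<Rightarrow> real^2^2" where
  "Rfield z q = (\<lambda>x. sym_part (outer (perp (x - z)) (q x)))"

lemma Rfield_nth: "Rfield z q x $ i $ j = (perp (x - z) $ i * q x $ j + perp (x - z) $ j * q x $ i) / 2"
  by (simp add: Rfield_def sym_part_nth outer_def)

lemma perp_bipoly: "(\<lambda>x. perp (x - z) $ i) \<in> bipoly 1"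
  using exhaust_2[of i] by (auto intro!: bipoly_diff bipoly_coord bipoly_const bipoly_uminus simp del: minus_diff_eq)

lemma Rfield_Psym:
  assumes "q \<in> Pvec m UNIV"
  shows "Rfield z q \<in> Psym (m + 1) UNIV"
proof -
  have "(\<lambda>x. perp (x - z) $ i * q x $ j) \<in> bipoly (m + 1)" for i j
    using bipoly_mult[OF perp_bipoly, of "\<lambda>x. q x $ j" m z i] assms by (simp add: Pvec_UNIV add.commute)
  then have "(\<lambda>x. (1/2) * (perp (x - z) $ i * q x $ j + perp (x - z) $ j * q x $ i)) \<in> bipoly (m + 1)" for i j
    by (intro bipoly_cmult bipoly_add)
  then show ?thesis
    by (auto simp: Psym_UNIV Rfield_nth)
qed

lemma linear_Rfield: "linear (Rfield z)"
  by (rule linearI) (simp_all add: fun_eq_iff vec_eq_iff Rfield_nth field_simps)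

text \<open>The quadratic form of \<open>Rfield z q x\<close> vanishes in the direction \<open>x - z\<close>, so a potential
  of it is affine along all lines through \<open>z\<close>.\<close>

lemma Rfield_hess_zero:
  assumes p: "p \<in> bipoly m" and h: "hess p = Rfield z q"
  shows "hess p = (\<lambda>_. 0)"
proof -
  define c where "c i = partial i p z" for i
  have "p x = p z + (x$1 - z$1) * c 1 + (x$2 - z$2) * c 2" for x
  proof -
    define y where "y = x - z"
    define g where "g s = y$1 * partial 1 p (z + s *\<^sub>R y) + y$2 * partial 2 p (z + s *\<^sub>R y)" for s
    have g': "(g has_field_derivative 0) (at s)" for s
    proof -
      let ?w = "z + s *\<^sub>R y"
      have "(g has_field_derivative
          (y$1 * (y$1 * partial 1 (partial 1 p) ?w + y$2 * partial 2 (partial 1 p) ?w) +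
           y$2 * (y$1 * partial 1 (partial 2 p) ?w + y$2 * partial 2 (partial 2 p) ?w))) (at s)"
        unfolding g_def
        by (intro DERIV_add DERIV_cmult bipoly_deriv_line[OF partial_bipoly[OF p]])
      moreover have "partial i (partial j p) ?w = Rfield z q ?w $ i $ j" for i j
        using fun_cong[OF h, of ?w] by (simp add: hess_def vec_eq_iff)
      ultimately show ?thesis
        by (simp add: Rfield_nth algebra_simps)
    qed
    have gc: "g s = g 0" for s
      using DERIV_isconst_all[of g s 0] g' by blast
    have "((\<lambda>s. p (z + s *\<^sub>R y)) has_field_derivative g 0) (at s)" for s
      using bipoly_deriv_line[OF p, of z y s] gc[of s] by (simp add: g_def)
    then have "((\<lambda>s. p (z + s *\<^sub>R y) - s * g 0) has_field_derivative g 0 - g 0) (at s)" for s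
      by (intro DERIV_diff) (auto intro!: derivative_eq_intros)
    then have "p (z + 1 *\<^sub>R y) - 1 * g 0 = p (z + 0 *\<^sub>R y) - 0 * g 0"
      using DERIV_isconst_all[of "\<lambda>s. p (z + s *\<^sub>R y) - s * g 0" 1 0] by simp
    then show ?thesis
      by (simp add: y_def g_def c_def algebra_simps)
  qed
  then have pe: "p = (\<lambda>x. (p z - z$1 * c 1 - z$2 * c 2) + (c 1 * x$1 + c 2 * x$2))"
    by (simp add: fun_eq_iff algebra_simps)
  have d: "(\<lambda>x :: real^2. x$i) differentiable at x" for i x
    using bipoly_differentiable[OF bipoly_coord[OF order_refl]] .
  have "partial j p x = c j" for j x
    by (subst pe) (use exhaust_2[of j] in \<open>auto simp: partial_add partial_cmult partial_coord d\<close>)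
  then have "partial j p = (\<lambda>x. c j)" for j
    by (rule ext)
  then show ?thesis
    unfolding hess_def by (simp only: partial_const) (simp add: fun_eq_iff vec_eq_iff)
qed

text \<open>Away from \<open>z\<close> the vector \<open>perp (x - z)\<close> is nonzero, and a
  symmetrized product of two vectors vanishes only if one of them does. The point \<open>z\<close>
  itself is covered because a polynomial vanishing on an open set is 0.\<close>

lemma Rfield_zero:
  assumes q: "q \<in> Pvec m UNIV" and 0: "Rfield z q = (\<lambda>_. 0)"
  shows "q = 0"
proof -
  have z: "q x $ i = 0" if "x \<noteq> z" for x i
  proof -
    define y where "y = x - z"
    have y: "y$1 \<noteq> 0 \<or> y$2 \<noteq> 0"
      using that by (simp add: y_def vec_eq_iff forall_2)
    have "perp y $ i * q x $ j + perp y $ j * q x $ i = 0" for i j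
      using 0 Rfield_nth[of z q x i j] by (simp add: y_def)
    from this[of 1 1] this[of 2 2] this[of 1 2]
    have e: "y$2 * q x $ 1 = 0" "y$1 * q x $ 2 = 0" "y$1 * q x $ 1 = y$2 * q x $ 2"
      unfolding perp_nth by auto
    then have "q x $ 1 = 0 \<and> q x $ 2 = 0"
      using y by auto
    then show ?thesis
      using exhaust_2[of i] by auto
  qed
  have "(\<lambda>x. q x $ i) = (\<lambda>_. 0)" for i
    by (rule bipoly_zero_on_open[of _ m "- {z}" "z + axis 1 1"])
       (use q z in \<open>auto simp: Pvec_UNIV axis_eq_0_iff\<close>)
  then show ?thesis
    by (simp add: fun_eq_iff vec_eq_iff)
qed

text \<open>Hessians and complement meet only in 0: a symmetric field without \<open>rot\<close> is
  a Hessian, and a Hessian of the form \<open>Rfield z q\<close> vanishes.\<close>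

lemma rot_Rfield_inj:
  assumes "q \<in> Pvec m UNIV" "rot (Rfield z q) = (\<lambda>_. 0)"
  shows "q = 0"
proof -
  obtain p where "p \<in> bipoly (m + 1 + 2)" "hess p = Rfield z q"
    using rot_free_hess[OF Rfield_Psym[OF assms(1)] assms(2)] by blast
  then show ?thesis
    using Rfield_hess_zero Rfield_zero assms(1) by metis
qed

lemma lin_on_rot_Rfield: "lin_on (Pvec m UNIV) (\<lambda>q. rot (Rfield z q))"
proof (rule lin_onI)
  fix f g assume *: "f \<in> Pvec m UNIV" "g \<in> Pvec m UNIV"
  show "rot (Rfield z (f + g)) = rot (Rfield z f) + rot (Rfield z g)"
    by (simp only: linear_add[OF linear_Rfield] lin_on_add[OF lin_on_rot Rfield_Psym[OF *(1)] Rfield_Psym[OF *(2)]])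
next
  fix c f assume *: "f \<in> Pvec m UNIV"
  show "rot (Rfield z (c *\<^sub>R f)) = c *\<^sub>R rot (Rfield z f)"
    by (simp only: linear_scale[OF linear_Rfield] lin_on_scale[OF lin_on_rot Rfield_Psym[OF *]])
qed

lemma rot_Rfield_Pvec: "q \<in> Pvec m UNIV \<Longrightarrow> rot (Rfield z q) \<in> Pvec m UNIV"
  using rot_Pvec[OF Rfield_Psym, of q m z] by simp

text \<open>\<open>Rfield\<close> raises the degree by one and \<open>rot\<close> lowers it by one,
  so the composition is an endomorphism and injectivity is enough.\<close>

lemma rot_Rfield_surj: "(\<lambda>q. rot (Rfield z q)) ` Pvec m UNIV = Pvec m UNIV"
proof (rule inj_endo_surj[OF findim_Pvec lin_on_rot_Rfield])
  show "(\<lambda>q. rot (Rfield z q)) ` Pvec m UNIV \<subseteq> Pvec m UNIV"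
    using rot_Rfield_Pvec by blast
  show "f = 0" if "f \<in> Pvec m UNIV" "rot (Rfield z f) = 0" for f
    using rot_Rfield_inj[OF that(1)] that(2) by (simp add: zero_fun_def)
qed

section \<open>Scalar products and projections on the polygon\<close>

lemma L2_proj_eq:
  assumes i: "inner_on W (\<lambda>g h. I (\<lambda>x. g x \<bullet> h x))" and g: "g \<in> W" "\<And>h. h \<in> W \<Longrightarrow> I (\<lambda>x. g x \<bullet> h x) = I (\<lambda>x. f x \<bullet> h x)"
  shows "L2_proj I W f = g"
  unfolding L2_proj_def
proof (rule the_equality)
  interpret inner_on W "\<lambda>g h. I (\<lambda>x. g x \<bullet> h x)"
    by (rule i)
  fix g' assume "g' \<in> W \<and> (\<forall>h\<in>W. I (\<lambda>x. g' x \<bullet> h x) = I (\<lambda>x. f x \<bullet> h x))"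
  then show "g' = g"
    using g by (intro riesz_unique) auto
qed (use g in auto)

lemma L2_proj:
  assumes i: "inner_on W (\<lambda>g h. I (\<lambda>x. g x \<bullet> h x))" and fin: "findim W" and ll: "lin_on W (\<lambda>h. I (\<lambda>x. f x \<bullet> h x))"
  shows "L2_proj I W f \<in> W" "h \<in> W \<Longrightarrow> I (\<lambda>x. L2_proj I W f x \<bullet> h x) = I (\<lambda>x. f x \<bullet> h x)"
proof -
  interpret inner_on W "\<lambda>g h. I (\<lambda>x. g x \<bullet> h x)"
    by (rule i)
  obtain g where g: "g \<in> W" "\<And>h. h \<in> W \<Longrightarrow> I (\<lambda>x. g x \<bullet> h x) = I (\<lambda>x. f x \<bullet> h x)"
    using riesz[OF fin ll] by auto
  have "L2_proj I W f = g"
    by (rule L2_proj_eq[OF i g])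
  then show "L2_proj I W f \<in> W" "h \<in> W \<Longrightarrow> I (\<lambda>x. L2_proj I W f x \<bullet> h x) = I (\<lambda>x. f x \<bullet> h x)"
    using g by auto
qed

section \<open>Riesz representation over the polygon\<close>

context polygon
begin

text \<open>Fields extended by zero may be discontinuous across the boundary, so integrability is
  obtained from continuous functions that agree with them on \<open>T\<close>.\<close>

lemma lin_on_int_T:
  fixes f :: "real^2 \<Rightarrow> 'b::real_inner"
  assumes f: "continuous_on UNIV p" "\<And>x. x \<in> T \<Longrightarrow> f x = p x"
    and c: "\<And>g. g \<in> W \<Longrightarrow> \<exists>p. continuous_on UNIV p \<and> (\<forall>x\<in>T. g x = p x)"
  shows "lin_on W (\<lambda>h. int_T T (\<lambda>x. f x \<bullet> h x))"
proof (rule lin_onI)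
  fix g h assume gh: "g \<in> W" "h \<in> W"
  obtain u where u: "continuous_on UNIV u" "\<forall>x\<in>T. g x = u x"
    using c[OF gh(1)] by blast
  obtain v where v: "continuous_on UNIV v" "\<forall>x\<in>T. h x = v x"
    using c[OF gh(2)] by blast
  note uv = u v
  have 1: "int_T T (\<lambda>x. f x \<bullet> (g + h) x) = int_T T (\<lambda>x. p x \<bullet> u x + p x \<bullet> v x)"
    using uv f by (intro int_T_cong) (auto simp: inner_add_right)
  have 2: "int_T T (\<lambda>x. p x \<bullet> u x + p x \<bullet> v x) = int_T T (\<lambda>x. p x \<bullet> u x) + int_T T (\<lambda>x. p x \<bullet> v x)"
    using f uv by (intro int_T_add continuous_intros) auto
  have 3: "int_T T (\<lambda>x. f x \<bullet> g x) = int_T T (\<lambda>x. p x \<bullet> u x)"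
    using uv f by (intro int_T_cong) auto
  have 4: "int_T T (\<lambda>x. f x \<bullet> h x) = int_T T (\<lambda>x. p x \<bullet> v x)"
    using uv f by (intro int_T_cong) auto
  show "int_T T (\<lambda>x. f x \<bullet> (g + h) x) = int_T T (\<lambda>x. f x \<bullet> g x) + int_T T (\<lambda>x. f x \<bullet> h x)"
    by (simp only: 1 2 3 4)
qed (simp add: int_T_cmult)

lemma inner_on_T:
  fixes W :: "(real^2 \<Rightarrow> 'b::real_inner) set"
  assumes W: "subspace W" and c: "\<And>g. g \<in> W \<Longrightarrow> \<exists>p. continuous_on UNIV p \<and> (\<forall>x\<in>T. g x = p x)"
    and z: "\<And>g. g \<in> W \<Longrightarrow> (\<forall>x\<in>T. g x = 0) \<Longrightarrow> g = 0"
  shows "inner_on W (\<lambda>g h. int_T T (\<lambda>x. g x \<bullet> h x))"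
proof
  show "subspace W"
    by (rule W)
  show "int_T T (\<lambda>x. f x \<bullet> g x) = int_T T (\<lambda>x. g x \<bullet> f x)" for f g :: "real^2 \<Rightarrow> 'b"
    by (simp add: inner_commute)
  fix f assume f: "f \<in> W"
  obtain p where p: "continuous_on UNIV p" "\<And>x. x \<in> T \<Longrightarrow> f x = p x"
    using c[OF f] by blast
  show "lin_on W (\<lambda>h. int_T T (\<lambda>x. f x \<bullet> h x))"
    using p c by (rule lin_on_int_T)
  assume "int_T T (\<lambda>x. f x \<bullet> f x) = 0"
  moreover have "int_T T (\<lambda>x. f x \<bullet> f x) = int_T T (\<lambda>x. p x \<bullet> p x)"
    using p by (intro int_T_cong) auto
  ultimately have 0: "int_T T (\<lambda>x. p x \<bullet> p x) = 0"
    by simp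
  have "f x = 0" if "x \<in> T" for x
  proof -
    have "p x \<bullet> p x = 0"
      by (rule int_T_pos[OF _ _ 0 that]) (auto intro!: continuous_intros p(1))
    then show ?thesis
      using p(2)[OF that] by simp
  qed
  then show "f = 0"
    using z[OF f] by blast
qed

lemma inner_on_zext:
  fixes W :: "(real^2 \<Rightarrow> 'b::real_inner) set"
  assumes "subspace W" "\<And>g. g \<in> W \<Longrightarrow> \<exists>p. continuous_on UNIV p \<and> g = zext T p"
  shows "inner_on W (\<lambda>g h. int_T T (\<lambda>x. g x \<bullet> h x))"
proof (rule inner_on_T[OF assms(1)])
  fix g assume "g \<in> W"
  then obtain p where p: "continuous_on UNIV p" "g = zext T p"
    using assms(2) by blast
  then show "\<exists>p. continuous_on UNIV p \<and> (\<forall>x\<in>T. g x = p x)"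
    by (auto simp: zext_def)
  show "g = 0" if "\<forall>x\<in>T. g x = 0"
    using that p(2) by (auto simp: zext_def fun_eq_iff)
qed

lemma inner_on_P: "inner_on (P m T) (\<lambda>g h. int_T T (\<lambda>x. g x \<bullet> h x))"
  by (rule inner_on_zext[OF subspace_P]) (auto simp: P_def intro: bipoly_continuous)

lemma bipoly_zero_on_T: "p \<in> bipoly m \<Longrightarrow> (\<And>x. x \<in> T \<Longrightarrow> p x = 0) \<Longrightarrow> p = (\<lambda>_. 0)"
  using bipoly_zero_on_open[OF _ open_T] T_ne by blast

lemma inner_on_bipoly: "inner_on (bipoly m) (\<lambda>g h. int_T T (\<lambda>x. g x \<bullet> h x))"
proof (rule inner_on_T[OF subspace_bipoly])
  fix g :: "real^2 \<Rightarrow> real" assume g: "g \<in> bipoly m"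
  then show "\<exists>p. continuous_on UNIV p \<and> (\<forall>x\<in>T. g x = p x)"
    using bipoly_continuous by blast
  show "g = 0" if "\<forall>x\<in>T. g x = 0"
    using bipoly_zero_on_T[OF g] that by (simp add: zero_fun_def)
qed

lemma inner_on_Psym_UNIV: "inner_on (Psym m UNIV) (\<lambda>g h. int_T T (\<lambda>x. g x \<bullet> h x))"
proof (rule inner_on_T[OF subspace_Psym])
  fix g assume g: "g \<in> Psym m UNIV"
  then show "\<exists>p. continuous_on UNIV p \<and> (\<forall>x\<in>T. g x = p x)"
    using Psym_continuous by blast
  assume "\<forall>x\<in>T. g x = 0"
  then have "(\<lambda>x. g x $ i $ j) = (\<lambda>_. 0)" for i j
    using bipoly_zero_on_T[of "\<lambda>x. g x $ i $ j" m] g by (simp add: Psym_UNIV)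
  then show "g = 0"
    by (simp add: fun_eq_iff vec_eq_iff)
qed

lemma inner_on_Pvec_UNIV: "inner_on (Pvec m UNIV) (\<lambda>g h. int_T T (\<lambda>x. g x \<bullet> h x))"
proof (rule inner_on_T[OF subspace_Pvec])
  fix g assume g: "g \<in> Pvec m UNIV"
  then show "\<exists>p. continuous_on UNIV p \<and> (\<forall>x\<in>T. g x = p x)"
    using Pvec_continuous by blast
  assume "\<forall>x\<in>T. g x = 0"
  then have "(\<lambda>x. g x $ i) = (\<lambda>_. 0)" for i
    using bipoly_zero_on_T[of "\<lambda>x. g x $ i" m] g by (simp add: Pvec_UNIV)
  then show "g = 0"
    by (simp add: fun_eq_iff vec_eq_iff)
qed

text \<open>The solution is a restriction to \<open>T\<close> while the test functions live on the
  plane, exactly the shape of the definitions of \<open>C_sym_full\<close> and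
  \<open>DD\<close>.\<close>

lemma ex1_riesz_zext:
  fixes W :: "(real^2 \<Rightarrow> 'b::real_inner) set"
  assumes i: "inner_on W (\<lambda>g h. int_T T (\<lambda>x. g x \<bullet> h x))" and fin: "findim W" and ll: "lin_on W L"
  shows "\<exists>!g. g \<in> zext T ` W \<and> (\<forall>h\<in>W. int_T T (\<lambda>x. g x \<bullet> h x) = L h)"
proof -
  interpret inner_on W "\<lambda>g h. int_T T (\<lambda>x. g x \<bullet> h x)"
    by (rule i)
  have z: "int_T T (\<lambda>x. zext T g x \<bullet> h x) = int_T T (\<lambda>x. g x \<bullet> h x)" for g h :: "real^2 \<Rightarrow> 'b"
    by (intro int_T_cong) (simp add: zext_eq)
  obtain g where g: "g \<in> W" "\<And>h. h \<in> W \<Longrightarrow> int_T T (\<lambda>x. g x \<bullet> h x) = L h"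
    using riesz[OF fin ll] by auto
  show ?thesis
  proof (rule ex1I[of _ "zext T g"])
    fix g' assume g': "g' \<in> zext T ` W \<and> (\<forall>h\<in>W. int_T T (\<lambda>x. g' x \<bullet> h x) = L h)"
    then obtain u where u: "u \<in> W" "g' = zext T u"
      by auto
    have "u = g"
      using g' g u z by (intro riesz_unique) auto
    then show "g' = zext T g"
      using u by simp
  qed (use g z in auto)
qed

lemma findim_Hsp: "findim (Hsp m T)"
proof -
  have "Hsp m T = (\<lambda>q. zext T (hess q)) ` bipoly (m + 2)"
    by (auto simp: Hsp_def P_UNIV)
  moreover have "lin_on (bipoly (m + 2)) (\<lambda>q. zext T (hess q))"
    by (rule lin_onI) (simp_all only: lin_on_add[OF lin_on_hess] lin_on_scale[OF lin_on_hess] linear_add[OF linear_zext] linear_scale[OF linear_zext])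
  ultimately show ?thesis
    using findim_image[OF findim_bipoly] by metis
qed

lemma inner_on_Hsp: "inner_on (Hsp m T) (\<lambda>g h. int_T T (\<lambda>x. g x \<bullet> h x))"
  by (rule inner_on_zext[OF findim_subspace[OF findim_Hsp]])
     (auto simp: Hsp_def P_UNIV intro: Psym_continuous[OF hess_Psym])

lemma Hcsp_eq: "Hcsp m T z = (\<lambda>q. zext T (Rfield z q)) ` Pvec (m - 1) UNIV"
  by (auto simp: Hcsp_def Rfield_def)

lemma findim_Hcsp: "findim (Hcsp m T z)"
  unfolding Hcsp_eq
  by (rule findim_image[OF findim_Pvec], rule lin_onI)
     (simp_all only: linear_add[OF linear_Rfield] linear_scale[OF linear_Rfield] linear_add[OF linear_zext] linear_scale[OF linear_zext])

lemma inner_on_Hcsp: "inner_on (Hcsp m T z) (\<lambda>g h. int_T T (\<lambda>x. g x \<bullet> h x))"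
  by (rule inner_on_zext[OF findim_subspace[OF findim_Hcsp]])
     (auto simp: Hcsp_eq intro: Psym_continuous[OF Rfield_Psym])

end

section \<open>Polynomials on an edge\<close>

text \<open>Affine coordinate along a nondegenerate edge: a left inverse of \<open>gam E\<close>,
  defined on the whole plane.\<close>

definition lam :: "edge \<Rightarrow> real^2 \<Rightarrow> real" where
  "lam E x = ((x - fst E) \<bullet> (snd E - fst E)) / (len E)^2"

lemma lam_gam: "fst E \<noteq> snd E \<Longrightarrow> lam E (gam E s) = s"
  by (simp add: lam_def gam_def len_def power2_norm_eq_inner)

lemma lam_bipoly: "lam E \<in> bipoly 1"
proof -
  have "(\<lambda>x. (1 / (len E)^2) * ((snd E - fst E) $ 1 * (x$1 - fst E $ 1) + (snd E - fst E) $ 2 * (x$2 - fst E $ 2))) \<in> bipoly 1"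
    by (intro bipoly_cmult bipoly_add bipoly_diff bipoly_coord bipoly_const) auto
  moreover have "lam E = (\<lambda>x. (1 / (len E)^2) * ((snd E - fst E) $ 1 * (x$1 - fst E $ 1) + (snd E - fst E) $ 2 * (x$2 - fst E $ 2)))"
    by (simp add: lam_def fun_eq_iff inner_2 mult.commute)
  ultimately show ?thesis
    by simp
qed

lemma bipoly_gam: "f \<in> bipoly m \<Longrightarrow> \<exists>r. deg_le m r \<and> (\<forall>s. f (gam E s) = poly r s)"
  unfolding gam_def by (rule bipoly_on_line)

text \<open>Translates restrictions of bivariate polynomials into univariate ones with the same
  degree bound in the edge parameter; composition with \<open>lam E\<close> gives the converse
  direction.\<close>

lemma P_seg_iff:
  assumes E: "fst E \<noteq> snd E"
  shows "f \<in> P m (seg E) \<longleftrightarrow>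
    (\<forall>x. x \<notin> seg E \<longrightarrow> f x = 0) \<and> (\<exists>r. deg_le m r \<and> (\<forall>s\<in>{0..1}. f (gam E s) = poly r s))"
    (is "_ \<longleftrightarrow> ?R")
proof
  assume "f \<in> P m (seg E)"
  then obtain p where p: "p \<in> bipoly m" "f = zext (seg E) p"
    by (auto simp: P_def)
  obtain r where r: "deg_le m r" "\<forall>s. p (gam E s) = poly r s"
    using bipoly_gam[OF p(1)] by blast
  have "f (gam E s) = poly r s" if "s \<in> {0..1}" for s
    using r p that by (auto simp: zext_def seg_gam)
  then show ?R
    using r(1) p(2) by (auto simp: zext_def)
next
  assume ?R
  then obtain r where r: "\<forall>x. x \<notin> seg E \<longrightarrow> f x = 0" "deg_le m r" "\<forall>s\<in>{0..1}. f (gam E s) = poly r s"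
    by blast
  have "f x = zext (seg E) (\<lambda>x. poly r (lam E x)) x" for x
  proof (cases "x \<in> seg E")
    case True
    then obtain s where "s \<in> {0..1}" "x = gam E s"
      by (auto simp: seg_gam)
    then show ?thesis
      using r True lam_gam[OF E] by (simp add: zext_def)
  qed (use r in \<open>simp add: zext_def\<close>)
  then have "f = zext (seg E) (\<lambda>x. poly r (lam E x))"
    by (rule ext)
  then show "f \<in> P m (seg E)"
    unfolding P_def using poly_affine_bipoly[OF r(2) lam_bipoly] by blast
qed

lemma continuous_poly: "continuous_on S (\<lambda>s. poly (r :: real poly) s)"
  by (intro continuous_intros)

lemma P_seg_continuous:
  assumes "fst E \<noteq> snd E" "f \<in> P m (seg E)"
  shows "continuous_on {0..1} (\<lambda>s. f (gam E s))"
proof -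
  obtain r where "\<forall>s\<in>{0..1}. f (gam E s) = poly r s"
    using assms P_seg_iff by blast
  then show ?thesis
    using continuous_on_cong[of "{0..1}" "{0..1}" "\<lambda>s. f (gam E s)" "\<lambda>s. poly r s"] continuous_poly by auto
qed

lemma lin_on_int_E:
  assumes E: "fst E \<noteq> snd E" and f: "continuous_on {0..1} (\<lambda>s. f (gam E s))"
  shows "lin_on (P m (seg E)) (\<lambda>h. int_E E (\<lambda>x. f x \<bullet> h x))"
proof (rule lin_onI)
  fix g h assume "g \<in> P m (seg E)" "h \<in> P m (seg E)"
  then have "continuous_on {0..1} (\<lambda>s. f (gam E s) * g (gam E s))" "continuous_on {0..1} (\<lambda>s. f (gam E s) * h (gam E s))"
    using P_seg_continuous[OF E] f by (auto intro!: continuous_intros)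
  from I01_add[OF this] show "int_E E (\<lambda>x. f x \<bullet> (g + h) x) = int_E E (\<lambda>x. f x \<bullet> g x) + int_E E (\<lambda>x. f x \<bullet> h x)"
    by (simp add: int_E_I01 algebra_simps)
next
  fix c :: real and h assume "h \<in> P m (seg E)"
  show "int_E E (\<lambda>x. f x \<bullet> (c *\<^sub>R h) x) = c *\<^sub>R int_E E (\<lambda>x. f x \<bullet> h x)"
    using int_E_cmult[of E c "\<lambda>x. f x * h x"] by (simp add: algebra_simps)
qed

lemma inner_on_P_seg:
  assumes E: "fst E \<noteq> snd E"
  shows "inner_on (P m (seg E)) (\<lambda>g h. int_E E (\<lambda>x. g x \<bullet> h x))"
proof
  show "subspace (P m (seg E))"
    by (rule subspace_P)
  show "int_E E (\<lambda>x. f x \<bullet> g x) = int_E E (\<lambda>x. g x \<bullet> f x)" for f g :: "real^2 \<Rightarrow> real"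
    by (simp add: mult.commute)
  fix f assume f: "f \<in> P m (seg E)"
  note c = P_seg_continuous[OF E f]
  show "lin_on (P m (seg E)) (\<lambda>h. int_E E (\<lambda>x. f x \<bullet> h x))"
    using E c by (rule lin_on_int_E)
  assume "int_E E (\<lambda>x. f x \<bullet> f x) = 0"
  then have "I01 (\<lambda>s. f (gam E s) * f (gam E s)) = 0"
    using len_pos[OF E] by (simp add: int_E_I01)
  then have "f (gam E s) * f (gam E s) = 0" if "s \<in> {0..1}" for s
    using that c by (intro I01_pos[where f = "\<lambda>s. f (gam E s) * f (gam E s)"]) (auto intro!: continuous_intros)
  then have "f x = 0" for x
    using f P_seg_iff[OF E, of f m] by (cases "x \<in> seg E") (auto simp: seg_gam)
  then show "f = 0"
    by (simp add: fun_eq_iff)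
qed

text \<open>Projections on edges become moment conditions on the unit interval; the positive factor
  \<open>len E\<close> drops out.\<close>

lemma proj_E_iff:
  assumes E: "fst E \<noteq> snd E" and f: "continuous_on {0..1} (\<lambda>s. f (gam E s))"
  shows "proj_E m E f = g \<longleftrightarrow> g \<in> P m (seg E) \<and>
     (\<forall>r. deg_le m r \<longrightarrow> I01 (\<lambda>s. g (gam E s) * poly r s) = I01 (\<lambda>s. f (gam E s) * poly r s))"
proof -
  have test: "(\<forall>h\<in>P m (seg E). int_E E (\<lambda>x. g x \<bullet> h x) = int_E E (\<lambda>x. f x \<bullet> h x)) \<longleftrightarrow>
      (\<forall>r. deg_le m r \<longrightarrow> I01 (\<lambda>s. g (gam E s) * poly r s) = I01 (\<lambda>s. f (gam E s) * poly r s))" for g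
  proof (intro iffI allI impI ballI)
    fix r assume *: "\<forall>h\<in>P m (seg E). int_E E (\<lambda>x. g x \<bullet> h x) = int_E E (\<lambda>x. f x \<bullet> h x)" "deg_le m r"
    have "zext (seg E) (\<lambda>x. poly r (lam E x)) \<in> P m (seg E)"
      using poly_affine_bipoly[OF *(2) lam_bipoly] by (auto simp: P_def)
    with *(1) have e: "int_E E (\<lambda>x. g x \<bullet> zext (seg E) (\<lambda>x. poly r (lam E x)) x) = int_E E (\<lambda>x. f x \<bullet> zext (seg E) (\<lambda>x. poly r (lam E x)) x)"
      by blast
    have "I01 (\<lambda>s. u (gam E s) \<bullet> zext (seg E) (\<lambda>x. poly r (lam E x)) (gam E s)) = I01 (\<lambda>s. u (gam E s) * poly r s)" for u
      by (rule I01_cong) (auto simp: zext_def seg_gam lam_gam[OF E])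
    then show "I01 (\<lambda>s. g (gam E s) * poly r s) = I01 (\<lambda>s. f (gam E s) * poly r s)"
      using e len_pos[OF E] by (simp add: int_E_I01)
  next
    fix h assume *: "\<forall>r. deg_le m r \<longrightarrow> I01 (\<lambda>s. g (gam E s) * poly r s) = I01 (\<lambda>s. f (gam E s) * poly r s)" "h \<in> P m (seg E)"
    then obtain r where r: "deg_le m r" "\<forall>s\<in>{0..1}. h (gam E s) = poly r s"
      using P_seg_iff[OF E] by blast
    have "I01 (\<lambda>s. u (gam E s) * h (gam E s)) = I01 (\<lambda>s. u (gam E s) * poly r s)" for u
      by (rule I01_cong) (use r in auto)
    then show "int_E E (\<lambda>x. g x \<bullet> h x) = int_E E (\<lambda>x. f x \<bullet> h x)"
      using * r by (simp add: int_E_I01)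
  qed
  have i: "inner_on (P m (seg E)) (\<lambda>g h. int_E E (\<lambda>x. g x \<bullet> h x))"
    by (rule inner_on_P_seg[OF E])
  show ?thesis
    unfolding test[symmetric] proj_E_def
    using L2_proj[OF i findim_P lin_on_int_E[OF E f]] L2_proj_eq[where W = "P m (seg E)" and I = "int_E E" and f = f and g = g, OF i]
    by blast
qed

lemma proj_E:
  assumes "fst E \<noteq> snd E" "continuous_on {0..1} (\<lambda>s. f (gam E s))"
  shows "proj_E m E f \<in> P m (seg E)"
    "deg_le m r \<Longrightarrow> I01 (\<lambda>s. proj_E m E f (gam E s) * poly r s) = I01 (\<lambda>s. f (gam E s) * poly r s)"
  using proj_E_iff[OF assms, of m "proj_E m E f"] by auto

section \<open>Moments and boundary values of univariate polynomials\<close>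

text \<open>Polynomials as functions, so that the Riesz argument for spaces of functions
  applies.\<close>

definition polyfuns :: "int \<Rightarrow> (real \<Rightarrow> real) set" where
  "polyfuns m = {f. \<exists>r. deg_le m r \<and> f = poly r}"

lemma findim_polyfuns: "findim (polyfuns m)"
proof (rule findim_subset)
  show "findim (span ((\<lambda>i s. s ^ i) ` {..nat m} :: (real \<Rightarrow> real) set))"
    by (intro findim_span) simp
  show "subspace (polyfuns m)"
    unfolding subspace_def
  proof (intro conjI ballI allI)
    show "0 \<in> polyfuns m"
      unfolding polyfuns_def by (intro CollectI exI[of _ 0]) (auto simp: deg_le_0 fun_eq_iff)
    show "f + g \<in> polyfuns m" if fg: "f \<in> polyfuns m" "g \<in> polyfuns m" for f g
    proof -
      obtain r q where "deg_le m r" "f = poly r" "deg_le m q" "g = poly q"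
        using fg by (auto simp: polyfuns_def)
      then show ?thesis
        unfolding polyfuns_def by (intro CollectI exI[of _ "r + q"]) (auto simp: deg_le_add fun_eq_iff)
    qed
    show "c *\<^sub>R f \<in> polyfuns m" if fg: "f \<in> polyfuns m" for c f
    proof -
      obtain r where "deg_le m r" "f = poly r"
        using fg by (auto simp: polyfuns_def)
      then show ?thesis
        unfolding polyfuns_def by (intro CollectI exI[of _ "smult c r"]) (auto simp: deg_le_smult fun_eq_iff)
    qed
  qed
  show "polyfuns m \<subseteq> span ((\<lambda>i s. s ^ i) ` {..nat m})"
  proof
    fix f assume "f \<in> polyfuns m"
    then obtain r where r: "deg_le m r" "f = poly r"
      by (auto simp: polyfuns_def)
    have f: "f = (\<Sum>i\<le>degree r. coeff r i *\<^sub>R (\<lambda>s. s ^ i))"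
      using r(2) by (simp add: fun_eq_iff sum_fun_apply poly_altdef)
    have c: "coeff r i *\<^sub>R (\<lambda>s. s ^ i) \<in> span ((\<lambda>i s. s ^ i) ` {..nat m})" for i
    proof (cases "coeff r i = 0")
      case True
      then show ?thesis
        by (simp add: span_0)
    next
      case False
      then have "\<not> m < int i"
        using r(1) unfolding deg_le_def by auto
      then have "i \<le> nat m"
        by simp
      then show ?thesis
        by (intro span_scale span_base) auto
    qed
    show "f \<in> span ((\<lambda>i s. s ^ i) ` {..nat m})"
      unfolding f by (rule span_sum) (rule c)
  qed
qed

text \<open>A weight that is positive in the open interval defines a scalar product on polynomials,
  even if it vanishes at the ends, since a polynomial that is 0 on the open interval is 0. The
  moments of \<open>f\<close> are a linear functional for it.\<close>

lemma weighted_moments: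
  fixes w :: "real poly"
  assumes w: "\<And>s. 0 < s \<Longrightarrow> s < 1 \<Longrightarrow> poly w s > 0" and f: "continuous_on {0..1} f"
  shows "\<exists>u. deg_le m u \<and> (\<forall>r. deg_le m r \<longrightarrow> I01 (\<lambda>s. poly w s * poly u s * poly r s) = I01 (\<lambda>s. f s * poly r s))"
proof -
  have w0: "poly w s \<ge> 0" if "s \<in> {0..1}" for s
  proof -
    have "closure {0<..<1::real} = {0..1}"
      by simp
    then have "s \<in> closure {0<..<1}"
      using that by simp
    then show ?thesis
      by (rule continuous_ge_on_closure[rotated]) (auto intro!: continuous_intros less_imp_le w)
  qed
  have lin': "lin_on (polyfuns m) (\<lambda>h. I01 (\<lambda>s. g s * h s))" if g: "continuous_on {0..1} g" for g
  proof (rule lin_onI)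
    fix u v assume "u \<in> polyfuns m" "v \<in> polyfuns m"
    then have "continuous_on {0..1} (\<lambda>s. g s * u s)" "continuous_on {0..1} (\<lambda>s. g s * v s)"
      using g by (auto simp: polyfuns_def intro!: continuous_intros)
    from I01_add[OF this] show "I01 (\<lambda>s. g s * (u + v) s) = I01 (\<lambda>s. g s * u s) + I01 (\<lambda>s. g s * v s)"
      by (simp add: algebra_simps)
  next
    fix c :: real and u assume "u \<in> polyfuns m"
    show "I01 (\<lambda>s. g s * (c *\<^sub>R u) s) = c *\<^sub>R I01 (\<lambda>s. g s * u s)"
      using I01_cmult[of c "\<lambda>s. g s * u s"] by (simp add: algebra_simps)
  qed
  have i: "inner_on (polyfuns m) (\<lambda>g h. I01 (\<lambda>s. poly w s * g s * h s))"
  proof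
    show "subspace (polyfuns m)"
      by (rule findim_subspace[OF findim_polyfuns])
    show "I01 (\<lambda>s. poly w s * g s * h s) = I01 (\<lambda>s. poly w s * h s * g s)" for g h
      by (simp add: mult.assoc mult.commute[of "g _"])
    fix g assume g: "g \<in> polyfuns m"
    then obtain r where r: "g = poly r"
      by (auto simp: polyfuns_def)
    show "lin_on (polyfuns m) (\<lambda>h. I01 (\<lambda>s. poly w s * g s * h s))"
      by (rule lin') (auto simp: r intro!: continuous_intros)
    assume 0: "I01 (\<lambda>s. poly w s * g s * g s) = 0"
    have "poly r s = 0" if "s \<in> {0<..<1}" for s
    proof -
      have "poly w s * g s * g s = 0"
      proof (rule I01_pos[OF _ _ 0])
        show "poly w s * g s * g s \<ge> 0" if "s \<in> {0..1}" for s
          using mult_nonneg_nonneg[OF w0[OF that] zero_le_square[of "g s"]] by (simp add: mult.assoc)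
      qed (use that in \<open>auto simp: r intro!: continuous_intros\<close>)
      then show ?thesis
        using w[of s] that r by auto
    qed
    then have "r = 0"
      using poly_zero_on_interval[of 0 1 r] by simp
    then show "g = 0"
      using r by (simp add: fun_eq_iff)
  qed
  obtain u where u: "u \<in> polyfuns m" "\<forall>h\<in>polyfuns m. I01 (\<lambda>s. poly w s * u s * h s) = I01 (\<lambda>s. f s * h s)"
    using inner_on.riesz[OF i findim_polyfuns lin'[OF f]] by auto
  then obtain r where "deg_le m r" "u = poly r"
    by (auto simp: polyfuns_def)
  moreover have "poly q \<in> polyfuns m" if "deg_le m q" for q
    using that by (auto simp: polyfuns_def)
  ultimately show ?thesis
    using u(2) by (intro exI[of _ r]) auto
qed

text \<open>Adding a multiple of it leaves endpoint values untouched, adding a multiple of its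
  square also endpoint derivatives; these are the corrections by which moments are adjusted.\<close>

definition bubble :: "real poly" where "bubble = [:0, 1:] * [:1, -1:]"

lemma poly_bubble: "poly bubble s = s * (1 - s)" and poly_pderiv_bubble: "poly (pderiv bubble) s = 1 - 2 * s"
  and deg_le_bubble: "deg_le 2 bubble"
  by (simp_all add: bubble_def pderiv_mult pderiv_pCons deg_le_iff algebra_simps)

lemma bubble_factor:
  assumes "deg_le m e" "poly e 0 = 0" "poly e 1 = 0"
  shows "\<exists>u. deg_le (m - 2) u \<and> e = bubble * u"
proof -
  obtain a where a: "e = [:0, 1:] * a"
    using assms(2) poly_eq_0_iff_dvd[of e 0] by (auto elim: dvdE)
  have "poly a 1 = 0"
    using assms(3) a by simp
  then obtain b where b: "a = [:-1, 1:] * b"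
    using poly_eq_0_iff_dvd[of a 1] by (auto elim: dvdE)
  have e: "e = bubble * (- b)"
    unfolding a b bubble_def by (simp add: algebra_simps)
  have "deg_le (m - 2) (- b)"
  proof (cases "b = 0")
    case False
    then have nz: "[:-1, 1:] * b \<noteq> 0"
      by (metis mult_eq_0_iff pCons_eq_0_iff zero_neq_one)
    have "degree e = 2 + degree b"
      unfolding a b using degree_mult_eq[OF _ nz, of "[:0, 1:]"] degree_mult_eq[OF _ False, of "[:-1, 1:]"]
      by (simp del: mult_pCons_left)
    moreover have "e \<noteq> 0"
      unfolding a b using nz by (metis mult_eq_0_iff pCons_eq_0_iff zero_neq_one)
    ultimately show ?thesis
      using assms(1) by (auto simp: deg_le_iff)
  qed (simp add: deg_le_0)
  then show ?thesis
    using e by blast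
qed

lemma bubble_power_pos: "0 < s \<Longrightarrow> s < 1 \<Longrightarrow> poly (bubble ^ n) s > 0"
  by (simp add: poly_bubble)

text \<open>Testing with \<open>u\<close> itself, the integrand is a nonnegative weight times a
  square.\<close>

lemma moments_zero:
  assumes "deg_le m u" "\<And>r. deg_le m r \<Longrightarrow> I01 (\<lambda>s. poly (bubble ^ n * u) s * poly r s) = 0"
  shows "u = 0"
proof -
  have 0: "I01 (\<lambda>s. poly (bubble ^ n * u) s * poly u s) = 0"
    using assms by blast
  have "poly u s = 0" if "s \<in> {0<..<1}" for s
  proof -
    have "poly (bubble ^ n * u) s * poly u s = 0"
      using that by (intro I01_pos[OF _ _ 0]) (auto simp: poly_bubble mult.assoc intro!: continuous_intros mult_nonneg_nonneg)
    then show ?thesis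
      using that by (auto simp: poly_bubble)
  qed
  then show ?thesis
    using poly_zero_on_interval[of 0 1 u] by simp
qed

lemma moments_fit:
  assumes f: "continuous_on {0..1} f"
  shows "\<exists>u. deg_le m u \<and> (\<forall>r. deg_le m r \<longrightarrow> I01 (\<lambda>s. poly (r0 + bubble ^ n * u) s * poly r s) = I01 (\<lambda>s. f s * poly r s))"
proof -
  have "continuous_on {0..1} (\<lambda>s. f s - poly r0 s)"
    using f by (intro continuous_intros)
  from weighted_moments[where w = "bubble ^ n" and m = m, OF bubble_power_pos this]
  obtain u where u: "deg_le m u" "\<And>r. deg_le m r \<Longrightarrow> I01 (\<lambda>s. poly (bubble ^ n) s * poly u s * poly r s) = I01 (\<lambda>s. (f s - poly r0 s) * poly r s)"
    by blast
  have "I01 (\<lambda>s. poly (r0 + bubble ^ n * u) s * poly r s) = I01 (\<lambda>s. f s * poly r s)" if "deg_le m r" for r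
  proof -
    have "I01 (\<lambda>s. poly (r0 + bubble ^ n * u) s * poly r s) = I01 (\<lambda>s. poly r0 s * poly r s + poly (bubble ^ n) s * poly u s * poly r s)"
      by (rule I01_cong) (simp add: algebra_simps)
    also have "\<dots> = I01 (\<lambda>s. poly r0 s * poly r s) + I01 (\<lambda>s. poly (bubble ^ n) s * poly u s * poly r s)"
      by (intro I01_add continuous_intros)
    also have "I01 (\<lambda>s. poly (bubble ^ n) s * poly u s * poly r s) = I01 (\<lambda>s. f s * poly r s - poly r0 s * poly r s)"
      unfolding u(2)[OF that] by (rule I01_cong) (simp add: algebra_simps)
    also have "\<dots> = I01 (\<lambda>s. f s * poly r s) - I01 (\<lambda>s. poly r0 s * poly r s)"
      using f by (intro I01_diff continuous_intros)
    finally show ?thesis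
      by simp
  qed
  then show ?thesis
    using u(1) by blast
qed

text \<open>Linear interpolation of the end values corrected by \<open>bubble * u\<close>, with
  \<open>u\<close> determined by the moments. The bound on \<open>m\<close> makes room for the
  linear part.\<close>

lemma lagrange_fit:
  assumes "m \<ge> -1" "continuous_on {0..1} f"
  shows "\<exists>b. deg_le (m + 2) b \<and> poly b 0 = a0 \<and> poly b 1 = a1 \<and>
    (\<forall>r. deg_le m r \<longrightarrow> I01 (\<lambda>s. poly b s * poly r s) = I01 (\<lambda>s. f s * poly r s))"
proof -
  let ?r0 = "[:a0, a1 - a0:]"
  obtain u where u: "deg_le m u" "\<forall>r. deg_le m r \<longrightarrow> I01 (\<lambda>s. poly (?r0 + bubble ^ 1 * u) s * poly r s) = I01 (\<lambda>s. f s * poly r s)"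
    using moments_fit[OF assms(2)] by blast
  have "deg_le (m + 2) (bubble ^ 1 * u)"
    using deg_le_mult[OF deg_le_bubble u(1)] by (simp add: add.commute)
  then have "deg_le (m + 2) (?r0 + bubble ^ 1 * u)"
    using assms(1) by (intro deg_le_add deg_le_linear) auto
  then show ?thesis
    using u(2) by (intro exI[of _ "?r0 + bubble ^ 1 * u"]) (auto simp: poly_bubble)
qed

lemma lagrange_unique:
  assumes "deg_le (m + 2) b" "poly b 0 = 0" "poly b 1 = 0" "\<And>r. deg_le m r \<Longrightarrow> I01 (\<lambda>s. poly b s * poly r s) = 0"
  shows "b = 0"
proof -
  obtain u where u: "deg_le m u" "b = bubble ^ 1 * u"
    using bubble_factor[OF assms(1-3)] by auto
  then show ?thesis
    using moments_zero[OF u(1), of 1] assms(4) by auto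
qed

lemma hermite_fit:
  assumes "m \<ge> 3" "continuous_on {0..1} f"
  shows "\<exists>b. deg_le m b \<and> poly b 0 = a0 \<and> poly b 1 = a1 \<and> poly (pderiv b) 0 = d0 \<and> poly (pderiv b) 1 = d1 \<and>
    (\<forall>r. deg_le (m - 4) r \<longrightarrow> I01 (\<lambda>s. poly b s * poly r s) = I01 (\<lambda>s. f s * poly r s))"
proof -
  \<comment> \<open>Cubic Hermite interpolant. The derivative of \<open>bubble\<close> is 1 at 0 and
    -1 at 1, so the linear factor must take the values \<open>d0 - (a1 - a0)\<close> at 0 and
    \<open>(a1 - a0) - d1\<close> at 1.\<close>
  define r0 where "r0 = [:a0, a1 - a0:] + bubble * [:d0 - (a1 - a0), 2 * (a1 - a0) - d0 - d1:]"
  obtain u where u: "deg_le (m - 4) u" "\<forall>r. deg_le (m - 4) r \<longrightarrow> I01 (\<lambda>s. poly (r0 + bubble ^ 2 * u) s * poly r s) = I01 (\<lambda>s. f s * poly r s)"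
    using moments_fit[OF assms(2)] by blast
  have "deg_le 3 r0"
    unfolding r0_def using deg_le_mult[OF deg_le_bubble deg_le_linear[OF order_refl]]
    by (intro deg_le_add) (auto intro: deg_le_linear)
  moreover have "deg_le (2 + 2 + (m - 4)) (bubble ^ 2 * u)"
    unfolding power2_eq_square by (intro deg_le_mult deg_le_bubble u)
  ultimately have "deg_le m (r0 + bubble ^ 2 * u)"
    using assms(1) by (intro deg_le_add) (auto elim: deg_le_mono)
  moreover have "poly r0 0 = a0" "poly r0 1 = a1" "poly (pderiv r0) 0 = d0" "poly (pderiv r0) 1 = d1"
    by (simp_all add: r0_def pderiv_add pderiv_mult pderiv_smult pderiv_pCons poly_bubble poly_pderiv_bubble)
  moreover have "poly (bubble ^ 2 * u) 0 = 0" "poly (bubble ^ 2 * u) 1 = 0" "poly (pderiv (bubble ^ 2 * u)) 0 = 0" "poly (pderiv (bubble ^ 2 * u)) 1 = 0"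
    by (simp_all add: power2_eq_square pderiv_mult poly_bubble)
  ultimately show ?thesis
    using u(2) by (intro exI[of _ "r0 + bubble ^ 2 * u"]) (auto simp: pderiv_add)
qed

text \<open>The four end conditions split off \<open>bubble ^ 2\<close>, leaving a factor of degree
  at most \<open>m - 4\<close> whose weighted moments up to that degree vanish.\<close>

lemma hermite_unique:
  assumes "deg_le m b" "poly b 0 = 0" "poly b 1 = 0" "poly (pderiv b) 0 = 0" "poly (pderiv b) 1 = 0"
    "\<And>r. deg_le (m - 4) r \<Longrightarrow> I01 (\<lambda>s. poly b s * poly r s) = 0"
  shows "b = 0"
proof -
  obtain u where u: "deg_le (m - 2) u" "b = bubble * u"
    using bubble_factor[OF assms(1-3)] by auto
  have "poly u 0 = 0" "poly u 1 = 0"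
    using assms(4,5) unfolding u(2) by (simp_all add: pderiv_mult poly_bubble poly_pderiv_bubble)
  then obtain v where v: "deg_le (m - 4) v" "u = bubble * v"
    using bubble_factor[OF u(1)] by auto
  have b: "b = bubble ^ 2 * v"
    by (simp add: u v power2_eq_square mult.assoc)
  have "v = 0"
    by (rule moments_zero[OF v(1), of 2]) (use assms(6) b in auto)
  then show ?thesis
    by (simp add: b)
qed

section \<open>Polynomial curves and tangential derivatives\<close>

definition curve :: "(2 \<Rightarrow> real poly) \<Rightarrow> real \<Rightarrow> real^2" where
  "curve p s = (\<chi> i. poly (p i) s)"

definition on_edge :: "edge \<Rightarrow> (real^2 \<Rightarrow> real^2) \<Rightarrow> (2 \<Rightarrow> real poly) \<Rightarrow> bool" where
  "on_edge E w p \<longleftrightarrow> (\<forall>s\<in>{0..1}. w (gam E s) = curve p s)"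

text \<open>The factor converts the derivative in the edge parameter into one with respect to arc
  length.\<close>

definition dcurve :: "edge \<Rightarrow> (2 \<Rightarrow> real poly) \<Rightarrow> 2 \<Rightarrow> real poly" where
  "dcurve E p = (\<lambda>i. smult (1 / len E) (pderiv (p i)))"

lemma curve_nth [simp]: "curve p s $ i = poly (p i) s"
  by (simp add: curve_def)

lemma on_edge_nth: "on_edge E w p \<Longrightarrow> s \<in> {0..1} \<Longrightarrow> w (gam E s) $ i = poly (p i) s"
  by (simp add: on_edge_def)

lemma has_vector_derivative_curve:
  "(curve p has_vector_derivative curve (\<lambda>i. pderiv (p i)) s) (at s)"
  unfolding has_vector_derivative_def
  by (subst has_derivative_componentwise_within)
     (auto simp: Basis_vec_def inner_axis intro!: poly_DERIV[THEN has_field_derivative_imp_has_derivative, THEN has_derivative_eq_rhs])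

text \<open>At parameter \<open>s\<close> the admissible displacements form an interval of positive
  length containing 0, as an end if \<open>s\<close> is 0 or 1. On it vector derivatives are unique,
  so the polynomial representation may be differentiated.\<close>

lemma deriv_t_on_edge:
  assumes E: "fst E \<noteq> snd E" and w: "on_edge E w p"
  shows "on_edge E (deriv_t E w) (dcurve E p)"
  unfolding on_edge_def
proof
  fix s :: real assume s: "s \<in> {0..1}"
  note l = len_pos[OF E]
  have g: "gam E s + u *\<^sub>R tangent E = gam E (s + u / len E)" for u
    using l by (simp add: gam_def tangent_len[symmetric] algebra_simps)
  have seg: "gam E u \<in> seg E \<longleftrightarrow> u \<in> {0..1}" for u
    using gam_inj[OF E] by (auto simp: seg_gam)
  have S: "{u. gam E s + u *\<^sub>R tangent E \<in> seg E} = cbox (- s * len E) ((1 - s) * len E)"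
    unfolding g seg using l by (auto simp: field_simps)
  have "((\<lambda>u. s + u / len E) has_vector_derivative 1 / len E) (at 0 within cbox (- s * len E) ((1 - s) * len E))"
    unfolding has_real_derivative_iff_has_vector_derivative[symmetric] using l by (auto intro!: derivative_eq_intros)
  then have "((curve p \<circ> (\<lambda>u. s + u / len E)) has_vector_derivative (1 / len E) *\<^sub>R curve (\<lambda>i. pderiv (p i)) s) (at 0 within cbox (- s * len E) ((1 - s) * len E))"
    by (rule vector_diff_chain_within) (auto intro!: has_vector_derivative_at_within has_vector_derivative_curve)
  then have "((\<lambda>u. w (gam E s + u *\<^sub>R tangent E)) has_vector_derivative (1 / len E) *\<^sub>R curve (\<lambda>i. pderiv (p i)) s) (at 0 within cbox (- s * len E) ((1 - s) * len E))"
  proof (rule has_vector_derivative_transform[rotated 2])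
    show "0 \<in> cbox (- s * len E) ((1 - s) * len E)"
      using s l by (auto simp: mult_nonneg_nonneg)
    fix u assume "u \<in> cbox (- s * len E) ((1 - s) * len E)"
    then have "s + u / len E \<in> {0..1}"
      using l by (auto simp: field_simps)
    then show "w (gam E s + u *\<^sub>R tangent E) = (curve p \<circ> (\<lambda>u. s + u / len E)) u"
      using w by (simp add: g on_edge_def)
  qed
  then have "vector_derivative (\<lambda>u. w (gam E s + u *\<^sub>R tangent E)) (at 0 within cbox (- s * len E) ((1 - s) * len E)) = (1 / len E) *\<^sub>R curve (\<lambda>i. pderiv (p i)) s"
    using s l by (intro vector_derivative_within_cbox) (auto simp: mult_nonneg_nonneg algebra_simps)
  then have "deriv_t E w (gam E s) = (1 / len E) *\<^sub>R curve (\<lambda>i. pderiv (p i)) s"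
    using s by (simp add: deriv_t_def seg S)
  then show "deriv_t E w (gam E s) = curve (dcurve E p) s"
    by (simp add: vec_eq_iff dcurve_def)
qed

lemma deriv_t_out: "x \<notin> seg E \<Longrightarrow> deriv_t E w x = 0"
  by (simp add: deriv_t_def)

lemma Pvec_seg_iff:
  assumes E: "fst E \<noteq> snd E"
  shows "zext (seg E) w \<in> Pvec m (seg E) \<longleftrightarrow> (\<exists>p. (\<forall>i. deg_le m (p i)) \<and> on_edge E w p)"
proof -
  have "gam E s \<in> seg E" if "s \<in> {0..1}" for s
    using that by (auto simp: seg_gam)
  then have "zext (seg E) w \<in> Pvec m (seg E) \<longleftrightarrow> (\<forall>i. \<exists>r. deg_le m r \<and> (\<forall>s\<in>{0..1}. w (gam E s) $ i = poly r s))"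
    unfolding Pvec_def by (auto simp: P_seg_iff[OF E] zext_def)
  also have "\<dots> \<longleftrightarrow> (\<exists>p. \<forall>i. deg_le m (p i) \<and> (\<forall>s\<in>{0..1}. w (gam E s) $ i = poly (p i) s))"
    by (rule choice_iff)
  finally show ?thesis
    by (auto simp: on_edge_def vec_eq_iff)
qed

lemma deg_le_dcurve: "deg_le m (p i) \<Longrightarrow> deg_le (m - 1) (dcurve E p i)"
  by (simp add: dcurve_def deg_le_smult deg_le_pderiv)

section \<open>The boundary function of a discrete vector field\<close>

text \<open>\<open>z\<close> stands for \<open>x\<^sub>T\<close>, the center of the complement
  space.\<close>

locale discrete_complex = contractible_polygon +
  fixes k :: int and z :: "real^2"
  assumes k: "k \<ge> 3"
begin

text \<open>The property described in \<open>v_bdry\<close>, named so that any candidate can be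
  checked against it.\<close>

definition bd_fun :: "disc_V \<Rightarrow> (real^2 \<Rightarrow> real^2) \<Rightarrow> bool" where
  "bd_fun v w \<longleftrightarrow>
     continuous_on (frontier T) w \<and> (\<forall>x. x \<notin> frontier T \<longrightarrow> w x = 0) \<and>
     (\<forall>E\<in>Es. zext (seg E) w \<in> Pvec k (seg E) \<and>
             proj_vec_E (k - 4) E w = v_E v E \<and>
             (\<forall>V\<in>ends E. deriv_t E w V = G_V v V *v tangent E)) \<and>
     (\<forall>V\<in>verts Es. w V = v_V v V)"

lemma v_bdry_The: "v_bdry T Es k v = (THE w. bd_fun v w)"
  by (simp add: v_bdry_def bd_fun_def)

lemma bd_fun_on_edge:
  assumes "bd_fun v w" "E \<in> Es"
  shows "\<exists>p. (\<forall>i. deg_le k (p i)) \<and> on_edge E w p"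
  using assms Pvec_seg_iff[OF edge_ne[OF assms(2)], of w k] unfolding bd_fun_def by blast

lemma on_edge_continuous:
  assumes "on_edge E w p"
  shows "continuous_on {0..1} (\<lambda>s. w (gam E s) $ i)" "continuous_on {0..1} (\<lambda>s. w (gam E s))"
proof -
  show *: "continuous_on {0..1} (\<lambda>s. w (gam E s) $ i)" for i
    using continuous_on_cong[of "{0..1}" "{0..1}" "\<lambda>s. w (gam E s) $ i" "\<lambda>s. poly (p i) s"] continuous_poly
      on_edge_nth[OF assms] by auto
  show "continuous_on {0..1} (\<lambda>s. w (gam E s))"
    using * by (rule continuous_vec)
qed

lemma proj_vec_E_moments:
  assumes E: "fst E \<noteq> snd E" and w: "on_edge E w p" and r: "deg_le m r"
  shows "I01 (\<lambda>s. poly (p i) s * poly r s) = I01 (\<lambda>s. proj_vec_E m E w (gam E s) $ i * poly r s)"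
proof -
  have "I01 (\<lambda>s. proj_E m E (\<lambda>y. w y $ i) (gam E s) * poly r s) = I01 (\<lambda>s. w (gam E s) $ i * poly r s)"
    by (rule proj_E(2)[OF E on_edge_continuous(1)[OF w] r])
  also have "\<dots> = I01 (\<lambda>s. poly (p i) s * poly r s)"
    by (rule I01_cong) (simp add: on_edge_nth[OF w])
  finally show ?thesis
    by (simp add: proj_vec_E_def)
qed

text \<open>On an edge two candidates have the same end values, end derivatives and moments up to
  degree \<open>k - 4\<close>, so Hermite uniqueness applies componentwise.\<close>

lemma bd_fun_unique:
  assumes w: "bd_fun v w" and w': "bd_fun v w'"
  shows "w = w'"
proof
  fix x
  show "w x = w' x"
  proof (cases "x \<in> frontier T")
    case True
    then obtain E where E: "E \<in> Es" "x \<in> seg E"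
      unfolding frontier_T by auto
    note ne = edge_ne[OF E(1)]
    obtain s where s: "s \<in> {0..1}" "x = gam E s"
      using E by (auto simp: seg_gam)
    obtain p where p: "\<And>i. deg_le k (p i)" "on_edge E w p"
      using bd_fun_on_edge[OF w E(1)] by blast
    obtain p' where p': "\<And>i. deg_le k (p' i)" "on_edge E w' p'"
      using bd_fun_on_edge[OF w' E(1)] by blast
    have V: "fst E \<in> verts Es" "snd E \<in> verts Es" "fst E \<in> ends E" "snd E \<in> ends E"
      using E(1) by (auto simp: verts_def ends_def)
    have "w V = w' V" if "V \<in> verts Es" for V
      using w w' that by (auto simp: bd_fun_def)
    then have val: "curve p u = curve p' u" if "u \<in> {0,1}" for u
      using p(2) p'(2) V that unfolding on_edge_def by (metis atLeastAtMost_iff gam_0 gam_1 insertE order_refl singletonD zero_le_one)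
    have "deriv_t E w V = deriv_t E w' V" if "V \<in> ends E" for V
      using w w' E(1) that by (auto simp: bd_fun_def)
    then have der: "curve (dcurve E p) u = curve (dcurve E p') u" if "u \<in> {0,1}" for u
      using deriv_t_on_edge[OF ne p(2)] deriv_t_on_edge[OF ne p'(2)] V that
      unfolding on_edge_def by (metis atLeastAtMost_iff gam_0 gam_1 insertE order_refl singletonD zero_le_one)
    have "proj_vec_E (k - 4) E w = proj_vec_E (k - 4) E w'"
      using w w' E(1) by (auto simp: bd_fun_def)
    then have mom: "I01 (\<lambda>s. poly (p i) s * poly r s) = I01 (\<lambda>s. poly (p' i) s * poly r s)" if "deg_le (k - 4) r" for i r
      using proj_vec_E_moments[OF ne p(2) that] proj_vec_E_moments[OF ne p'(2) that] by simp
    have "p i - p' i = 0" for i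
    proof (rule hermite_unique)
      show "deg_le k (p i - p' i)"
        using p p' by (intro deg_le_diff)
      show "poly (p i - p' i) 0 = 0" "poly (p i - p' i) 1 = 0"
        using val[of 0] val[of 1] by (auto simp: vec_eq_iff)
      have "poly (dcurve E p i) u = poly (dcurve E p' i) u" if "u \<in> {0,1}" for u
        using der[OF that] by (auto simp: vec_eq_iff)
      then show "poly (pderiv (p i - p' i)) 0 = 0" "poly (pderiv (p i - p' i)) 1 = 0"
        using len_pos[OF ne] by (auto simp: dcurve_def pderiv_diff)
      fix r assume r: "deg_le (k - 4) r"
      have "I01 (\<lambda>s. poly (p i - p' i) s * poly r s) = I01 (\<lambda>s. poly (p i) s * poly r s - poly (p' i) s * poly r s)"
        by (rule I01_cong) (simp add: algebra_simps)
      also have "\<dots> = 0"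
        using mom[OF r, of i] by (subst I01_diff) (auto intro!: continuous_intros)
      finally show "I01 (\<lambda>s. poly (p i - p' i) s * poly r s) = 0" .
    qed
    then have "p = p'"
      by (simp add: fun_eq_iff)
    then show ?thesis
      using p(2) p'(2) s by (simp add: on_edge_def)
  qed (use w w' in \<open>auto simp: bd_fun_def\<close>)
qed

lemma v_bdry_eq: "bd_fun v w \<Longrightarrow> v_bdry T Es k v = w"
  unfolding v_bdry_The using bd_fun_unique by (intro the_equality) auto

lemma glue_edges:
  assumes p: "\<And>E. E \<in> Es \<Longrightarrow> curve (p E) 0 = a (fst E)" "\<And>E. E \<in> Es \<Longrightarrow> curve (p E) 1 = a (snd E)"
  shows "\<exists>w. continuous_on (frontier T) w \<and> (\<forall>x. x \<notin> frontier T \<longrightarrow> w x = 0) \<and>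
    (\<forall>E\<in>Es. on_edge E w (p E)) \<and> (\<forall>V\<in>verts Es. w V = a V)"
proof -
  \<comment> \<open>The chosen edge is ambiguous only at vertices, where all curves take the
    prescribed value.\<close>
  define w where "w x = (if x \<in> frontier T then let E = (SOME E. E \<in> Es \<and> x \<in> seg E) in curve (p E) (lam E x) else 0)" for x
  have e: "curve (p E) (lam E x) = a x" if "E \<in> Es" "x \<in> ends E" for E x
    using that p[OF that(1)] lam_gam[OF edge_ne[OF that(1)], of 0] lam_gam[OF edge_ne[OF that(1)], of 1]
    by (auto simp: ends_def)
  have wx: "w x = curve (p E) (lam E x)" if E: "E \<in> Es" "x \<in> seg E" for E x
  proof -
    define E' where "E' = (SOME E. E \<in> Es \<and> x \<in> seg E)"
    have E': "E' \<in> Es" "x \<in> seg E'"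
      unfolding E'_def using someI[of "\<lambda>E. E \<in> Es \<and> x \<in> seg E" E] E by auto
    have "curve (p E') (lam E' x) = curve (p E) (lam E x)"
    proof (cases "E = E'")
      case False
      then have "x \<in> ends E" "x \<in> ends E'"
        using seg_Int[OF E(1) E'(1)] E E' by auto
      then show ?thesis
        using e E E' by simp
    qed simp
    moreover have "x \<in> frontier T"
      using E unfolding frontier_T by auto
    ultimately show ?thesis
      by (simp add: w_def E'_def[symmetric])
  qed
  have "continuous_on (seg E) w" if "E \<in> Es" for E
  proof -
    have "continuous_on (seg E) (\<lambda>x. curve (p E) (lam E x))"
      unfolding curve_def using bipoly_continuous[OF lam_bipoly] by (intro continuous_intros) auto
    then show ?thesis
      using continuous_on_cong[of "seg E" "seg E" w "\<lambda>x. curve (p E) (lam E x)"] wx that by auto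
  qed
  then have "continuous_on (frontier T) w"
    unfolding frontier_T using finite_Es by (intro continuous_on_closed_Union) (auto simp: seg_def)
  moreover have "on_edge E w (p E)" if "E \<in> Es" for E
    unfolding on_edge_def using wx[OF that] lam_gam[OF edge_ne[OF that]] by (auto simp: seg_gam)
  moreover have "w V = a V" if "V \<in> verts Es" for V
    using that e wx by (auto simp: verts_def ends_def seg_def)
  ultimately show ?thesis
    by (intro exI[of _ w]) (simp add: w_def)
qed

lemma V_space_edge:
  assumes "v \<in> V_space T Es k" "E \<in> Es"
  shows "(\<lambda>x. v_E v E x $ i) \<in> P (k - 4) (seg E)"
  using assms by (auto simp: V_space_def Pvec_def)

text \<open>Hermite interpolation, possible since \<open>k \<ge> 3\<close>, followed by gluing. The
  factor \<open>len E\<close> in the end derivatives accounts for the parametrization.\<close>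

lemma bd_fun_ex:
  assumes v: "v \<in> V_space T Es k"
  shows "\<exists>w. bd_fun v w"
proof -
  have ex: "\<exists>b. deg_le k b \<and> poly b 0 = v_V v (fst E) $ i \<and> poly b 1 = v_V v (snd E) $ i \<and>
    poly (pderiv b) 0 = len E * (G_V v (fst E) *v tangent E) $ i \<and> poly (pderiv b) 1 = len E * (G_V v (snd E) *v tangent E) $ i \<and>
    (\<forall>r. deg_le (k - 4) r \<longrightarrow> I01 (\<lambda>s. poly b s * poly r s) = I01 (\<lambda>s. v_E v E (gam E s) $ i * poly r s))"
    if "E \<in> Es" for E i
    by (rule hermite_fit[OF k P_seg_continuous[OF edge_ne[OF that] V_space_edge[OF v that]]])
  define p where "p E i = (SOME b. deg_le k b \<and> poly b 0 = v_V v (fst E) $ i \<and> poly b 1 = v_V v (snd E) $ i \<and>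
    poly (pderiv b) 0 = len E * (G_V v (fst E) *v tangent E) $ i \<and> poly (pderiv b) 1 = len E * (G_V v (snd E) *v tangent E) $ i \<and>
    (\<forall>r. deg_le (k - 4) r \<longrightarrow> I01 (\<lambda>s. poly b s * poly r s) = I01 (\<lambda>s. v_E v E (gam E s) $ i * poly r s)))" for E i
  have p: "deg_le k (p E i)" "poly (p E i) 0 = v_V v (fst E) $ i" "poly (p E i) 1 = v_V v (snd E) $ i"
    "poly (pderiv (p E i)) 0 = len E * (G_V v (fst E) *v tangent E) $ i" "poly (pderiv (p E i)) 1 = len E * (G_V v (snd E) *v tangent E) $ i"
    "deg_le (k - 4) r \<Longrightarrow> I01 (\<lambda>s. poly (p E i) s * poly r s) = I01 (\<lambda>s. v_E v E (gam E s) $ i * poly r s)"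
    if "E \<in> Es" for E i r
    using someI_ex[OF ex[OF that, of i]] unfolding p_def[symmetric] by blast+
  have "\<exists>w. continuous_on (frontier T) w \<and> (\<forall>x. x \<notin> frontier T \<longrightarrow> w x = 0) \<and>
    (\<forall>E\<in>Es. on_edge E w (p E)) \<and> (\<forall>V\<in>verts Es. w V = v_V v V)"
    by (rule glue_edges) (simp_all add: vec_eq_iff p)
  then obtain w where w: "continuous_on (frontier T) w" "\<forall>x. x \<notin> frontier T \<longrightarrow> w x = 0"
    "\<And>E. E \<in> Es \<Longrightarrow> on_edge E w (p E)" "\<forall>V\<in>verts Es. w V = v_V v V"
    by blast
  have "zext (seg E) w \<in> Pvec k (seg E) \<and> proj_vec_E (k - 4) E w = v_E v E \<and>
        (\<forall>V\<in>ends E. deriv_t E w V = G_V v V *v tangent E)" if E: "E \<in> Es" for E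
  proof (intro conjI ballI)
    note ne = edge_ne[OF E]
    show "zext (seg E) w \<in> Pvec k (seg E)"
      using Pvec_seg_iff[OF ne] p(1)[OF E] w(3)[OF E] by blast
    have "proj_E (k - 4) E (\<lambda>y. w y $ i) = (\<lambda>x. v_E v E x $ i)" for i
      unfolding proj_E_iff[OF ne on_edge_continuous(1)[OF w(3)[OF E]]]
    proof (intro conjI allI impI)
      show "(\<lambda>x. v_E v E x $ i) \<in> P (k - 4) (seg E)"
        using v E by (rule V_space_edge)
      fix r assume r: "deg_le (k - 4) r"
      have "I01 (\<lambda>s. w (gam E s) $ i * poly r s) = I01 (\<lambda>s. poly (p E i) s * poly r s)"
        by (rule I01_cong) (simp add: on_edge_nth[OF w(3)[OF E]])
      then show "I01 (\<lambda>s. v_E v E (gam E s) $ i * poly r s) = I01 (\<lambda>s. w (gam E s) $ i * poly r s)"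
        using p(6)[OF E r] by simp
    qed
    then show "proj_vec_E (k - 4) E w = v_E v E"
      by (simp add: proj_vec_E_def fun_eq_iff vec_eq_iff)
    have d: "deriv_t E w (gam E s) = curve (dcurve E (p E)) s" if "s \<in> {0..1}" for s
      using deriv_t_on_edge[OF ne w(3)[OF E]] that by (simp add: on_edge_def)
    have "deriv_t E w (fst E) = G_V v (fst E) *v tangent E"
      using d[of 0] p(4)[OF E] len_pos[OF ne] by (simp add: vec_eq_iff dcurve_def)
    moreover have "deriv_t E w (snd E) = G_V v (snd E) *v tangent E"
      using d[of 1] p(5)[OF E] len_pos[OF ne] by (simp add: vec_eq_iff dcurve_def)
    moreover fix V assume "V \<in> ends E"
    ultimately show "deriv_t E w V = G_V v V *v tangent E"
      by (auto simp: ends_def)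
  qed
  then show ?thesis
    using w by (intro exI[of _ w]) (simp add: bd_fun_def)
qed

lemma v_bdry: "v \<in> V_space T Es k \<Longrightarrow> bd_fun v (v_bdry T Es k v)"
  using bd_fun_ex v_bdry_eq by metis

section \<open>The discrete symmetric curl\<close>

text \<open>The boundary function is an argument, so that the form can be evaluated for any
  candidate satisfying \<open>bd_fun\<close>.\<close>

definition curl_form :: "disc_V \<Rightarrow> (real^2 \<Rightarrow> real^2) \<Rightarrow> (real^2 \<Rightarrow> real^2^2) \<Rightarrow> real" where
  "curl_form v w \<tau> = - int_T T (\<lambda>x. v_T v x \<bullet> rot \<tau> x)
          + (\<Sum>E\<in>Es. om E * int_E E (\<lambda>x. w x \<bullet> (\<tau> x *v tangent E)))"

lemma matrix_vector_2: "((A :: real^2^2) *v x) $ i = A$i$1 * x$1 + A$i$2 * x$2"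
  by (simp add: matrix_vector_mult_def sum_2)

lemma bd_fun_continuous:
  assumes "bd_fun v w" "E \<in> Es"
  shows "continuous_on {0..1} (\<lambda>s. w (gam E s))"
proof -
  obtain p where "on_edge E w p"
    using bd_fun_on_edge[OF assms] by blast
  then show ?thesis
    by (rule on_edge_continuous(2))
qed

lemma lin_on_curl_form:
  assumes v: "v_T v \<in> Pvec (k - 2) T" and w: "bd_fun v w"
  shows "lin_on (Psym (k - 1) UNIV) (curl_form v w)"
proof -
  obtain u where u: "u \<in> Pvec (k - 2) UNIV" "v_T v = zext T u"
    using v Pvec_image[of "k - 2" T] by auto
  have 1: "lin_on (Pvec (k - 2) UNIV) (\<lambda>h. int_T T (\<lambda>x. v_T v x \<bullet> h x))"
    by (rule lin_on_int_T[where p = u]) (use u Pvec_continuous in \<open>auto simp: zext_eq\<close>)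
  have rot: "rot \<tau> \<in> Pvec (k - 2) UNIV" if "\<tau> \<in> Psym (k - 1) UNIV" for \<tau>
    using rot_Pvec[OF that] by simp
  have c: "continuous_on {0..1} (\<lambda>s. w (gam E s) \<bullet> (\<tau> (gam E s) *v tangent E))" if "\<tau> \<in> Psym (k - 1) UNIV" "E \<in> Es" for E \<tau>
    unfolding inner_2 matrix_vector_2
    by (intro continuous_intros bd_fun_continuous[OF w that(2)] continuous_gam Psym_continuous[OF that(1)])
  show ?thesis
  proof (rule lin_onI)
    fix \<sigma> \<tau> assume st: "\<sigma> \<in> Psym (k - 1) UNIV" "\<tau> \<in> Psym (k - 1) UNIV"
    have "int_E E (\<lambda>x. w x \<bullet> ((\<sigma> + \<tau>) x *v tangent E)) = int_E E (\<lambda>x. w x \<bullet> (\<sigma> x *v tangent E)) + int_E E (\<lambda>x. w x \<bullet> (\<tau> x *v tangent E))"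
      if "E \<in> Es" for E
      using I01_add[OF c[OF st(1) that] c[OF st(2) that]]
      by (simp add: int_E_I01 matrix_vector_mult_add_rdistrib inner_add_right distrib_left)
    moreover have "int_T T (\<lambda>x. v_T v x \<bullet> rot (\<sigma> + \<tau>) x) = int_T T (\<lambda>x. v_T v x \<bullet> rot \<sigma> x) + int_T T (\<lambda>x. v_T v x \<bullet> rot \<tau> x)"
      using lin_on_add[OF 1 rot[OF st(1)] rot[OF st(2)]] lin_on_add[OF lin_on_rot st] by simp
    ultimately show "curl_form v w (\<sigma> + \<tau>) = curl_form v w \<sigma> + curl_form v w \<tau>"
      by (simp add: curl_form_def sum.distrib distrib_left)
  next
    fix c \<tau> assume t: "\<tau> \<in> Psym (k - 1) UNIV"
    have "int_E E (\<lambda>x. w x \<bullet> ((c *\<^sub>R \<tau>) x *v tangent E)) = c * int_E E (\<lambda>x. w x \<bullet> (\<tau> x *v tangent E))" for E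
      by (simp add: int_E_cmult[symmetric] scaleR_matrix_vector_assoc[symmetric])
    moreover have "int_T T (\<lambda>x. v_T v x \<bullet> rot (c *\<^sub>R \<tau>) x) = c * int_T T (\<lambda>x. v_T v x \<bullet> rot \<tau> x)"
      using lin_on_scale[OF 1 rot[OF t]] lin_on_scale[OF lin_on_rot t] by simp
    ultimately show "curl_form v w (c *\<^sub>R \<tau>) = c *\<^sub>R curl_form v w \<tau>"
      by (simp add: curl_form_def sum_distrib_left algebra_simps)
  qed
qed

lemma C_sym_full_ex1:
  assumes "v_T v \<in> Pvec (k - 2) T" "bd_fun v w"
  shows "\<exists>!\<sigma>. \<sigma> \<in> Psym (k - 1) T \<and> (\<forall>\<tau>\<in>Psym (k - 1) UNIV. int_T T (\<lambda>x. \<sigma> x \<bullet> \<tau> x) = curl_form v w \<tau>)"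
  using ex1_riesz_zext[OF inner_on_Psym_UNIV findim_Psym lin_on_curl_form[OF assms]]
  unfolding Psym_image[symmetric] .

lemma C_sym_full_The:
  assumes "bd_fun v w"
  shows "C_sym_full T Es k v = (THE \<sigma>. \<sigma> \<in> Psym (k - 1) T \<and> (\<forall>\<tau>\<in>Psym (k - 1) UNIV. int_T T (\<lambda>x. \<sigma> x \<bullet> \<tau> x) = curl_form v w \<tau>))"
  by (simp add: C_sym_full_def curl_form_def v_bdry_eq[OF assms])

lemma C_sym_full:
  assumes "v_T v \<in> Pvec (k - 2) T" "bd_fun v w"
  shows "C_sym_full T Es k v \<in> Psym (k - 1) T"
    "\<tau> \<in> Psym (k - 1) UNIV \<Longrightarrow> int_T T (\<lambda>x. C_sym_full T Es k v x \<bullet> \<tau> x) = curl_form v w \<tau>"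
  using theI'[OF C_sym_full_ex1[OF assms]] unfolding C_sym_full_The[OF assms(2), symmetric] by auto

lemma zext_Psym:
  assumes "\<sigma> \<in> Psym m T"
  obtains p where "p \<in> Psym m UNIV" "\<sigma> = zext T p"
  using assms Psym_image[of m T] by auto

lemma lin_on_Psym_zext:
  fixes W :: "(real^2 \<Rightarrow> real^2^2) set"
  assumes s: "\<sigma> \<in> Psym m T" and W: "\<And>g. g \<in> W \<Longrightarrow> \<exists>p. continuous_on UNIV p \<and> g = zext T p"
  shows "lin_on W (\<lambda>h. int_T T (\<lambda>x. \<sigma> x \<bullet> h x))"
proof -
  obtain p where p: "p \<in> Psym m UNIV" "\<sigma> = zext T p"
    using zext_Psym[OF s] .
  have "\<exists>p. continuous_on UNIV p \<and> (\<forall>x\<in>T. g x = p x)" if g: "g \<in> W" for g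
  proof -
    obtain q where "continuous_on UNIV q" "g = zext T q"
      using W[OF g] by blast
    then show ?thesis
      by (auto simp: zext_def)
  qed
  then show ?thesis
    using p by (intro lin_on_int_T[OF Psym_continuous[OF p(1)]]) (auto simp: zext_eq)
qed

lemma Hsp_zext: "g \<in> Hsp m T \<Longrightarrow> \<exists>p. continuous_on UNIV p \<and> g = zext T p"
  unfolding Hsp_def P_UNIV using Psym_continuous[OF hess_Psym] by blast

lemma Hcsp_zext: "g \<in> Hcsp m T z \<Longrightarrow> \<exists>p. continuous_on UNIV p \<and> g = zext T p"
  unfolding Hcsp_eq using Psym_continuous[OF Rfield_Psym] by blast

lemma int_T_zext: "int_T T (\<lambda>x. f x \<bullet> zext T h x) = int_T T (\<lambda>x. f x \<bullet> h x)"
  by (rule int_T_cong) (simp add: zext_eq)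

text \<open>Moments of the projection against Hessians of polynomials on the whole plane, the form
  in which \<open>dd_form\<close> tests it.\<close>

lemma proj_Hsp:
  assumes s: "\<sigma> \<in> Psym m T"
  shows "L2_proj (int_T T) (Hsp n T) \<sigma> \<in> Hsp n T"
    "q \<in> bipoly (n + 2) \<Longrightarrow> int_T T (\<lambda>x. L2_proj (int_T T) (Hsp n T) \<sigma> x \<bullet> hess q x) = int_T T (\<lambda>x. \<sigma> x \<bullet> hess q x)"
proof -
  note L = L2_proj[OF inner_on_Hsp findim_Hsp lin_on_Psym_zext[OF s Hsp_zext], of n]
  show "L2_proj (int_T T) (Hsp n T) \<sigma> \<in> Hsp n T"
    by (rule L(1))
  assume "q \<in> bipoly (n + 2)"
  then have "zext T (hess q) \<in> Hsp n T"
    by (auto simp: Hsp_def P_UNIV)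
  from L(2)[OF _ this]
  show "int_T T (\<lambda>x. L2_proj (int_T T) (Hsp n T) \<sigma> x \<bullet> hess q x) = int_T T (\<lambda>x. \<sigma> x \<bullet> hess q x)"
    by (simp add: int_T_zext)
qed

lemma proj_Hcsp:
  assumes s: "\<sigma> \<in> Psym m T"
  shows "L2_proj (int_T T) (Hcsp n T z) \<sigma> \<in> Hcsp n T z"
    "q \<in> Pvec (n - 1) UNIV \<Longrightarrow> int_T T (\<lambda>x. L2_proj (int_T T) (Hcsp n T z) \<sigma> x \<bullet> Rfield z q x) = int_T T (\<lambda>x. \<sigma> x \<bullet> Rfield z q x)"
proof -
  note L = L2_proj[OF inner_on_Hcsp findim_Hcsp lin_on_Psym_zext[OF s Hcsp_zext], of n]
  show "L2_proj (int_T T) (Hcsp n T z) \<sigma> \<in> Hcsp n T z"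
    by (rule L(1))
  assume "q \<in> Pvec (n - 1) UNIV"
  then have "zext T (Rfield z q) \<in> Hcsp n T z"
    by (auto simp: Hcsp_eq)
  from L(2)[OF _ this]
  show "int_T T (\<lambda>x. L2_proj (int_T T) (Hcsp n T z) \<sigma> x \<bullet> Rfield z q x) = int_T T (\<lambda>x. \<sigma> x \<bullet> Rfield z q x)"
    by (simp add: int_T_zext)
qed

section \<open>Integration by parts along an edge\<close>

definition gradient :: "(real^2 \<Rightarrow> real) \<Rightarrow> real^2 \<Rightarrow> real^2" where
  "gradient q x = (\<chi> i. partial i q x)"

lemma deriv_n_partial: "q \<in> bipoly m \<Longrightarrow> deriv_n E q x = normal E $ 1 * partial 1 q x + normal E $ 2 * partial 2 q x"
  unfolding deriv_n_def by (rule frechet_partial[OF bipoly_differentiable])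

text \<open>Two integrations by parts along the edge. After the first one, the derivative of
  \<open>w\<close> meets the gradient of \<open>q\<close>; splitting both into tangential and normal
  parts leaves the normal derivative of \<open>q\<close>, which is kept, and its tangential
  derivative, which is integrated by parts again.\<close>

lemma edge_identity:
  assumes E: "E \<in> Es" and w: "on_edge E w p" and q: "q \<in> bipoly m"
  shows "int_E E (\<lambda>x. w x \<bullet> (hess q x *v tangent E)) =
    (w (snd E) \<bullet> gradient q (snd E) - w (fst E) \<bullet> gradient q (fst E))
    - ((deriv_t E w (snd E) \<bullet> tangent E) * q (snd E) - (deriv_t E w (fst E) \<bullet> tangent E) * q (fst E))
    + int_E E (\<lambda>x. (deriv_t E (deriv_t E w) x \<bullet> tangent E) * q x)
    - int_E E (\<lambda>x. (deriv_t E w x \<bullet> normal E) * deriv_n E q x)"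
proof -
  note ne = edge_ne[OF E]
  note l = len_pos[OF ne]
  let ?t = "tangent E" and ?n = "normal E"
  have w1: "on_edge E (deriv_t E w) (dcurve E p)"
    by (rule deriv_t_on_edge[OF ne w])
  have w2: "on_edge E (deriv_t E (deriv_t E w)) (dcurve E (dcurve E p))"
    by (rule deriv_t_on_edge[OF ne w1])
  \<comment> \<open>\<open>H\<close> collects the end terms of both integrations; its derivative is
    \<open>len E\<close> times the signed sum of all integrands, so one use of the fundamental
    theorem suffices.\<close>
  define H where "H s = (poly (p 1) s * partial 1 q (gam E s) + poly (p 2) s * partial 2 q (gam E s))
     - (poly (dcurve E p 1) s * ?t$1 + poly (dcurve E p 2) s * ?t$2) * q (gam E s)" for s
  define a where "a s = curve p s \<bullet> (hess q (gam E s) *v ?t)" for s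
  define b where "b s = (curve (dcurve E (dcurve E p)) s \<bullet> ?t) * q (gam E s)" for s
  define c where "c s = (curve (dcurve E p) s \<bullet> ?n) * deriv_n E q (gam E s)" for s
  have pd: "(poly r has_field_derivative len E * poly (smult (1 / len E) (pderiv r)) s) (at s)" for r s
    using poly_DERIV[of r s] l by simp
  have pp: "partial i q \<in> bipoly (m - 1)" for i
    by (rule partial_bipoly[OF q])
  have com: "partial 2 (partial 1 q) = partial 1 (partial 2 q)"
    by (rule partial_commute[OF q])
  have tt: "(?t$1)^2 + (?t$2)^2 = 1"
    by (rule tangent_norm[OF ne])
  have "(H has_field_derivative len E * (a s + c s - b s)) (at s)" for s
  proof -
    let ?p1 = "poly (p 1) s" and ?p2 = "poly (p 2) s" and ?d1 = "poly (dcurve E p 1) s" and ?d2 = "poly (dcurve E p 2) s"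
      and ?e1 = "poly (dcurve E (dcurve E p) 1) s" and ?e2 = "poly (dcurve E (dcurve E p) 2) s"
      and ?q1 = "partial 1 q (gam E s)" and ?q2 = "partial 2 q (gam E s)"
      and ?q11 = "partial 1 (partial 1 q) (gam E s)" and ?q12 = "partial 1 (partial 2 q) (gam E s)" and ?q22 = "partial 2 (partial 2 q) (gam E s)"
    have d: "(poly (p i) has_field_derivative len E * poly (dcurve E p i) s) (at s)"
      "(poly (dcurve E p i) has_field_derivative len E * poly (dcurve E (dcurve E p) i) s) (at s)" for i
      using pd[of "p i" s] pd[of "dcurve E p i" s] by (simp_all add: dcurve_def)
    have "(H has_field_derivative
       (?p1 * (len E * (?t$1 * ?q11 + ?t$2 * ?q12)) + len E * ?d1 * ?q1
        + (?p2 * (len E * (?t$1 * ?q12 + ?t$2 * ?q22)) + len E * ?d2 * ?q2)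
        - ((?d1 * ?t$1 + ?d2 * ?t$2) * (len E * (?t$1 * ?q1 + ?t$2 * ?q2))
           + (len E * ?e1 * ?t$1 + len E * ?e2 * ?t$2) * q (gam E s)))) (at s)"
      unfolding H_def
      by (rule derivative_eq_intros d deriv_gam[OF pp] deriv_gam[OF q] refl | simp add: com)+
    moreover have "?p1 * (len E * (?t$1 * ?q11 + ?t$2 * ?q12)) + len E * ?d1 * ?q1
        + (?p2 * (len E * (?t$1 * ?q12 + ?t$2 * ?q22)) + len E * ?d2 * ?q2)
        - ((?d1 * ?t$1 + ?d2 * ?t$2) * (len E * (?t$1 * ?q1 + ?t$2 * ?q2))
           + (len E * ?e1 * ?t$1 + len E * ?e2 * ?t$2) * q (gam E s)) = len E * (a s + c s - b s)"
    proof -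
      have h: "hess q (gam E s) $ 1 $ 1 = ?q11" "hess q (gam E s) $ 1 $ 2 = ?q12" "hess q (gam E s) $ 2 $ 1 = ?q12" "hess q (gam E s) $ 2 $ 2 = ?q22"
        by (simp_all add: hess_def com)
      \<comment> \<open>Scalar product of the derivative of \<open>w\<close> with the gradient of
        \<open>q\<close>, expanded in the orthonormal frame of tangent and normal.\<close>
      have split: "?d1 * ?q1 + ?d2 * ?q2 = (?d1 * ?t$1 + ?d2 * ?t$2) * (?t$1 * ?q1 + ?t$2 * ?q2) + (?d2 * ?t$1 - ?d1 * ?t$2) * (?t$1 * ?q2 - ?t$2 * ?q1)"
        using tt by algebra
      have "a s = ?p1 * (?q11 * ?t$1 + ?q12 * ?t$2) + ?p2 * (?q12 * ?t$1 + ?q22 * ?t$2)"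
        by (simp add: a_def inner_2 matrix_vector_2 h)
      moreover have "b s = (?e1 * ?t$1 + ?e2 * ?t$2) * q (gam E s)"
        by (simp add: b_def inner_2)
      moreover have "c s = (?d2 * ?t$1 - ?d1 * ?t$2) * (?t$1 * ?q2 - ?t$2 * ?q1)"
        by (simp add: c_def inner_2 deriv_n_partial[OF q] normal_nth algebra_simps)
      ultimately show ?thesis
        using split by algebra
    qed
    ultimately show ?thesis
      by simp
  qed
  moreover have ca: "continuous_on {0..1} a" and cb: "continuous_on {0..1} b" and cc: "continuous_on {0..1} c"
    unfolding a_def b_def c_def hess_def deriv_n_partial[OF q] inner_2 matrix_vector_2 vec_lambda_beta curve_nth
    by (intro continuous_intros continuous_gam bipoly_continuous[OF pp] bipoly_continuous[OF partial_bipoly[OF pp]] bipoly_continuous[OF q])+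
  ultimately have "I01 (\<lambda>s. len E * (a s + c s - b s)) = H 1 - H 0"
    by (intro I01_FTC) (auto intro!: continuous_intros)
  then have 1: "len E * I01 a + len E * I01 c - len E * I01 b = H 1 - H 0"
    using ca cb cc by (simp add: I01_cmult I01_add I01_diff continuous_intros algebra_simps)
  have 2: "int_E E (\<lambda>x. w x \<bullet> (hess q x *v ?t)) = len E * I01 a"
    unfolding int_E_I01 a_def using w by (auto simp: on_edge_def intro!: I01_cong)
  have 3: "int_E E (\<lambda>x. (deriv_t E (deriv_t E w) x \<bullet> ?t) * q x) = len E * I01 b"
    unfolding int_E_I01 b_def using w2 by (auto simp: on_edge_def intro!: I01_cong)
  have 4: "int_E E (\<lambda>x. (deriv_t E w x \<bullet> ?n) * deriv_n E q x) = len E * I01 c"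
    unfolding int_E_I01 c_def using w1 by (auto simp: on_edge_def intro!: I01_cong)
  have 5: "w (gam E s) \<bullet> gradient q (gam E s) - (deriv_t E w (gam E s) \<bullet> ?t) * q (gam E s) = H s" if "s \<in> {0..1}" for s
    using on_edge_nth[OF w that] on_edge_nth[OF w1 that] by (simp add: H_def inner_2 gradient_def)
  show ?thesis
    using 1 5[of 0] 5[of 1] unfolding 2 3 4 by simp
qed

end

section \<open>The discrete div-div operator\<close>

context discrete_complex
begin

definition dd_form :: "disc_Sigma \<Rightarrow> (real^2 \<Rightarrow> real) \<Rightarrow> real" where
  "dd_form \<tau> q =
     int_T T (\<lambda>x. tau_H \<tau> x \<bullet> hess q x)
     - (\<Sum>E\<in>Es. om E * (\<Sum>V\<in>ends E. omega_EV E V * ((tau_V \<tau> V *v normal E) \<bullet> tangent E) * q V))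
     - (\<Sum>E\<in>Es. om E * (int_E E (\<lambda>x. tau_E \<tau> E x * deriv_n E q x) - int_E E (\<lambda>x. D_E \<tau> E x * q x)))"

lemma ends_sum:
  "E \<in> Es \<Longrightarrow> (\<Sum>V\<in>ends E. omega_EV E V * a V * q V) = a (snd E) * q (snd E) - a (fst E) * q (fst E)"
  using edge_ne[of E] by (simp add: ends_def omega_EV_def)

text \<open>With \<open>G\<close> the gradient at a vertex, this trades the tangential part of the
  derivative along the edge for the vertex unknown of the div-div operator.\<close>

lemma CC_identity:
  assumes "E \<in> Es"
  shows "(CC G *v normal E) \<bullet> tangent E + (G *v tangent E) \<bullet> tangent E = (G$1$1 + G$2$2) / 2"
proof -
  have "(tangent E $ 1)^2 + (tangent E $ 2)^2 = 1"
    using tangent_norm[OF edge_ne[OF assms]] .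
  then show ?thesis
    by (simp add: CC_def inner_2 matrix_vector_2 normal_nth field_simps) algebra
qed

lemma deriv_n_bipoly:
  assumes "q \<in> bipoly m"
  shows "deriv_n E q \<in> bipoly (m - 1)"
proof -
  have "deriv_n E q = (\<lambda>x. normal E $ 1 * partial 1 q x + normal E $ 2 * partial 2 q x)"
    using deriv_n_partial[OF assms] by (rule ext)
  then show ?thesis
    using partial_bipoly[OF assms] by (auto intro!: bipoly_add bipoly_cmult)
qed

text \<open>Stated for \<tau> and \<open>w\<close> separately, not for the symmetric curl of some
  \<open>v\<close>: it serves the complex property, and also a given \<tau> in the kernel whose
  boundary data have been matched but whose component \<open>tau_H\<close> has not.\<close>

lemma dd_form_curl:
  assumes w: "\<And>E. E \<in> Es \<Longrightarrow> \<exists>p. on_edge E w p"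
    and G: "\<And>E V. E \<in> Es \<Longrightarrow> V \<in> ends E \<Longrightarrow> deriv_t E w V = G V *v tangent E"
    and tV: "\<And>V. V \<in> verts Es \<Longrightarrow> tau_V \<tau> V = CC (G V)"
    and D: "\<And>E x. E \<in> Es \<Longrightarrow> x \<in> seg E \<Longrightarrow> D_E \<tau> E x = - (deriv_t E (deriv_t E w) x \<bullet> tangent E)"
    and tE: "\<And>E h. E \<in> Es \<Longrightarrow> h \<in> bipoly (k - 3) \<Longrightarrow>
       int_E E (\<lambda>x. tau_E \<tau> E x * h x) = - int_E E (\<lambda>x. (deriv_t E w x \<bullet> normal E) * h x)"
    and q: "q \<in> bipoly (k - 2)"
  shows "dd_form \<tau> q = int_T T (\<lambda>x. tau_H \<tau> x \<bullet> hess q x) - (\<Sum>E\<in>Es. om E * int_E E (\<lambda>x. w x \<bullet> (hess q x *v tangent E)))"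
proof -
  define X where "X E = int_E E (\<lambda>x. (deriv_t E (deriv_t E w) x \<bullet> tangent E) * q x)" for E
  define Y where "Y E = int_E E (\<lambda>x. (deriv_t E w x \<bullet> normal E) * deriv_n E q x)" for E
  \<comment> \<open>The end terms of the edge identity become increments of \<phi> and \<psi>, apart
    from the vertex contributions \<open>Vs\<close>. Neither function refers to the edge, so their
    oriented sums vanish by \<open>om_telescope\<close>.\<close>
  define \<phi> where "\<phi> V = w V \<bullet> gradient q V" for V
  define \<psi> where "\<psi> V = (G V $ 1 $ 1 + G V $ 2 $ 2) / 2 * q V" for V
  define Vs where "Vs E = (\<Sum>V\<in>ends E. omega_EV E V * ((tau_V \<tau> V *v normal E) \<bullet> tangent E) * q V)" for E
  have I: "int_E E (\<lambda>x. w x \<bullet> (hess q x *v tangent E)) = (\<phi> (snd E) - \<phi> (fst E)) - (\<psi> (snd E) - \<psi> (fst E)) + Vs E + X E - Y E"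
    if E: "E \<in> Es" for E
  proof -
    obtain p where p: "on_edge E w p"
      using w[OF E] by blast
    have V: "(deriv_t E w V \<bullet> tangent E) * q V = \<psi> V - ((tau_V \<tau> V *v normal E) \<bullet> tangent E) * q V" if "V \<in> ends E" for V
    proof -
      have "V \<in> verts Es"
        using E that by (auto simp: verts_def)
      then have "(tau_V \<tau> V *v normal E) \<bullet> tangent E + deriv_t E w V \<bullet> tangent E = (G V $ 1 $ 1 + G V $ 2 $ 2) / 2"
        using CC_identity[OF E, of "G V"] by (simp add: tV G[OF E that])
      then have "deriv_t E w V \<bullet> tangent E = (G V $ 1 $ 1 + G V $ 2 $ 2) / 2 - (tau_V \<tau> V *v normal E) \<bullet> tangent E"
        by linarith
      then show ?thesis
        by (simp only: \<psi>_def left_diff_distrib)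
    qed
    have "Vs E = ((tau_V \<tau> (snd E) *v normal E) \<bullet> tangent E) * q (snd E) - ((tau_V \<tau> (fst E) *v normal E) \<bullet> tangent E) * q (fst E)"
      unfolding Vs_def using ends_sum[OF E, of "\<lambda>V. (tau_V \<tau> V *v normal E) \<bullet> tangent E" q] .
    then show ?thesis
      using edge_identity[OF E p q] V[of "fst E"] V[of "snd E"]
      by (simp add: X_def Y_def \<phi>_def ends_def)
  qed
  have iD: "int_E E (\<lambda>x. D_E \<tau> E x * q x) = - X E" if E: "E \<in> Es" for E
    unfolding X_def int_E_uminus[symmetric] by (rule int_E_cong) (simp add: D[OF E])
  have iE: "int_E E (\<lambda>x. tau_E \<tau> E x * deriv_n E q x) = - Y E" if E: "E \<in> Es" for E
  proof -
    have "deriv_n E q \<in> bipoly (k - 3)"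
      using deriv_n_bipoly[OF q, of E] by simp
    then show ?thesis
      unfolding Y_def by (rule tE[OF E])
  qed
  have "(\<Sum>E\<in>Es. om E * int_E E (\<lambda>x. w x \<bullet> (hess q x *v tangent E)))
     = (\<Sum>E\<in>Es. om E * (\<phi> (snd E) - \<phi> (fst E)) - om E * (\<psi> (snd E) - \<psi> (fst E)) + om E * (Vs E + X E - Y E))"
    by (intro sum.cong refl) (simp add: I algebra_simps)
  also have "\<dots> = (\<Sum>E\<in>Es. om E * (Vs E + X E - Y E))"
    by (simp add: sum.distrib sum_subtractf om_telescope)
  also have "\<dots> = (\<Sum>E\<in>Es. om E * Vs E) + (\<Sum>E\<in>Es. om E * (- Y E - - X E))"
    unfolding sum.distrib[symmetric] by (intro sum.cong refl) (simp add: algebra_simps)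
  also have "(\<Sum>E\<in>Es. om E * (- Y E - - X E)) = (\<Sum>E\<in>Es. om E * (int_E E (\<lambda>x. tau_E \<tau> E x * deriv_n E q x) - int_E E (\<lambda>x. D_E \<tau> E x * q x)))"
    by (intro sum.cong refl) (simp only: iD iE)
  finally show ?thesis
    unfolding dd_form_def Vs_def[symmetric] by simp
qed

lemma Sigma_iff:
  "\<tau> \<in> Sigma_space T Es z (k - 1) \<longleftrightarrow>
     tau_H \<tau> \<in> Hsp (k - 4) T \<and> tau_Hc \<tau> \<in> Hcsp (k - 1) T z \<and>
     (\<forall>E\<in>Es. tau_E \<tau> E \<in> P (k - 3) (seg E) \<and> D_E \<tau> E \<in> P (k - 2) (seg E)) \<and>
     (\<forall>V\<in>verts Es. tau_V \<tau> V \<in> sym_mats) \<and>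
     (\<forall>E. E \<notin> Es \<longrightarrow> tau_E \<tau> E = (\<lambda>_. 0) \<and> D_E \<tau> E = (\<lambda>_. 0)) \<and>
     (\<forall>V. V \<notin> verts Es \<longrightarrow> tau_V \<tau> V = 0)"
  by (simp add: Sigma_space_def)

lemma lin_on_int_E_bipoly:
  assumes E: "E \<in> Es" and f: "f \<in> P n (seg E)"
  shows "lin_on (bipoly m) (\<lambda>h. int_E E (\<lambda>x. f x * h x))"
proof (rule lin_onI)
  fix g h assume gh: "g \<in> bipoly m" "h \<in> bipoly m"
  have "continuous_on {0..1} (\<lambda>s. f (gam E s) * h (gam E s))" if "h \<in> bipoly m" for h
    by (intro continuous_intros P_seg_continuous[OF edge_ne[OF E] f] continuous_gam bipoly_continuous[OF that])
  from I01_add[OF this[OF gh(1)] this[OF gh(2)]]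
  show "int_E E (\<lambda>x. f x * (g + h) x) = int_E E (\<lambda>x. f x * g x) + int_E E (\<lambda>x. f x * h x)"
    by (simp add: int_E_I01 distrib_left)
next
  fix c h
  show "int_E E (\<lambda>x. f x * (c *\<^sub>R h) x) = c *\<^sub>R int_E E (\<lambda>x. f x * h x)"
    by (simp add: int_E_cmult[symmetric] mult.left_commute)
qed

lemma lin_on_compose:
  assumes "lin_on W R" "R ` W \<subseteq> V" "lin_on V \<phi>"
  shows "lin_on W (\<lambda>x. \<phi> (R x))"
proof (rule lin_onI)
  fix f g assume "f \<in> W" "g \<in> W"
  then show "\<phi> (R (f + g)) = \<phi> (R f) + \<phi> (R g)"
    using lin_on_add[OF assms(1)] lin_on_add[OF assms(3)] assms(2) by (simp add: image_subset_iff)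
next
  fix c f assume "f \<in> W"
  then show "\<phi> (R (c *\<^sub>R f)) = c *\<^sub>R \<phi> (R f)"
    using lin_on_scale[OF assms(1)] lin_on_scale[OF assms(3)] assms(2) by (simp add: image_subset_iff)
qed

lemma lin_on_deriv_n: "lin_on (bipoly m) (deriv_n E)"
proof (rule lin_onI)
  fix f g assume fg: "f \<in> bipoly m" "g \<in> bipoly m"
  have "f + g \<in> bipoly m"
    using fg subspace_add[OF subspace_bipoly] by blast
  then show "deriv_n E (f + g) = deriv_n E f + deriv_n E g"
    using fg lin_on_add[OF lin_on_partial fg]
    by (simp add: fun_eq_iff deriv_n_partial distrib_left)
next
  fix c f assume f: "f \<in> bipoly m"
  have "c *\<^sub>R f \<in> bipoly m"
    using f subspace_scale[OF subspace_bipoly] by blast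
  then show "deriv_n E (c *\<^sub>R f) = c *\<^sub>R deriv_n E f"
    using f lin_on_scale[OF lin_on_partial f]
    by (simp add: fun_eq_iff deriv_n_partial algebra_simps)
qed

lemma lin_on_plus: "lin_on W \<phi> \<Longrightarrow> lin_on W \<psi> \<Longrightarrow> lin_on W (\<lambda>x. \<phi> x + \<psi> x)"
  and lin_on_minus: "lin_on W \<phi> \<Longrightarrow> lin_on W \<psi> \<Longrightarrow> lin_on W (\<lambda>x. \<phi> x - \<psi> x)"
  by (auto simp: lin_on_def algebra_simps)

lemma lin_on_cmult: "lin_on W \<phi> \<Longrightarrow> lin_on W (\<lambda>x. c * (\<phi> x :: real))"
  by (auto simp: lin_on_def algebra_simps)

lemma lin_on_sum: "(\<And>i. i \<in> I \<Longrightarrow> lin_on W (\<phi> i)) \<Longrightarrow> lin_on W (\<lambda>x. \<Sum>i\<in>I. \<phi> i x :: real)"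
  by (induction I rule: infinite_finite_induct) (auto intro!: lin_on_plus simp: lin_on_def[of _ "\<lambda>_. 0"])

lemma lin_on_hess_T:
  assumes "\<sigma> \<in> Hsp n T"
  shows "lin_on (bipoly m) (\<lambda>q. int_T T (\<lambda>x. \<sigma> x \<bullet> hess q x))"
proof (rule lin_on_compose[OF lin_on_hess])
  show "hess ` bipoly m \<subseteq> Psym (m - 2) UNIV"
    using hess_Psym[of _ "m - 2"] by auto
  obtain p where p: "continuous_on UNIV p" "\<sigma> = zext T p"
    using Hsp_zext[OF assms] by blast
  show "lin_on (Psym (m - 2) UNIV) (\<lambda>h. int_T T (\<lambda>x. \<sigma> x \<bullet> h x))"
    by (rule lin_on_int_T[OF p(1)]) (use p(2) Psym_continuous in \<open>auto simp: zext_eq\<close>)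
qed

lemma lin_on_dd_form:
  assumes t: "\<tau> \<in> Sigma_space T Es z (k - 1)"
  shows "lin_on (bipoly (k - 2)) (dd_form \<tau>)"
proof -
  have 1: "lin_on (bipoly (k - 2)) (\<lambda>q. int_E E (\<lambda>x. tau_E \<tau> E x * deriv_n E q x))" if E: "E \<in> Es" for E
  proof (rule lin_on_compose[OF lin_on_deriv_n])
    show "deriv_n E ` bipoly (k - 2) \<subseteq> bipoly (k - 2 - 1)"
      using deriv_n_bipoly by blast
    show "lin_on (bipoly (k - 2 - 1)) (\<lambda>h. int_E E (\<lambda>x. tau_E \<tau> E x * h x))"
      using t E by (intro lin_on_int_E_bipoly) (auto simp: Sigma_iff)
  qed
  have 2: "lin_on (bipoly (k - 2)) (\<lambda>q. int_E E (\<lambda>x. D_E \<tau> E x * q x))" if E: "E \<in> Es" for E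
    using t E by (intro lin_on_int_E_bipoly) (auto simp: Sigma_iff)
  have 3: "lin_on (bipoly (k - 2)) (\<lambda>q. \<Sum>V\<in>ends E. omega_EV E V * ((tau_V \<tau> V *v normal E) \<bullet> tangent E) * q V)" for E
    by (intro lin_on_sum lin_on_cmult) (simp add: lin_on_def)
  have 4: "lin_on (bipoly (k - 2)) (\<lambda>q. int_T T (\<lambda>x. tau_H \<tau> x \<bullet> hess q x))"
    using t by (intro lin_on_hess_T) (auto simp: Sigma_iff)
  have "dd_form \<tau> = (\<lambda>q. int_T T (\<lambda>x. tau_H \<tau> x \<bullet> hess q x)
     - (\<Sum>E\<in>Es. om E * (\<Sum>V\<in>ends E. omega_EV E V * ((tau_V \<tau> V *v normal E) \<bullet> tangent E) * q V))
     - (\<Sum>E\<in>Es. om E * (int_E E (\<lambda>x. tau_E \<tau> E x * deriv_n E q x) - int_E E (\<lambda>x. D_E \<tau> E x * q x))))"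
    by (simp add: dd_form_def fun_eq_iff)
  then show ?thesis
    by (simp only:) (intro lin_on_minus lin_on_sum lin_on_cmult 1 2 3 4)
qed

lemma DD_The: "DD T Es (k - 1) \<tau> = (THE g. g \<in> zext T ` bipoly (k - 2) \<and> (\<forall>q\<in>bipoly (k - 2). int_T T (\<lambda>x. g x \<bullet> q x) = dd_form \<tau> q))"
  by (simp add: DD_def dd_form_def P_UNIV P_def)

lemma DD_ex1:
  assumes "\<tau> \<in> Sigma_space T Es z (k - 1)"
  shows "\<exists>!g. g \<in> zext T ` bipoly (k - 2) \<and> (\<forall>q\<in>bipoly (k - 2). int_T T (\<lambda>x. g x \<bullet> q x) = dd_form \<tau> q)"
  by (rule ex1_riesz_zext[OF inner_on_bipoly findim_bipoly lin_on_dd_form[OF assms]])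

lemma DD_P: "\<tau> \<in> Sigma_space T Es z (k - 1) \<Longrightarrow> DD T Es (k - 1) \<tau> \<in> P (k - 2) T"
  using theI'[OF DD_ex1, of \<tau>] unfolding DD_The P_def by blast

lemma DD_eq:
  assumes "\<tau> \<in> Sigma_space T Es z (k - 1)" "g \<in> P (k - 2) T" "\<And>q. q \<in> bipoly (k - 2) \<Longrightarrow> int_T T (\<lambda>x. g x * q x) = dd_form \<tau> q"
  shows "DD T Es (k - 1) \<tau> = g"
  unfolding DD_The using assms by (intro the1_equality[OF DD_ex1]) (auto simp: P_def)

lemma DD_zero_iff:
  assumes t: "\<tau> \<in> Sigma_space T Es z (k - 1)"
  shows "DD T Es (k - 1) \<tau> = (\<lambda>_. 0) \<longleftrightarrow> (\<forall>q\<in>bipoly (k - 2). dd_form \<tau> q = 0)"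
proof
  assume 0: "DD T Es (k - 1) \<tau> = (\<lambda>_. 0)"
  have "\<forall>q\<in>bipoly (k - 2). int_T T (\<lambda>x. DD T Es (k - 1) \<tau> x \<bullet> q x) = dd_form \<tau> q"
    using theI'[OF DD_ex1[OF t]] unfolding DD_The[symmetric] by blast
  then show "\<forall>q\<in>bipoly (k - 2). dd_form \<tau> q = 0"
    unfolding 0 by (simp add: int_T_0)
next
  assume "\<forall>q\<in>bipoly (k - 2). dd_form \<tau> q = 0"
  moreover have "(\<lambda>_. 0) \<in> P (k - 2) T"
    using subspace_0[OF subspace_P] by (simp add: zero_fun_def)
  ultimately show "DD T Es (k - 1) \<tau> = (\<lambda>_. 0)"
    by (intro DD_eq[OF t]) (auto simp: int_T_0)
qed

lemma gradient_zero_const: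
  assumes "F \<in> bipoly m" "\<And>i. partial i F = (\<lambda>_. 0)"
  shows "F x = F y"
proof -
  have "((\<lambda>s. F (y + s *\<^sub>R (x - y))) has_field_derivative 0) (at s)" for s
    using bipoly_deriv_line[OF assms(1), of y "x - y" s] assms(2) by simp
  then have "F (y + 1 *\<^sub>R (x - y)) = F (y + 0 *\<^sub>R (x - y))"
    using DERIV_isconst_all[of "\<lambda>s. F (y + s *\<^sub>R (x - y))" 1 0] by blast
  then show ?thesis
    by simp
qed

text \<open>Through every point of \<open>T\<close> runs a line on which an affine function is
  constant; as \<open>T\<close> is bounded, the line meets the frontier.\<close>

lemma affine_zero_on_boundary:
  assumes p: "p \<in> bipoly m" and h: "hess p = (\<lambda>_. 0)" and b: "\<And>x. x \<in> frontier T \<Longrightarrow> p x = 0"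
  shows "p = (\<lambda>_. 0)"
proof (rule bipoly_zero_on_T[OF p])
  fix x assume x: "x \<in> T"
  have "partial i (partial j p) = (\<lambda>_. 0)" for i j
  proof
    fix y
    show "partial i (partial j p) y = 0"
      using fun_cong[OF h, of y] by (simp add: hess_def vec_eq_iff)
  qed
  then have c: "partial j p y = partial j p x" for j y
    using gradient_zero_const[OF partial_bipoly[OF p]] by blast
  \<comment> \<open>A direction orthogonal to the gradient; if the gradient vanishes, any direction
    will do.\<close>
  define d where "d = (if gradient p x = 0 then axis 1 1 else perp (gradient p x))"
  have d: "d \<noteq> 0"
    by (auto simp: d_def axis_eq_0_iff vec_eq_iff forall_2)
  have dg: "d$1 * partial 1 p x + d$2 * partial 2 p x = 0"
    by (auto simp: d_def gradient_def vec_eq_iff forall_2)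
  have "((\<lambda>s. p (x + s *\<^sub>R d)) has_field_derivative 0) (at s)" for s
    using bipoly_deriv_line[OF p, of x d s] dg unfolding c[of _ "x + s *\<^sub>R d"] by simp
  then have const: "p (x + s *\<^sub>R d) = p (x + 0 *\<^sub>R d)" for s
    using DERIV_isconst_all[of "\<lambda>s. p (x + s *\<^sub>R d)" s 0] by blast
  obtain s where "x + s *\<^sub>R d \<in> frontier T"
    using ray_to_frontier[OF bounded_T _ d, of x] x open_T by (metis interior_open)
  then show "p x = 0"
    using b const[of s] by simp
qed

lemma DD_surj:
  assumes g: "g \<in> P (k - 2) T"
  shows "g \<in> DD T Es (k - 1) ` Sigma_space T Es z (k - 1)"
proof -
  let ?W = "bipoly (k - 2)"
  define B where "B p q = int_T T (\<lambda>x. hess p x \<bullet> hess q x) + (\<Sum>E\<in>Es. int_E E (\<lambda>x. p x * q x))" for p q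
  have W: "q \<in> bipoly (k - 4 + 2)" if "q \<in> ?W" for q
    using that by simp
  have z: "int_T T (\<lambda>x. hess p x \<bullet> hess q x) = int_T T (\<lambda>x. zext T (hess p) x \<bullet> hess q x)" for p q
    by (rule int_T_cong) (simp add: zext_eq)
  have zE: "int_E E (\<lambda>x. zext (seg E) p x * q x) = int_E E (\<lambda>x. p x * q x)" for p q E
    by (rule int_E_cong) (simp add: zext_eq)
  have ph: "zext T (hess p) \<in> Hsp (k - 4) T" if "p \<in> ?W" for p
    using W[OF that] by (auto simp: Hsp_def P_UNIV)
  have pE: "zext (seg E) p \<in> P (k - 2) (seg E)" if "p \<in> ?W" for p E
    using that by (auto simp: P_def)
  have i: "inner_on ?W B"
  proof
    show "subspace ?W"
      by (rule subspace_bipoly)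
    show "B p q = B q p" for p q
      by (simp add: B_def inner_commute mult.commute)
    fix p assume p: "p \<in> ?W"
    have "lin_on ?W (\<lambda>q. int_T T (\<lambda>x. zext T (hess p) x \<bullet> hess q x) + (\<Sum>E\<in>Es. int_E E (\<lambda>x. zext (seg E) p x * q x)))"
      by (intro lin_on_plus lin_on_sum lin_on_hess_T[OF ph[OF p]] lin_on_int_E_bipoly[OF _ pE[OF p]])
    then show "lin_on ?W (B p)"
      unfolding B_def[abs_def] z zE .
    have hc: "continuous_on UNIV (hess p)"
      using Psym_continuous[OF hess_Psym[OF W[OF p]]] .
    have nnT: "int_T T (\<lambda>x. hess p x \<bullet> hess p x) \<ge> 0"
      unfolding int_T_def set_lebesgue_integral_def by (intro integral_nonneg_AE) (auto simp: indicator_def)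
    have nnE: "int_E E (\<lambda>x. p x * p x) \<ge> 0" for E
      unfolding int_E_I01 I01_def set_lebesgue_integral_def
      by (intro mult_nonneg_nonneg integral_nonneg_AE) (auto simp: indicator_def len_def)
    assume "B p p = 0"
    then have T0: "int_T T (\<lambda>x. hess p x \<bullet> hess p x) = 0" and S0: "(\<Sum>E\<in>Es. int_E E (\<lambda>x. p x * p x)) = 0"
      using nnT sum_nonneg[of Es "\<lambda>E. int_E E (\<lambda>x. p x * p x)"] nnE by (auto simp: B_def)
    have E0: "int_E E (\<lambda>x. p x * p x) = 0" if "E \<in> Es" for E
      using S0 nnE that finite_Es by (subst (asm) sum_nonneg_eq_0_iff) auto
    have "hess p = 0"
      by (rule inner_on.definite[OF inner_on_Psym_UNIV hess_Psym[OF W[OF p]]]) (rule T0)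
    moreover have "p x = 0" if xf: "x \<in> frontier T" for x
    proof -
      obtain E where E: "E \<in> Es" "x \<in> seg E"
        using xf unfolding frontier_T by blast
      have "int_E E (\<lambda>x. zext (seg E) p x \<bullet> zext (seg E) p x) = int_E E (\<lambda>x. p x * p x)"
        by (rule int_E_cong) (simp add: zext_eq)
      then have "int_E E (\<lambda>x. zext (seg E) p x \<bullet> zext (seg E) p x) = 0"
        using E0[OF E(1)] by simp
      then have "zext (seg E) p = 0"
        by (rule inner_on.definite[OF inner_on_P_seg[OF edge_ne[OF E(1)]] pE[OF p]])
      then show ?thesis
        using E(2) by (metis zero_fun_apply zext_eq)
    qed
    ultimately show "p = 0"
      using affine_zero_on_boundary[OF p] by (simp add: zero_fun_def)
  qed
  obtain g' where g': "continuous_on UNIV g'" "g = zext T g'"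
    using g bipoly_continuous by (auto simp: P_def)
  have "lin_on ?W (\<lambda>q. int_T T (\<lambda>x. g x \<bullet> q x))"
    by (rule lin_on_int_T[OF g'(1)]) (use g'(2) bipoly_continuous in \<open>auto simp: zext_eq\<close>)
  then obtain p where p: "p \<in> ?W" "\<And>q. q \<in> ?W \<Longrightarrow> B p q = int_T T (\<lambda>x. g x * q x)"
    using inner_on.riesz[OF i findim_bipoly] by force
  \<comment> \<open>Reads the two parts of the form \<open>B\<close> as components: the Hessian goes
    to \<open>tau_H\<close>, the edge values to \<open>D_E\<close>. The sign \<open>om E\<close>
    cancels against the one in \<open>dd_form\<close>.\<close>
  define \<tau> where "\<tau> = \<lparr>tau_H = zext T (hess p), tau_Hc = (\<lambda>_. 0), tau_E = (\<lambda>_ _. 0),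
     D_E = (\<lambda>E. if E \<in> Es then om E *\<^sub>R zext (seg E) p else (\<lambda>_. 0)), tau_V = (\<lambda>_. 0)\<rparr>"
  have "(\<lambda>_. 0) \<in> P m Y" for m Y
    using subspace_0[OF subspace_P] by (simp add: zero_fun_def)
  moreover have "(\<lambda>_. 0) \<in> Hcsp (k - 1) T z"
    using subspace_0[OF findim_subspace[OF findim_Hcsp]] by (simp add: zero_fun_def)
  ultimately have \<tau>: "\<tau> \<in> Sigma_space T Es z (k - 1)"
    using ph[OF p(1)] subspace_scale[OF subspace_P pE[OF p(1)]]
    by (simp add: Sigma_iff \<tau>_def sym_mats_def transpose_def vec_eq_iff)
  have "DD T Es (k - 1) \<tau> = g"
  proof (rule DD_eq[OF \<tau> g])
    fix q assume q: "q \<in> ?W"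
    have "om E * int_E E (\<lambda>x. D_E \<tau> E x * q x) = int_E E (\<lambda>x. p x * q x)" if "E \<in> Es" for E
    proof -
      have "int_E E (\<lambda>x. D_E \<tau> E x * q x) = om E * int_E E (\<lambda>x. zext (seg E) p x * q x)"
        using that by (simp add: \<tau>_def int_E_cmult[symmetric] mult.assoc)
      then show ?thesis
        using om_square[of E] by (simp add: zE flip: mult.assoc)
    qed
    then have "dd_form \<tau> q = B p q"
      unfolding dd_form_def B_def z by (simp add: \<tau>_def int_E_0 sum_negf)
    then show "int_T T (\<lambda>x. g x * q x) = dd_form \<tau> q"
      using p(2)[OF q] by simp
  qed
  then show ?thesis
    using \<tau> by blast
qed

section \<open>The complex property\<close>

lemma C_sym_fields:
  assumes "bd_fun v w"
  shows "tau_H (C_sym T Es z k v) = L2_proj (int_T T) (Hsp (k - 4) T) (C_sym_full T Es k v)"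
    "tau_Hc (C_sym T Es z k v) = L2_proj (int_T T) (Hcsp (k - 1) T z) (C_sym_full T Es k v)"
    "tau_E (C_sym T Es z k v) E = (if E \<in> Es then (\<lambda>x. - proj_E (k - 3) E (\<lambda>y. deriv_t E w y \<bullet> normal E) x) else (\<lambda>_. 0))"
    "D_E (C_sym T Es z k v) E = (if E \<in> Es then (\<lambda>x. - (deriv_t E (deriv_t E w) x \<bullet> tangent E)) else (\<lambda>_. 0))"
    "tau_V (C_sym T Es z k v) = zext (verts Es) (\<lambda>V. CC (G_V v V))"
  by (simp_all add: C_sym_def Let_def v_bdry_eq[OF assms])

lemma CC_sym: "CC G \<in> sym_mats"
  by (simp add: CC_def sym_mats_def transpose_def vec_eq_iff forall_2)

lemma on_edge_inner:
  assumes "on_edge E w p"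
  shows "\<forall>s\<in>{0..1}. w (gam E s) \<bullet> a = poly (smult (a$1) (p 1) + smult (a$2) (p 2)) s"
  using on_edge_nth[OF assms] by (simp add: inner_2 mult.commute)

lemma continuous_on_edge_inner:
  assumes "on_edge E w p"
  shows "continuous_on {0..1} (\<lambda>s. w (gam E s) \<bullet> a)"
  by (intro continuous_intros on_edge_continuous(2)[OF assms])

lemma proj_normal:
  assumes w: "on_edge E w p" and E: "E \<in> Es" and h: "h \<in> bipoly m"
  shows "int_E E (\<lambda>x. proj_E m E (\<lambda>y. deriv_t E w y \<bullet> normal E) x * h x) = int_E E (\<lambda>x. (deriv_t E w x \<bullet> normal E) * h x)"
proof -
  note ne = edge_ne[OF E]
  obtain r where r: "deg_le m r" "\<forall>s. h (gam E s) = poly r s"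
    using bipoly_gam[OF h] by blast
  have "I01 (\<lambda>s. proj_E m E (\<lambda>y. deriv_t E w y \<bullet> normal E) (gam E s) * poly r s) = I01 (\<lambda>s. (deriv_t E w (gam E s) \<bullet> normal E) * poly r s)"
    by (rule proj_E(2)[OF ne continuous_on_edge_inner[OF deriv_t_on_edge[OF ne w]] r(1)])
  then show ?thesis
    using r(2) by (simp add: int_E_I01)
qed

text \<open>The degrees are what has to be checked: two tangential derivatives of a curve of degree
  \<open>k\<close> have degree \<open>k - 2\<close>, as required of \<open>D_E\<close>, which is why
  that component carries no projection.\<close>

lemma C_sym_Sigma:
  assumes v: "v \<in> V_space T Es k"
  shows "C_sym T Es z k v \<in> Sigma_space T Es z (k - 1)"
proof -
  define w where "w = v_bdry T Es k v"
  have w: "bd_fun v w"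
    unfolding w_def by (rule v_bdry[OF v])
  have vT: "v_T v \<in> Pvec (k - 2) T"
    using v by (simp add: V_space_def)
  note \<sigma> = C_sym_full[OF vT w]
  have "- proj_E (k - 3) E (\<lambda>y. deriv_t E w y \<bullet> normal E) \<in> P (k - 3) (seg E) \<and>
        (\<lambda>x. - (deriv_t E (deriv_t E w) x \<bullet> tangent E)) \<in> P (k - 2) (seg E)" if E: "E \<in> Es" for E
  proof (rule conjI)
    note ne = edge_ne[OF E]
    from bd_fun_on_edge[OF w E] obtain p where p: "\<forall>i. deg_le k (p i)" "on_edge E w p"
      by blast
    have w1: "on_edge E (deriv_t E w) (dcurve E p)"
      by (rule deriv_t_on_edge[OF ne p(2)])
    have w2: "on_edge E (deriv_t E (deriv_t E w)) (dcurve E (dcurve E p))"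
      by (rule deriv_t_on_edge[OF ne w1])
    have "proj_E (k - 3) E (\<lambda>y. deriv_t E w y \<bullet> normal E) \<in> P (k - 3) (seg E)"
      by (rule proj_E(1)[OF ne continuous_on_edge_inner[OF w1]])
    then show "- proj_E (k - 3) E (\<lambda>y. deriv_t E w y \<bullet> normal E) \<in> P (k - 3) (seg E)"
      by (rule subspace_neg[OF subspace_P])
    let ?r = "smult (tangent E $ 1) (dcurve E (dcurve E p) 1) + smult (tangent E $ 2) (dcurve E (dcurve E p) 2)"
    have d1: "deg_le (k - 1) (dcurve E p i)" for i
      by (rule deg_le_dcurve) (use p(1) in simp)
    have "deg_le (k - 2) (dcurve E (dcurve E p) i)" for i
      using deg_le_dcurve[where m = "k - 1" and p = "dcurve E p", OF d1] by simp
    then have "deg_le (k - 2) (- ?r)"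
      by (intro deg_le_uminus deg_le_add deg_le_smult)
    moreover have "\<forall>s\<in>{0..1}. - (deriv_t E (deriv_t E w) (gam E s) \<bullet> tangent E) = poly (- ?r) s"
      using on_edge_inner[OF w2, of "tangent E"] by simp
    moreover have "\<forall>x. x \<notin> seg E \<longrightarrow> - (deriv_t E (deriv_t E w) x \<bullet> tangent E) = 0"
      by (simp add: deriv_t_out)
    ultimately show "(\<lambda>x. - (deriv_t E (deriv_t E w) x \<bullet> tangent E)) \<in> P (k - 2) (seg E)"
      unfolding P_seg_iff[OF ne] by blast
  qed
  then show ?thesis
    using proj_Hsp(1)[OF \<sigma>(1), of "k - 4"] proj_Hcsp(1)[OF \<sigma>(1), of "k - 1"]
    unfolding Sigma_iff by (simp add: C_sym_fields[OF w] zext_def CC_sym fun_Compl_def)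
qed

text \<open>The Hessian of \<open>q\<close> is an admissible test function both for the projection
  in \<open>tau_H\<close> and for the full symmetric curl. As its \<open>rot\<close> is 0, only
  boundary integrals remain, and these are the ones in \<open>dd_form_curl\<close>.\<close>

lemma DD_C_sym:
  assumes v: "v \<in> V_space T Es k"
  shows "DD T Es (k - 1) (C_sym T Es z k v) = (\<lambda>_. 0)"
  unfolding DD_zero_iff[OF C_sym_Sigma[OF v]]
proof
  fix q assume q: "q \<in> bipoly (k - 2)"
  define w where "w = v_bdry T Es k v"
  have w: "bd_fun v w"
    unfolding w_def by (rule v_bdry[OF v])
  have vT: "v_T v \<in> Pvec (k - 2) T"
    using v by (simp add: V_space_def)
  note \<sigma> = C_sym_full[OF vT w]
  let ?\<tau> = "C_sym T Es z k v"
  have we: "\<exists>p. on_edge E w p" if "E \<in> Es" for E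
    using bd_fun_on_edge[OF w that] by blast
  have "dd_form ?\<tau> q = int_T T (\<lambda>x. tau_H ?\<tau> x \<bullet> hess q x) - (\<Sum>E\<in>Es. om E * int_E E (\<lambda>x. w x \<bullet> (hess q x *v tangent E)))"
  proof (rule dd_form_curl[where G = "G_V v"])
    show "deriv_t E w V = G_V v V *v tangent E" if "E \<in> Es" "V \<in> ends E" for E V
      using w that by (auto simp: bd_fun_def)
    show "tau_V ?\<tau> V = CC (G_V v V)" if "V \<in> verts Es" for V
      using that by (simp add: C_sym_fields[OF w] zext_def)
    show "D_E ?\<tau> E x = - (deriv_t E (deriv_t E w) x \<bullet> tangent E)" if "E \<in> Es" for E x
      using that by (simp add: C_sym_fields[OF w])
    show "int_E E (\<lambda>x. tau_E ?\<tau> E x * h x) = - int_E E (\<lambda>x. (deriv_t E w x \<bullet> normal E) * h x)"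
      if E: "E \<in> Es" and h: "h \<in> bipoly (k - 3)" for E h
    proof -
      obtain p where p: "on_edge E w p"
        using we[OF E] by blast
      show ?thesis
        using proj_normal[OF p E h] E by (simp add: C_sym_fields[OF w] int_E_uminus)
    qed
  qed (use we q in auto)
  also have "int_T T (\<lambda>x. tau_H ?\<tau> x \<bullet> hess q x) = int_T T (\<lambda>x. C_sym_full T Es k v x \<bullet> hess q x)"
    unfolding C_sym_fields[OF w] by (rule proj_Hsp(2)[OF \<sigma>(1)]) (use q in simp)
  also have "\<dots> = curl_form v w (hess q)"
  proof (rule \<sigma>(2))
    have "hess q \<in> Psym (k - 4) UNIV"
      using hess_Psym[of q "k - 4"] q by simp
    then show "hess q \<in> Psym (k - 1) UNIV"
      using bipoly_mono[of "k - 4" "k - 1"] by (auto simp: Psym_UNIV)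
  qed
  also have "\<dots> = (\<Sum>E\<in>Es. om E * int_E E (\<lambda>x. w x \<bullet> (hess q x *v tangent E)))"
    by (simp add: curl_form_def rot_hess[OF q] int_T_0)
  finally show "dd_form ?\<tau> q = 0"
    by simp
qed

end

section \<open>The kernel of the discrete symmetric curl\<close>

context discrete_complex
begin

lemma affine_Pvec: "m \<ge> 1 \<Longrightarrow> (\<lambda>x. \<alpha> + \<beta> *\<^sub>R x) \<in> Pvec m UNIV"
  by (auto simp: Pvec_UNIV intro!: bipoly_add bipoly_cmult bipoly_coord bipoly_const)

lemma partial_affine: "partial l (\<lambda>x. a + b * x $ i) x = (if i = l then b else 0)"
proof -
  have d: "(\<lambda>x::real^2. x $ i) differentiable at x"
    by (rule bipoly_differentiable[OF bipoly_coord[OF order_refl]])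
  then have d': "(\<lambda>x::real^2. b * x $ i) differentiable at x"
    by (intro differentiable_mult differentiable_const)
  show ?thesis
    by (simp add: partial_add[OF differentiable_const d'] partial_cmult[OF d] partial_coord)
qed

text \<open>Green's formula for a field whose gradient is \<beta> times the identity: the remaining
  volume term is \<beta> times the difference of the two off-diagonal entries of \<tau>, which
  vanishes by symmetry.\<close>

lemma affine_green:
  assumes \<tau>: "\<tau> \<in> Psym m UNIV"
  shows "- int_T T (\<lambda>x. (\<alpha> + \<beta> *\<^sub>R x) \<bullet> rot \<tau> x) + (\<Sum>E\<in>Es. om E * int_E E (\<lambda>x. (\<alpha> + \<beta> *\<^sub>R x) \<bullet> (\<tau> x *v tangent E))) = 0"
proof -
  let ?v = "\<lambda>x. \<alpha> + \<beta> *\<^sub>R x :: real^2"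
  define F where "F j x = ?v x $ 1 * \<tau> x $ 1 $ j + ?v x $ 2 * \<tau> x $ 2 $ j" for j x
  have v: "(\<lambda>x. ?v x $ i) \<in> bipoly 1" for i
    using affine_Pvec[of 1 \<alpha> \<beta>] unfolding Pvec_UNIV by simp
  have t: "(\<lambda>x. \<tau> x $ i $ j) \<in> bipoly m" for i j
    using \<tau> by (auto simp: Psym_UNIV)
  have F: "F j \<in> bipoly (1 + m)" for j
    unfolding F_def[abs_def] by (intro bipoly_add bipoly_mult v t)
  note dv = bipoly_differentiable[OF v] and dtau = bipoly_differentiable[OF t]
  have pv: "partial l (\<lambda>x. ?v x $ i) x = (if i = l then \<beta> else 0)" for l i x
    using partial_affine[of l "\<alpha> $ i" \<beta> i x] by simp
  have pF: "partial l (F j) x = (?v x $ 1 * partial l (\<lambda>x. \<tau> x $ 1 $ j) x + (if 1 = l then \<beta> else 0) * \<tau> x $ 1 $ j)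
      + (?v x $ 2 * partial l (\<lambda>x. \<tau> x $ 2 $ j) x + (if 2 = l then \<beta> else 0) * \<tau> x $ 2 $ j)" for l j x
  proof -
    have "partial l (F j) x = partial l (\<lambda>x. ?v x $ 1 * \<tau> x $ 1 $ j) x + partial l (\<lambda>x. ?v x $ 2 * \<tau> x $ 2 $ j) x"
      unfolding F_def[abs_def] by (intro partial_add bipoly_differentiable[OF bipoly_mult[OF v t]])
    then show ?thesis
      by (simp only: partial_mult[OF dv dtau] pv)
  qed
  have "?v x \<bullet> rot \<tau> x = partial 2 (F 1) x - partial 1 (F 2) x" for x
  proof -
    have "\<tau> x $ 1 $ 2 = \<tau> x $ 2 $ 1"
      using \<tau> by (auto simp: Psym_UNIV)
    then show ?thesis
      unfolding pF by (simp add: inner_2 rot_nth algebra_simps)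
  qed
  then have "int_T T (\<lambda>x. ?v x \<bullet> rot \<tau> x) = int_T T (partial 2 (F 1)) - int_T T (partial 1 (F 2))"
    by (simp add: int_T_diff bipoly_continuous[OF partial_bipoly[OF F]])
  also have "\<dots> = (\<Sum>E\<in>Es. om E * normal E $ 2 * int_E E (F 1) - om E * normal E $ 1 * int_E E (F 2))"
    unfolding divergence_om[OF F] by (simp add: sum_subtractf)
  also have "\<dots> = (\<Sum>E\<in>Es. om E * int_E E (\<lambda>x. ?v x \<bullet> (\<tau> x *v tangent E)))"
  proof (intro sum.cong refl)
    fix E
    have "(\<lambda>x. ?v x \<bullet> (\<tau> x *v tangent E)) = (\<lambda>x. tangent E $ 1 * F 1 x + tangent E $ 2 * F 2 x)"
      by (simp add: fun_eq_iff F_def inner_2 matrix_vector_2 algebra_simps)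
    then have "int_E E (\<lambda>x. ?v x \<bullet> (\<tau> x *v tangent E)) = tangent E $ 1 * int_E E (F 1) + tangent E $ 2 * int_E E (F 2)"
      using int_E_add[of "\<lambda>x. tangent E $ 1 * F 1 x" "\<lambda>x. tangent E $ 2 * F 2 x" E]
      by (simp add: int_E_cmult bipoly_continuous[OF F] continuous_intros)
    then show "om E * normal E $ 2 * int_E E (F 1) - om E * normal E $ 1 * int_E E (F 2) = om E * int_E E (\<lambda>x. ?v x \<bullet> (\<tau> x *v tangent E))"
      by (simp add: normal_nth algebra_simps)
  qed
  finally show ?thesis
    by simp
qed

lemma grad_affine: "grad (\<lambda>x. \<alpha> + \<beta> *\<^sub>R x) x = (\<chi> i j. if i = j then \<beta> else 0)"
  by (simp add: grad_def vec_eq_iff partial_affine)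

text \<open>Applies to affine fields since \<open>k - 2 \<ge> 1\<close>; the interpolator thus keeps
  them unchanged inside \<open>T\<close>.\<close>

lemma proj_vec_T_Pvec:
  assumes "v \<in> Pvec m UNIV"
  shows "proj_vec_T m T v = zext T v"
proof -
  have "L2_proj (int_T T) (P m T) (\<lambda>y. v y $ i) = zext T (\<lambda>y. v y $ i)" for i
    using assms
    by (intro L2_proj_eq[OF inner_on_P]) (auto simp: P_def Pvec_UNIV zext_eq intro!: int_T_cong)
  then show ?thesis
    by (auto simp: proj_vec_T_def zext_def fun_eq_iff vec_eq_iff)
qed

text \<open>A projection on an edge sees its argument only through edge integrals. This allows a
  field on the plane to be exchanged for its restriction to the boundary, extended by zero.\<close>

lemma proj_vec_E_cong: "(\<And>x. x \<in> seg E \<Longrightarrow> v x = w x) \<Longrightarrow> proj_vec_E m E v = proj_vec_E m E w"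
proof -
  assume vw: "\<And>x. x \<in> seg E \<Longrightarrow> v x = w x"
  have "int_E E (\<lambda>x. v x $ i \<bullet> h x) = int_E E (\<lambda>x. w x $ i \<bullet> h x)" for i h
    by (rule int_E_cong) (simp add: vw)
  then show ?thesis
    by (intro ext) (simp add: proj_vec_E_def proj_E_def L2_proj_def)
qed

definition affine_curve :: "real^2 \<Rightarrow> real \<Rightarrow> edge \<Rightarrow> 2 \<Rightarrow> real poly" where
  "affine_curve \<alpha> \<beta> E = (\<lambda>i. [:\<alpha>$i + \<beta> * fst E $ i, \<beta> * (snd E - fst E) $ i:])"

lemma affine_curve:
  assumes "\<And>x. x \<in> seg E \<Longrightarrow> w x = \<alpha> + \<beta> *\<^sub>R x"
  shows "on_edge E w (affine_curve \<alpha> \<beta> E)"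
proof -
  have "w (gam E s) = \<alpha> + \<beta> *\<^sub>R gam E s" if "s \<in> {0..1}" for s
    by (rule assms) (use that in \<open>auto simp: seg_gam\<close>)
  then show ?thesis
    by (simp add: on_edge_def vec_eq_iff affine_curve_def gam_def algebra_simps)
qed

lemma dcurve_affine_curve:
  assumes "E \<in> Es"
  shows "dcurve E (affine_curve \<alpha> \<beta> E) = (\<lambda>i. [:\<beta> * tangent E $ i:])" "dcurve E (dcurve E (affine_curve \<alpha> \<beta> E)) = (\<lambda>i. 0)"
proof -
  note l = len_pos[OF edge_ne[OF assms]]
  have "(snd E - fst E) $ i = len E * tangent E $ i" for i
    using tangent_len[of E] by (metis vector_scaleR_component real_scaleR_def)
  then show "dcurve E (affine_curve \<alpha> \<beta> E) = (\<lambda>i. [:\<beta> * tangent E $ i:])"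
    using l by (simp add: dcurve_def affine_curve_def pderiv_pCons fun_eq_iff)
  then show "dcurve E (dcurve E (affine_curve \<alpha> \<beta> E)) = (\<lambda>i. 0)"
    by (simp add: dcurve_def fun_eq_iff pderiv_pCons)
qed

lemma interp_V_space: "interp_V T Es k (\<lambda>x. \<alpha> + \<beta> *\<^sub>R x) \<in> V_space T Es k"
proof -
  let ?v = "\<lambda>x. \<alpha> + \<beta> *\<^sub>R x :: real^2"
  have "proj_vec_T (k - 2) T ?v \<in> Pvec (k - 2) T"
    unfolding proj_vec_T_Pvec[OF affine_Pvec[of "k - 2" \<alpha> \<beta>], simplified, OF k[THEN order_trans[of 3, rotated]], simplified]
    using affine_Pvec[of "k - 2" \<alpha> \<beta>] k Pvec_image[of "k - 2" T] by auto
  moreover have "proj_vec_E (k - 4) E ?v \<in> Pvec (k - 4) (seg E)" if E: "E \<in> Es" for E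
  proof -
    have "on_edge E ?v (affine_curve \<alpha> \<beta> E)"
      by (rule affine_curve) simp
    from on_edge_continuous(1)[OF this] show ?thesis
      unfolding Pvec_def proj_vec_E_def by (auto intro!: proj_E(1)[OF edge_ne[OF E]])
  qed
  ultimately show ?thesis
    by (simp add: V_space_def interp_V_def zext_def)
qed

text \<open>By uniqueness, checking the defining conditions identifies the boundary function of the
  interpolate as the affine field itself, cut off outside the frontier.\<close>

lemma interp_bd_fun: "bd_fun (interp_V T Es k (\<lambda>x. \<alpha> + \<beta> *\<^sub>R x)) (zext (frontier T) (\<lambda>x. \<alpha> + \<beta> *\<^sub>R x))"
proof -
  let ?v = "\<lambda>x. \<alpha> + \<beta> *\<^sub>R x :: real^2"
  let ?w = "zext (frontier T) ?v"
  have w: "?w x = ?v x" if "E \<in> Es" "x \<in> seg E" for E x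
    using that frontier_T by (auto simp: zext_def)
  have "continuous_on (frontier T) ?v"
    by (intro continuous_intros)
  then have "continuous_on (frontier T) ?w"
    using continuous_on_cong[of "frontier T" "frontier T" ?w ?v] by (simp add: zext_def)
  moreover have "zext (seg E) ?w \<in> Pvec k (seg E) \<and> proj_vec_E (k - 4) E ?w = proj_vec_E (k - 4) E ?v \<and>
     (\<forall>V\<in>ends E. deriv_t E ?w V = zext (verts Es) (grad ?v) V *v tangent E)" if E: "E \<in> Es" for E
  proof (intro conjI ballI)
    have c: "on_edge E ?w (affine_curve \<alpha> \<beta> E)"
      by (rule affine_curve) (rule w[OF E])
    have "deg_le k (affine_curve \<alpha> \<beta> E i)" for i
      using k by (simp add: affine_curve_def deg_le_linear)
    then show "zext (seg E) ?w \<in> Pvec k (seg E)"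
      using c Pvec_seg_iff[OF edge_ne[OF E]] by blast
    show "proj_vec_E (k - 4) E ?w = proj_vec_E (k - 4) E ?v"
      by (rule proj_vec_E_cong) (rule w[OF E])
    have d: "deriv_t E ?w (gam E s) = \<beta> *\<^sub>R tangent E" if "s \<in> {0..1}" for s
      using deriv_t_on_edge[OF edge_ne[OF E] c] that by (simp add: on_edge_def dcurve_affine_curve[OF E] vec_eq_iff)
    fix V assume V: "V \<in> ends E"
    then have "V \<in> verts Es"
      using E by (auto simp: verts_def)
    then have "zext (verts Es) (grad ?v) V *v tangent E = \<beta> *\<^sub>R tangent E"
      by (simp add: zext_eq grad_affine vec_eq_iff forall_2 matrix_vector_2)
    moreover have "deriv_t E ?w V = \<beta> *\<^sub>R tangent E"
      using V d[of 0] d[of 1] by (auto simp: ends_def)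
    ultimately show "deriv_t E ?w V = zext (verts Es) (grad ?v) V *v tangent E"
      by simp
  qed
  moreover have "?w V = zext (verts Es) ?v V" if V: "V \<in> verts Es" for V
  proof -
    obtain E where "E \<in> Es" "V \<in> seg E"
      using V by (auto simp: verts_def ends_def seg_def)
    then show ?thesis
      using w V by (simp add: zext_eq)
  qed
  ultimately show ?thesis
    unfolding bd_fun_def interp_V_def by (simp add: zext_out)
qed

lemma curl_form_interp:
  assumes "\<tau> \<in> Psym (k - 1) UNIV"
  shows "curl_form (interp_V T Es k (\<lambda>x. \<alpha> + \<beta> *\<^sub>R x)) (zext (frontier T) (\<lambda>x. \<alpha> + \<beta> *\<^sub>R x)) \<tau> = 0"
proof -
  let ?v = "\<lambda>x. \<alpha> + \<beta> *\<^sub>R x :: real^2"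
  have "v_T (interp_V T Es k ?v) = zext T ?v"
    unfolding interp_V_def using proj_vec_T_Pvec[OF affine_Pvec[of "k - 2" \<alpha> \<beta>]] k by simp
  then have "int_T T (\<lambda>x. v_T (interp_V T Es k ?v) x \<bullet> rot \<tau> x) = int_T T (\<lambda>x. ?v x \<bullet> rot \<tau> x)"
    by (intro int_T_cong) (simp add: zext_eq)
  moreover have "int_E E (\<lambda>x. zext (frontier T) ?v x \<bullet> (\<tau> x *v tangent E)) = int_E E (\<lambda>x. ?v x \<bullet> (\<tau> x *v tangent E))" if "E \<in> Es" for E
    using that frontier_T by (intro int_E_cong) (auto simp: zext_def)
  ultimately show ?thesis
    unfolding curl_form_def using affine_green[OF assms, of \<alpha> \<beta>] by simp
qed

lemma C_sym_interp: "C_sym T Es z k (interp_V T Es k (\<lambda>x. \<alpha> + \<beta> *\<^sub>R x)) = zero_Sigma"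
proof -
  let ?v = "\<lambda>x. \<alpha> + \<beta> *\<^sub>R x :: real^2"
  let ?w = "zext (frontier T) ?v" and ?i = "interp_V T Es k ?v"
  have b: "bd_fun ?i ?w"
    by (rule interp_bd_fun)
  have vT: "v_T ?i \<in> Pvec (k - 2) T"
    using interp_V_space[of \<alpha> \<beta>] by (simp add: V_space_def)
  have "(\<lambda>_. 0) \<in> Psym (k - 1) T"
    using subspace_0[OF subspace_Psym] by (simp add: zero_fun_def)
  then have \<sigma>: "C_sym_full T Es k ?i = (\<lambda>_. 0)"
    unfolding C_sym_full_The[OF b]
    by (intro the1_equality[OF C_sym_full_ex1[OF vT b]]) (auto simp: int_T_0 curl_form_interp)
  have H: "L2_proj (int_T T) (Hsp (k - 4) T) (\<lambda>_. 0) = (\<lambda>_. 0)"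
    using subspace_0[OF findim_subspace[OF findim_Hsp]] by (intro L2_proj_eq[OF inner_on_Hsp]) (auto simp: zero_fun_def)
  have Hc: "L2_proj (int_T T) (Hcsp (k - 1) T z) (\<lambda>_. 0) = (\<lambda>_. 0)"
    using subspace_0[OF findim_subspace[OF findim_Hcsp]] by (intro L2_proj_eq[OF inner_on_Hcsp]) (auto simp: zero_fun_def)
  \<comment> \<open>The tangential derivative is the constant vector \<beta> times the tangent: it
    has no normal part, and its own derivative is 0.\<close>
  have E0: "proj_E (k - 3) E (\<lambda>y. deriv_t E ?w y \<bullet> normal E) = (\<lambda>_. 0) \<and> deriv_t E (deriv_t E ?w) x = 0" if E: "E \<in> Es" for E x
  proof
    note ne = edge_ne[OF E]
    have c: "on_edge E ?w (affine_curve \<alpha> \<beta> E)"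
      by (rule affine_curve) (use E frontier_T in \<open>auto simp: zext_def\<close>)
    have c1: "on_edge E (deriv_t E ?w) (\<lambda>i. [:\<beta> * tangent E $ i:])"
      using deriv_t_on_edge[OF ne c] unfolding dcurve_affine_curve[OF E] .
    have c2: "on_edge E (deriv_t E (deriv_t E ?w)) (\<lambda>i. 0)"
      using deriv_t_on_edge[OF ne deriv_t_on_edge[OF ne c]] unfolding dcurve_affine_curve(2)[OF E] .
    show "deriv_t E (deriv_t E ?w) x = 0"
    proof (cases "x \<in> seg E")
      case True
      then obtain s where "s \<in> {0..1}" "x = gam E s"
        by (auto simp: seg_gam)
      moreover have "curve (\<lambda>i. 0) s = 0"
        by (simp add: vec_eq_iff)
      ultimately show ?thesis
        using c2 by (simp add: on_edge_def)
    qed (rule deriv_t_out)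
    have n0: "deriv_t E ?w (gam E s) \<bullet> normal E = 0" if "s \<in> {0..1}" for s
      using on_edge_nth[OF c1 that] by (simp add: inner_2 normal_nth algebra_simps)
    show "proj_E (k - 3) E (\<lambda>y. deriv_t E ?w y \<bullet> normal E) = (\<lambda>_. 0)"
      unfolding proj_E_iff[OF ne continuous_on_edge_inner[OF c1]]
    proof (intro conjI allI impI)
      show "(\<lambda>_. 0) \<in> P (k - 3) (seg E)"
        using subspace_0[OF subspace_P] by (simp add: zero_fun_def)
      show "I01 (\<lambda>s. 0 * poly r s) = I01 (\<lambda>s. (deriv_t E ?w (gam E s) \<bullet> normal E) * poly r s)" for r
        by (rule I01_cong) (simp add: n0)
    qed
  qed
  have tV: "zext (verts Es) (\<lambda>V. CC (G_V ?i V)) = (\<lambda>_. 0)"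
    by (auto simp: zext_def interp_V_def grad_affine CC_def fun_eq_iff vec_eq_iff forall_2)
  show ?thesis
  proof (rule disc_Sigma.equality)
    show "tau_H (C_sym T Es z k ?i) = tau_H zero_Sigma"
      by (simp add: C_sym_fields[OF b] \<sigma> H zero_Sigma_def)
    show "tau_Hc (C_sym T Es z k ?i) = tau_Hc zero_Sigma"
      by (simp add: C_sym_fields[OF b] \<sigma> Hc zero_Sigma_def)
    show "tau_E (C_sym T Es z k ?i) = tau_E zero_Sigma"
      by (rule ext) (simp add: C_sym_fields[OF b] E0 zero_Sigma_def)
    show "D_E (C_sym T Es z k ?i) = D_E zero_Sigma"
      by (rule ext) (simp add: C_sym_fields[OF b] E0 zero_Sigma_def)
    show "tau_V (C_sym T Es z k ?i) = tau_V zero_Sigma"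
      by (simp add: C_sym_fields[OF b] tV zero_Sigma_def)
  qed simp
qed

lemma tangent_normal_decomp:
  assumes "E \<in> Es"
  shows "x = (x \<bullet> tangent E) *\<^sub>R tangent E + (x \<bullet> normal E) *\<^sub>R normal E"
proof -
  have "(tangent E $ 1)^2 + (tangent E $ 2)^2 = 1"
    by (rule tangent_norm[OF edge_ne[OF assms]])
  then show ?thesis
    by (simp add: vec_eq_iff forall_2 inner_2 normal_nth) algebra
qed

lemma poly_zero_01:
  assumes "\<And>s. s \<in> {0..1} \<Longrightarrow> poly r s = (0 :: real)"
  shows "r = 0"
  using poly_zero_on_interval[of 0 1 r] assms by auto

lemma poly_const_of_pderiv:
  assumes "\<And>s. poly (pderiv r) s = (c :: real)"
  shows "poly r s = poly r 0 + c * s"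
proof -
  have "((\<lambda>s. poly r s - c * s) has_field_derivative poly (pderiv r) s - c * 1) (at s)" for s
    by (intro DERIV_diff poly_DERIV DERIV_cmult DERIV_ident)
  then have "poly r s - c * s = poly r 0 - c * 0"
    using DERIV_isconst_all[of "\<lambda>s. poly r s - c * s" s 0] assms by simp
  then show ?thesis
    by simp
qed

text \<open>On an edge the derivative of \<open>w\<close> has a tangential part \<open>a\<close> and
  a normal part \<open>c\<close>. Vanishing \<open>D_E\<close> makes \<open>a\<close> constant, so
  the scalars at the two ends coincide. The part \<open>c\<close> is 0 at both ends, the gradients
  there being multiples of the identity, and its moments up to degree \<open>k - 3\<close>
  vanish.\<close>

lemma kernel_boundary:
  assumes v: "v \<in> V_space T Es k" and w: "bd_fun v w" and 0: "C_sym T Es z k v = zero_Sigma"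
  shows "\<exists>\<alpha> \<beta>. (\<forall>x\<in>frontier T. w x = \<alpha> + \<beta> *\<^sub>R x) \<and> (\<forall>V\<in>verts Es. G_V v V = (\<chi> i j. if i = j then \<beta> else 0))"
proof -
  define b where "b V = G_V v V $ 1 $ 1" for V
  have GV: "G_V v V = (\<chi> i j. if i = j then b V else 0)" if V: "V \<in> verts Es" for V
  proof -
    have "CC (G_V v V) = 0"
      using C_sym_fields(5)[OF w] 0 V by (simp add: zero_Sigma_def zext_def fun_eq_iff) metis
    then show ?thesis
      by (simp add: CC_def vec_eq_iff forall_2 b_def)
  qed
  have Gt: "G_V v V *v x = b V *\<^sub>R x" if V: "V \<in> verts Es" for V x
    unfolding GV[OF V] by (simp add: vec_eq_iff forall_2 matrix_vector_2)
  have edge: "b (fst E) = b (snd E) \<and> (\<forall>s\<in>{0..1}. w (gam E s) = w (fst E) + (b (fst E) * s) *\<^sub>R (snd E - fst E))" if E: "E \<in> Es" for E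
  proof -
    note ne = edge_ne[OF E]
    note l = len_pos[OF ne]
    let ?t = "tangent E" and ?n = "normal E"
    from bd_fun_on_edge[OF w E] obtain p where p: "\<forall>i. deg_le k (p i)" "on_edge E w p"
      by blast
    have w1: "on_edge E (deriv_t E w) (dcurve E p)"
      by (rule deriv_t_on_edge[OF ne p(2)])
    have w2: "on_edge E (deriv_t E (deriv_t E w)) (dcurve E (dcurve E p))"
      by (rule deriv_t_on_edge[OF ne w1])
    have V: "fst E \<in> verts Es" "snd E \<in> verts Es" "fst E \<in> ends E" "snd E \<in> ends E"
      using E by (auto simp: verts_def ends_def)
    have dV: "deriv_t E w V = b V *\<^sub>R ?t" if "V \<in> ends E" for V
    proof -
      have "deriv_t E w V = G_V v V *v ?t" "V \<in> verts Es"
        using w E that V by (auto simp: bd_fun_def ends_def)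
      then show ?thesis
        using Gt by simp
    qed
    define a where "a = smult (?t$1) (dcurve E p 1) + smult (?t$2) (dcurve E p 2)"
    define c where "c = smult (?n$1) (dcurve E p 1) + smult (?n$2) (dcurve E p 2)"
    have a: "deriv_t E w (gam E s) \<bullet> ?t = poly a s" and c: "deriv_t E w (gam E s) \<bullet> ?n = poly c s" if "s \<in> {0..1}" for s
      using on_edge_inner[OF w1] that unfolding a_def c_def by blast+
    have tt: "?t \<bullet> ?t = 1"
      using tangent_norm[OF ne] by (simp add: inner_2 power2_eq_square)
    have a01: "poly a 0 = b (fst E)" "poly a 1 = b (snd E)" and c01: "poly c 0 = 0" "poly c 1 = 0"
      using a[of 0] a[of 1] c[of 0] c[of 1] dV V tt by (auto simp: tangent_normal)
    have "pderiv a = 0"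
    proof (rule poly_zero_01)
      fix s :: real assume s: "s \<in> {0..1}"
      have "D_E (C_sym T Es z k v) E (gam E s) = 0"
        unfolding 0 by (simp add: zero_Sigma_def)
      then have "deriv_t E (deriv_t E w) (gam E s) \<bullet> ?t = 0"
        using E by (simp add: C_sym_fields[OF w])
      then have "poly (smult (?t$1) (dcurve E (dcurve E p) 1) + smult (?t$2) (dcurve E (dcurve E p) 2)) s = 0"
        using on_edge_inner[OF w2, of ?t] s by auto
      moreover have "smult (?t$1) (dcurve E (dcurve E p) 1) + smult (?t$2) (dcurve E (dcurve E p) 2) = smult (1 / len E) (pderiv a)"
        by (simp add: a_def dcurve_def[of E "dcurve E p"] pderiv_add pderiv_smult smult_add_right mult.commute)
      ultimately show "poly (pderiv a) s = 0"
        using l by simp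
    qed
    then have ac: "poly a s = b (fst E)" for s
      using poly_const_of_pderiv[of a 0 s] a01 by simp
    \<comment> \<open>A polynomial of degree \<open>k - 1\<close> is determined by its two end
      values and its moments up to degree \<open>k - 3\<close>.\<close>
    have "c = 0"
    proof (rule lagrange_unique[where m = "k - 3"])
      have "deg_le (k - 1) (dcurve E p i)" for i
        by (rule deg_le_dcurve) (use p(1) in simp)
      then show "deg_le (k - 3 + 2) c"
        unfolding c_def by (auto intro!: deg_le_add deg_le_smult)
      fix r assume r: "deg_le (k - 3) r"
      have "tau_E (C_sym T Es z k v) E = (\<lambda>_. 0)"
        unfolding 0 by (simp add: zero_Sigma_def)
      then have p0: "proj_E (k - 3) E (\<lambda>y. deriv_t E w y \<bullet> ?n) = (\<lambda>_. 0)"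
        using E by (simp add: C_sym_fields[OF w] fun_eq_iff)
      have "I01 (\<lambda>s. poly c s * poly r s) = I01 (\<lambda>s. (deriv_t E w (gam E s) \<bullet> ?n) * poly r s)"
        by (rule I01_cong) (simp add: c)
      also have "\<dots> = I01 (\<lambda>s. proj_E (k - 3) E (\<lambda>y. deriv_t E w y \<bullet> ?n) (gam E s) * poly r s)"
        by (rule proj_E(2)[OF ne continuous_on_edge_inner[OF w1] r, symmetric])
      also have "\<dots> = 0"
        unfolding p0 by (simp add: I01_0)
      finally show "I01 (\<lambda>s. poly c s * poly r s) = 0" .
    qed (rule c01)+
    have pd: "poly (pderiv (p i)) s = b (fst E) * (snd E - fst E) $ i" for i s
    proof -
      have "curve (dcurve E p) s \<bullet> ?t = poly a s" "curve (dcurve E p) s \<bullet> ?n = poly c s"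
        by (simp_all add: a_def c_def inner_2 mult.commute)
      then have "curve (dcurve E p) s = b (fst E) *\<^sub>R ?t"
        using tangent_normal_decomp[OF E, of "curve (dcurve E p) s"] ac \<open>c = 0\<close> by simp
      then have "poly (dcurve E p i) s = b (fst E) * ?t $ i"
        by (simp add: vec_eq_iff)
      moreover have "(snd E - fst E) $ i = len E * ?t $ i"
        using tangent_len[of E] by (metis vector_scaleR_component real_scaleR_def)
      ultimately show ?thesis
        using l by (simp add: dcurve_def field_simps)
    qed
    have "w (gam E s) = w (fst E) + (b (fst E) * s) *\<^sub>R (snd E - fst E)" if "s \<in> {0..1}" for s
    proof -
      have "w (fst E) = curve p 0"
        using p(2) unfolding on_edge_def by (metis atLeastAtMost_iff gam_0 order_refl zero_le_one)
      then show ?thesis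
        using on_edge_nth[OF p(2) that] poly_const_of_pderiv[OF pd, of _ s] by (simp add: vec_eq_iff)
    qed
    then show ?thesis
      using ac a01 by auto
  qed
  obtain E0 where E0: "E0 \<in> Es"
  proof -
    have "frontier T \<noteq> {}"
      using T_ne bounded_T by (metis frontier_eq_empty not_bounded_UNIV)
    then show ?thesis
      using that unfolding frontier_T by auto
  qed
  define \<beta> where "\<beta> = b (fst E0)"
  define \<alpha> where "\<alpha> = w (fst E0) - \<beta> *\<^sub>R fst E0"
  have V0: "fst E0 \<in> verts Es"
    using E0 by (auto simp: verts_def ends_def)
  \<comment> \<open>The scalar is shown to be constant first: only then is
    \<open>w V - \<beta> *\<^sub>R V\<close> unchanged along every edge.\<close>
  have b: "b V = \<beta>" if "V \<in> verts Es" for V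
    unfolding \<beta>_def using edge by (intro vertex_constant[OF _ that V0]) blast
  have wV: "w V - \<beta> *\<^sub>R V = \<alpha>" if "V \<in> verts Es" for V
    unfolding \<alpha>_def
  proof (rule vertex_constant[where h = "\<lambda>V. w V - \<beta> *\<^sub>R V", OF _ that V0])
    fix E assume E: "E \<in> Es"
    then have "fst E \<in> verts Es"
      by (auto simp: verts_def ends_def)
    then have "b (fst E) = \<beta>"
      by (rule b)
    moreover have "w (gam E 1) = w (fst E) + (b (fst E) * 1) *\<^sub>R (snd E - fst E)"
      by (rule bspec[OF conjunct2[OF edge[OF E]]]) simp
    ultimately show "w (fst E) - \<beta> *\<^sub>R fst E = w (snd E) - \<beta> *\<^sub>R snd E"
      by (simp add: algebra_simps)
  qed
  have "w x = \<alpha> + \<beta> *\<^sub>R x" if x: "x \<in> frontier T" for x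
  proof -
    obtain E where E: "E \<in> Es" "x \<in> seg E"
      using x unfolding frontier_T by blast
    obtain s where s: "s \<in> {0..1}" "x = gam E s"
      using E by (auto simp: seg_gam)
    have V: "fst E \<in> verts Es"
      using E by (auto simp: verts_def ends_def)
    have "w x = w (fst E) + (b (fst E) * s) *\<^sub>R (snd E - fst E)"
      using edge[OF E(1)] s by blast
    also have "\<dots> = (\<alpha> + \<beta> *\<^sub>R fst E) + (\<beta> * s) *\<^sub>R (snd E - fst E)"
      using b[OF V] wV[OF V] by (simp add: algebra_simps)
    also have "\<dots> = \<alpha> + \<beta> *\<^sub>R x"
      by (simp add: s(2) gam_def algebra_simps)
    finally show ?thesis .
  qed
  moreover have "G_V v V = (\<chi> i j. if i = j then \<beta> else 0)" if "V \<in> verts Es" for V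
    using GV[OF that] unfolding b[OF that] .
  ultimately show ?thesis
    by blast
qed

text \<open>Once the boundary function is affine, the curl tested with \<open>Rfield z q\<close>
  says that \<open>v_T\<close> and the affine field have the same product with
  \<open>rot (Rfield z q)\<close>. Choosing \<open>q\<close> so that this rotation equals their
  difference makes a squared norm vanish.\<close>

lemma kernel_interp:
  assumes v: "v \<in> V_space T Es k" and 0: "C_sym T Es z k v = zero_Sigma"
  shows "v \<in> interp_V T Es k ` RT1"
proof -
  obtain w where w: "bd_fun v w"
    using v_bdry[OF v] by blast
  obtain \<alpha> \<beta> where ab: "\<And>x. x \<in> frontier T \<Longrightarrow> w x = \<alpha> + \<beta> *\<^sub>R x"
    "\<And>V. V \<in> verts Es \<Longrightarrow> G_V v V = (\<chi> i j. if i = j then \<beta> else 0)"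
    using kernel_boundary[OF v w 0] by blast
  let ?l = "\<lambda>x. \<alpha> + \<beta> *\<^sub>R x :: real^2"
  have segf: "x \<in> frontier T" if "E \<in> Es" "x \<in> seg E" for E x
    using that unfolding frontier_T by blast
  have vT: "v_T v \<in> Pvec (k - 2) T"
    using v by (simp add: V_space_def)
  then obtain u where u: "u \<in> Pvec (k - 2) UNIV" "v_T v = zext T u"
    using Pvec_image[of "k - 2" T] by blast
  have l: "?l \<in> Pvec (k - 2) UNIV"
    using affine_Pvec k by simp
  have ul: "u - ?l \<in> Pvec (k - 2) UNIV"
    by (rule subspace_diff[OF subspace_Pvec u(1) l])
  then obtain q where q: "q \<in> Pvec (k - 2) UNIV" "rot (Rfield z q) = u - ?l"
    using rot_Rfield_surj[of z "k - 2"] by (metis (no_types, lifting) imageE)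
  have Rq: "Rfield z q \<in> Psym (k - 1) UNIV"
    using Rfield_Psym[OF q(1), of z] by simp
  note \<sigma> = C_sym_full[OF vT w]
  have "int_T T (\<lambda>x. L2_proj (int_T T) (Hcsp (k - 1) T z) (C_sym_full T Es k v) x \<bullet> Rfield z q x) = int_T T (\<lambda>x. C_sym_full T Es k v x \<bullet> Rfield z q x)"
    by (rule proj_Hcsp(2)[OF \<sigma>(1)]) (use q in simp)
  moreover have "L2_proj (int_T T) (Hcsp (k - 1) T z) (C_sym_full T Es k v) = (\<lambda>_. 0)"
    using C_sym_fields(2)[OF w] 0 by (simp add: zero_Sigma_def)
  ultimately have cf: "curl_form v w (Rfield z q) = 0"
    using \<sigma>(2)[OF Rq] by (simp add: int_T_0)
  have "int_E E (\<lambda>x. w x \<bullet> (Rfield z q x *v tangent E)) = int_E E (\<lambda>x. ?l x \<bullet> (Rfield z q x *v tangent E))" if "E \<in> Es" for E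
    by (rule int_E_cong) (simp add: ab(1) segf[OF that])
  then have "int_T T (\<lambda>x. v_T v x \<bullet> rot (Rfield z q) x) = int_T T (\<lambda>x. ?l x \<bullet> rot (Rfield z q) x)"
    using cf affine_green[OF Rq, of \<alpha> \<beta>] by (simp add: curl_form_def)
  moreover have "int_T T (\<lambda>x. v_T v x \<bullet> rot (Rfield z q) x) = int_T T (\<lambda>x. u x \<bullet> rot (Rfield z q) x)"
    by (rule int_T_cong) (simp add: u(2) zext_eq)
  moreover have c: "continuous_on UNIV u" "continuous_on UNIV ?l" "continuous_on UNIV (rot (Rfield z q))"
    using Pvec_continuous[OF u(1)] Pvec_continuous[OF l] Pvec_continuous[OF ul] q(2) by auto
  ultimately have "int_T T (\<lambda>x. u x \<bullet> rot (Rfield z q) x - ?l x \<bullet> rot (Rfield z q) x) = 0"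
    by (subst int_T_diff) (auto intro!: continuous_intros)
  then have "int_T T (\<lambda>x. (u - ?l) x \<bullet> (u - ?l) x) = 0"
    unfolding q(2) by (simp add: inner_diff_left)
  then have "u - ?l = 0"
    by (rule inner_on.definite[OF inner_on_Pvec_UNIV ul])
  then have ue: "u = ?l"
    by simp
  have "v = interp_V T Es k ?l"
  proof (rule disc_V.equality)
    show "v_T v = v_T (interp_V T Es k ?l)"
      using u ue by (simp add: interp_V_def proj_vec_T_Pvec[OF l])
    show "v_E v = v_E (interp_V T Es k ?l)"
    proof
      fix E
      show "v_E v E = v_E (interp_V T Es k ?l) E"
      proof (cases "E \<in> Es")
        case True
        then have "v_E v E = proj_vec_E (k - 4) E w"
          using w by (auto simp: bd_fun_def)
        also have "\<dots> = proj_vec_E (k - 4) E ?l"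
          by (rule proj_vec_E_cong) (simp add: ab(1) segf[OF True])
        finally show ?thesis
          using True by (simp add: interp_V_def)
      next
        case False
        then have "v_E v E = (\<lambda>_. 0)"
          using v unfolding V_space_def by blast
        then show ?thesis
          using False by (simp add: interp_V_def)
      qed
    qed
    show "v_V v = v_V (interp_V T Es k ?l)"
    proof
      fix V
      show "v_V v V = v_V (interp_V T Es k ?l) V"
      proof (cases "V \<in> verts Es")
        case True
        then obtain E where "E \<in> Es" "V \<in> seg E"
          by (auto simp: verts_def ends_def seg_def)
        then have "w V = ?l V"
          using ab(1) segf by blast
        then show ?thesis
          using w True by (simp add: bd_fun_def interp_V_def zext_def)
      qed (use v in \<open>simp add: V_space_def interp_V_def zext_def\<close>)
    qed
    show "G_V v = G_V (interp_V T Es k ?l)"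
    proof
      fix V
      show "G_V v V = G_V (interp_V T Es k ?l) V"
        using v ab(2)[of V] by (cases "V \<in> verts Es") (simp_all add: V_space_def interp_V_def zext_def grad_affine)
    qed
  qed simp
  then show ?thesis
    by (auto simp: RT1_def)
qed

end

section \<open>The kernel of the discrete div-div operator\<close>

text \<open>Pullback of a scalar product along an injective linear map, needed for the form built
  from \<open>rot (Rfield z q)\<close>.\<close>

lemma inner_on_compose:
  assumes "inner_on V B" "subspace W" "lin_on W R" "R ` W \<subseteq> V" "\<And>f. f \<in> W \<Longrightarrow> R f = 0 \<Longrightarrow> f = 0"
  shows "inner_on W (\<lambda>f g. B (R f) (R g))"
proof -
  interpret V: inner_on V B
    by (rule assms(1))
  have RV: "R f \<in> V" if "f \<in> W" for f
    using assms(4) that by auto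
  show ?thesis
  proof
    show "subspace W"
      by (rule assms(2))
    fix f g assume f: "f \<in> W"
    show "lin_on W (\<lambda>g. B (R f) (R g))"
      using V.lin[OF RV[OF f]] lin_on_add[OF assms(3)] lin_on_scale[OF assms(3)] RV by (simp add: lin_on_def)
    show "f = 0" if "B (R f) (R f) = 0"
      using assms(5)[OF f] V.definite[OF RV[OF f] that] by simp
    show "B (R f) (R g) = B (R g) (R f)" if "g \<in> W"
      using V.sym[OF RV[OF f] RV[OF that]] .
  qed
qed

text \<open>The fibre of \<open>CC\<close> over a symmetric matrix, parametrized by half the trace.\<close>

definition tensor_lift :: "real^2^2 \<Rightarrow> real \<Rightarrow> real^2^2" where
  "tensor_lift S b = vector [vector [b - S$1$2, S$1$1], vector [- S$2$2, b + S$1$2]]"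

lemma tensor_lift_nth:
  "tensor_lift S b $ 1 $ 1 = b - S$1$2" "tensor_lift S b $ 1 $ 2 = S$1$1"
  "tensor_lift S b $ 2 $ 1 = - S$2$2" "tensor_lift S b $ 2 $ 2 = b + S$1$2"
  by (simp_all add: tensor_lift_def)

lemma CC_tensor_lift:
  assumes "S \<in> sym_mats"
  shows "CC (tensor_lift S b) = S"
proof -
  have "transpose S $ 2 $ 1 = S $ 2 $ 1"
    using assms by (simp add: sym_mats_def)
  then have "S $ 1 $ 2 = S $ 2 $ 1"
    by (simp add: transpose_def)
  then show ?thesis
    by (simp add: CC_def vec_eq_iff forall_2 tensor_lift_nth)
qed

context discrete_complex
begin

lemma tensor_lift_tangent:
  assumes "E \<in> Es" "S \<in> sym_mats"
  shows "(tensor_lift S b *v tangent E) \<bullet> tangent E = b - (S *v normal E) \<bullet> tangent E"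
  using CC_identity[OF assms(1), of "tensor_lift S b"] unfolding CC_tensor_lift[OF assms(2)]
  by (simp add: tensor_lift_nth)

lemma hess_const: "hess (\<lambda>x. c) x = 0"
  by (simp add: hess_def vec_eq_iff)

lemma hess_coord: "hess (\<lambda>x. x $ i) x = 0"
proof -
  have "partial j (\<lambda>x. x $ i) = (\<lambda>x. if i = j then 1 else 0)" for j
    by (rule partial_coord)
  then have "partial l (partial j (\<lambda>x. x $ i)) x = 0" for l j
    by simp
  then show ?thesis
    by (simp add: hess_def vec_eq_iff)
qed

text \<open>The potential \<open>b\<close> is the half trace still to be chosen at the vertices. By
  \<open>tensor_lift_tangent\<close>, the prescribed increment says that the tangential part of the
  boundary derivative changes along \<open>E\<close> by minus the integral of
  \<open>D_E\<close>.\<close>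

lemma edge_potential:
  assumes \<tau>: "\<tau> \<in> Sigma_space T Es z (k - 1)" and dd: "dd_form \<tau> (\<lambda>_. 1) = 0"
  shows "\<exists>b. \<forall>E\<in>Es. b (snd E) - b (fst E) = - int_E E (D_E \<tau> E) +
    ((tau_V \<tau> (snd E) *v normal E) \<bullet> tangent E - (tau_V \<tau> (fst E) *v normal E) \<bullet> tangent E)"
proof (rule vertex_potential)
  have dn: "deriv_n E (\<lambda>_. 1) x = 0" for E x
    using deriv_n_partial[OF bipoly_const[of 0 1]] by simp
  have "(\<Sum>V\<in>ends E. omega_EV E V * ((tau_V \<tau> V *v normal E) \<bullet> tangent E) * 1) =
    (tau_V \<tau> (snd E) *v normal E) \<bullet> tangent E - (tau_V \<tau> (fst E) *v normal E) \<bullet> tangent E" if "E \<in> Es" for E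
    using ends_sum[OF that, of "\<lambda>V. (tau_V \<tau> V *v normal E) \<bullet> tangent E" "\<lambda>_. 1"] by simp
  then have "dd_form \<tau> (\<lambda>_. 1) =
      - (\<Sum>E\<in>Es. om E * ((tau_V \<tau> (snd E) *v normal E) \<bullet> tangent E - (tau_V \<tau> (fst E) *v normal E) \<bullet> tangent E))
      - (\<Sum>E\<in>Es. om E * (- int_E E (D_E \<tau> E)))"
    unfolding dd_form_def by (simp add: hess_const dn int_T_0 int_E_0)
  then show "(\<Sum>E\<in>Es. om E * (- int_E E (D_E \<tau> E) +
    ((tau_V \<tau> (snd E) *v normal E) \<bullet> tangent E - (tau_V \<tau> (fst E) *v normal E) \<bullet> tangent E))) = 0"
    unfolding distrib_left sum.distrib using dd by linarith
qed

text \<open>The derivative of the curve is built first: its tangential part \<open>a\<close> by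
  integrating \<open>- D\<close>, its normal part \<open>c\<close> by fitting end values and the
  moments of \<open>- t\<close>. The hypothesis \<open>a01\<close> makes the end values of
  \<open>a\<close> compatible with \<open>D\<close>. The last clause expresses the increment of the
  curve by the data alone, which is what the div-div equation controls.\<close>

lemma edge_curve:
  assumes E: "E \<in> Es" and D: "D \<in> P (k - 2) (seg E)" and t: "t \<in> P (k - 3) (seg E)"
    and a01: "a1 = a0 - int_E E D"
  shows "\<exists>p. (\<forall>i. deg_le k (p i)) \<and>
    (\<forall>s\<in>{0..1}. curve (dcurve E (dcurve E p)) s \<bullet> tangent E = - D (gam E s)) \<and>
    (\<forall>r. deg_le (k - 3) r \<longrightarrow> I01 (\<lambda>s. (curve (dcurve E p) s \<bullet> normal E) * poly r s) = I01 (\<lambda>s. - t (gam E s) * poly r s)) \<and>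
    curve (dcurve E p) 0 = a0 *\<^sub>R tangent E + b0 *\<^sub>R normal E \<and> curve (dcurve E p) 1 = a1 *\<^sub>R tangent E + b1 *\<^sub>R normal E \<and>
    (\<forall>i. poly (p i) 1 - poly (p i) 0 = a1 * snd E $ i - a0 * fst E $ i + int_E E (\<lambda>x. D x * x $ i) - int_E E (\<lambda>x. t x * normal E $ i))"
proof -
  note ne = edge_ne[OF E]
  note l = len_pos[OF ne]
  obtain rD where rD: "deg_le (k - 2) rD" "\<forall>s\<in>{0..1}. D (gam E s) = poly rD s"
    using D P_seg_iff[OF ne] by blast
  obtain a' where a': "deg_le (k - 2 + 1) a'" "pderiv a' = smult (- len E) rD"
    using deg_le_antideriv[OF deg_le_smult[OF rD(1)]] by blast
  define a where "a = a' + [:a0 - poly a' 0:]"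
  have da: "deg_le (k - 1) a"
    unfolding a_def using a'(1) k by (intro deg_le_add deg_le_const) auto
  have pa: "pderiv a = smult (- len E) rD"
    by (simp add: a_def pderiv_add a' pderiv_pCons)
  have a0: "poly a 0 = a0"
    by (simp add: a_def)
  have intD: "int_E E D = len E * I01 (poly rD)"
    unfolding int_E_I01 using rD(2) by (auto intro!: I01_cong)
  have a1: "poly a 1 = a1"
  proof -
    have "I01 (poly (pderiv a)) = poly a 1 - poly a 0"
      by (rule I01_FTC[OF poly_DERIV continuous_poly])
    moreover have "I01 (poly (pderiv a)) = I01 (\<lambda>s. - len E * poly rD s)"
      by (rule I01_cong) (simp add: pa)
    ultimately show ?thesis
      using a0 a01 unfolding I01_cmult intD by simp
  qed
  have tc: "continuous_on {0..1} (\<lambda>s. - t (gam E s))"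
    by (intro continuous_intros P_seg_continuous[OF ne t])
  obtain c where c: "deg_le (k - 3 + 2) c" "poly c 0 = b0" "poly c 1 = b1"
    "\<forall>r. deg_le (k - 3) r \<longrightarrow> I01 (\<lambda>s. poly c s * poly r s) = I01 (\<lambda>s. - t (gam E s) * poly r s)"
    using lagrange_fit[OF _ tc, of "k - 3" b0 b1] k by auto
  define d where "d i = smult (tangent E $ i) a + smult (normal E $ i) c" for i
  have "deg_le (k - 1) (d i)" for i
    unfolding d_def using da c(1) by (intro deg_le_add deg_le_smult) auto
  then have "\<exists>q. deg_le k q \<and> pderiv q = smult (len E) (d i)" for i
    using deg_le_antideriv[OF deg_le_smult, of "k - 1" "d i" "len E"] by simp
  then obtain p where p: "\<And>i. deg_le k (p i)" "\<And>i. pderiv (p i) = smult (len E) (d i)"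
    by metis
  have dtp: "dcurve E p = d"
    using l by (simp add: dcurve_def p fun_eq_iff)
  have nn: "tangent E \<bullet> tangent E = 1" "normal E \<bullet> normal E = 1"
    using tangent_norm[OF ne] normal_nz[OF ne] by (simp_all add: inner_2 power2_eq_square)
  have pcd: "curve d s = poly a s *\<^sub>R tangent E + poly c s *\<^sub>R normal E" for s
    by (simp add: vec_eq_iff d_def mult.commute)
  have "curve (dcurve E d) s = (1 / len E) *\<^sub>R (poly (pderiv a) s *\<^sub>R tangent E + poly (pderiv c) s *\<^sub>R normal E)" for s
    by (simp add: vec_eq_iff dcurve_def d_def pderiv_add pderiv_smult mult.commute)
  then have D2: "curve (dcurve E d) s \<bullet> tangent E = - poly rD s" for s
    using l nn by (simp add: pa inner_add_left inner_diff_left tangent_normal)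
  have inc: "poly (p i) 1 - poly (p i) 0 = a1 * snd E $ i - a0 * fst E $ i + int_E E (\<lambda>x. D x * x $ i) - int_E E (\<lambda>x. t x * normal E $ i)" for i
  proof -
    have g: "gam E s $ i = fst E $ i + s * (len E * tangent E $ i)" for s
      using tangent_len[of E] by (simp add: gam_def) (metis vector_minus_component vector_scaleR_component real_scaleR_def)
    \<comment> \<open>The increment contains the integral of \<open>a\<close>; integration by parts
      against the coordinate moves the derivative onto \<open>a\<close>, where it becomes a multiple
      of \<open>- D\<close>.\<close>
    have "((\<lambda>s. poly a s * gam E s $ i) has_field_derivative poly a s * (len E * tangent E $ i) + poly (pderiv a) s * gam E s $ i) (at s)" for s
      unfolding g by (auto intro!: derivative_eq_intros poly_DERIV)
    then have "I01 (\<lambda>s. poly a s * (len E * tangent E $ i) + poly (pderiv a) s * gam E s $ i) = poly a 1 * gam E 1 $ i - poly a 0 * gam E 0 $ i"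
      by (rule I01_FTC) (auto simp: g intro!: continuous_intros)
    moreover have "I01 (\<lambda>s. poly a s * (len E * tangent E $ i) + poly (pderiv a) s * gam E s $ i)
        = I01 (\<lambda>s. (len E * tangent E $ i) * poly a s) + I01 (\<lambda>s. - len E * (poly rD s * gam E s $ i))"
      by (subst I01_add[symmetric]) (auto simp: pa g algebra_simps intro!: continuous_intros)
    moreover have "int_E E (\<lambda>x. D x * x $ i) = len E * I01 (\<lambda>s. poly rD s * gam E s $ i)"
      unfolding int_E_I01 using rD(2) by (auto intro!: I01_cong)
    ultimately have A: "len E * tangent E $ i * I01 (poly a) = a1 * snd E $ i - a0 * fst E $ i + int_E E (\<lambda>x. D x * x $ i)"
      by (simp only: I01_cmult a0 a1 gam_0 gam_1)
    \<comment> \<open>The moment of degree 0 is available because \<open>k - 3 \<ge> 0\<close>; it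
      expresses the integral of \<open>c\<close> by that of \<open>t\<close>.\<close>
    have "I01 (\<lambda>s. poly c s * poly [:1:] s) = I01 (\<lambda>s. - t (gam E s) * poly [:1:] s)"
      by (rule c(4)[rule_format]) (use deg_le_const[of "k - 3" 1] k in simp)
    then have C: "len E * normal E $ i * I01 (poly c) = - int_E E (\<lambda>x. t x * normal E $ i)"
      using I01_cmult[of "normal E $ i" "\<lambda>s. t (gam E s)"] by (simp add: int_E_I01 I01_uminus mult.commute)
    have "I01 (poly (pderiv (p i))) = poly (p i) 1 - poly (p i) 0"
      by (rule I01_FTC[OF poly_DERIV continuous_poly])
    moreover have "I01 (poly (pderiv (p i))) = I01 (\<lambda>s. len E * tangent E $ i * poly a s + len E * normal E $ i * poly c s)"
      by (rule I01_cong) (simp add: p d_def algebra_simps)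
    moreover have "\<dots> = len E * tangent E $ i * I01 (poly a) + len E * normal E $ i * I01 (poly c)"
      by (subst I01_add) (auto simp: I01_cmult intro!: continuous_intros)
    ultimately show ?thesis
      using A C by simp
  qed
  show ?thesis
  proof (intro exI[of _ p] conjI allI impI ballI)
    show "deg_le k (p i)" for i
      by (rule p(1))
    show "curve (dcurve E (dcurve E p)) s \<bullet> tangent E = - D (gam E s)" if "s \<in> {0..1}" for s
      using rD(2) that by (simp add: dtp D2)
    show "curve (dcurve E p) 0 = a0 *\<^sub>R tangent E + b0 *\<^sub>R normal E" "curve (dcurve E p) 1 = a1 *\<^sub>R tangent E + b1 *\<^sub>R normal E"
      by (simp_all add: dtp pcd a0 a1 c)
    show "poly (p i) 1 - poly (p i) 0 = a1 * snd E $ i - a0 * fst E $ i + int_E E (\<lambda>x. D x * x $ i) - int_E E (\<lambda>x. t x * normal E $ i)" for i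
      by (rule inc)
    have "curve (dcurve E p) s \<bullet> normal E = poly c s" for s
      using nn by (simp add: dtp pcd inner_add_left tangent_normal)
    then show "I01 (\<lambda>s. (curve (dcurve E p) s \<bullet> normal E) * poly r s) = I01 (\<lambda>s. - t (gam E s) * poly r s)" if "deg_le (k - 3) r" for r
      using c(4) that by simp
  qed
qed

text \<open>The curves \<open>p0\<close>, built edge by edge, already have the right derivatives,
  with end derivatives taken from a common \<open>G\<close>. Only their constants of integration are
  free, and the question is whether these can be chosen so that the curves fit together at the
  vertices.\<close>

lemma boundary_preimage:
  assumes \<tau>: "\<tau> \<in> Sigma_space T Es z (k - 1)" and dd: "\<And>q. q \<in> bipoly (k - 2) \<Longrightarrow> dd_form \<tau> q = 0"
  shows "\<exists>w G. continuous_on (frontier T) w \<and> (\<forall>x. x \<notin> frontier T \<longrightarrow> w x = 0) \<and>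
    (\<forall>E\<in>Es. \<exists>p. (\<forall>i. deg_le k (p i)) \<and> on_edge E w p) \<and>
    (\<forall>E\<in>Es. \<forall>V\<in>ends E. deriv_t E w V = G V *v tangent E) \<and>
    (\<forall>V\<in>verts Es. CC (G V) = tau_V \<tau> V) \<and>
    (\<forall>E\<in>Es. \<forall>x\<in>seg E. - (deriv_t E (deriv_t E w) x \<bullet> tangent E) = D_E \<tau> E x) \<and>
    (\<forall>E\<in>Es. proj_E (k - 3) E (\<lambda>y. deriv_t E w y \<bullet> normal E) = - tau_E \<tau> E)"
proof -
  have sym: "tau_V \<tau> V \<in> sym_mats" if "V \<in> verts Es" for V
    using \<tau> that by (auto simp: Sigma_iff)
  have DP: "D_E \<tau> E \<in> P (k - 2) (seg E)" and tP: "tau_E \<tau> E \<in> P (k - 3) (seg E)" if "E \<in> Es" for E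
    using \<tau> that by (auto simp: Sigma_iff)
  have V: "fst E \<in> verts Es" "snd E \<in> verts Es" if "E \<in> Es" for E
    using that by (auto simp: verts_def ends_def)
  define m where "m E V = (tau_V \<tau> V *v normal E) \<bullet> tangent E" for E V
  have "dd_form \<tau> (\<lambda>_. 1) = 0"
    using k by (intro dd bipoly_const) simp
  then obtain b where b: "\<And>E. E \<in> Es \<Longrightarrow> b (snd E) - b (fst E) = - int_E E (D_E \<tau> E) + (m E (snd E) - m E (fst E))"
    using edge_potential[OF \<tau>] unfolding m_def by blast
  define G where "G V = tensor_lift (tau_V \<tau> V) (b V)" for V
  define a where "a E V = (G V *v tangent E) \<bullet> tangent E" for E V
  define c where "c E V = (G V *v tangent E) \<bullet> normal E" for E V
  have am: "a E V = b V - m E V" if "E \<in> Es" "V \<in> verts Es" for E V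
    unfolding a_def G_def m_def by (rule tensor_lift_tangent[OF that(1) sym[OF that(2)]])
  have "a E (snd E) = a E (fst E) - int_E E (D_E \<tau> E)" if "E \<in> Es" for E
    using am[OF that V(1)[OF that]] am[OF that V(2)[OF that]] b[OF that] by simp
  note ec = edge_curve[OF _ DP tP this]
  define Q where "Q E p \<longleftrightarrow> (\<forall>i. deg_le k (p i)) \<and>
    (\<forall>s\<in>{0..1}. curve (dcurve E (dcurve E p)) s \<bullet> tangent E = - D_E \<tau> E (gam E s)) \<and>
    (\<forall>r. deg_le (k - 3) r \<longrightarrow> I01 (\<lambda>s. (curve (dcurve E p) s \<bullet> normal E) * poly r s) = I01 (\<lambda>s. - tau_E \<tau> E (gam E s) * poly r s)) \<and>
    curve (dcurve E p) 0 = a E (fst E) *\<^sub>R tangent E + c E (fst E) *\<^sub>R normal E \<and>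
    curve (dcurve E p) 1 = a E (snd E) *\<^sub>R tangent E + c E (snd E) *\<^sub>R normal E \<and>
    (\<forall>i. poly (p i) 1 - poly (p i) 0 = a E (snd E) * snd E $ i - a E (fst E) * fst E $ i
        + int_E E (\<lambda>x. D_E \<tau> E x * x $ i) - int_E E (\<lambda>x. tau_E \<tau> E x * normal E $ i))" for E p
  have "\<forall>E\<in>Es. \<exists>p. Q E p"
    unfolding Q_def by (intro ballI ec)
  then obtain p0 where Q: "\<forall>E\<in>Es. Q E (p0 E)"
    by (rule bchoice[THEN exE])
  have p0: "deg_le k (p0 E i)"
    "s \<in> {0..1} \<Longrightarrow> curve (dcurve E (dcurve E (p0 E))) s \<bullet> tangent E = - D_E \<tau> E (gam E s)"
    "deg_le (k - 3) r \<Longrightarrow> I01 (\<lambda>s. (curve (dcurve E (p0 E)) s \<bullet> normal E) * poly r s) = I01 (\<lambda>s. - tau_E \<tau> E (gam E s) * poly r s)"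
    "curve (dcurve E (p0 E)) 0 = a E (fst E) *\<^sub>R tangent E + c E (fst E) *\<^sub>R normal E"
    "curve (dcurve E (p0 E)) 1 = a E (snd E) *\<^sub>R tangent E + c E (snd E) *\<^sub>R normal E"
    "poly (p0 E i) 1 - poly (p0 E i) 0 = a E (snd E) * snd E $ i - a E (fst E) * fst E $ i
        + int_E E (\<lambda>x. D_E \<tau> E x * x $ i) - int_E E (\<lambda>x. tau_E \<tau> E x * normal E $ i)"
    if "E \<in> Es" for E i s r
    using bspec[OF Q that] unfolding Q_def by blast+
  have "\<exists>W. \<forall>E\<in>Es. W (snd E) - W (fst E) = poly (p0 E i) 1 - poly (p0 E i) 0" for i
  proof (rule vertex_potential)
    have dn: "deriv_n E (\<lambda>x. x $ i) x = normal E $ i" for E x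
      using deriv_n_partial[OF bipoly_coord[OF order_refl]] exhaust_2[of i] by (auto simp: partial_coord)
    \<comment> \<open>The tangential end values are rewritten as \<open>b V - m E V\<close>: the
      part with \<open>b\<close> is an increment of a vertex function and telescopes, the part with
      \<open>m\<close> is the vertex term of \<open>dd_form\<close>.\<close>
    have "(\<Sum>E\<in>Es. om E * (poly (p0 E i) 1 - poly (p0 E i) 0)) =
      (\<Sum>E\<in>Es. om E * (b (snd E) * snd E $ i - b (fst E) * fst E $ i)
         - om E * (\<Sum>V\<in>ends E. omega_EV E V * m E V * V $ i)
         - om E * (int_E E (\<lambda>x. tau_E \<tau> E x * deriv_n E (\<lambda>x. x $ i) x) - int_E E (\<lambda>x. D_E \<tau> E x * x $ i)))"
    proof (intro sum.cong refl)
      fix E assume E: "E \<in> Es"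
      show "om E * (poly (p0 E i) 1 - poly (p0 E i) 0) = om E * (b (snd E) * snd E $ i - b (fst E) * fst E $ i)
         - om E * (\<Sum>V\<in>ends E. omega_EV E V * m E V * V $ i)
         - om E * (int_E E (\<lambda>x. tau_E \<tau> E x * deriv_n E (\<lambda>x. x $ i) x) - int_E E (\<lambda>x. D_E \<tau> E x * x $ i))"
        unfolding p0(6)[OF E] ends_sum[OF E] dn am[OF E V(1)[OF E]] am[OF E V(2)[OF E]]
        by (simp add: algebra_simps)
    qed
    also have "\<dots> = (\<Sum>E\<in>Es. om E * (b (snd E) * snd E $ i - b (fst E) * fst E $ i)) + dd_form \<tau> (\<lambda>x. x $ i)"
      unfolding dd_form_def m_def by (simp add: sum_subtractf hess_coord int_T_0)
    also have "\<dots> = 0"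
      using om_telescope[of "\<lambda>V. b V * V $ i"] dd[OF bipoly_coord] k by simp
    finally show "(\<Sum>E\<in>Es. om E * (poly (p0 E i) 1 - poly (p0 E i) 0)) = 0" .
  qed
  then obtain W where W: "\<And>i E. E \<in> Es \<Longrightarrow> W i (snd E) - W i (fst E) = poly (p0 E i) 1 - poly (p0 E i) 0"
    by metis
  \<comment> \<open>Shifting by a constant keeps all derivatives and starts the curve at the value
    of the potential \<open>W\<close>; by the choice of \<open>W\<close> it then also ends at its
    value.\<close>
  define p where "p E i = p0 E i + [:W i (fst E) - poly (p0 E i) 0:]" for E i
  have dp: "dcurve E (p E) = dcurve E (p0 E)" for E
    by (simp add: dcurve_def p_def pderiv_add pderiv_pCons)
  have degp: "deg_le k (p E i)" if "E \<in> Es" for E i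
    unfolding p_def using p0(1)[OF that] k by (intro deg_le_add deg_le_const) auto
  have "\<exists>w. continuous_on (frontier T) w \<and> (\<forall>x. x \<notin> frontier T \<longrightarrow> w x = 0) \<and>
    (\<forall>E\<in>Es. on_edge E w (p E)) \<and> (\<forall>V\<in>verts Es. w V = (\<chi> i. W i V))"
  proof (rule glue_edges)
    fix E assume E: "E \<in> Es"
    show "curve (p E) 0 = (\<chi> i. W i (fst E))"
      by (simp add: vec_eq_iff p_def)
    show "curve (p E) 1 = (\<chi> i. W i (snd E))"
      using W[OF E] by (simp add: vec_eq_iff p_def algebra_simps)
  qed
  then obtain w where w: "continuous_on (frontier T) w" "\<forall>x. x \<notin> frontier T \<longrightarrow> w x = 0"
    "\<And>E. E \<in> Es \<Longrightarrow> on_edge E w (p E)"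
    by blast
  have w1: "on_edge E (deriv_t E w) (dcurve E (p0 E))" if "E \<in> Es" for E
    using deriv_t_on_edge[OF edge_ne[OF that] w(3)[OF that]] unfolding dp .
  have w2: "on_edge E (deriv_t E (deriv_t E w)) (dcurve E (dcurve E (p0 E)))" if "E \<in> Es" for E
    by (rule deriv_t_on_edge[OF edge_ne[OF that] w1[OF that]])
  show ?thesis
  proof (intro exI[of _ w] exI[of _ G] conjI ballI)
    fix E assume E: "E \<in> Es"
    note ne = edge_ne[OF E]
    show "\<exists>p. (\<forall>i. deg_le k (p i)) \<and> on_edge E w p"
      using w(3)[OF E] degp[OF E] by blast
    show "deriv_t E w V = G V *v tangent E" if VE: "V \<in> ends E" for V
    proof -
      have dec: "a E V *\<^sub>R tangent E + c E V *\<^sub>R normal E = G V *v tangent E"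
        unfolding a_def c_def by (rule tangent_normal_decomp[OF E, symmetric])
      have "deriv_t E w (gam E 0) = curve (dcurve E (p0 E)) 0" "deriv_t E w (gam E 1) = curve (dcurve E (p0 E)) 1"
        using bspec[OF w1[OF E, unfolded on_edge_def], of 0] bspec[OF w1[OF E, unfolded on_edge_def], of 1] by simp_all
      then have "deriv_t E w V = a E V *\<^sub>R tangent E + c E V *\<^sub>R normal E"
        using VE p0(4,5)[OF E] by (auto simp: ends_def)
      then show ?thesis
        unfolding dec .
    qed
    show "- (deriv_t E (deriv_t E w) x \<bullet> tangent E) = D_E \<tau> E x" if x: "x \<in> seg E" for x
    proof -
      obtain s where s: "s \<in> {0..1}" "x = gam E s"
        using x by (auto simp: seg_gam)
      have "deriv_t E (deriv_t E w) (gam E s) = curve (dcurve E (dcurve E (p0 E))) s"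
        using w2[OF E] s(1) by (simp add: on_edge_def)
      then show ?thesis
        using p0(2)[OF E s(1)] s(2) by simp
    qed
    show "proj_E (k - 3) E (\<lambda>y. deriv_t E w y \<bullet> normal E) = - tau_E \<tau> E"
      unfolding proj_E_iff[OF ne continuous_on_edge_inner[OF w1[OF E]]]
    proof (intro conjI allI impI)
      show "- tau_E \<tau> E \<in> P (k - 3) (seg E)"
        by (rule subspace_neg[OF subspace_P tP[OF E]])
      fix r assume r: "deg_le (k - 3) r"
      have "I01 (\<lambda>s. (deriv_t E w (gam E s) \<bullet> normal E) * poly r s) = I01 (\<lambda>s. (curve (dcurve E (p0 E)) s \<bullet> normal E) * poly r s)"
        using w1[OF E] by (auto simp: on_edge_def intro!: I01_cong)
      then show "I01 (\<lambda>s. (- tau_E \<tau> E) (gam E s) * poly r s) = I01 (\<lambda>s. (deriv_t E w (gam E s) \<bullet> normal E) * poly r s)"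
        using p0(3)[OF E r] by simp
    qed
  next
    show "CC (G V) = tau_V \<tau> V" if "V \<in> verts Es" for V
      unfolding G_def by (rule CC_tensor_lift[OF sym[OF that]])
  qed (use w in auto)
qed

text \<open>With the boundary function fixed, \<open>v_T\<close> is still free and is sought as
  \<open>u = rot (Rfield z p)\<close>. The scalar product of such rotations represents the
  functional measuring the error in \<open>tau_Hc\<close>, which determines \<open>p\<close>. The
  component \<open>tau_H\<close> is compared by testing with Hessians, where \<open>u\<close> has no
  influence.\<close>

lemma DD_kernel_image:
  assumes \<tau>: "\<tau> \<in> Sigma_space T Es z (k - 1)" and DD0: "DD T Es (k - 1) \<tau> = (\<lambda>_. 0)"
  shows "\<tau> \<in> C_sym T Es z k ` V_space T Es k"
proof -
  have dd: "dd_form \<tau> q = 0" if "q \<in> bipoly (k - 2)" for q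
    using DD0 that unfolding DD_zero_iff[OF \<tau>] by blast
  obtain w G where w: "continuous_on (frontier T) w" "\<forall>x. x \<notin> frontier T \<longrightarrow> w x = 0"
    and wE: "\<And>E. E \<in> Es \<Longrightarrow> \<exists>p. (\<forall>i. deg_le k (p i)) \<and> on_edge E w p"
    and wG: "\<And>E V. E \<in> Es \<Longrightarrow> V \<in> ends E \<Longrightarrow> deriv_t E w V = G V *v tangent E"
    and GV: "\<And>V. V \<in> verts Es \<Longrightarrow> CC (G V) = tau_V \<tau> V"
    and D: "\<And>E x. E \<in> Es \<Longrightarrow> x \<in> seg E \<Longrightarrow> - (deriv_t E (deriv_t E w) x \<bullet> tangent E) = D_E \<tau> E x"
    and tE: "\<And>E. E \<in> Es \<Longrightarrow> proj_E (k - 3) E (\<lambda>y. deriv_t E w y \<bullet> normal E) = - tau_E \<tau> E"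
    using boundary_preimage[OF \<tau> dd] by blast
  \<comment> \<open>The interior field enters only in \<open>v_T\<close>, so \<open>bd_fun\<close>
    holds for all \<open>u\<close> at once, and \<open>vf 0\<close> isolates the boundary part of
    the curl form.\<close>
  define vf where "vf u = \<lparr>v_T = zext T u, v_E = (\<lambda>E. if E \<in> Es then proj_vec_E (k - 4) E w else (\<lambda>_. 0)),
    v_V = zext (verts Es) w, G_V = zext (verts Es) G\<rparr>" for u
  have bd: "bd_fun (vf u) w" for u
    unfolding bd_fun_def
  proof (intro conjI ballI)
    fix E assume E: "E \<in> Es"
    show "zext (seg E) w \<in> Pvec k (seg E)"
      using wE[OF E] Pvec_seg_iff[OF edge_ne[OF E]] by blast
    show "proj_vec_E (k - 4) E w = v_E (vf u) E"
      using E by (simp add: vf_def)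
    show "deriv_t E w V = G_V (vf u) V *v tangent E" if "V \<in> ends E" for V
    proof -
      have "V \<in> verts Es"
        using that E by (auto simp: verts_def)
      then show ?thesis
        using wG[OF E that] by (simp add: vf_def zext_eq)
    qed
  qed (use w in \<open>auto simp: vf_def zext_def\<close>)
  have vV: "vf u \<in> V_space T Es k" if "u \<in> Pvec (k - 2) UNIV" for u
  proof -
    have "proj_vec_E (k - 4) E w \<in> Pvec (k - 4) (seg E)" if E: "E \<in> Es" for E
    proof -
      obtain p where p: "on_edge E w p"
        using wE[OF E] by blast
      have "proj_E (k - 4) E (\<lambda>y. w y $ i) \<in> P (k - 4) (seg E)" for i
        by (rule proj_E(1)[OF edge_ne[OF E] on_edge_continuous(1)[OF p]])
      then show ?thesis
        by (simp add: Pvec_def proj_vec_E_def)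
    qed
    moreover have "zext T u \<in> Pvec (k - 2) T"
      using Pvec_image[of "k - 2" T] that by auto
    ultimately show ?thesis
      by (simp add: V_space_def vf_def zext_def)
  qed
  have vfT: "v_T (vf u) = zext T u" for u
    by (simp add: vf_def)
  let ?W = "Pvec (k - 2) UNIV :: (real^2 \<Rightarrow> real^2) set"
  have RP: "Rfield z q \<in> Psym (k - 1) UNIV" if "q \<in> ?W" for q
    using Rfield_Psym[OF that, of z] by simp
  have inner: "inner_on ?W (\<lambda>p q. int_T T (\<lambda>x. rot (Rfield z p) x \<bullet> rot (Rfield z q) x))"
  proof (rule inner_on_compose[OF inner_on_Pvec_UNIV subspace_Pvec lin_on_rot_Rfield])
    show "(\<lambda>q. rot (Rfield z q)) ` ?W \<subseteq> ?W"
      using rot_Rfield_Pvec by blast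
    show "f = 0" if "f \<in> ?W" "rot (Rfield z f) = 0" for f
      using rot_Rfield_inj[OF that(1)] that(2) by (simp add: zero_fun_def)
  qed
  obtain h where h: "continuous_on UNIV h" "tau_Hc \<tau> = zext T h"
    using Hcsp_zext[of "tau_Hc \<tau>" "k - 1"] \<tau> by (auto simp: Sigma_iff)
  have lin1: "lin_on ?W (\<lambda>q. curl_form (vf 0) w (Rfield z q))"
    by (rule lin_on_compose[OF lin_on_linear[OF linear_Rfield] _ lin_on_curl_form[OF _ bd]])
       (use RP vV[OF subspace_0[OF subspace_Pvec]] in \<open>auto simp: V_space_def\<close>)
  have lin2: "lin_on ?W (\<lambda>q. int_T T (\<lambda>x. tau_Hc \<tau> x \<bullet> Rfield z q x))"
  proof (rule lin_on_compose[OF lin_on_linear[OF linear_Rfield]])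
    show "Rfield z ` ?W \<subseteq> Psym (k - 1) UNIV"
      using RP by blast
    show "lin_on (Psym (k - 1) UNIV) (\<lambda>g. int_T T (\<lambda>x. tau_Hc \<tau> x \<bullet> g x))"
      by (rule lin_on_int_T[OF h(1)]) (use h(2) Psym_continuous in \<open>auto simp: zext_eq\<close>)
  qed
  \<comment> \<open>The right-hand side is the curl form without interior field minus the wanted
    component; the interior field \<open>u\<close> subtracts exactly the left-hand side from the
    curl form.\<close>
  obtain p where p: "p \<in> ?W" "\<And>q. q \<in> ?W \<Longrightarrow> int_T T (\<lambda>x. rot (Rfield z p) x \<bullet> rot (Rfield z q) x)
      = curl_form (vf 0) w (Rfield z q) - int_T T (\<lambda>x. tau_Hc \<tau> x \<bullet> Rfield z q x)"
    using inner_on.riesz[OF inner findim_Pvec lin_on_minus[OF lin1 lin2]] by blast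
  define u where "u = rot (Rfield z p)"
  have u: "u \<in> ?W"
    unfolding u_def by (rule rot_Rfield_Pvec[OF p(1)])
  define v where "v = vf u"
  have v: "v \<in> V_space T Es k" and b: "bd_fun v w"
    unfolding v_def by (rule vV[OF u], rule bd)
  have vT: "v_T v \<in> Pvec (k - 2) T"
    using v by (simp add: V_space_def)
  note \<sigma> = C_sym_full[OF vT b]
  have cf: "curl_form v w \<rho> = curl_form (vf 0) w \<rho> - int_T T (\<lambda>x. u x \<bullet> rot \<rho> x)" for \<rho>
  proof -
    have "int_T T (\<lambda>x. zext T u x \<bullet> rot \<rho> x) = int_T T (\<lambda>x. u x \<bullet> rot \<rho> x)"
      by (rule int_T_cong) (simp add: zext_eq)
    moreover have "zext T 0 = (\<lambda>_. 0 :: real^2)"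
      by (auto simp: zext_def fun_eq_iff)
    then have "int_T T (\<lambda>x. zext T 0 x \<bullet> rot \<rho> x) = 0"
      by (simp add: int_T_0)
    ultimately show ?thesis
      by (simp add: curl_form_def v_def vfT)
  qed
  have Hc: "L2_proj (int_T T) (Hcsp (k - 1) T z) (C_sym_full T Es k v) = tau_Hc \<tau>"
  proof (rule L2_proj_eq[OF inner_on_Hcsp])
    show "tau_Hc \<tau> \<in> Hcsp (k - 1) T z"
      using \<tau> by (simp add: Sigma_iff)
    fix g assume "g \<in> Hcsp (k - 1) T z"
    then obtain q where q: "q \<in> ?W" "g = zext T (Rfield z q)"
      unfolding Hcsp_eq by auto
    have "int_T T (\<lambda>x. C_sym_full T Es k v x \<bullet> Rfield z q x) = int_T T (\<lambda>x. tau_Hc \<tau> x \<bullet> Rfield z q x)"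
      unfolding \<sigma>(2)[OF RP[OF q(1)]] cf using p(2)[OF q(1)] by (simp add: u_def)
    then show "int_T T (\<lambda>x. tau_Hc \<tau> x \<bullet> g x) = int_T T (\<lambda>x. C_sym_full T Es k v x \<bullet> g x)"
      by (simp add: q(2) int_T_zext)
  qed
  have H: "L2_proj (int_T T) (Hsp (k - 4) T) (C_sym_full T Es k v) = tau_H \<tau>"
  proof (rule L2_proj_eq[OF inner_on_Hsp])
    show "tau_H \<tau> \<in> Hsp (k - 4) T"
      using \<tau> by (simp add: Sigma_iff)
    fix g assume "g \<in> Hsp (k - 4) T"
    then obtain q where q: "q \<in> bipoly (k - 2)" "g = zext T (hess q)"
      by (auto simp: Hsp_def P_UNIV)
    have "hess q \<in> Psym (k - 4) UNIV"
      using hess_Psym[of q "k - 4"] q by simp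
    then have hP: "hess q \<in> Psym (k - 1) UNIV"
      using bipoly_mono[of "k - 4" "k - 1"] by (auto simp: Psym_UNIV)
    \<comment> \<open>Since \<tau> lies in the kernel, this equates the moments of
      \<open>tau_H\<close> with the boundary part of the curl form.\<close>
    have "dd_form \<tau> q = int_T T (\<lambda>x. tau_H \<tau> x \<bullet> hess q x) - (\<Sum>E\<in>Es. om E * int_E E (\<lambda>x. w x \<bullet> (hess q x *v tangent E)))"
    proof (rule dd_form_curl[where G = G])
      show "\<exists>p. on_edge E w p" if "E \<in> Es" for E
        using wE[OF that] by blast
      show "int_E E (\<lambda>x. tau_E \<tau> E x * h x) = - int_E E (\<lambda>x. (deriv_t E w x \<bullet> normal E) * h x)"
        if E: "E \<in> Es" and h: "h \<in> bipoly (k - 3)" for E h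
      proof -
        obtain p where p: "on_edge E w p"
          using wE[OF E] by blast
        show ?thesis
          using proj_normal[OF p E h] unfolding tE[OF E] by (simp add: int_E_uminus)
      qed
    qed (use wG GV D q in auto)
    then have "int_T T (\<lambda>x. tau_H \<tau> x \<bullet> hess q x) = curl_form v w (hess q)"
      using dd[OF q(1)] by (simp add: curl_form_def rot_hess[OF q(1)] int_T_0)
    then show "int_T T (\<lambda>x. tau_H \<tau> x \<bullet> g x) = int_T T (\<lambda>x. C_sym_full T Es k v x \<bullet> g x)"
      using \<sigma>(2)[OF hP] by (simp add: q(2) int_T_zext)
  qed
  have "C_sym T Es z k v = \<tau>"
  proof (rule disc_Sigma.equality)
    show "tau_H (C_sym T Es z k v) = tau_H \<tau>" "tau_Hc (C_sym T Es z k v) = tau_Hc \<tau>"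
      by (simp_all only: C_sym_fields[OF b] H Hc)
    show "tau_E (C_sym T Es z k v) = tau_E \<tau>"
    proof
      fix E
      show "tau_E (C_sym T Es z k v) E = tau_E \<tau> E"
      proof (cases "E \<in> Es")
        case True
        then show ?thesis
          by (simp add: C_sym_fields(3)[OF b] tE)
      next
        case False
        then have "tau_E \<tau> E = (\<lambda>_. 0)"
          using \<tau> unfolding Sigma_iff by blast
        then show ?thesis
          using False by (simp add: C_sym_fields(3)[OF b])
      qed
    qed
    show "D_E (C_sym T Es z k v) = D_E \<tau>"
    proof (intro ext)
      fix E x
      show "D_E (C_sym T Es z k v) E x = D_E \<tau> E x"
      proof (cases "E \<in> Es")
        case True
        show ?thesis
        proof (cases "x \<in> seg E")
          case x: True
          then show ?thesis
            using True D[OF True x] by (simp add: C_sym_fields(4)[OF b])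
        next
          case False
          \<comment> \<open>Equality of the components as total functions also concerns points off
            the edge, where both sides are 0.\<close>
          have "D_E \<tau> E \<in> P (k - 2) (seg E)"
            using \<tau> True unfolding Sigma_iff by blast
          then have "D_E \<tau> E x = 0"
            using False P_seg_iff[OF edge_ne[OF True]] by blast
          then show ?thesis
            using True False by (simp add: C_sym_fields(4)[OF b] deriv_t_out)
        qed
      next
        case False
        then have "D_E \<tau> E = (\<lambda>_. 0)"
          using \<tau> unfolding Sigma_iff by blast
        then show ?thesis
          using False by (simp add: C_sym_fields(4)[OF b])
      qed
    qed
    show "tau_V (C_sym T Es z k v) = tau_V \<tau>"
    proof
      fix V
      show "tau_V (C_sym T Es z k v) V = tau_V \<tau> V"
      proof (cases "V \<in> verts Es")
        case True
        then have "G_V v V = G V"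
          by (simp add: v_def vf_def zext_eq)
        then show ?thesis
          using GV[OF True] by (simp add: C_sym_fields(5)[OF b] zext_eq[OF True])
      next
        case False
        then have "tau_V \<tau> V = 0"
          using \<tau> unfolding Sigma_iff by blast
        then show ?thesis
          using False by (simp add: C_sym_fields(5)[OF b] zext_out)
      qed
    qed
  qed simp
  then show ?thesis
    using v by blast
qed

end

theorem theorem3:
  fixes T :: "(real^2) set" and Es :: "edge set" and x\<^sub>T :: "real^2" and k :: int
  assumes "polygonal_domain T Es" and "contractible T"
    and "\<exists>r>0. ball x\<^sub>T r \<subseteq> T"
    and "k \<ge> 3"
  shows "interp_V T Es k ` RT1 = {v \<in> V_space T Es k. C_sym T Es x\<^sub>T k v = zero_Sigma} \<and>
         C_sym T Es x\<^sub>T k ` V_space T Es k =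
           {\<tau> \<in> Sigma_space T Es x\<^sub>T (k - 1). DD T Es (k - 1) \<tau> = (\<lambda>_. 0)} \<and>
         DD T Es (k - 1) ` Sigma_space T Es x\<^sub>T (k - 1) = P (k - 2) T"
proof -
  interpret discrete_complex T Es k "x\<^sub>T"
    using assms by unfold_locales
  show ?thesis
  proof (intro conjI)
    show "interp_V T Es k ` RT1 = {v \<in> V_space T Es k. C_sym T Es x\<^sub>T k v = zero_Sigma}"
      using interp_V_space C_sym_interp kernel_interp by (auto simp: RT1_def)
    show "C_sym T Es x\<^sub>T k ` V_space T Es k = {\<tau> \<in> Sigma_space T Es x\<^sub>T (k - 1). DD T Es (k - 1) \<tau> = (\<lambda>_. 0)}"
      using C_sym_Sigma DD_C_sym DD_kernel_image by blast
    show "DD T Es (k - 1) ` Sigma_space T Es x\<^sub>T (k - 1) = P (k - 2) T"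
      using DD_P DD_surj by blast
  qed
qed

end
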